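(* Let $(E,d)$ be a complete metric space, and let $\varphi^+,\varphi^-$ be finite positive Borel measures on $E$ of equal total mass and with bounded (not necessarily compact) supports. Assume that $E$ is a geodesic metric space (i.e. for every $(x,y)\in E\times E$ there is a curve $\theta\in\Theta(E)$ connecting $x$ to $y$ such that $d(x,y)=\ell(\theta)$), and, moreover, that there is a Borel map $q:\operatorname{supp}\varphi^+\times\operatorname{supp}\varphi^-\to\Theta(E)$ such that $q(x,y)$ is a curve from $x$ to $y$ with $d(x,y)=\ell(q(x,y))$. Then $$W_1(\varphi^+,\varphi^-)=\min\{\mathbb{M}(T): T\in\mathcal{M}_1(E),\ \partial T=\varphi^--\varphi^+\}.\qquad( * )$$ Moreover, if $T$ is a minimizer of the problem on the right-hand side of $( * )$, then $T$ is acyclic, and if $\eta$ is a transport that represents $T$, then $\gamma:=(e_0\times e_1)_\#\eta$ is a minimizer of the Monge–Kantorovich problem defining $W_1(\varphi^+,\varphi^-)$. Vice versa, when $\gamma$ is a minimizer of the Monge–Kantorovich problem defining $W_1(\varphi^+,\varphi^-)$, then, setting $\eta:=q_\#\gamma$ (so that in particular $\eta$ is concentrated on a set of geodesics), the current $T=T_\eta$ is represented by $\eta$ and minimizes the problem on the right-hand side of $( * )$. Here "$\eta$ represents $T$" means: $T=T_\eta$, $\mathbb{M}(T)=\int_\Theta\mathbb{M}([\![\theta]\!])\,d\eta(\theta)=\int_\Theta\ell(\theta)\,d\eta(\theta)$, $\eta(1)=(\partial T)^+$, $\eta(0)=(\partial T)^-$, and $\eta$-a.e. $\theta\in\Theta$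 is an arc.
   Context: Standing assumption: the density character (minimum cardinality of a dense subset) of every metric space is an Ulam number (a cardinal $\kappa$ such that every finite positive measure defined on all subsets of a set of cardinality $\kappa$ and vanishing on singletons is zero); hence every finite positive Borel measure on a complete metric space is tight and concentrated on a $\sigma$-compact set. Monge–Kantorovich problem. $W_1(\varphi^+,\varphi^-):=\inf\int_{E\times E}d(x,y)\,d\gamma(x,y)$ over admissible plans $\gamma$, i.e. finite positive Borel measures on $E\times E$ with $\pi^\pm_\#\gamma=\varphi^\pm$, where $\pi^\pm(x^+,x^-)=x^\pm$; the infimum is attained. Currents. For a metric space $E$, $\mathrm{Lip}(E)$ (resp. $\mathrm{Lip}_b(E)$) denotes the real (resp. bounded real) Lipschitz functions, and $D^k(E)$ is the set of $(f,\pi_1,\dots,\pi_k)$ with $f\in \mathrm{Lip}_b(E)$, $\pi_i\in\mathrm{Lip}(E)$, written $f\,d\pi$. A (real, $k$-dimensional) current is a functional $T:D^k(E)\to\mathbb{R}$ that is multilinear; satisfies $T(f\,d\pi_\nu)\to T(f\,d\pi)$ whenever $\pi_\nu\to\pi$ pointwise with uniformly bounded Lipschitz constants; satisfies $T(f\,d\pi)=0$ if some $\pi_i$ is constant in a neighborhood of $\{f\ne0\}$; and satisfies $|T(f\,d\pi)|\le\prod_i\mathrm{Lip}(\pi_i)\int_E|f|\,d\mu$ for some finite positive Borel measure $\mu$ (empty product $=1$). The minimal such $\mu$ is the mass measure $\mu_T$; $\mathbb{M}(T):=\mu_T(E)$. $\mathcal{M}_k(E)$ is the set of these currents. Elements of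 $\mathcal{M}_0(E)$ are identified with signed measures of finite total variation. The boundary of $T\in\mathcal M_1(E)$ is $\partial T(f):=T(1\,df)$; when it is a measure, $(\partial T)^\pm$ are its positive and negative parts. $S\le T$ means $\mathbb{M}(T-S)+\mathbb{M}(S)\le\mathbb{M}(T)$; $C$ is a cycle of $T$ if $C\le T$ and $\partial C=0$; $T$ is acyclic if $0$ is its only cycle. Curves. On Lipschitz curves $\theta:[0,1]\to E$ let $d_\Theta(\theta_1,\theta_2)=\inf_\phi\max_t d(\theta_1(t),\theta_2(\phi(t)))$ over increasing bijections $\phi$ of $[0,1]$. $\Theta=\Theta(E)$ is the metric space of equivalence classes ($d_\Theta=0$) of Lipschitz curves; classes are identified with their parameterizations. $\theta$ is an arc if it is injective (admits an injective parameterization). $[\![\theta]\!](f\,d\pi)=\int_0^1 f(\theta(t))\,d\pi(\theta(t))$ and $\ell(\theta)=\int_0^1|\dot\theta(t)|\,dt$. A transport is a finite positive Borel measure $\eta$ on $\Theta$; $T_\eta(\omega):=\int_\Theta[\![\theta]\!](\omega)\,d\eta(\theta)$ for $\omega\in D^1(E)$; $\eta(i):=(e_i)_\#\eta$, $e_i(\theta):=\theta(i)$, $i=0,1$; $(e_0\times e_1)(\theta)=(\theta(0),\theta(1))$.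
   Formalization: Two claims (if η represents T then γ is a minimizer; T_η is represented by η) are stated for mutually singular φ⁺, φ⁻: they fail otherwise, e.g. for φ⁺=φ⁻=δ_x, where T=0 but η(1)=δ_x. All other claims, including the mass identities for T_η, are stated without this assumption. *)

theory Defs
  imports "HOL-Analysis.Analysis"
begin

text \<open>The density character of a metric space is represented by a dense subset
  of least cardinality, and a cardinal by any set having that cardinality.\<close>

definition ulam_number :: "'b set \<Rightarrow> bool" where
  "ulam_number A \<longleftrightarrow>
     (\<forall>\<mu>. finite_measure \<mu> \<and> space \<mu> = A \<and> sets \<mu> = Pow A \<and>
        (\<forall>x\<in>A. emeasure \<mu> {x} = 0) \<longrightarrow> emeasure \<mu> A = 0)"

definition dense_subset :: "'b set \<Rightarrow> ('b \<Rightarrow> 'b \<Rightarrow> real) \<Rightarrow> 'b set \<Rightarrow> bool" where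
  "dense_subset M d D \<longleftrightarrow>
     D \<subseteq> M \<and> Abstract_Topology.closure_of (Metric_space.mtopology M d) D = M"

definition realizes_density_character ::
  "'b set \<Rightarrow> ('b \<Rightarrow> 'b \<Rightarrow> real) \<Rightarrow> 'b set \<Rightarrow> bool" where
  "realizes_density_character M d D \<longleftrightarrow>
     dense_subset M d D \<and> (\<forall>D'. dense_subset M d D' \<longrightarrow> D \<lesssim> D')"


section \<open>Measures and optimal transport\<close>

definition finite_borel_measure :: "'a::topological_space measure \<Rightarrow> bool" where
  "finite_borel_measure \<mu> \<longleftrightarrow> finite_measure \<mu> \<and> sets \<mu> = sets borel"

definition msupport :: "'a::topological_space measure \<Rightarrow> 'a set" where
  "msupport \<mu> = {x. \<forall>U. open U \<and> x \<in> U \<longrightarrow> emeasure \<mu> U > 0}"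

definition mutually_singular ::
  "'a::topological_space measure \<Rightarrow> 'a measure \<Rightarrow> bool" where
  "mutually_singular \<mu> \<nu> \<longleftrightarrow>
     (\<exists>A\<in>sets borel. emeasure \<mu> A = 0 \<and> emeasure \<nu> (- A) = 0)"

definition transport_plans ::
  "'a::metric_space measure \<Rightarrow> 'a measure \<Rightarrow> ('a \<times> 'a) measure set" where
  "transport_plans \<mu> \<nu> =
     {\<gamma>. finite_borel_measure \<gamma> \<and> distr \<gamma> borel fst = \<mu> \<and> distr \<gamma> borel snd = \<nu>}"

definition transport_cost :: "('a::metric_space \<times> 'a) measure \<Rightarrow> ennreal" where
  "transport_cost \<gamma> = (\<integral>\<^sup>+ z. ennreal (dist (fst z) (snd z)) \<partial>\<gamma>)"

definition W1 :: "'a::metric_space measure \<Rightarrow> 'a measure \<Rightarrow> ennreal" where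
  "W1 \<mu> \<nu> = (INF \<gamma>\<in>transport_plans \<mu> \<nu>. transport_cost \<gamma>)"

definition optimal_plan ::
  "'a::metric_space measure \<Rightarrow> 'a measure \<Rightarrow> ('a \<times> 'a) measure \<Rightarrow> bool" where
  "optimal_plan \<mu> \<nu> \<gamma> \<longleftrightarrow> is_arg_min transport_cost (\<lambda>\<gamma>'. \<gamma>' \<in> transport_plans \<mu> \<nu>) \<gamma>"


section \<open>Metric currents\<close>

definition Lip :: "('a::metric_space \<Rightarrow> real) set" where
  "Lip = {f. \<exists>L. L-lipschitz_on UNIV f}"

definition Lip_b :: "('a::metric_space \<Rightarrow> real) set" where
  "Lip_b = {f \<in> Lip. bounded (range f)}"

definition lip_const :: "('a::metric_space \<Rightarrow> real) \<Rightarrow> real" where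
  "lip_const f = Inf {L. L-lipschitz_on UNIV f}"

text \<open>The pair \<open>(f, [\<pi>\<^sub>1, \<dots>, \<pi>\<^sub>k])\<close> stands for \<open>f d\<pi>\<close>. A functional on \<open>D k\<close> is
  represented by its extension by zero, so that equality of currents is
  equality of functions.\<close>

type_synonym 'a form = "('a \<Rightarrow> real) \<times> ('a \<Rightarrow> real) list"
type_synonym 'a form_functional = "'a form \<Rightarrow> real"

definition D :: "nat \<Rightarrow> 'a::metric_space form set" where
  "D k = {(f, \<pi>). f \<in> Lip_b \<and> length \<pi> = k \<and> set \<pi> \<subseteq> Lip}"

definition multilinear_on_forms :: "nat \<Rightarrow> 'a::metric_space form_functional \<Rightarrow> bool" where
  "multilinear_on_forms k T \<longleftrightarrow>
     (\<forall>f g \<pi> a b. (f, \<pi>) \<in> D k \<and> (g, \<pi>) \<in> D k \<longrightarrow>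
        T (\<lambda>x. a * f x + b * g x, \<pi>) = a * T (f, \<pi>) + b * T (g, \<pi>)) \<and>
     (\<forall>f \<pi> i u v a b. (f, \<pi>) \<in> D k \<and> i < k \<and> u \<in> Lip \<and> v \<in> Lip \<longrightarrow>
        T (f, \<pi>[i := \<lambda>x. a * u x + b * v x]) =
          a * T (f, \<pi>[i := u]) + b * T (f, \<pi>[i := v]))"

definition continuous_on_forms :: "nat \<Rightarrow> 'a::metric_space form_functional \<Rightarrow> bool" where
  "continuous_on_forms k T \<longleftrightarrow>
     (\<forall>f (\<pi>n :: nat \<Rightarrow> ('a \<Rightarrow> real) list) \<pi> L.
        (f, \<pi>) \<in> D k \<and> (\<forall>n. (f, \<pi>n n) \<in> D k) \<and>
        (\<forall>i<k. \<forall>n. L-lipschitz_on UNIV (\<pi>n n ! i)) \<and>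
        (\<forall>i<k. \<forall>x. (\<lambda>n. (\<pi>n n ! i) x) \<longlonglongrightarrow> (\<pi> ! i) x) \<longrightarrow>
        (\<lambda>n. T (f, \<pi>n n)) \<longlonglongrightarrow> T (f, \<pi>))"

definition local_on_forms :: "nat \<Rightarrow> 'a::metric_space form_functional \<Rightarrow> bool" where
  "local_on_forms k T \<longleftrightarrow>
     (\<forall>f \<pi>. (f, \<pi>) \<in> D k \<and>
        (\<exists>i<k. \<exists>U c. open U \<and> {x. f x \<noteq> 0} \<subseteq> U \<and> (\<forall>x\<in>U. (\<pi> ! i) x = c)) \<longrightarrow>
        T (f, \<pi>) = 0)"

definition mass_bound ::
  "nat \<Rightarrow> 'a::metric_space form_functional \<Rightarrow> 'a measure \<Rightarrow> bool" where
  "mass_bound k T \<mu> \<longleftrightarrow> finite_borel_measure \<mu> \<and>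
     (\<forall>f \<pi>. (f, \<pi>) \<in> D k \<longrightarrow>
        \<bar>T (f, \<pi>)\<bar> \<le> (\<Prod>i<k. lip_const (\<pi> ! i)) * (\<integral>x. \<bar>f x\<bar> \<partial>\<mu>))"

definition currents :: "nat \<Rightarrow> 'a::metric_space form_functional set" where
  "currents k = {T. (\<forall>\<omega>. \<omega> \<notin> D k \<longrightarrow> T \<omega> = 0) \<and> multilinear_on_forms k T \<and>
     continuous_on_forms k T \<and> local_on_forms k T \<and> (\<exists>\<mu>. mass_bound k T \<mu>)}"

text \<open>On Borel measures the order on \<^typ>\<open>'a measure\<close> is the setwise one.\<close>

definition mass_measure :: "nat \<Rightarrow> 'a::metric_space form_functional \<Rightarrow> 'a measure" where
  "mass_measure k T = (LEAST \<mu>. mass_bound k T \<mu>)"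

definition mass :: "nat \<Rightarrow> 'a::metric_space form_functional \<Rightarrow> ennreal" where
  "mass k T = emeasure (mass_measure k T) UNIV"

definition boundary :: "'a::metric_space form_functional \<Rightarrow> 'a form_functional" where
  "boundary T = (\<lambda>\<omega>. if \<omega> \<in> D 0 then T (\<lambda>_. 1, [fst \<omega>]) else 0)"

text \<open>The element of \<open>currents 0\<close> identified with the signed measure \<open>\<mu> - \<nu>\<close>.\<close>

definition difference_current ::
  "'a::metric_space measure \<Rightarrow> 'a measure \<Rightarrow> 'a form_functional" where
  "difference_current \<mu> \<nu> =
     (\<lambda>\<omega>. if \<omega> \<in> D 0 then (\<integral>x. fst \<omega> x \<partial>\<mu>) - (\<integral>x. fst \<omega> x \<partial>\<nu>) else 0)"

text \<open>\<open>jordan_parts S \<mu> \<nu>\<close>: the functional \<open>S\<close> is a signed measure with positive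
  part \<open>\<mu>\<close> and negative part \<open>\<nu>\<close>.\<close>

definition jordan_parts ::
  "'a::metric_space form_functional \<Rightarrow> 'a measure \<Rightarrow> 'a measure \<Rightarrow> bool" where
  "jordan_parts S \<mu> \<nu> \<longleftrightarrow> finite_borel_measure \<mu> \<and> finite_borel_measure \<nu> \<and>
     mutually_singular \<mu> \<nu> \<and> S = difference_current \<mu> \<nu>"

definition subcurrent ::
  "'a::metric_space form_functional \<Rightarrow> 'a form_functional \<Rightarrow> bool" where
  "subcurrent S T \<longleftrightarrow> S \<in> currents 1 \<and> mass 1 (\<lambda>\<omega>. T \<omega> - S \<omega>) + mass 1 S \<le> mass 1 T"

definition cycle_of ::
  "'a::metric_space form_functional \<Rightarrow> 'a form_functional \<Rightarrow> bool" where
  "cycle_of C T \<longleftrightarrow> subcurrent C T \<and> boundary C = (\<lambda>_. 0)"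

definition acyclic_current :: "'a::metric_space form_functional \<Rightarrow> bool" where
  "acyclic_current T \<longleftrightarrow> (\<forall>C. cycle_of C T \<longleftrightarrow> C = (\<lambda>_. 0))"

definition admissible_currents ::
  "'a::metric_space measure \<Rightarrow> 'a measure \<Rightarrow> 'a form_functional set" where
  "admissible_currents \<mu> \<nu> = {T \<in> currents 1. boundary T = difference_current \<nu> \<mu>}"

definition minimal_current ::
  "'a::metric_space measure \<Rightarrow> 'a measure \<Rightarrow> 'a form_functional \<Rightarrow> bool" where
  "minimal_current \<mu> \<nu> T \<longleftrightarrow> is_arg_min (mass 1) (\<lambda>S. S \<in> admissible_currents \<mu> \<nu>) T"


section \<open>The metric space of curves\<close>

definition lipschitz_curve :: "(real \<Rightarrow> 'a::metric_space) \<Rightarrow> bool" where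
  "lipschitz_curve \<theta> \<longleftrightarrow> (\<exists>L. L-lipschitz_on {0..1} \<theta>)"

definition reparams :: "(real \<Rightarrow> real) set" where
  "reparams = {\<phi>. bij_betw \<phi> {0..1} {0..1} \<and> strict_mono_on {0..1} \<phi>}"

definition curve_sup_dist ::
  "(real \<Rightarrow> 'a::metric_space) \<Rightarrow> (real \<Rightarrow> 'a) \<Rightarrow> (real \<Rightarrow> real) \<Rightarrow> real" where
  "curve_sup_dist p q \<phi> = (SUP t\<in>{0..1}. dist (p t) (q (\<phi> t)))"

definition curve_dist :: "(real \<Rightarrow> 'a::metric_space) \<Rightarrow> (real \<Rightarrow> 'a) \<Rightarrow> real" where
  "curve_dist p q = (INF \<phi>\<in>reparams. curve_sup_dist p q \<phi>)"

lemma id_in_reparams: "(\<lambda>t. t) \<in> reparams"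
  by (auto simp: reparams_def bij_betw_def strict_mono_on_def inj_on_def)

lemma reparams_mem: "\<phi> \<in> reparams \<Longrightarrow> t \<in> {0..1} \<Longrightarrow> \<phi> t \<in> {0..1}"
  unfolding reparams_def using bij_betwE by blast

lemma reparams_comp:
  assumes "\<phi> \<in> reparams" "\<psi> \<in> reparams"
  shows "(\<lambda>t. \<psi> (\<phi> t)) \<in> reparams"
proof -
  have "bij_betw (\<psi> \<circ> \<phi>) {0..1} {0..1}"
    using assms by (auto simp: reparams_def intro: bij_betw_trans)
  moreover have "strict_mono_on {0..1} (\<lambda>t. \<psi> (\<phi> t))"
    using assms reparams_mem[OF assms(1)]
    by (auto simp: reparams_def strict_mono_on_def)
  ultimately show ?thesis by (simp add: reparams_def comp_def)
qed

lemma reparams_inv: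
  assumes "\<phi> \<in> reparams"
  shows "inv_into {0..1} \<phi> \<in> reparams"
proof -
  have b: "bij_betw \<phi> {0..1} {0..1}" and m: "strict_mono_on {0..1} \<phi>"
    using assms by (auto simp: reparams_def)
  have b': "bij_betw (inv_into {0..1} \<phi>) {0..1} {0..1}"
    using b by (rule bij_betw_inv_into)
  have "inv_into {0..1} \<phi> s < inv_into {0..1} \<phi> t"
    if st: "s \<in> {0..1}" "t \<in> {0..1}" "s < t" for s t
  proof (rule ccontr)
    let ?a = "inv_into {0..1} \<phi> s" and ?b = "inv_into {0..1} \<phi> t"
    assume "\<not> ?a < ?b"
    moreover have "?a \<in> {0..1}" "?b \<in> {0..1}"
      using b' st bij_betwE by blast+
    moreover have "\<phi> ?a = s" "\<phi> ?b = t"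
      using b st by (auto simp: bij_betw_inv_into_right)
    ultimately show False
      using st(3) strict_mono_onD[OF m, of ?b ?a] by (cases "?a = ?b") auto
  qed
  then show ?thesis using b' by (simp add: reparams_def strict_mono_on_def)
qed

lemma reparams_0:
  assumes "\<phi> \<in> reparams" shows "\<phi> 0 = 0"
proof -
  let ?i = "inv_into {0..1} \<phi>"
  have b: "bij_betw \<phi> {0..1} {0..1}" and m: "strict_mono_on {0..1} \<phi>"
    using assms by (auto simp: reparams_def)
  have i: "?i 0 \<in> {0..1}" "\<phi> (?i 0) = 0"
    using reparams_mem[OF reparams_inv[OF assms], of 0] b
    by (auto simp: bij_betw_inv_into_right)
  have "\<not> 0 < ?i 0"
    using strict_mono_onD[OF m, of "0" "?i 0"] i reparams_mem[OF assms, of 0] by auto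
  then have "?i 0 = 0" using i(1) by auto
  then show ?thesis using i(2) by simp
qed

lemma reparams_1:
  assumes "\<phi> \<in> reparams" shows "\<phi> 1 = 1"
proof -
  let ?i = "inv_into {0..1} \<phi>"
  have b: "bij_betw \<phi> {0..1} {0..1}" and m: "strict_mono_on {0..1} \<phi>"
    using assms by (auto simp: reparams_def)
  have i: "?i 1 \<in> {0..1}" "\<phi> (?i 1) = 1"
    using reparams_mem[OF reparams_inv[OF assms], of 1] b
    by (auto simp: bij_betw_inv_into_right)
  have "\<not> ?i 1 < 1"
    using strict_mono_onD[OF m, of "?i 1" "1"] i reparams_mem[OF assms, of 1] by auto
  then have "?i 1 = 1" using i(1) by auto
  then show ?thesis using i(2) by simp
qed

lemma lipschitz_curve_bounded:
  assumes "lipschitz_curve p" shows "bounded (p ` {0..1})"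
proof -
  obtain L where "L-lipschitz_on {0..1} p" using assms by (auto simp: lipschitz_curve_def)
  then have "continuous_on {0..1} p" by (rule lipschitz_on_continuous_on)
  then show ?thesis by (intro compact_imp_bounded compact_continuous_image) auto
qed

lemma curve_dist_bdd_above:
  assumes "lipschitz_curve p" "lipschitz_curve q" "\<phi> \<in> reparams"
  shows "bdd_above ((\<lambda>t. dist (p t) (q (\<phi> t))) ` {0..1})"
proof -
  have "bounded (p ` {0..1} \<union> q ` {0..1})"
    by (simp add: lipschitz_curve_bounded assms)
  then obtain x B where B: "\<forall>y\<in>p ` {0..1} \<union> q ` {0..1}. dist x y \<le> B"
    unfolding bounded_def by blast
  have "dist (p t) (q (\<phi> t)) \<le> B + B" if t: "t \<in> {0..1}" for t
  proof -
    have "dist x (p t) \<le> B" "dist x (q (\<phi> t)) \<le> B"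
      using B imageI[OF t, of p] imageI[OF reparams_mem[OF assms(3) t], of q] by simp_all
    then show ?thesis using dist_triangle3[of "p t" "q (\<phi> t)" x] by linarith
  qed
  then show ?thesis by (intro bdd_aboveI2)
qed

lemma curve_sup_dist_upper:
  assumes "lipschitz_curve p" "lipschitz_curve q" "\<phi> \<in> reparams" "t \<in> {0..1}"
  shows "dist (p t) (q (\<phi> t)) \<le> curve_sup_dist p q \<phi>"
  unfolding curve_sup_dist_def
  by (rule cSUP_upper[OF assms(4) curve_dist_bdd_above[OF assms(1-3)]])

lemma curve_sup_dist_nonneg:
  assumes "lipschitz_curve p" "lipschitz_curve q" "\<phi> \<in> reparams"
  shows "0 \<le> curve_sup_dist p q \<phi>"
  using order_trans[OF zero_le_dist curve_sup_dist_upper[OF assms, of 0]] by simp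

lemma curve_dist_lower:
  assumes "lipschitz_curve p" "lipschitz_curve q" "\<phi> \<in> reparams"
  shows "curve_dist p q \<le> curve_sup_dist p q \<phi>"
  unfolding curve_dist_def
  by (rule cINF_lower[OF _ assms(3)])
     (use curve_sup_dist_nonneg[OF assms(1,2)] in \<open>auto intro!: bdd_belowI\<close>)

lemma curve_dist_greatest:
  assumes "\<And>\<phi>. \<phi> \<in> reparams \<Longrightarrow> m \<le> curve_sup_dist p q \<phi>"
  shows "m \<le> curve_dist p q"
  unfolding curve_dist_def using assms id_in_reparams by (intro cINF_greatest) auto

lemma curve_dist_nonneg:
  "lipschitz_curve p \<Longrightarrow> lipschitz_curve q \<Longrightarrow> 0 \<le> curve_dist p q"
  by (intro curve_dist_greatest curve_sup_dist_nonneg)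

lemma curve_dist_refl:
  assumes "lipschitz_curve p" shows "curve_dist p p = 0"
proof -
  have "curve_sup_dist p p (\<lambda>t. t) = 0"
    by (simp add: curve_sup_dist_def)
  then show ?thesis
    using curve_dist_lower[OF assms assms id_in_reparams] curve_dist_nonneg[OF assms assms]
    by simp
qed

lemma curve_dist_commute_le:
  assumes "lipschitz_curve p" "lipschitz_curve q"
  shows "curve_dist p q \<le> curve_dist q p"
proof (rule curve_dist_greatest)
  fix \<phi> assume phi: "\<phi> \<in> reparams"
  have b: "bij_betw \<phi> {0..1} {0..1}" using phi by (simp add: reparams_def)
  note inv = reparams_inv[OF phi]
  have "dist (p t) (q (inv_into {0..1} \<phi> t)) \<le> curve_sup_dist q p \<phi>"
    if t: "t \<in> {0..1}" for t
    using curve_sup_dist_upper[OF assms(2,1) phi reparams_mem[OF inv t]] b t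
    by (simp add: bij_betw_inv_into_right dist_commute)
  then have "curve_sup_dist p q (inv_into {0..1} \<phi>) \<le> curve_sup_dist q p \<phi>"
    unfolding curve_sup_dist_def[of p q] by (intro cSUP_least) auto
  then show "curve_dist p q \<le> curve_sup_dist q p \<phi>"
    using curve_dist_lower[OF assms inv] by simp
qed

lemma curve_dist_commute:
  "lipschitz_curve p \<Longrightarrow> lipschitz_curve q \<Longrightarrow> curve_dist p q = curve_dist q p"
  by (intro antisym curve_dist_commute_le)

lemma curve_dist_triangle:
  assumes p: "lipschitz_curve p" and q: "lipschitz_curve q" and r: "lipschitz_curve r"
  shows "curve_dist p r \<le> curve_dist p q + curve_dist q r"
proof -
  have *: "curve_dist p r \<le> curve_sup_dist p q \<phi> + curve_sup_dist q r \<psi>"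
    if phi: "\<phi> \<in> reparams" and psi: "\<psi> \<in> reparams" for \<phi> \<psi>
  proof -
    have "dist (p t) (r (\<psi> (\<phi> t))) \<le> curve_sup_dist p q \<phi> + curve_sup_dist q r \<psi>"
      if t: "t \<in> {0..1}" for t
      using dist_triangle[of "p t" "r (\<psi> (\<phi> t))" "q (\<phi> t)"]
        curve_sup_dist_upper[OF p q phi t]
        curve_sup_dist_upper[OF q r psi reparams_mem[OF phi t]] by linarith
    then have "curve_sup_dist p r (\<lambda>t. \<psi> (\<phi> t)) \<le> curve_sup_dist p q \<phi> + curve_sup_dist q r \<psi>"
      unfolding curve_sup_dist_def[of p r] by (intro cSUP_least) auto
    then show ?thesis
      using curve_dist_lower[OF p r reparams_comp[OF phi psi]] by simp
  qed
  have "curve_dist p r - curve_sup_dist p q \<phi> \<le> curve_dist q r" if "\<phi> \<in> reparams" for \<phi>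
    using *[OF that] by (intro curve_dist_greatest) (simp add: algebra_simps)
  then have "curve_dist p r - curve_dist q r \<le> curve_dist p q"
    by (intro curve_dist_greatest) (simp add: algebra_simps)
  then show ?thesis by simp
qed

definition same_curve :: "(real \<Rightarrow> 'a::metric_space) \<Rightarrow> (real \<Rightarrow> 'a) \<Rightarrow> bool" where
  "same_curve p q \<longleftrightarrow> lipschitz_curve p \<and> lipschitz_curve q \<and> curve_dist p q = 0"

text \<open>Values of a parameterization outside the unit interval are irrelevant.\<close>

quotient_type (overloaded) 'a curve = "real \<Rightarrow> 'a::metric_space" / partial: same_curve
proof (rule part_equivpI)
  have "lipschitz_curve (\<lambda>_. undefined :: 'a)"
    unfolding lipschitz_curve_def by (intro exI[of _ 0] lipschitz_onI) auto
  then show "\<exists>p :: real \<Rightarrow> 'a. same_curve p p"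
    by (auto simp: same_curve_def curve_dist_refl)
  show "symp (same_curve :: (real \<Rightarrow> 'a) \<Rightarrow> _)"
    by (auto simp: symp_def same_curve_def curve_dist_commute)
  show "transp (same_curve :: (real \<Rightarrow> 'a) \<Rightarrow> _)"
  proof (rule transpI)
    fix p q r :: "real \<Rightarrow> 'a"
    assume "same_curve p q" "same_curve q r"
    then show "same_curve p r"
      using curve_dist_triangle[of p q r] curve_dist_nonneg[of p r]
      by (auto simp: same_curve_def)
  qed
qed

instantiation curve :: (metric_space) metric_space
begin

lift_definition dist_curve :: "'a curve \<Rightarrow> 'a curve \<Rightarrow> real" is curve_dist
proof -
  fix p p' q q' :: "real \<Rightarrow> 'a"
  assume "same_curve p p'" "same_curve q q'"
  then show "curve_dist p q = curve_dist p' q'"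
    using curve_dist_triangle[of p p' q] curve_dist_triangle[of p' q' q]
      curve_dist_triangle[of p' p q'] curve_dist_triangle[of p q q']
      curve_dist_commute[of p p'] curve_dist_commute[of q q']
    by (auto simp: same_curve_def)
qed

definition uniformity_curve :: "('a curve \<times> 'a curve) filter" where
  "uniformity_curve = (INF e\<in>{0<..}. principal {(x, y). dist x y < e})"

definition open_curve :: "'a curve set \<Rightarrow> bool" where
  "open_curve U \<longleftrightarrow> (\<forall>x\<in>U. eventually (\<lambda>(x', y). x' = x \<longrightarrow> y \<in> U) uniformity)"

instance
proof
  show "dist x y = 0 \<longleftrightarrow> x = y" for x y :: "'a curve"
    by transfer (auto simp: same_curve_def)
  show "dist x y \<le> dist x z + dist y z" for x y z :: "'a curve"
  proof transfer
    fix p q r :: "real \<Rightarrow> 'a"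
    assume "same_curve p p" "same_curve q q" "same_curve r r"
    then show "curve_dist p q \<le> curve_dist p r + curve_dist q r"
      using curve_dist_triangle[of p r q] curve_dist_commute[of q r]
      by (simp add: same_curve_def)
  qed
qed (simp_all add: uniformity_curve_def open_curve_def)

end

lemma same_curve_endpoint:
  assumes "same_curve p q" and e: "\<And>\<phi>. \<phi> \<in> reparams \<Longrightarrow> \<phi> e = e" "e \<in> {0..1}"
  shows "p e = q e"
proof -
  have l: "lipschitz_curve p" "lipschitz_curve q" "curve_dist p q = 0"
    using assms by (auto simp: same_curve_def)
  have "dist (p e) (q e) \<le> curve_sup_dist p q \<phi>" if "\<phi> \<in> reparams" for \<phi>
    using curve_sup_dist_upper[OF l(1,2) that e(2)] e(1)[OF that] by simp
  then have "dist (p e) (q e) \<le> curve_dist p q" by (rule curve_dist_greatest)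
  then show ?thesis using l(3) by simp
qed

lift_definition start :: "'a::metric_space curve \<Rightarrow> 'a" is "\<lambda>p. p 0"
  by (erule same_curve_endpoint) (auto simp: reparams_0)

lift_definition finish :: "'a::metric_space curve \<Rightarrow> 'a" is "\<lambda>p. p 1"
  by (erule same_curve_endpoint) (auto simp: reparams_1)

text \<open>The function \<^term>\<open>rep_curve\<close> picks some Lipschitz parameterization of a
  class. The length and the current below depend on the class only, so the
  choice is immaterial. The limit and the derivative used there exist at almost
  every \<open>t\<close>.\<close>

definition metric_derivative :: "(real \<Rightarrow> 'a::metric_space) \<Rightarrow> real \<Rightarrow> real" where
  "metric_derivative p t = Lim (at t) (\<lambda>s. dist (p s) (p t) / \<bar>s - t\<bar>)"

definition curve_length :: "'a::metric_space curve \<Rightarrow> real" where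
  "curve_length \<theta> = integral {0..1} (metric_derivative (rep_curve \<theta>))"

definition curve_current :: "'a::metric_space curve \<Rightarrow> 'a form_functional" where
  "curve_current \<theta> = (\<lambda>\<omega>. if \<omega> \<in> D 1
     then integral {0..1} (\<lambda>t. fst \<omega> (rep_curve \<theta> t) *
            deriv (\<lambda>s. (snd \<omega> ! 0) (rep_curve \<theta> s)) t)
     else 0)"

definition is_arc :: "'a::metric_space curve \<Rightarrow> bool" where
  "is_arc \<theta> \<longleftrightarrow> (\<exists>p. lipschitz_curve p \<and> abs_curve p = \<theta> \<and> inj_on p {0..1})"

definition geodesic :: "'a::metric_space curve \<Rightarrow> 'a \<Rightarrow> 'a \<Rightarrow> bool" where
  "geodesic \<theta> x y \<longleftrightarrow> start \<theta> = x \<and> finish \<theta> = y \<and> dist x y = curve_length \<theta>"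


section \<open>Transports\<close>

definition transport_current ::
  "'a::metric_space curve measure \<Rightarrow> 'a form_functional" where
  "transport_current \<eta> = (\<lambda>\<omega>. \<integral>\<theta>. curve_current \<theta> \<omega> \<partial>\<eta>)"

definition transport_mass_identity ::
  "'a::metric_space curve measure \<Rightarrow> 'a form_functional \<Rightarrow> bool" where
  "transport_mass_identity \<eta> T \<longleftrightarrow>
     mass 1 T = (\<integral>\<^sup>+ \<theta>. mass 1 (curve_current \<theta>) \<partial>\<eta>) \<and>
     mass 1 T = (\<integral>\<^sup>+ \<theta>. ennreal (curve_length \<theta>) \<partial>\<eta>)"

definition represents ::
  "'a::metric_space curve measure \<Rightarrow> 'a form_functional \<Rightarrow> bool" where
  "represents \<eta> T \<longleftrightarrow> finite_borel_measure \<eta> \<and> T = transport_current \<eta> \<and>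
     transport_mass_identity \<eta> T \<and>
     jordan_parts (boundary T) (distr \<eta> borel finish) (distr \<eta> borel start) \<and>
     (AE \<theta> in \<eta>. is_arc \<theta>)"

end

theory Submission
  imports Defs
begin

text \<open>For an admissible current \<open>T\<close> and a bounded 1-Lipschitz \<open>u\<close> one has
  \<open>\<integral>u d\<phi>m - \<integral>u d\<phi>p = \<partial>T(u) = T(1 du) \<le> mass T\<close>, so the Kantorovich dual value \<open>c\<close> bounds every
  mass from below. Conversely a plan \<open>\<gamma>\<close> pushed forward by \<open>q\<close> is a transport along geodesics,
  whose current is admissible and has mass at most the cost of \<open>\<gamma>\<close>. Duality provides a plan of
  cost \<open>c\<close>; hence \<open>W1\<close>, the minimal mass and \<open>c\<close> coincide and all remaining claims are equality
  cases. No tightness or weak compactness is used: the optimal plan is an almost sure limit of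
  discrete optimal plans realised on a common interval.\<close>

section \<open>Differentiation of Lipschitz functions of a real variable\<close>

text \<open>Three features of the definitions shape the proof. Length and current of a curve are
  read off an arbitrary representative through \<open>Lim\<close> and \<open>deriv\<close>, and two
  representatives of a class are related only by approximate reparameterizations; so
  differentiability almost everywhere comes first, and invariance rests on semicontinuity and
  Riemann sums instead of a change of variables. \<open>mass_measure\<close> is a
  \<open>LEAST\<close> in the setwise order, so a least bound has to be constructed before any mass
  can be estimated. The space, and with it the space of curves, may be nonseparable: Ulam numbers
  supply a separable carrier for each of the two measures, and measurability on curves rests on
  constant-speed parameterizations of geodesics. Mutual singularity enters where Jordan parts do: if
  the two measures share mass, the Jordan parts of their difference are smaller than the measures
  themselves, so they cannot be the endpoint marginals of the transport built from a plan.\<close>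

definition measure_add :: "'b measure \<Rightarrow> 'b measure \<Rightarrow> 'b measure" where
  "measure_add M N = measure_of (space M) (sets M) (\<lambda>A. emeasure M A + emeasure N A)"

lemma space_measure_add [simp]: "space (measure_add M N) = space M"
  by (simp add: measure_add_def space_measure_of_conv)

lemma sets_measure_add [simp, measurable_cong]: "sets (measure_add M N) = sets M"
  by (simp add: measure_add_def)

lemma emeasure_measure_add:
  assumes "sets N = sets M" "A \<in> sets M"
  shows "emeasure (measure_add M N) A = emeasure M A + emeasure N A"
  unfolding measure_add_def
proof (rule emeasure_measure_of_sigma)
  show "countably_additive (sets M) (\<lambda>A. emeasure M A + emeasure N A)"
  proof (rule countably_additiveI)
    fix F :: "nat \<Rightarrow> _" assume F: "range F \<subseteq> sets M" "disjoint_family F"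
    then show "(\<Sum>i. emeasure M (F i) + emeasure N (F i)) = emeasure M (\<Union>i. F i) + emeasure N (\<Union>i. F i)"
      using suminf_emeasure[of F M] suminf_emeasure[of F N] assms(1)
      by (simp add: suminf_add[symmetric])
  qed
qed (use assms in \<open>auto simp: positive_def sets.sigma_algebra_axioms\<close>)

lemma nn_integral_measure_add:
  assumes [measurable_cong]: "sets N = sets M" and f: "f \<in> borel_measurable M"
  shows "(\<integral>\<^sup>+x. f x \<partial>measure_add M N) = (\<integral>\<^sup>+x. f x \<partial>M) + (\<integral>\<^sup>+x. f x \<partial>N)"
  using f
proof (induction rule: borel_measurable_induct)
  case (cong f g)
  have sp: "space N = space M" using sets_eq_imp_space_eq[OF assms(1)] .
  show ?case
    using cong.IH nn_integral_cong[of "measure_add M N" f g] nn_integral_cong[of M f g] nn_integral_cong[of N f g]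
      cong.hyps sp by simp
next
  case (set A)
  then show ?case using assms(1) by (simp add: emeasure_measure_add)
next
  case (mult u c)
  then have "u \<in> borel_measurable N" using assms(1) measurable_cong_sets by blast
  with mult show ?case by (simp add: nn_integral_cmult distrib_left)
next
  case (add u v)
  then have "u \<in> borel_measurable N" "v \<in> borel_measurable N"
    using assms(1) measurable_cong_sets by blast+
  with add show ?case by (simp add: nn_integral_add ac_simps)
next
  case (seq U)
  then have m: "\<And>i. U i \<in> borel_measurable N"
    using assms(1) measurable_cong_sets by blast
  have inc: "incseq (\<lambda>i. \<integral>\<^sup>+x. U i x \<partial>M)" "incseq (\<lambda>i. \<integral>\<^sup>+x. U i x \<partial>N)"
    using seq(3) by (auto simp: incseq_def le_fun_def intro!: nn_integral_mono)
  show ?case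
    using seq m by (simp add: image_comp nn_integral_monotone_convergence_SUP ennreal_SUP_add[OF inc] SUP_apply)
qed

text \<open>Over any interval the increments of \<open>f\<close> and of its complement
  \<open>x - f x\<close> add up to the length, and \<open>lborel\<close> is determined by its values
  on boxes. Passing to the complement exchanges large and small slopes, so one covering estimate
  will control both the upper and the lower derivative.\<close>

lemma outer_lipschitz_interval_measure:
  fixes f :: "real \<Rightarrow> real"
  assumes "mono f" "mono (\<lambda>x. x - f x)"
  shows "measure_add (interval_measure f) (interval_measure (\<lambda>x. x - f x)) = lborel"
    and "continuous_on UNIV f"
proof -
  have lip: "\<bar>f y - f x\<bar> \<le> \<bar>y - x\<bar>" for x y
    using monoD[OF assms(1), of x y] monoD[OF assms(1), of y x]
      monoD[OF assms(2), of x y] monoD[OF assms(2), of y x] by (cases "x \<le> y") auto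
  have "1-lipschitz_on UNIV f"
    by (rule lipschitz_onI) (use lip in \<open>auto simp: dist_real_def abs_minus_commute\<close>)
  then show c: "continuous_on UNIV f" by (rule lipschitz_on_continuous_on)
  then have c': "continuous_on UNIV (\<lambda>x. x - f x)" by (intro continuous_intros)
  have *: "emeasure (interval_measure F) (box l u) = F u - F l"
    if lu: "l \<le> u" and F: "mono F" "continuous_on UNIV F" for F and l u :: real
  proof -
    \<comment> \<open>The Stieltjes measure is given on half-open intervals; continuity of
      \<open>F\<close> makes the right endpoint a null set.\<close>
    have Ioc: "emeasure (interval_measure F) {l<..u} = F u - F l"
      using F by (intro emeasure_interval_measure_Ioc lu monoD[OF F(1)])
        (auto intro: continuous_on_subset continuous_at_imp_continuous_at_within simp: continuous_on_eq_continuous_at)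
    have "emeasure (interval_measure F) {u..u} = F u - F u"
      using F by (intro emeasure_interval_measure_Icc) (auto dest: monoD)
    then have z: "emeasure (interval_measure F) {u} = 0" by simp
    show ?thesis
    proof (cases "l = u")
      case True then show ?thesis by simp
    next
      case False
      with lu have "{l<..u} = box l u \<union> {u}" by (auto simp: box_real)
      moreover have "emeasure (interval_measure F) (box l u \<union> {u}) = emeasure (interval_measure F) (box l u)"
        using z by (intro emeasure_Un_null_set) (auto simp: null_sets_def)
      ultimately show ?thesis using Ioc by simp
    qed
  qed
  show "measure_add (interval_measure f) (interval_measure (\<lambda>x. x - f x)) = lborel"
  proof (rule lborel_eqI[symmetric])
    fix l u :: real assume "\<And>b. b \<in> Basis \<Longrightarrow> l \<bullet> b \<le> u \<bullet> b"
    then have lu: "l \<le> u" by simp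
    have "emeasure (measure_add (interval_measure f) (interval_measure (\<lambda>x. x - f x))) (box l u)
       = ennreal (f u - f l) + ennreal ((u - f u) - (l - f l))"
      using *[OF lu assms(1) c] *[OF lu assms(2) c'] by (subst emeasure_measure_add) simp_all
    also have "\<dots> = ennreal (u - l)"
      using lu monoD[OF assms(1) lu] monoD[OF assms(2) lu] by (subst ennreal_plus[symmetric]) auto
    finally show "emeasure (measure_add (interval_measure f) (interval_measure (\<lambda>x. x - f x))) (box l u) =
      ennreal (\<Prod>b\<in>Basis. (u - l) \<bullet> b)" by simp
  qed simp
qed

text \<open>Vitali's theorem picks from the given short intervals countably many disjoint ones that
  exhaust \<open>E\<close> up to a null set; each carries Stieltjes measure at least
  \<open>r\<close> times its length. Keeping them inside an open set \<open>U\<close> only slightly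
  larger than \<open>E\<close> confines the error, because the Stieltjes measure is dominated by
  \<open>lborel\<close>.\<close>

lemma emeasure_ge_of_fine_cover:
  fixes f :: "real \<Rightarrow> real"
  assumes f: "mono f" "mono (\<lambda>x. x - f x)" and E: "E \<in> sets borel" "emeasure lborel E < \<infinity>"
    and r: "0 \<le> r"
    and cov: "\<And>x d. x \<in> E \<Longrightarrow> 0 < d \<Longrightarrow> \<exists>u v. u < x \<and> x < v \<and> v - u < d \<and> r * (v - u) \<le> f v - f u"
  shows "ennreal r * emeasure lborel E \<le> emeasure (interval_measure f) E"
proof (rule ennreal_le_epsilon)
  fix e :: real assume e: "0 < e"
  let ?M = "interval_measure f"
  note A = outer_lipschitz_interval_measure[OF f]
  have le: "emeasure ?M B \<le> emeasure lborel B" if "B \<in> sets borel" for B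
    using that by (subst A(1)[symmetric], subst emeasure_measure_add) auto
  obtain U where U: "open U" "E \<subseteq> U" "emeasure lborel (U - E) < e"
    using outer_regular_lborel[OF E(1) e] .
  define K where "K = {(a, d). 0 < d \<and> cball a d \<subseteq> U \<and> r * (2 * d) \<le> f (a + d) - f (a - d)}"
  have "\<exists>i. i \<in> K \<and> x \<in> cball (fst i) (snd i) \<and> snd i < d" if x: "x \<in> E" and d: "0 < d" for x d
  proof -
    obtain h where h: "0 < h" "ball x h \<subseteq> U" using U x by (meson openE subsetD)
    obtain u v where uv: "u < x" "x < v" "v - u < min h d" "r * (v - u) \<le> f v - f u"
      using cov[OF x, of "min h d"] h d by auto
    \<comment> \<open>An interval \<open>{u..v}\<close> enters the family as the ball about its
      midpoint, the form that the covering theorem handles.\<close>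
    have eq: "cball ((u+v)/2) ((v-u)/2) = {u..v}"
      unfolding cball_eq_atLeastAtMost by (simp add: field_simps)
    have "cball ((u+v)/2) ((v-u)/2) \<subseteq> ball x h"
      unfolding eq using uv by (auto simp: ball_eq_greaterThanLessThan)
    moreover have "r * (2 * ((v - u) / 2)) \<le> f ((u + v) / 2 + (v - u) / 2) - f ((u + v) / 2 - (v - u) / 2)"
    proof -
      have "(u + v) / 2 + (v - u) / 2 = v" "(u + v) / 2 - (v - u) / 2 = u" "2 * ((v - u) / 2) = v - u"
        by (simp_all add: field_simps)
      then show ?thesis using uv(4) by (simp only:)
    qed
    moreover have "0 < (v - u) / 2" using uv by simp
    ultimately have "((u+v)/2, (v-u)/2) \<in> K"
      using h(2) unfolding K_def mem_Collect_eq case_prod_conv by blast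
    moreover have "x \<in> cball ((u+v)/2) ((v-u)/2)" unfolding eq using uv by auto
    moreover have "(v-u)/2 < d" using uv by auto
    ultimately show ?thesis
      by (intro exI[of _ "((u+v)/2, (v-u)/2)"] conjI) (simp_all only: fst_conv snd_conv)
  qed
  note vit = this
  obtain C where C: "countable C" "C \<subseteq> K"
     "pairwise (\<lambda>i j. disjnt (cball (fst i) (snd i)) (cball (fst j) (snd j))) C"
     "negligible(E - (\<Union>i \<in> C. cball (fst i) (snd i)))"
  proof (rule Vitali_covering_theorem_cballs[of K snd E fst])
    show "0 < snd i" if "i \<in> K" for i using that by (simp add: K_def split_beta)
  qed (use vit in blast)+
  let ?I = "\<lambda>i. cball (fst i) (snd i)"
  have dis: "disjoint_family_on ?I C"
    using C(3) by (auto simp: disjoint_family_on_def pairwise_def disjnt_def)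
  have mI: "(\<Union>i\<in>C. ?I i) \<in> sets borel" using C(1) by (intro sets.countable_UN') auto
  have null: "emeasure lborel (E - (\<Union>i\<in>C. ?I i)) = 0"
    using C(4) E(1) mI
    by (metis (no_types, lifting) negligible_iff_null_sets null_sets_completion_iff sets.Diff sets_lborel null_setsD1)
  have I: "emeasure lborel (?I i) = ennreal (2 * snd i)"
      "ennreal r * ennreal (2 * snd i) \<le> emeasure ?M (?I i)" if "i \<in> C" for i
  proof -
    have i: "0 < snd i" "r * (2 * snd i) \<le> f (fst i + snd i) - f (fst i - snd i)"
      using that C(2) by (auto simp: K_def)
    then show "emeasure lborel (?I i) = ennreal (2 * snd i)"
      by (simp add: cball_eq_atLeastAtMost)
    have "emeasure ?M (?I i) = f (fst i + snd i) - f (fst i - snd i)"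
      unfolding cball_eq_atLeastAtMost
      using i A(2) by (intro emeasure_interval_measure_Icc) (auto dest: monoD[OF f(1)])
    then show "ennreal r * ennreal (2 * snd i) \<le> emeasure ?M (?I i)"
      using i r by (simp add: ennreal_mult[symmetric] ennreal_leI)
  qed
  have "emeasure lborel E \<le> emeasure lborel ((E - (\<Union>i\<in>C. ?I i)) \<union> (\<Union>i\<in>C. ?I i))"
    using E mI by (intro emeasure_mono) auto
  also have "\<dots> \<le> emeasure lborel (E - (\<Union>i\<in>C. ?I i)) + emeasure lborel (\<Union>i\<in>C. ?I i)"
    using E mI by (intro emeasure_subadditive) auto
  also have "\<dots> = (\<integral>\<^sup>+i. emeasure lborel (?I i) \<partial>count_space C)"
    using null emeasure_UN_countable[OF _ C(1) dis, of lborel] by simp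
  finally have "ennreal r * emeasure lborel E \<le> ennreal r * (\<integral>\<^sup>+i. emeasure lborel (?I i) \<partial>count_space C)"
    by (rule mult_left_mono) simp
  also have "\<dots> = (\<integral>\<^sup>+i. ennreal r * emeasure lborel (?I i) \<partial>count_space C)"
    by (simp add: nn_integral_cmult)
  also have "\<dots> \<le> (\<integral>\<^sup>+i. emeasure ?M (?I i) \<partial>count_space C)"
    using I by (intro nn_integral_mono) auto
  also have "\<dots> = emeasure ?M (\<Union>i\<in>C. ?I i)"
    using emeasure_UN_countable[OF _ C(1) dis, of ?M] by simp
  also have "\<dots> \<le> emeasure ?M (E \<union> (U - E))"
  proof (intro emeasure_mono)
    have "?I i \<subseteq> U" if "i \<in> C" for i
      using subsetD[OF C(2) that] by (simp add: K_def split_beta)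
    then show "(\<Union>i\<in>C. ?I i) \<subseteq> E \<union> (U - E)" by blast
  qed (use E U(1) in auto)
  also have "\<dots> \<le> emeasure ?M E + emeasure ?M (U - E)"
    using E U(1) by (intro emeasure_subadditive) auto
  also have "emeasure ?M (U - E) \<le> e"
    using le[of "U - E"] U E by (meson borel_open less_imp_le order_trans sets.Diff)
  finally show "ennreal r * emeasure lborel E \<le> emeasure ?M E + ennreal e"
    by (simp add: add_left_mono)
qed

text \<open>Slopes are taken over intervals straddling \<open>x\<close> and not from
  \<open>x\<close> itself: the set is then a countable intersection of open sets for every
  \<open>f\<close>. Its complement still bounds the ordinary difference quotients of a monotone
  function.\<close>

definition upper_slope_set :: "(real \<Rightarrow> real) \<Rightarrow> real \<Rightarrow> real set" where
  "upper_slope_set f r = {x. \<forall>n. \<exists>u v. u < x \<and> x < v \<and> v - u < 1 / Suc n \<and> r * (v - u) < f v - f u}"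

lemma upper_slope_set_borel: "upper_slope_set f r \<in> sets borel"
proof -
  have "upper_slope_set f r = (\<Inter>n. \<Union>(u, v)\<in>{(u, v). v - u < 1 / Suc n \<and> r * (v - u) < f v - f u}. {u<..<v})"
    by (auto simp: upper_slope_set_def) blast+
  also have "\<dots> \<in> sets borel"
  proof (intro sets.countable_INT'')
    fix n show "(\<Union>(u, v)\<in>{(u, v). v - u < 1 / Suc n \<and> r * (v - u) < f v - f u}. {u<..<v}) \<in> sets borel"
      by (intro borel_open open_UN ballI) (auto split: prod.split)
  qed auto
  finally show ?thesis .
qed

text \<open>A straddling interval arises by pushing the endpoint \<open>x\<close> a distance
  \<open>h\<close> to the other side; by monotonicity this can only enlarge the increment, and the
  extra term \<open>r * h\<close> is arbitrarily small.\<close>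

lemma slope_le_of_not_upper_slope_set:
  assumes f: "mono f" and x: "x \<notin> upper_slope_set f r" and r: "0 \<le> r"
  shows "eventually (\<lambda>y. (f y - f x) / (y - x) \<le> r) (at x)"
proof -
  obtain n where n: "\<And>u v. u < x \<Longrightarrow> x < v \<Longrightarrow> v - u < 1 / Suc n \<Longrightarrow> f v - f u \<le> r * (v - u)"
    using x unfolding upper_slope_set_def mem_Collect_eq not_all not_ex de_Morgan_conj not_less
    by (meson not_le)
  \<comment> \<open>Half of the admissible length: a point within \<open>d\<close> of
    \<open>x\<close> and a shift of at most \<open>d\<close> to the other side together span less
    than \<open>1 / Suc n\<close>.\<close>
  define d where "d = 1 / (2 * real (Suc n))"
  have d: "0 < d" "\<And>e. e \<le> d \<Longrightarrow> e < d + d \<and> d + d = 1 / Suc n" by (auto simp: d_def field_simps)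
  have right: "f v - f x \<le> r * (v - x)" if v: "x < v" "v < x + d" for v
  proof (rule field_le_epsilon)
    fix e :: real assume e: "0 < e"
    define h where "h = min d (e / (r + 1))"
    have h: "0 < h" "h \<le> d" using d e r by (auto simp: h_def)
    have "r * h \<le> r * (e / (r + 1))" using r by (intro mult_left_mono) (auto simp: h_def)
    also have "\<dots> \<le> e" using r e by (simp add: field_simps)
    finally have "r * h \<le> e" .
    moreover have "f v - f (x - h) \<le> r * (v - (x - h))" using h v d(2)[of d] by (intro n) auto
    moreover have "f (x - h) \<le> f x" using h by (intro monoD[OF f]) auto
    ultimately show "f v - f x \<le> r * (v - x) + e" by (simp add: algebra_simps)
  qed
  have left: "f x - f u \<le> r * (x - u)" if u: "u < x" "x - d < u" for u
  proof (rule field_le_epsilon)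
    fix e :: real assume e: "0 < e"
    define h where "h = min d (e / (r + 1))"
    have h: "0 < h" "h \<le> d" using d e r by (auto simp: h_def)
    have "r * h \<le> r * (e / (r + 1))" using r by (intro mult_left_mono) (auto simp: h_def)
    also have "\<dots> \<le> e" using r e by (simp add: field_simps)
    finally have "r * h \<le> e" .
    moreover have "f (x + h) - f u \<le> r * (x + h - u)" using h u d(2)[of d] by (intro n) auto
    moreover have "f x \<le> f (x + h)" using h by (intro monoD[OF f]) auto
    ultimately show "f x - f u \<le> r * (x - u) + e" by (simp add: algebra_simps)
  qed
  have "(f y - f x) / (y - x) \<le> r" if "y \<noteq> x" "dist y x < d" for y
  proof (cases "y < x")
    case True
    then show ?thesis using left[of y] that by (simp add: dist_real_def divide_le_eq algebra_simps)
  next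
    case False
    then show ?thesis using right[of y] that by (simp add: dist_real_def divide_le_eq algebra_simps)
  qed
  then show ?thesis using d(1) unfolding eventually_at by blast
qed

text \<open>Where the derivative fails to exist, two rationals \<open>s < r\<close> separate the
  slopes: that of \<open>f\<close> exceeds \<open>r\<close> and that of the complement exceeds
  \<open>1 - s\<close> on arbitrarily short intervals. On a bounded set \<open>F\<close> of such
  points the covering estimate gives \<open>(r + 1 - s) |F| \<le> |F|\<close>, since the two
  Stieltjes measures add up to \<open>lborel\<close>; as \<open>r > s\<close>, \<open>F\<close> is
  null.\<close>

lemma mono_contraction_AE_differentiable:
  fixes f :: "real \<Rightarrow> real"
  assumes f: "mono f" "mono (\<lambda>x. x - f x)"
  shows "AE x in lborel. \<exists>l. (f has_real_derivative l) (at x)"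
proof -
  let ?g = "\<lambda>x. x - f x"
  let ?E = "\<lambda>r s. upper_slope_set f r \<inter> upper_slope_set ?g (1 - s)"
  have null: "AE x in lborel. x \<notin> ?E r s" if rs: "s < r" "0 \<le> r" "s \<le> 1" for r s
  proof -
    \<comment> \<open>Truncation provides finite measure, without which the factor
      \<open>r + 1 - s > 1\<close> would give no contradiction.\<close>
    have "?E r s \<inter> {-real n..real n} \<in> null_sets lborel" for n :: nat
    proof -
      let ?F = "?E r s \<inter> {-real n..real n}"
      have F: "?F \<in> sets borel" by (intro sets.Int upper_slope_set_borel) auto
      have "emeasure lborel ?F \<le> emeasure lborel {-real n..real n}" by (intro emeasure_mono) auto
      then have fin: "emeasure lborel ?F < \<infinity>" by (auto intro: le_less_trans)
      have cov: "\<exists>u v. u < x \<and> x < v \<and> v - u < d \<and> t * (v - u) \<le> h v - h u"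
        if x: "x \<in> upper_slope_set h t" and d: "0 < d" for h x t and d :: real
      proof -
        obtain k :: nat where "1 / Suc k < d" using d nat_approx_posE by blast
        then show ?thesis using x unfolding upper_slope_set_def
          by (auto dest!: spec[of _ k]) (meson less_imp_le less_trans)
      qed
      have gg: "mono (\<lambda>x. x - ?g x)" using f by simp
      have 1: "ennreal r * emeasure lborel ?F \<le> emeasure (interval_measure f) ?F"
        using rs by (intro emeasure_ge_of_fine_cover f F fin cov) auto
      have 2: "ennreal (1 - s) * emeasure lborel ?F \<le> emeasure (interval_measure ?g) ?F"
        using rs by (intro emeasure_ge_of_fine_cover f gg F fin cov) auto
      have "ennreal (r + (1 - s)) * emeasure lborel ?F
          = ennreal r * emeasure lborel ?F + ennreal (1 - s) * emeasure lborel ?F"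
        using rs by (subst ennreal_plus) (auto simp: distrib_right)
      also have "\<dots> \<le> emeasure (interval_measure f) ?F + emeasure (interval_measure ?g) ?F"
        using 1 2 by (rule add_mono)
      also have "\<dots> = emeasure lborel ?F"
        using F by (subst outer_lipschitz_interval_measure(1)[OF f, symmetric])
          (subst emeasure_measure_add, auto)
      finally have *: "ennreal (r + (1 - s)) * emeasure lborel ?F \<le> emeasure lborel ?F" .
      obtain a where a: "emeasure lborel ?F = ennreal a" "0 \<le> a"
        using fin by (cases "emeasure lborel ?F") auto
      have "(r + (1 - s)) * a \<le> a" using * a rs
        by (simp add: ennreal_mult[symmetric] del: ennreal_plus)
      then have "(r - s) * a \<le> 0" by (simp add: algebra_simps)
      then have "a = 0" using rs a(2) by (simp add: mult_le_0_iff)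
      then show ?thesis using a F by (simp add: null_sets_def)
    qed
    then have "(\<Union>n. ?E r s \<inter> {-real n..real n}) \<in> null_sets lborel" by (intro null_sets_UN) auto
    moreover have "?E r s \<subseteq> (\<Union>n. ?E r s \<inter> {-real n..real n})"
    proof
      fix x assume x: "x \<in> ?E r s"
      obtain n :: nat where "\<bar>x\<bar> \<le> real n" using real_arch_simple by blast
      then show "x \<in> (\<Union>n. ?E r s \<inter> {-real n..real n})" using x by (auto intro!: exI[of _ n])
    qed
    ultimately show ?thesis by (rule AE_I'[OF _ order_trans[rotated]]) auto
  qed
  have "AE x in lborel. \<forall>r\<in>\<rat>. \<forall>s\<in>\<rat>. s < r \<longrightarrow> 0 \<le> r \<longrightarrow> s \<le> 1 \<longrightarrow> x \<notin> ?E r s"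
    using null by (intro AE_ball_countable' countable_rat AE_impI)  auto
  then show ?thesis
  proof eventually_elim
    fix x assume x: "\<forall>r\<in>\<rat>. \<forall>s\<in>\<rat>. s < r \<longrightarrow> 0 \<le> r \<longrightarrow> s \<le> 1 \<longrightarrow> x \<notin> ?E r s"
    define Q where "Q y = (f y - f x) / (y - x)" for y
    have Q01: "0 \<le> Q y" "Q y \<le> 1" if "y \<noteq> x" for y
    proof -
      have "0 \<le> Q y \<and> Q y \<le> 1"
        using that monoD[OF f(1), of x y] monoD[OF f(1), of y x] monoD[OF f(2), of x y] monoD[OF f(2), of y x]
        by (cases "x < y") (auto simp: Q_def field_simps zero_le_divide_iff)
      then show "0 \<le> Q y" "Q y \<le> 1" by auto
    qed
    have alt: "eventually (\<lambda>y. Q y \<le> r) (at x) \<or> eventually (\<lambda>y. s \<le> Q y) (at x)"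
      if rs: "r \<in> \<rat>" "s \<in> \<rat>" "s < r" "0 \<le> r" "s \<le> 1" for r s
    proof -
      have "x \<notin> upper_slope_set f r \<or> x \<notin> upper_slope_set ?g (1 - s)" using x rs by auto
      then show ?thesis
      proof
        assume "x \<notin> upper_slope_set f r"
        then show ?thesis using slope_le_of_not_upper_slope_set[OF f(1)] rs by (auto simp: Q_def)
      next
        assume "x \<notin> upper_slope_set ?g (1 - s)"
        then have "eventually (\<lambda>y. (?g y - ?g x) / (y - x) \<le> 1 - s) (at x)"
          using rs by (intro slope_le_of_not_upper_slope_set f) auto
        moreover have "eventually (\<lambda>y. y \<noteq> x) (at x)" by (auto simp: eventually_at_filter)
        ultimately have "eventually (\<lambda>y. s \<le> Q y) (at x)"
        proof eventually_elim
          fix y assume y: "(?g y - ?g x) / (y - x) \<le> 1 - s" "y \<noteq> x"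
          have "(?g y - ?g x) / (y - x) = 1 - Q y" using y(2) by (simp add: Q_def field_simps)
          then show "s \<le> Q y" using y by simp
        qed
        then show ?thesis by simp
      qed
    qed
    \<comment> \<open>The limit of the quotients is the infimum of their eventual upper bounds. Of
      two rationals below \<open>Inf S\<close> the larger is not an eventual upper bound, so by
      \<open>alt\<close> the smaller is an eventual lower bound.\<close>
    define S where "S = {r. 0 \<le> r \<and> eventually (\<lambda>y. Q y \<le> r) (at x)}"
    have ev: "eventually (\<lambda>y. 0 \<le> Q y \<and> Q y \<le> 1) (at x)"
      using Q01 by (auto simp: eventually_at_filter)
    have "eventually (\<lambda>y. Q y \<le> 1) (at x)" using ev by (rule eventually_mono) auto
    then have S1: "1 \<in> S" by (simp add: S_def)
    have Sb: "bdd_below S" by (auto simp: S_def intro: bdd_belowI[of _ 0])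
    have S0: "0 \<le> Inf S" by (rule cInf_greatest) (use S1 in blast, auto simp: S_def)
    have SI1: "Inf S \<le> 1" using cInf_lower[OF S1 Sb] .
    have "(Q \<longlongrightarrow> Inf S) (at x)"
    proof (rule order_tendstoI)
      fix a assume a: "a < Inf S"
      show "eventually (\<lambda>y. a < Q y) (at x)"
      proof (cases "a < 0")
        case True then show ?thesis using ev by (auto elim: eventually_mono)
      next
        case False
        obtain s where s: "s \<in> \<rat>" "a < s" "s < Inf S" using Rats_dense_in_real[OF a] by auto
        obtain r where r: "r \<in> \<rat>" "s < r" "r < Inf S" using Rats_dense_in_real[OF s(3)] by auto
        have "r \<notin> S" using cInf_lower[OF _ Sb, of r] r by auto
        then have "\<not> eventually (\<lambda>y. Q y \<le> r) (at x)" using r s False by (auto simp: S_def)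
        then have "eventually (\<lambda>y. s \<le> Q y) (at x)" using alt[of r s] r s False SI1 by auto
        then show ?thesis using s by (auto elim: eventually_mono)
      qed
    next
      fix a assume "Inf S < a"
      then obtain r where "r \<in> S" "r < a" using cInf_lessD[of S a] S1 by auto
      then show "eventually (\<lambda>y. Q y < a) (at x)" by (auto simp: S_def elim: eventually_mono)
    qed
    then show "\<exists>l. (f has_real_derivative l) (at x)"
      unfolding has_field_derivative_iff Q_def by blast
  qed
qed

text \<open>Adding \<open>L * x\<close> and dividing by \<open>2 * L + 1\<close> brings all slopes
  between 0 and 1, where the monotone case applies; the extra 1 avoids a division by zero for
  \<open>L = 0\<close>.\<close>

lemma lipschitz_AE_differentiable:
  fixes g :: "real \<Rightarrow> real"
  assumes g: "L-lipschitz_on UNIV g"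
  shows "AE x in lborel. \<exists>l. (g has_real_derivative l) (at x)"
proof -
  define c where "c = 2 * L + 1"
  define f where "f x = (g x + L * x) / c" for x
  have L: "0 \<le> L" using g by (rule lipschitz_on_nonneg)
  have b: "\<bar>g y - g x\<bar> \<le> L * (y - x)" if "x \<le> y" for x y
    using lipschitz_onD[OF g, of y x] that by (simp add: dist_real_def)
  have f1: "mono f"
  proof (rule monoI)
    fix x y :: real assume "x \<le> y"
    then have "g x + L * x \<le> g y + L * y" using b[of x y] by (simp add: algebra_simps)
    then show "f x \<le> f y" using L by (auto simp: f_def c_def intro: divide_right_mono)
  qed
  have f2: "mono (\<lambda>x. x - f x)"
  proof (rule monoI)
    fix x y :: real assume xy: "x \<le> y"
    have "(g y - g x) + L * (y - x) \<le> c * (y - x)"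
      using b[OF xy] xy by (simp add: c_def algebra_simps)
    then have "((g y - g x) + L * (y - x)) / c \<le> y - x" using L by (simp add: c_def field_simps)
    moreover have "f y - f x = ((g y - g x) + L * (y - x)) / c"
      by (simp add: f_def diff_divide_distrib[symmetric] algebra_simps)
    ultimately show "x - f x \<le> y - f y" by simp
  qed
  have "AE x in lborel. \<exists>l. (f has_real_derivative l) (at x)"
    by (rule mono_contraction_AE_differentiable[OF f1 f2])
  then show ?thesis
  proof eventually_elim
    fix x assume "\<exists>l. (f has_real_derivative l) (at x)"
    then obtain l where l: "(f has_real_derivative l) (at x)" by blast
    have "g = (\<lambda>x. c * f x - L * x)" using L by (auto simp: f_def c_def)
    moreover have "((\<lambda>x. c * f x - L * x) has_real_derivative (c * l - L)) (at x)"
      by (rule derivative_eq_intros l | simp)+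
    ultimately show "\<exists>l. (g has_real_derivative l) (at x)" by auto
  qed
qed

lemma lipschitz_diff_quot_bound:
  fixes g :: "real \<Rightarrow> real"
  assumes g: "L-lipschitz_on UNIV g"
  shows "\<bar>(g y - g x) / (y - x)\<bar> \<le> L"
proof (cases "y = x")
  case False
  then show ?thesis using lipschitz_onD[OF g, of y x] by (simp add: dist_real_def field_simps)
qed (use lipschitz_on_nonneg[OF g] in simp)

lemma lipschitz_deriv_bound:
  fixes g :: "real \<Rightarrow> real"
  assumes g: "L-lipschitz_on UNIV g" and d: "(g has_real_derivative l) (at x)"
  shows "\<bar>l\<bar> \<le> L"
proof (rule tendsto_le[OF _ tendsto_const])
  show "((\<lambda>y. \<bar>(g y - g x) / (y - x)\<bar>) \<longlongrightarrow> \<bar>l\<bar>) (at x)"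
    using d unfolding has_field_derivative_iff by (rule tendsto_rabs)
qed (use lipschitz_diff_quot_bound[OF g] in auto)

text \<open>The derivative is represented by the everywhere defined Borel function
  \<open>limsup n (g (x + 1/n) - g x)\<close>, which avoids measurability questions for \<^const>\<open>deriv\<close>.\<close>

lemma lipschitz_FTC:
  fixes g :: "real \<Rightarrow> real"
  assumes g: "L-lipschitz_on UNIV g"
  obtains g' where "g' \<in> borel_measurable borel" "\<And>x. \<bar>g' x\<bar> \<le> L"
    "AE x in lborel. (g has_real_derivative g' x) (at x)"
    "\<And>a b. a \<le> b \<Longrightarrow> (g' has_integral (g b - g a)) {a..b}"
proof -
  define Q where "Q n x = (g (x + 1 / Suc n) - g x) / (x + 1 / Suc n - x)" for n :: nat and x
  define G where "G x = lim (\<lambda>n. Q n x)" for x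
  \<comment> \<open>Clamping makes the bound hold everywhere, also on the null set where
    \<open>lim\<close> has an unspecified value.\<close>
  define g' where "g' x = max (-L) (min L (G x))" for x
  have L: "0 \<le> L" using g by (rule lipschitz_on_nonneg)
  have cg: "continuous_on UNIV g" using g by (rule lipschitz_on_continuous_on)
  have mQ [measurable]: "Q n \<in> borel_measurable borel" for n
    unfolding Q_def using cg
    by (intro borel_measurable_continuous_onI continuous_intros)
      (auto intro!: continuous_intros continuous_on_compose2[OF cg])
  have mG [measurable]: "G \<in> borel_measurable borel" unfolding G_def by measurable
  have m: "g' \<in> borel_measurable borel" unfolding g'_def by measurable
  have Qb: "\<bar>Q n x\<bar> \<le> L" for n x unfolding Q_def by (rule lipschitz_diff_quot_bound[OF g])
  have bd: "\<bar>g' x\<bar> \<le> L" for x using L by (auto simp: g'_def)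
  have conv: "(\<lambda>n. Q n x) \<longlonglongrightarrow> l" if "(g has_real_derivative l) (at x)" for x l
  proof -
    have "((\<lambda>y. (g y - g x) / (y - x)) \<longlongrightarrow> l) (at x)"
      using that by (simp add: has_field_derivative_iff)
    moreover have "filterlim (\<lambda>n::nat. x + 1 / Suc n) (at x) sequentially"
    proof (rule filterlim_atI)
      have "(\<lambda>n::nat. x + 1 / Suc n) \<longlonglongrightarrow> x + 0"
        by (intro tendsto_intros LIMSEQ_Suc[OF lim_1_over_n])
      then show "(\<lambda>n::nat. x + 1 / Suc n) \<longlonglongrightarrow> x" by simp
    qed auto
    ultimately show ?thesis unfolding Q_def by (rule filterlim_compose)
  qed
  have eq: "g' x = l" if "(g has_real_derivative l) (at x)" for x l
    using limI[OF conv[OF that]] lipschitz_deriv_bound[OF g that] by (auto simp: g'_def G_def)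
  have AE: "AE x in lborel. (g has_real_derivative g' x) (at x)"
    using lipschitz_AE_differentiable[OF g] by eventually_elim (use eq in auto)
  have "(g' has_integral (g b - g a)) {a..b}" if ab: "a \<le> b" for a b
  proof -
    define F where "F x = integral {a..x} g" for x
    define N where "N = {x. \<not> (g has_real_derivative g' x) (at x)}"
    have neg: "negligible N"
      using AE unfolding N_def
      by (simp add: eventually_ae_filter negligible_iff_null_sets)
        (meson completion.complete_sets_sandwich null_sets_completionI null_sets_completion_subset)
    have Qi: "(Q n has_integral (integral {a..b} (Q n))) {a..b}" for n
      unfolding Q_def using cg
      by (intro integrable_integral integrable_continuous_real)
         (auto intro!: continuous_intros continuous_on_compose2[OF cg])
    have lim: "(\<lambda>n. integral {a..b} (Q n)) \<longlonglongrightarrow> integral {a..b} (\<lambda>x. if x \<in> N then 0 else g' x)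
        \<and> (\<lambda>x. if x \<in> N then 0 else g' x) integrable_on {a..b}"
    proof -
      have i: "(\<lambda>x. if x \<in> N then 0 else Q n x) integrable_on {a..b}"
         and e: "integral {a..b} (\<lambda>x. if x \<in> N then 0 else Q n x) = integral {a..b} (Q n)" for n
      proof -
        have "((\<lambda>x. if x \<in> N then 0 else Q n x) has_integral (integral {a..b} (Q n))) {a..b}"
          by (rule has_integral_spike[OF neg _ Qi]) auto
        then show "(\<lambda>x. if x \<in> N then 0 else Q n x) integrable_on {a..b}"
          "integral {a..b} (\<lambda>x. if x \<in> N then 0 else Q n x) = integral {a..b} (Q n)"
          by (auto simp: integral_unique)
      qed
      have "(\<lambda>x. if x \<in> N then 0 else g' x) integrable_on {a..b} \<and>
        (\<lambda>n. integral {a..b} (\<lambda>x. if x \<in> N then 0 else Q n x)) \<longlonglongrightarrow> integral {a..b} (\<lambda>x. if x \<in> N then 0 else g' x)"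
      proof (intro conjI)
        note D = dominated_convergence[of "\<lambda>n x. if x \<in> N then 0 else Q n x" "{a..b}" "\<lambda>_. L"
            "\<lambda>x. if x \<in> N then 0 else g' x", OF i integrable_const_ivl]
        have 1: "\<And>n x. x \<in> {a..b} \<Longrightarrow> norm (if x \<in> N then 0 else Q n x) \<le> L" using Qb L by auto
        have 2: "\<And>x. x \<in> {a..b} \<Longrightarrow> (\<lambda>n. if x \<in> N then 0 else Q n x) \<longlonglongrightarrow> (if x \<in> N then 0 else g' x)"
          using conv by (auto simp: N_def)
        show "(\<lambda>x. if x \<in> N then 0 else g' x) integrable_on {a..b}" using D(1) 1 2 by blast
        show "(\<lambda>n. integral {a..b} (\<lambda>x. if x \<in> N then 0 else Q n x)) \<longlonglongrightarrow> integral {a..b} (\<lambda>x. if x \<in> N then 0 else g' x)"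
          using D(2) 1 2 by blast
      qed
      then show ?thesis by (simp add: e)
    qed
    have spike: "(g' has_integral l) {a..b}" if "((\<lambda>x. if x \<in> N then 0 else g' x) has_integral l) {a..b}" for l
      by (rule has_integral_spike[OF neg _ that]) auto
    \<comment> \<open>The integral of a difference quotient of \<open>g\<close> over
      \<open>{a..b}\<close> telescopes to the mean of \<open>g\<close> over a short interval to the
      right of \<open>b\<close> minus the corresponding mean at \<open>a\<close>; continuity of
      \<open>g\<close> gives the limit. The same integrals converge to that of \<open>g'\<close> by
      dominated convergence.\<close>
    have val: "(\<lambda>n. integral {a..b} (Q n)) \<longlonglongrightarrow> g b - g a"
    proof -
      define F where "F x = integral {a..x} g" for x
      have Fd: "(F has_vector_derivative g x) (at x within {a..b+1})" if "x \<in> {a..b+1}" for x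
        unfolding F_def using that
        by (intro integral_has_vector_derivative continuous_on_subset[OF cg]) auto
      have int: "integral {u..v} g = F v - F u" if "a \<le> u" "u \<le> v" for u v
      proof -
        have "integral {a..u} g + integral {u..v} g = integral {a..v} g"
          using that cg by (intro Henstock_Kurzweil_Integration.integral_combine integrable_continuous_real)
            (auto intro: continuous_on_subset)
        then show ?thesis by (simp add: F_def)
      qed
      have shift: "integral {a..b} (\<lambda>x. g (x + h)) = integral {a+h..b+h} g" for h
        using integral_shift_real_ivl[of "a+h" h "b+h" g] by simp
      have Qn: "integral {a..b} (Q n) =
         (F (b + 1 / Suc n) - F b) / (1 / Suc n) - (F (a + 1 / Suc n) - F a) / (1 / Suc n)" for n
      proof -
        let ?h = "1 / Suc n"
        have "integral {a..b} (Q n) = integral {a..b} (\<lambda>x. (1 / ?h) * (g (x + ?h) - g x))"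
          by (intro integral_cong) (simp add: Q_def)
        also have "\<dots> = (1 / ?h) * (integral {a..b} (\<lambda>x. g (x + ?h)) - integral {a..b} g)"
          using cg by (subst integral_mult_right, subst integral_diff)
           (auto intro!: integrable_continuous_real continuous_intros continuous_on_compose2[OF cg])
        also have "\<dots> = (1 / ?h) * ((F (b + ?h) - F (a + ?h)) - (F b - F a))"
          using ab by (simp add: shift int)
        finally show ?thesis by (simp add: field_simps)
      qed
      have slope: "(\<lambda>n. (F (x + 1 / Suc n) - F x) / (1 / Suc n)) \<longlonglongrightarrow> g x" if x: "x \<in> {a..b}" for x
      proof -
        have "(F has_real_derivative g x) (at x within {a..b+1})"
          using Fd[of x] x by (simp add: has_real_derivative_iff_has_vector_derivative)
        then have "((\<lambda>y. (F y - F x) / (y - x)) \<longlongrightarrow> g x) (at x within {a..b+1})"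
          by (simp add: has_field_derivative_iff)
        moreover have "filterlim (\<lambda>n::nat. x + 1 / Suc n) (at x within {a..b+1}) sequentially"
          unfolding filterlim_at
        proof
          show "\<forall>\<^sub>F n in sequentially. x + 1 / real (Suc n) \<in> {a..b + 1} \<and> x + 1 / real (Suc n) \<noteq> x"
          proof (intro always_eventually allI)
            fix n :: nat
            have "0 < 1 / real (Suc n)" "1 / real (Suc n) \<le> 1" by auto
            then show "x + 1 / real (Suc n) \<in> {a..b + 1} \<and> x + 1 / real (Suc n) \<noteq> x"
              using x unfolding atLeastAtMost_iff by linarith
          qed
          have "(\<lambda>n::nat. x + 1 / Suc n) \<longlonglongrightarrow> x + 0"
            by (intro tendsto_intros LIMSEQ_Suc[OF lim_1_over_n])
          then show "(\<lambda>n::nat. x + 1 / Suc n) \<longlonglongrightarrow> x" by simp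
        qed
        ultimately have "(\<lambda>n. (F (x + 1 / Suc n) - F x) / (x + 1 / Suc n - x)) \<longlonglongrightarrow> g x"
          by (rule filterlim_compose)
        then show ?thesis by simp
      qed
      show ?thesis unfolding Qn using ab by (intro tendsto_diff slope) auto
    qed
    show ?thesis
      using lim val LIMSEQ_unique spike by (metis integrable_integral)
  qed
  then show thesis using that m bd AE by blast
qed

lemma bounded_borel_integrable_Icc:
  fixes f :: "real \<Rightarrow> real"
  assumes "f \<in> borel_measurable borel" "\<And>x. \<bar>f x\<bar> \<le> B"
  shows "set_integrable lborel {a..b} f" "f integrable_on {a..b}"
    "(LINT x:{a..b}|lborel. f x) = integral {a..b} f"
proof -
  show s: "set_integrable lborel {a..b} f"
    unfolding set_integrable_def
    by (rule integrableI_bounded_set_indicator[where B=B]) (use assms in \<open>auto simp: emeasure_lborel_Icc_eq\<close>)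
  show "f integrable_on {a..b}" "(LINT x:{a..b}|lborel. f x) = integral {a..b} f"
    using set_borel_integral_eq_integral[OF s] by auto
qed

lemma AE_eq_of_le_integral_eq:
  fixes f g :: "real \<Rightarrow> real"
  assumes f: "f \<in> borel_measurable borel" "\<And>x. \<bar>f x\<bar> \<le> B"
    and g: "g \<in> borel_measurable borel" "\<And>x. \<bar>g x\<bar> \<le> B"
    and le: "AE x in lborel. x \<in> {a..b} \<longrightarrow> f x \<le> g x"
    and eq: "integral {a..b} f = integral {a..b} g"
  shows "AE x in lborel. x \<in> {a..b} \<longrightarrow> f x = g x"
proof -
  let ?h = "\<lambda>x. indicator {a..b} x *\<^sub>R g x - indicator {a..b} x *\<^sub>R f x"
  note F = bounded_borel_integrable_Icc[OF f, of a b, unfolded set_integrable_def set_lebesgue_integral_def]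
  note G = bounded_borel_integrable_Icc[OF g, of a b, unfolded set_integrable_def set_lebesgue_integral_def]
  have "integrable lborel ?h" using F G by (intro Bochner_Integration.integrable_diff)
  moreover have "(LINT x|lborel. ?h x) = 0"
    using F G eq by (subst Bochner_Integration.integral_diff) auto
  moreover have "AE x in lborel. 0 \<le> ?h x"
    using le by eventually_elim (auto simp: indicator_def)
  ultimately have "AE x in lborel. ?h x = 0"
    by (simp add: integral_nonneg_eq_0_iff_AE)
  then show ?thesis by eventually_elim (auto simp: indicator_def)
qed

lemma integral_cong_AE_lborel:
  fixes f g :: "real \<Rightarrow> real"
  assumes "AE x in lborel. x \<in> {a..b} \<longrightarrow> f x = g x"
  shows "(f has_integral l) {a..b} \<longleftrightarrow> (g has_integral l) {a..b}"
    and "integral {a..b} f = integral {a..b} g"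
    and "f integrable_on {a..b} \<longleftrightarrow> g integrable_on {a..b}"
proof -
  define N where "N = {x. \<not> (x \<in> {a..b} \<longrightarrow> f x = g x)}"
  have "AE x in lebesgue. x \<notin> N" unfolding AE_completion_iff using assms by (rule eventually_mono) (auto simp: N_def)
  then obtain N' where "N' \<in> null_sets lebesgue" "N \<subseteq> N'"
    unfolding eventually_ae_filter by auto
  then have N: "negligible N" by (meson negligible_iff_null_sets negligible_subset)
  have *: "(f has_integral k) {a..b} \<longleftrightarrow> (g has_integral k) {a..b}" for k
    using N by (intro has_integral_spike_eq) (auto simp: N_def)
  show "(f has_integral l) {a..b} \<longleftrightarrow> (g has_integral l) {a..b}" by (rule *)
  show "integral {a..b} f = integral {a..b} g"
    using N by (intro integral_spike) (auto simp: N_def)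
  show "f integrable_on {a..b} \<longleftrightarrow> g integrable_on {a..b}"
    unfolding integrable_on_def * ..
qed

text \<open>This is the existence of the metric derivative. The real functions
  \<open>dist (P s) (P (r n))\<close>, with rational \<open>r n\<close>, are differentiable almost
  everywhere, and the supremum \<open>m\<close> of their absolute derivatives bounds the distance
  quotient from below in the limit. From above the quotient is bounded by that of the primitive
  \<open>F\<close> of \<open>m\<close>, whose derivative is identified with \<open>m\<close> by
  comparing integrals.\<close>

lemma AE_limit_of_dist_quotient:
  fixes P :: "real \<Rightarrow> 'a::metric_space"
  assumes P: "K-lipschitz_on UNIV P"
  obtains m where "m \<in> borel_measurable borel" "\<And>t. 0 \<le> m t" "\<And>t. m t \<le> K"
    "AE t in lborel. t \<in> {0<..<1} \<longrightarrow> ((\<lambda>s. dist (P s) (P t) / \<bar>s - t\<bar>) \<longlongrightarrow> m t) (at t)"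
    "\<And>a b. a \<le> b \<Longrightarrow> dist (P a) (P b) \<le> integral {a..b} m"
proof -
  define r where "r = from_nat_into (\<rat> :: real set)"
  have r: "range r = \<rat>" unfolding r_def by (rule range_from_nat_into) (auto simp: countable_rat Rats_infinite)
  define \<phi> where "\<phi> n s = dist (P s) (P (r n))" for n s
  have K: "0 \<le> K" using P by (rule lipschitz_on_nonneg)
  have dP: "dist (P x) (P y) \<le> K * \<bar>x - y\<bar>" for x y
    using lipschitz_onD[OF P, of x y] by (simp add: dist_real_def)
  have \<phi>P: "\<bar>\<phi> n x - \<phi> n y\<bar> \<le> dist (P x) (P y)" for n x y
    unfolding \<phi>_def by (metis abs_dist_diff_le dist_commute)
  have \<phi>: "K-lipschitz_on UNIV (\<phi> n)" for n
  proof (rule lipschitz_onI)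
    fix x y show "dist (\<phi> n x) (\<phi> n y) \<le> K * dist x y"
      using order_trans[OF \<phi>P dP, of n x y] by (simp add: dist_real_def)
  qed (rule K)
  have "\<exists>d. d \<in> borel_measurable borel \<and> (\<forall>x. \<bar>d x\<bar> \<le> K) \<and>
    (AE x in lborel. (\<phi> n has_real_derivative d x) (at x)) \<and>
    (\<forall>a b. a \<le> b \<longrightarrow> (d has_integral (\<phi> n b - \<phi> n a)) {a..b})" for n
    using lipschitz_FTC[OF \<phi>[of n]] by metis
  then obtain d where d: "\<And>n. d n \<in> borel_measurable borel" "\<And>n x. \<bar>d n x\<bar> \<le> K"
     "\<And>n. AE x in lborel. (\<phi> n has_real_derivative d n x) (at x)"
     "\<And>n a b. a \<le> b \<Longrightarrow> (d n has_integral (\<phi> n b - \<phi> n a)) {a..b}" by metis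
  note d(1)[measurable]
  define m where "m t = (SUP n. \<bar>d n t\<bar>)" for t
  have bdd: "bdd_above (range (\<lambda>n. \<bar>d n t\<bar>))" for t using d(2) by (intro bdd_aboveI2)
  have mm: "m \<in> borel_measurable borel"
    unfolding m_def by (rule borel_measurable_cSUP) (use bdd in auto)
  have up: "\<bar>d n t\<bar> \<le> m t" for n t unfolding m_def by (rule cSUP_upper[OF _ bdd]) simp
  have m0: "0 \<le> m t" for t using up[of 0 t] by linarith
  have mK: "m t \<le> K" for t unfolding m_def using d(2) by (intro cSUP_least) auto
  have mB: "\<bar>m t\<bar> \<le> K" for t using m0[of t] mK[of t] by simp
  note mi = bounded_borel_integrable_Icc(2)[OF mm mB]
  \<comment> \<open>A rational time \<open>r n\<close> just after \<open>a\<close> makes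
    \<open>\<phi> n\<close> almost zero at \<open>a\<close>, so its increment over
    \<open>{a..b}\<close> is almost the whole distance.\<close>
  have dist_le: "dist (P a) (P b) \<le> integral {a..b} m" if ab: "a \<le> b" for a b
  proof (rule field_le_epsilon)
    fix e :: real assume e: "0 < e"
    define h where "h = e / (2 * (K + 1))"
    have h: "0 < h" using e K by (simp add: h_def)
    obtain q where "q \<in> \<rat>" "a < q" "q < a + h" using Rats_dense_in_real[of a "a + h"] h by auto
    then obtain n where n: "a < r n" "r n < a + h" using r by (metis imageE)
    have "\<phi> n b - \<phi> n a = integral {a..b} (d n)" by (rule integral_unique[OF d(4)[OF ab], symmetric])
    also have "\<dots> \<le> integral {a..b} m"
      using d(4)[OF ab, of n] up by (intro integral_le mi) (auto simp: has_integral_integrable abs_le_iff)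
    finally have 1: "\<phi> n b - \<phi> n a \<le> integral {a..b} m" .
    have "dist (P a) (P b) \<le> dist (P a) (P (r n)) + \<phi> n b"
      unfolding \<phi>_def using dist_triangle[of "P a" "P b" "P (r n)"] by (simp add: dist_commute)
    also have "\<dots> = (\<phi> n b - \<phi> n a) + 2 * dist (P a) (P (r n))" by (simp add: \<phi>_def)
    also have "2 * dist (P a) (P (r n)) \<le> 2 * (K * h)"
      using dP[of a "r n"] n K mult_left_mono[of "r n - a" h K] by simp
    also have "2 * (K * h) \<le> e" using K e by (simp add: h_def field_simps)
    finally show "dist (P a) (P b) \<le> integral {a..b} m + e" using 1 by simp
  qed
  \<comment> \<open>Constant to the left of 0, so that \<open>F\<close> is monotone and Lipschitz on
    the whole line.\<close>
  define F where "F t = integral {0..max 0 t} m" for t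
  have Fd: "F y - F x = integral {max 0 x..max 0 y} m" if "x \<le> y" for x y
  proof -
    have "integral {0..max 0 x} m + integral {max 0 x..max 0 y} m = integral {0..max 0 y} m"
      using that by (intro Henstock_Kurzweil_Integration.integral_combine mi) auto
    then show ?thesis by (simp add: F_def)
  qed
  have Fl: "\<bar>F y - F x\<bar> \<le> K * (y - x)" if "x \<le> y" for x y
  proof -
    have 1: "0 \<le> integral {max 0 x..max 0 y} m" using m0 by (intro integral_nonneg mi) auto
    have "integral {max 0 x..max 0 y} m \<le> integral {max 0 x..max 0 y} (\<lambda>_. K)"
      using mK by (intro integral_le mi) auto
    also have "\<dots> = (max 0 y - max 0 x) * K" using that by (subst integral_const_real) auto
    also have "\<dots> \<le> (y - x) * K" using K that by (intro mult_right_mono) auto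
    finally show ?thesis using Fd[OF that] 1 by (simp add: mult.commute)
  qed
  have FL: "K-lipschitz_on UNIV F"
  proof (rule lipschitz_onI)
    fix x y
    have *: "dist (F x) (F y) \<le> K * dist x y" if "x \<le> y" for x y
    proof -
      have "dist (F x) (F y) = \<bar>F y - F x\<bar>" "dist x y = y - x"
        using that by (simp_all add: dist_real_def)
      then show ?thesis using Fl[OF that] by (simp only:)
    qed
    show "dist (F x) (F y) \<le> K * dist x y"
      using *[of x y] *[of y x] by (cases "x \<le> y") (simp_all add: dist_commute)
  qed (rule K)
  obtain F' where F': "F' \<in> borel_measurable borel" "\<And>x. \<bar>F' x\<bar> \<le> K"
    "AE x in lborel. (F has_real_derivative F' x) (at x)"
    "\<And>a b. a \<le> b \<Longrightarrow> (F' has_integral (F b - F a)) {a..b}"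
    using lipschitz_FTC[OF FL] by metis
  have QF: "dist (P s) (P t) / \<bar>s - t\<bar> \<le> \<bar>(F s - F t) / (s - t)\<bar>" if "0 < s" "0 < t" for s t
  proof -
    have "dist (P s) (P t) \<le> \<bar>F s - F t\<bar>"
      using dist_le[of s t] dist_le[of t s] Fd[of s t] Fd[of t s] that
      by (cases "s \<le> t") (auto simp: dist_commute)
    then show ?thesis by (simp add: divide_right_mono)
  qed
  have Fmono: "F x \<le> F y" if "x \<le> y" for x y
  proof -
    have "0 \<le> integral {max 0 x..max 0 y} m" using m0 by (intro integral_nonneg mi) auto
    then show ?thesis using Fd[OF that] by simp
  qed
  have pos: "eventually (\<lambda>s. 0 < s) (at t)" if "0 < t" for t :: real
    using that by (intro order_tendstoD(1)[OF tendsto_ident_at])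
  have lim_\<phi>: "((\<lambda>s. \<bar>\<phi> n s - \<phi> n t\<bar> / \<bar>s - t\<bar>) \<longlongrightarrow> \<bar>d n t\<bar>) (at t)"
    if "(\<phi> n has_real_derivative d n t) (at t)" for n t
    using tendsto_rabs[OF that[unfolded has_field_derivative_iff]] by simp
  have AEd: "AE t in lborel. \<forall>n. (\<phi> n has_real_derivative d n t) (at t)"
    using d(3) by (simp add: AE_all_countable)
  have le: "AE t in lborel. t \<in> {0..1} \<longrightarrow> m t \<le> F' t"
    using AEd F'(3) AE_lborel_singleton[of 0]
  proof eventually_elim
    case (elim t)
    show ?case
    proof
      assume "t \<in> {0..1}"
      then have t: "0 < t" using elim by auto
      have Flim: "((\<lambda>s. (F s - F t) / (s - t)) \<longlongrightarrow> F' t) (at t)"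
        using elim by (simp add: has_field_derivative_iff)
      have nonneg: "0 \<le> (F s - F t) / (s - t)" for s
        using Fmono[of s t] Fmono[of t s] by (cases "s \<le> t") (auto simp: zero_le_divide_iff)
      have "\<bar>d n t\<bar> \<le> F' t" for n
      proof (rule tendsto_le[OF _ Flim lim_\<phi>])
        show "(\<phi> n has_real_derivative d n t) (at t)" using elim by simp
        show "\<forall>\<^sub>F s in at t. \<bar>\<phi> n s - \<phi> n t\<bar> / \<bar>s - t\<bar> \<le> (F s - F t) / (s - t)"
          using pos[OF t]
        proof eventually_elim
          case (elim s)
          have "\<bar>\<phi> n s - \<phi> n t\<bar> / \<bar>s - t\<bar> \<le> dist (P s) (P t) / \<bar>s - t\<bar>"
            by (intro divide_right_mono \<phi>P) auto
          also have "\<dots> \<le> (F s - F t) / (s - t)"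
            using QF[OF elim t] unfolding abs_of_nonneg[OF nonneg] .
          finally show ?case .
        qed
      qed simp
      then show "m t \<le> F' t" unfolding m_def by (rule cSUP_least[OF UNIV_not_empty])
    qed
  qed
  \<comment> \<open>\<open>F'\<close> dominates every \<open>\<bar>d n\<bar>\<close>, hence
    \<open>m\<close>, and has the same integral over the unit interval; so the two agree almost
    everywhere.\<close>
  have "integral {0..1} F' = integral {0..1} m"
    using integral_unique[OF F'(4), of 0 1] Fd[of 0 1] by simp
  then have eq: "AE t in lborel. t \<in> {0..1} \<longrightarrow> m t = F' t"
    using AE_eq_of_le_integral_eq[OF mm mB F'(1,2) le] by simp
  have "AE t in lborel. t \<in> {0<..<1} \<longrightarrow> ((\<lambda>s. dist (P s) (P t) / \<bar>s - t\<bar>) \<longlongrightarrow> m t) (at t)"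
    using AEd F'(3) eq
  proof eventually_elim
    case (elim t)
    show ?case
    proof
      assume t: "t \<in> {0<..<1}"
      then have mF: "m t = F' t" using elim by auto
      have Flim: "((\<lambda>s. \<bar>(F s - F t) / (s - t)\<bar>) \<longlongrightarrow> m t) (at t)"
        using tendsto_rabs[of "\<lambda>s. (F s - F t) / (s - t)" "F' t" "at t"] elim m0[of t]
        by (simp add: has_field_derivative_iff mF)
      show "((\<lambda>s. dist (P s) (P t) / \<bar>s - t\<bar>) \<longlongrightarrow> m t) (at t)"
      proof (rule order_tendstoI)
        fix a assume "a < m t"
        then obtain n where n: "a < \<bar>d n t\<bar>" unfolding m_def using less_cSUP_iff[OF _ bdd] by auto
        have "((\<lambda>s. \<bar>\<phi> n s - \<phi> n t\<bar> / \<bar>s - t\<bar>) \<longlongrightarrow> \<bar>d n t\<bar>) (at t)"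
          using elim by (intro lim_\<phi>) auto
        from order_tendstoD(1)[OF this n]
        show "\<forall>\<^sub>F s in at t. a < dist (P s) (P t) / \<bar>s - t\<bar>"
        proof eventually_elim
          case (elim s)
          have "\<bar>\<phi> n s - \<phi> n t\<bar> / \<bar>s - t\<bar> \<le> dist (P s) (P t) / \<bar>s - t\<bar>"
            by (intro divide_right_mono \<phi>P) auto
          then show ?case using elim by simp
        qed
      next
        fix a assume "m t < a"
        have "eventually (\<lambda>s. 0 < s) (at t)" using t by (intro pos) auto
        with order_tendstoD(2)[OF Flim \<open>m t < a\<close>]
        show "\<forall>\<^sub>F s in at t. dist (P s) (P t) / \<bar>s - t\<bar> < a"
        proof eventually_elim
          case (elim s)
          have "dist (P s) (P t) / \<bar>s - t\<bar> \<le> \<bar>(F s - F t) / (s - t)\<bar>"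
            using elim(2) t by (intro QF) auto
          then show ?case using elim(1) by (rule le_less_trans)
        qed
      qed
    qed
  qed
  then show thesis by (rule that[OF mm m0 mK _ dist_le])
qed

section \<open>Length and line integrals of Lipschitz curves\<close>

definition param_length :: "(real \<Rightarrow> 'a::metric_space) \<Rightarrow> real" where
  "param_length p = integral {0..1} (metric_derivative p)"

definition line_integral :: "(real \<Rightarrow> 'a::metric_space) \<Rightarrow> ('a \<Rightarrow> real) \<Rightarrow> ('a \<Rightarrow> real) \<Rightarrow> real" where
  "line_integral p f \<pi> = integral {0..1} (\<lambda>t. f (p t) * deriv (\<lambda>s. \<pi> (p s)) t)"

text \<open>Continuation by the end values: the differentiation lemmas speak of functions on the
  whole line, while a parameterization is controlled on the unit interval only.\<close>

lemma lipschitz_curve_extension: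
  assumes "lipschitz_curve p"
  obtains K P where "K-lipschitz_on UNIV P" "\<And>t. t \<in> {0..1} \<Longrightarrow> P t = p t"
    "\<And>t. P t = p (max 0 (min 1 t))"
proof -
  obtain K where K: "K-lipschitz_on {0..1} p" using assms by (auto simp: lipschitz_curve_def)
  define P where "P t = p (max 0 (min 1 t))" for t
  have "K-lipschitz_on UNIV P"
  proof (rule lipschitz_onI)
    fix x y :: real
    have "dist (P x) (P y) \<le> K * dist (max 0 (min 1 x)) (max 0 (min 1 y))"
      unfolding P_def by (rule lipschitz_onD[OF K]) auto
    also have "\<dots> \<le> K * dist x y"
      using lipschitz_on_nonneg[OF K] by (intro mult_left_mono) (auto simp: dist_real_def)
    finally show "dist (P x) (P y) \<le> K * dist x y" .
  qed (rule lipschitz_on_nonneg[OF K])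
  then show thesis by (rule that) (auto simp: P_def)
qed

lemma eventually_at_unit_interval:
  "t \<in> {0<..<1} \<Longrightarrow> eventually (\<lambda>s. s \<in> {0<..<1::real}) (at t)"
  by (rule eventually_at_in_open') auto

text \<open>One speed \<open>m\<close> serves the length, all distances along the curve and the
  derivative of every Lipschitz \<open>\<pi>\<close>. Borel versions with pointwise bounds replace
  \<open>metric_derivative\<close> and \<open>deriv\<close>, whose values are meaningful only almost
  everywhere.\<close>

lemma curve_derivatives:
  fixes p :: "real \<Rightarrow> 'a::metric_space"
  assumes p: "lipschitz_curve p"
  obtains K m where "K-lipschitz_on {0..1} p" "m \<in> borel_measurable borel" "\<And>t. 0 \<le> m t" "\<And>t. m t \<le> K"
    "param_length p = integral {0..1} m"
    "AE t in lborel. t \<in> {0<..<1} \<longrightarrow> ((\<lambda>s. dist (p s) (p t) / \<bar>s - t\<bar>) \<longlongrightarrow> m t) (at t)"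
    "\<And>a b. 0 \<le> a \<Longrightarrow> a \<le> b \<Longrightarrow> b \<le> 1 \<Longrightarrow> dist (p a) (p b) \<le> integral {a..b} m"
    "\<And>\<pi> B. B-lipschitz_on UNIV \<pi> \<Longrightarrow> \<exists>g'. g' \<in> borel_measurable borel \<and> (\<forall>t. \<bar>g' t\<bar> \<le> B * m t) \<and>
      (AE t in lborel. t \<in> {0<..<1} \<longrightarrow> ((\<lambda>s. \<pi> (p s)) has_real_derivative g' t) (at t)) \<and>
      (\<forall>a b. 0 \<le> a \<longrightarrow> a \<le> b \<longrightarrow> b \<le> 1 \<longrightarrow> (g' has_integral (\<pi> (p b) - \<pi> (p a))) {a..b})"
proof -
  obtain K P where P: "K-lipschitz_on UNIV P" "\<And>t. t \<in> {0..1} \<Longrightarrow> P t = p t"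
    "\<And>t. P t = p (max 0 (min 1 t))"
    using lipschitz_curve_extension[OF p] by blast
  obtain m where m: "m \<in> borel_measurable borel" "\<And>t. 0 \<le> m t" "\<And>t. m t \<le> K"
    "AE t in lborel. t \<in> {0<..<1} \<longrightarrow> ((\<lambda>s. dist (P s) (P t) / \<bar>s - t\<bar>) \<longlongrightarrow> m t) (at t)"
    "\<And>a b. a \<le> b \<Longrightarrow> dist (P a) (P b) \<le> integral {a..b} m"
    using AE_limit_of_dist_quotient[OF P(1)] by blast
  have K: "K-lipschitz_on {0..1} p"
  proof (rule lipschitz_onI)
    fix x y :: real assume "x \<in> {0..1}" "y \<in> {0..1}"
    then show "dist (p x) (p y) \<le> K * dist x y"
      using lipschitz_onD[OF P(1), of x y] P(2) by auto
  qed (rule lipschitz_on_nonneg[OF P(1)])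
  have evP: "eventually (\<lambda>s. P s = p s) (at t)" if "t \<in> {0<..<1}" for t
    using eventually_at_unit_interval[OF that] by eventually_elim (auto intro: P(2))
  have lim: "AE t in lborel. t \<in> {0<..<1} \<longrightarrow> ((\<lambda>s. dist (p s) (p t) / \<bar>s - t\<bar>) \<longlongrightarrow> m t) (at t)"
    using m(4)
  proof (rule eventually_mono, intro impI)
    fix t :: real assume t: "t \<in> {0<..<1}"
      and l: "t \<in> {0<..<1} \<longrightarrow> ((\<lambda>s. dist (P s) (P t) / \<bar>s - t\<bar>) \<longlongrightarrow> m t) (at t)"
    have "P t = p t" using t by (intro P(2)) auto
    moreover have "eventually (\<lambda>s. dist (P s) (P t) / \<bar>s - t\<bar> = dist (p s) (P t) / \<bar>s - t\<bar>) (at t)"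
      using evP[OF t] by (rule eventually_mono) simp
    ultimately have "eventually (\<lambda>s. dist (P s) (P t) / \<bar>s - t\<bar> = dist (p s) (p t) / \<bar>s - t\<bar>) (at t)"
      by simp
    then show "((\<lambda>s. dist (p s) (p t) / \<bar>s - t\<bar>) \<longlongrightarrow> m t) (at t)"
      by (rule Lim_transform_eventually[OF l[rule_format, OF t]])
  qed
  have open_AE: "AE t in lborel. t \<in> {0..1::real} \<longrightarrow> t \<in> {0<..<1}"
    using AE_lborel_singleton[of "0::real"] AE_lborel_singleton[of "1::real"] by eventually_elim auto
  have "AE t in lborel. t \<in> {0..1} \<longrightarrow> metric_derivative p t = m t"
    using lim open_AE
  proof eventually_elim
    case (elim t)
    show ?case
      unfolding metric_derivative_def using elim by (auto intro!: tendsto_Lim)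
  qed
  then have len: "param_length p = integral {0..1} m"
    unfolding param_length_def by (rule integral_cong_AE_lborel(2))
  have dl: "dist (p a) (p b) \<le> integral {a..b} m" if "0 \<le> a" "a \<le> b" "b \<le> 1" for a b
    using m(5)[OF that(2)] P(2)[of a] P(2)[of b] that by simp
  have der: "\<exists>g'. g' \<in> borel_measurable borel \<and> (\<forall>t. \<bar>g' t\<bar> \<le> B * m t) \<and>
      (AE t in lborel. t \<in> {0<..<1} \<longrightarrow> ((\<lambda>s. \<pi> (p s)) has_real_derivative g' t) (at t)) \<and>
      (\<forall>a b. 0 \<le> a \<longrightarrow> a \<le> b \<longrightarrow> b \<le> 1 \<longrightarrow> (g' has_integral (\<pi> (p b) - \<pi> (p a))) {a..b})"
    if \<pi>: "B-lipschitz_on UNIV \<pi>" for \<pi> B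
  proof -
    have B: "0 \<le> B" using \<pi> by (rule lipschitz_on_nonneg)
    have "(B * K)-lipschitz_on UNIV (\<lambda>t. \<pi> (P t))"
      by (rule lipschitz_on_compose2[OF P(1)]) (auto intro: lipschitz_on_subset[OF \<pi>])
    then obtain g where g: "g \<in> borel_measurable borel" "\<And>x. \<bar>g x\<bar> \<le> B * K"
      "AE x in lborel. ((\<lambda>t. \<pi> (P t)) has_real_derivative g x) (at x)"
      "\<And>a b. a \<le> b \<Longrightarrow> (g has_integral (\<pi> (P b) - \<pi> (P a))) {a..b}"
      by (rule lipschitz_FTC) blast
    \<comment> \<open>The derivative is clamped by \<open>B * m t\<close> and not by
      \<open>B * K\<close>: a bound in terms of the speed turns into a bound by length after
      integration.\<close>
    define g' where "g' t = max (- (B * m t)) (min (B * m t) (g t))" for t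
    have Bm: "0 \<le> B * m t" for t using B m(2) by simp
    have g'm: "g' \<in> borel_measurable borel" unfolding g'_def using g(1) m(1) by measurable
    have g'b: "\<bar>g' t\<bar> \<le> B * m t" for t using Bm[of t] by (auto simp: g'_def abs_if)
    have both: "AE t in lborel. t \<in> {0<..<1} \<longrightarrow> g' t = g t \<and> ((\<lambda>s. \<pi> (p s)) has_real_derivative g t) (at t)"
      using lim g(3)
    proof eventually_elim
      case (elim t)
      show ?case
      proof
        assume t: "t \<in> {0<..<1}"
        have Pt: "P t = p t" using t by (intro P(2)) auto
        have "eventually (\<lambda>s. (\<pi> (P s) - \<pi> (P t)) / (s - t) = (\<pi> (p s) - \<pi> (p t)) / (s - t)) (at t)"
          using evP[OF t] by (rule eventually_mono) (simp add: Pt)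
        with elim(2) have l: "((\<lambda>s. (\<pi> (p s) - \<pi> (p t)) / (s - t)) \<longlongrightarrow> g t) (at t)"
          unfolding has_field_derivative_iff by (rule Lim_transform_eventually)
        have "\<bar>g t\<bar> \<le> B * m t"
        proof (rule tendsto_le[OF _ _ tendsto_rabs[OF l]])
          show "((\<lambda>s. B * (dist (p s) (p t) / \<bar>s - t\<bar>)) \<longlongrightarrow> B * m t) (at t)"
            using elim t by (intro tendsto_intros) auto
          show "\<forall>\<^sub>F s in at t. \<bar>(\<pi> (p s) - \<pi> (p t)) / (s - t)\<bar> \<le> B * (dist (p s) (p t) / \<bar>s - t\<bar>)"
          proof (intro always_eventually allI)
            fix s
            have "\<bar>\<pi> (p s) - \<pi> (p t)\<bar> \<le> B * dist (p s) (p t)"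
              using lipschitz_onD[OF \<pi>, of "p s" "p t"] by (simp add: dist_real_def)
            then show "\<bar>(\<pi> (p s) - \<pi> (p t)) / (s - t)\<bar> \<le> B * (dist (p s) (p t) / \<bar>s - t\<bar>)"
              by (simp add: divide_right_mono)
          qed
        qed simp
        then show "g' t = g t \<and> ((\<lambda>s. \<pi> (p s)) has_real_derivative g t) (at t)"
          using l by (auto simp: g'_def has_field_derivative_iff abs_le_iff min_def max_def)
      qed
    qed
    have hi: "(g' has_integral (\<pi> (p b) - \<pi> (p a))) {a..b}" if ab: "0 \<le> a" "a \<le> b" "b \<le> 1" for a b
    proof -
      have "AE t in lborel. t \<in> {a..b} \<longrightarrow> g' t = g t"
        using both open_AE by eventually_elim (use ab in auto)
      then show ?thesis
        using g(4)[OF ab(2)] P(2)[of a] P(2)[of b] ab by (simp add: integral_cong_AE_lborel(1))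
    qed
    have "AE t in lborel. t \<in> {0<..<1} \<longrightarrow> ((\<lambda>s. \<pi> (p s)) has_real_derivative g' t) (at t)"
      using both by (rule eventually_mono) auto
    then show ?thesis using g'm g'b hi by blast
  qed
  show thesis by (rule that[OF K m(1) m(2) m(3) len lim dl der])
qed

lemma param_length_nonneg: "lipschitz_curve p \<Longrightarrow> 0 \<le> param_length p"
proof (erule curve_derivatives)
  fix K and m :: "real \<Rightarrow> real"
  assume m: "m \<in> borel_measurable borel" "\<And>t. 0 \<le> m t" "\<And>t. m t \<le> K" "param_length p = integral {0..1} m"
  then have "m integrable_on {0..1}" by (intro bounded_borel_integrable_Icc(2)[where B=K]) auto
  then show "0 \<le> param_length p" using m by (simp add: integral_nonneg)
qed

lemma dist_endpoints_le_param_length: "lipschitz_curve p \<Longrightarrow> dist (p 0) (p 1) \<le> param_length p"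
  by (erule curve_derivatives) auto

lemma integral_sum_partition:
  fixes h :: "real \<Rightarrow> real"
  assumes "\<And>i. i < N \<Longrightarrow> t i \<le> t (Suc i)" "\<And>a b. h integrable_on {a..b}"
  shows "(\<Sum>i<N. integral {t i..t (Suc i)} h) = integral {t 0..t N} h"
  using assms(1)
proof (induction N)
  case (Suc N)
  have "t 0 \<le> t N" using Suc.prems by (intro lift_Suc_mono_le[of "\<lambda>i. t (min i N)" 0 N, simplified]) (auto simp: min_def not_le Suc_le_eq le_Suc_eq)
  then show ?case
    using Suc Henstock_Kurzweil_Integration.integral_combine[of "t 0" "t N" "t (Suc N)" h] assms(2) by simp
qed simp

text \<open>Total variation, encoded as an upper bound so that no supremum is formed. In contrast to
  the integral of the speed, each condition involves finitely many values of \<open>p\<close>, hence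
  passes to uniform limits.\<close>

definition variation_le :: "(real \<Rightarrow> 'a::metric_space) \<Rightarrow> real \<Rightarrow> bool" where
  "variation_le p L \<longleftrightarrow> (\<forall>N t. (\<forall>i\<le>N. t i \<in> {0..1}) \<longrightarrow> (\<forall>i<N. t i \<le> t (Suc i)) \<longrightarrow>
     (\<Sum>i<N. dist (p (t i)) (p (t (Suc i)))) \<le> L)"

text \<open>Integrating the speed bounds every variation sum. Conversely, integrate the difference
  quotient with step \<open>h = 1 / Suc n\<close>: folding the unit interval onto one piece of
  length \<open>h\<close> turns the integral into an average of variation sums, each at most
  \<open>L\<close>, and dominated convergence recovers the length.\<close>

lemma param_length_le_iff:
  fixes p :: "real \<Rightarrow> 'a::metric_space"
  assumes p: "lipschitz_curve p"
  shows "param_length p \<le> L \<longleftrightarrow> variation_le p L"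
proof (rule curve_derivatives[OF p])
  fix K and m :: "real \<Rightarrow> real"
  assume K: "K-lipschitz_on {0..1} p"
    and m: "m \<in> borel_measurable borel" "\<And>t. 0 \<le> m t" "\<And>t. m t \<le> K" "param_length p = integral {0..1} m"
    and lim: "AE t in lborel. t \<in> {0<..<1} \<longrightarrow> ((\<lambda>s. dist (p s) (p t) / \<bar>s - t\<bar>) \<longlongrightarrow> m t) (at t)"
    and dl: "\<And>a b. 0 \<le> a \<Longrightarrow> a \<le> b \<Longrightarrow> b \<le> 1 \<Longrightarrow> dist (p a) (p b) \<le> integral {a..b} m"
  have mi: "m integrable_on {a..b}" for a b
    using m by (intro bounded_borel_integrable_Icc(2)[where B=K]) auto
  show ?thesis
  proof
    assume L: "param_length p \<le> L"
    show "variation_le p L" unfolding variation_le_def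
    proof (intro allI impI)
      fix N and t :: "nat \<Rightarrow> real"
      assume t: "\<forall>i\<le>N. t i \<in> {0..1}" "\<forall>i<N. t i \<le> t (Suc i)"
      have "(\<Sum>i<N. dist (p (t i)) (p (t (Suc i)))) \<le> (\<Sum>i<N. integral {t i..t (Suc i)} m)"
      proof (rule sum_mono)
        fix i assume "i \<in> {..<N}"
        then have "i \<le> N" "Suc i \<le> N" "i < N" by auto
        then show "dist (p (t i)) (p (t (Suc i))) \<le> integral {t i..t (Suc i)} m"
          using t by (intro dl) auto
      qed
      also have "\<dots> = integral {t 0..t N} m" using t mi by (intro integral_sum_partition) auto
      also have "\<dots> \<le> integral {0..1} m"
        using t(1) mi m(2) by (intro integral_subset_le) auto
      finally show "(\<Sum>i<N. dist (p (t i)) (p (t (Suc i)))) \<le> L" using L m(4) by simp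
    qed
  next
    assume V: "variation_le p L"
    obtain K' P where P: "K'-lipschitz_on UNIV P" "\<And>t. t \<in> {0..1} \<Longrightarrow> P t = p t"
      "\<And>t. P t = p (max 0 (min 1 t))"
      using lipschitz_curve_extension[OF p] by blast
    have cP: "continuous_on UNIV P" using P(1) by (rule lipschitz_on_continuous_on)
    define Q where "Q n s = real (Suc n) * dist (P (s + 1 / Suc n)) (P s)" for n :: nat and s
    have cQ: "continuous_on S (Q n)" for n S
      unfolding Q_def by (intro continuous_intros continuous_on_compose2[OF cP]) auto
    have iQ: "Q n integrable_on {a..b}" for n a b by (intro integrable_continuous_real cQ)
    have Qb: "\<bar>Q n s\<bar> \<le> K'" for n s
    proof -
      have "dist (P (s + 1 / Suc n)) (P s) \<le> K' * (1 / Suc n)"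
        using lipschitz_onD[OF P(1), of "s + 1 / Suc n" s] by (simp add: dist_real_def)
      then have "real (Suc n) * dist (P (s + 1 / Suc n)) (P s) \<le> real (Suc n) * (K' * (1 / Suc n))"
        by (intro mult_left_mono) auto
      then show ?thesis by (simp add: Q_def)
    qed
    have Qle: "integral {0..1} (Q n) \<le> L" for n
    proof -
      define h where "h = 1 / real (Suc n)"
      have h: "0 < h" "real (Suc n) * h = 1" by (auto simp: h_def)
      have "integral {0..1} (Q n) = (\<Sum>i<Suc n. integral {real i * h..real (Suc i) * h} (Q n))"
        using integral_sum_partition[of "Suc n" "\<lambda>i. real i * h" "Q n"] iQ h by (simp add: algebra_simps)
      also have "\<dots> = (\<Sum>i<Suc n. integral {0..h} (\<lambda>s. Q n (s + real i * h)))"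
      proof (rule sum.cong[OF refl])
        fix i
        show "integral {real i * h..real (Suc i) * h} (Q n) = integral {0..h} (\<lambda>s. Q n (s + real i * h))"
          using integral_shift_real_ivl[of "real i * h" "real i * h" "real (Suc i) * h" "Q n"]
          by (simp add: algebra_simps)
      qed
      also have "\<dots> = integral {0..h} (\<lambda>s. \<Sum>i<Suc n. Q n (s + real i * h))"
        by (subst integral_sum) (auto intro!: integrable_continuous_real continuous_on_compose2[OF cQ[of UNIV n]] continuous_intros)
      also have "\<dots> \<le> integral {0..h} (\<lambda>_. real (Suc n) * L)"
      proof (rule integral_le)
        show "(\<lambda>s. \<Sum>i<Suc n. Q n (s + real i * h)) integrable_on {0..h}"
          by (auto intro!: integrable_continuous_real continuous_on_compose2[OF cQ[of UNIV n]] continuous_intros)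
        fix s assume s: "s \<in> {0..h}"
        \<comment> \<open>The shifted grid may leave the unit interval on the right; clamping keeps
          it a partition, and \<open>P\<close> takes the same values there.\<close>
        let ?t = "\<lambda>i. max 0 (min 1 (s + real i * h))"
        have "?t i \<le> ?t (Suc i)" for i
        proof -
          have "s + real i * h \<le> s + real (Suc i) * h" using h(1) by (simp add: mult_right_mono)
          then show ?thesis by (intro max.mono min.mono order_refl)
        qed
        then have "(\<Sum>i<Suc n. dist (p (?t i)) (p (?t (Suc i)))) \<le> L"
          by (intro V[unfolded variation_le_def, rule_format]) auto
        moreover have "P (s + real i * h + 1 / Suc n) = p (?t (Suc i))" "P (s + real i * h) = p (?t i)" for i
        proof -
          have "s + real i * h + 1 / Suc n = s + real (Suc i) * h" unfolding h_def by (simp add: add_divide_distrib)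
          then show "P (s + real i * h + 1 / Suc n) = p (?t (Suc i))" unfolding P(3) by (rule arg_cong)
        qed (simp add: P(3))
        ultimately have "(\<Sum>i<Suc n. dist (P (s + real i * h + 1 / Suc n)) (P (s + real i * h))) \<le> L"
          by (simp only: dist_commute)
        then have "real (Suc n) * (\<Sum>i<Suc n. dist (P (s + real i * h + 1 / Suc n)) (P (s + real i * h))) \<le> real (Suc n) * L"
          by (intro mult_left_mono) auto
        then show "(\<Sum>i<Suc n. Q n (s + real i * h)) \<le> real (Suc n) * L"
          by (simp add: Q_def sum_distrib_left del: sum.lessThan_Suc)
      qed auto
      also have "\<dots> = L" using h by (simp add: mult.assoc[symmetric] mult.commute)
      finally show ?thesis .
    qed
    define N where "N = {t. \<not> (t \<in> {0<..<1} \<longrightarrow> ((\<lambda>s. dist (p s) (p t) / \<bar>s - t\<bar>) \<longlongrightarrow> m t) (at t))} \<union> {0, 1}"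
    \<comment> \<open>Altered on the null set \<open>N\<close> so that convergence to
      \<open>m\<close> holds at every point of the unit interval, as this form of dominated
      convergence demands.\<close>
    define Q' where "Q' n t = (if t \<in> N then m t else Q n t)" for n t
    have AEN: "AE t in lborel. t \<notin> N"
      using lim AE_lborel_singleton[of "0::real"] AE_lborel_singleton[of "1::real"]
      by eventually_elim (auto simp: N_def)
    have QQ: "AE t in lborel. t \<in> {0..1} \<longrightarrow> Q' n t = Q n t" for n
      using AEN by eventually_elim (simp add: Q'_def)
    have conv: "(\<lambda>n. Q' n t) \<longlonglongrightarrow> m t" if t: "t \<in> {0..1}" for t
    proof (cases "t \<in> N")
      case False
      then have t': "t \<in> {0<..<1}" and l: "((\<lambda>s. dist (p s) (p t) / \<bar>s - t\<bar>) \<longlongrightarrow> m t) (at t)"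
        using t by (auto simp: N_def)
      have f: "filterlim (\<lambda>n::nat. t + 1 / Suc n) (at t) sequentially"
      proof (rule filterlim_atI)
        have "(\<lambda>n::nat. t + 1 / Suc n) \<longlonglongrightarrow> t + 0"
          by (intro tendsto_intros LIMSEQ_Suc[OF lim_1_over_n])
        then show "(\<lambda>n::nat. t + 1 / Suc n) \<longlonglongrightarrow> t" by simp
      qed auto
      have "(\<lambda>n. dist (p (t + 1 / Suc n)) (p t) / \<bar>t + 1 / Suc n - t\<bar>) \<longlonglongrightarrow> m t"
        by (rule filterlim_compose[OF l f])
      moreover have "\<forall>\<^sub>F n in sequentially. dist (p (t + 1 / Suc n)) (p t) / \<bar>t + 1 / Suc n - t\<bar> = Q' n t"
        using filterlim_iff[THEN iffD1, OF f, rule_format, OF eventually_at_unit_interval[OF t']]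
      proof eventually_elim
        case (elim n)
        then have "P (t + 1 / Suc n) = p (t + 1 / Suc n)" "P t = p t" using t by (auto intro!: P(2))
        then show ?case using False by (simp add: Q'_def Q_def)
      qed
      ultimately show ?thesis by (rule Lim_transform_eventually)
    qed (simp add: Q'_def)
    have "(\<lambda>n. integral {0..1} (Q' n)) \<longlonglongrightarrow> integral {0..1} m"
    proof (rule dominated_convergence(2))
      show "Q' n integrable_on {0..1}" for n using iQ integral_cong_AE_lborel(3)[OF QQ] by blast
      show "(\<lambda>_. max K K') integrable_on {0..1::real}" by (rule integrable_const_ivl)
      show "norm (Q' n t) \<le> max K K'" for n t
        using Qb[of n t] m(2)[of t] m(3)[of t] by (auto simp: Q'_def)
    qed (rule conv)
    then have "integral {0..1} m \<le> L"
      by (rule LIMSEQ_le_const2) (use Qle integral_cong_AE_lborel(2)[OF QQ] in auto)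
    then show "param_length p \<le> L" using m(4) by simp
  qed
qed

text \<open>Freezing \<open>f\<close> at the left end of a piece costs at most oscillation times
  \<open>B\<close> times the length of the piece. Measuring the error by length and not by a
  Lipschitz constant of the parameterization makes the estimate uniform over nearby curves of
  bounded length.\<close>

lemma line_integral_Riemann_sum:
  fixes p :: "real \<Rightarrow> 'a::metric_space"
  assumes p: "lipschitz_curve p" and f: "A-lipschitz_on UNIV f" and \<pi>: "B-lipschitz_on UNIV \<pi>"
    and t: "\<And>i. i < N \<Longrightarrow> t i \<le> t (Suc i)" "t 0 = 0" "t N = 1"
    and osc: "\<And>i s. i < N \<Longrightarrow> t i \<le> s \<Longrightarrow> s \<le> t (Suc i) \<Longrightarrow> \<bar>f (p s) - f (p (t i))\<bar> \<le> \<omega>"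
  shows "\<bar>line_integral p f \<pi> - (\<Sum>i<N. f (p (t i)) * (\<pi> (p (t (Suc i))) - \<pi> (p (t i))))\<bar>
    \<le> \<omega> * B * param_length p"
proof (rule curve_derivatives[OF p])
  fix K and m :: "real \<Rightarrow> real"
  assume K: "K-lipschitz_on {0..1} p"
    and m: "m \<in> borel_measurable borel" "\<And>t. 0 \<le> m t" "\<And>t. m t \<le> K" "param_length p = integral {0..1} m"
    and der: "\<And>\<pi> B. B-lipschitz_on UNIV \<pi> \<Longrightarrow> \<exists>g'. g' \<in> borel_measurable borel \<and> (\<forall>t. \<bar>g' t\<bar> \<le> B * m t) \<and>
      (AE t in lborel. t \<in> {0<..<1} \<longrightarrow> ((\<lambda>s. \<pi> (p s)) has_real_derivative g' t) (at t)) \<and>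
      (\<forall>a b. 0 \<le> a \<longrightarrow> a \<le> b \<longrightarrow> b \<le> 1 \<longrightarrow> (g' has_integral (\<pi> (p b) - \<pi> (p a))) {a..b})"
  have mi: "m integrable_on {a..b}" for a b
    using m by (intro bounded_borel_integrable_Icc(2)[where B=K]) auto
  obtain g' where g': "g' \<in> borel_measurable borel" "\<And>t. \<bar>g' t\<bar> \<le> B * m t"
      "AE t in lborel. t \<in> {0<..<1} \<longrightarrow> ((\<lambda>s. \<pi> (p s)) has_real_derivative g' t) (at t)"
      "\<And>a b. 0 \<le> a \<Longrightarrow> a \<le> b \<Longrightarrow> b \<le> 1 \<Longrightarrow> (g' has_integral (\<pi> (p b) - \<pi> (p a))) {a..b}"
    using der[OF \<pi>] by blast
  obtain K' P where P: "K'-lipschitz_on UNIV P" "\<And>t. t \<in> {0..1} \<Longrightarrow> P t = p t"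
    "\<And>t. P t = p (max 0 (min 1 t))"
    using lipschitz_curve_extension[OF p] by blast
  have B: "0 \<le> B" using \<pi> by (rule lipschitz_on_nonneg)
  have cf: "continuous_on UNIV f" using f by (rule lipschitz_on_continuous_on)
  have cP: "continuous_on UNIV P" using P(1) by (rule lipschitz_on_continuous_on)
  have cfP: "continuous_on UNIV (\<lambda>t. f (P t))" by (intro continuous_on_compose2[OF cf cP]) auto
  have fPm: "(\<lambda>t. f (P t)) \<in> borel_measurable borel" by (rule borel_measurable_continuous_onI[OF cfP])
  have "bounded (f ` P ` {0..1})"
    by (intro compact_imp_bounded compact_continuous_image continuous_on_subset[OF cf] continuous_on_subset[OF cP]) auto
  then obtain M where "\<forall>x\<in>f ` P ` {0..1}. norm x \<le> M" unfolding bounded_iff by blast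
  then have M: "\<And>t. t \<in> {0..1} \<Longrightarrow> \<bar>f (P t)\<bar> \<le> M" by auto
  \<comment> \<open>The extension takes no values beyond those on the unit interval, since clamping
    is idempotent.\<close>
  have fPb: "\<bar>f (P t)\<bar> \<le> M" for t
  proof -
    have "max 0 (min 1 (max 0 (min 1 t))) = max 0 (min 1 t)" by simp
    then have "P (max 0 (min 1 t)) = P t" unfolding P(3) by (rule arg_cong)
    then show ?thesis using M[of "max 0 (min 1 t)"] by simp
  qed
  have M0: "0 \<le> M" using fPb[of 0] by linarith
  have g'K: "\<bar>g' t\<bar> \<le> B * K" for t using g'(2)[of t] m(3)[of t] B by (meson mult_left_mono order_trans)
  have prodi: "(\<lambda>t. f (P t) * g' t) integrable_on {a..b}" for a b
    using fPm g'(1) by (intro bounded_borel_integrable_Icc(2)[where B="M * (B * K)"])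
      (auto simp: abs_mult intro!: mult_mono fPb g'K M0)
  have g'i: "g' integrable_on {a..b}" for a b
    by (rule bounded_borel_integrable_Icc(2)[OF g'(1) g'K])
  have "AE t in lborel. t \<in> {0..1} \<longrightarrow> f (p t) * deriv (\<lambda>s. \<pi> (p s)) t = f (P t) * g' t"
    using g'(3) AE_lborel_singleton[of "0::real"] AE_lborel_singleton[of "1::real"]
    by eventually_elim (auto simp: P(2) DERIV_imp_deriv)
  then have "line_integral p f \<pi> = integral {0..1} (\<lambda>t. f (P t) * g' t)"
    unfolding line_integral_def by (rule integral_cong_AE_lborel(2))
  also have "\<dots> = (\<Sum>i<N. integral {t i..t (Suc i)} (\<lambda>t. f (P t) * g' t))"
    using integral_sum_partition[of N t, OF t(1) prodi] t by simp
  finally have li: "line_integral p f \<pi> = (\<Sum>i<N. integral {t i..t (Suc i)} (\<lambda>t. f (P t) * g' t))" .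
  have tmono: "t i \<le> t j" if "i \<le> j" "j \<le> N" for i j
    using that
  proof (induction j)
    case (Suc j) then show ?case using t(1)[of j] by (auto simp: le_Suc_eq)
  qed simp
  have t01: "t i \<in> {0..1}" if "i \<le> N" for i using tmono[of 0 i] tmono[of i N] that t by auto
  have piece: "\<bar>integral {t i..t (Suc i)} (\<lambda>t. f (P t) * g' t) - f (p (t i)) * (\<pi> (p (t (Suc i))) - \<pi> (p (t i)))\<bar>
     \<le> \<omega> * B * integral {t i..t (Suc i)} m" if i: "i < N" for i
  proof -
    have ti: "0 \<le> t i" "t i \<le> t (Suc i)" "t (Suc i) \<le> 1" using t01[of i] t01[of "Suc i"] t(1)[OF i] i by auto
    have "integral {t i..t (Suc i)} (\<lambda>s. f (P s) * g' s) - f (p (t i)) * (\<pi> (p (t (Suc i))) - \<pi> (p (t i)))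
       = integral {t i..t (Suc i)} (\<lambda>s. f (P s) * g' s) - integral {t i..t (Suc i)} (\<lambda>s. f (p (t i)) * g' s)"
      using integral_unique[OF g'(4)[OF ti]] by simp
    also have "\<dots> = integral {t i..t (Suc i)} (\<lambda>s. f (P s) * g' s - f (p (t i)) * g' s)"
      using prodi g'i by (intro integral_diff[symmetric]) (auto intro: integrable_on_mult_right)
    also have "\<bar>\<dots>\<bar> \<le> integral {t i..t (Suc i)} (\<lambda>s. \<omega> * B * m s)"
    proof -
      have "norm (integral {t i..t (Suc i)} (\<lambda>s. f (P s) * g' s - f (p (t i)) * g' s)) \<le> integral {t i..t (Suc i)} (\<lambda>s. \<omega> * B * m s)"
      proof (rule integral_norm_bound_integral)
        show "(\<lambda>s. f (P s) * g' s - f (p (t i)) * g' s) integrable_on {t i..t (Suc i)}"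
          using prodi g'i by (intro integrable_diff) (auto intro: integrable_on_mult_right)
        show "(\<lambda>s. \<omega> * B * m s) integrable_on {t i..t (Suc i)}" using mi by (rule integrable_on_mult_right)
        fix s assume s: "s \<in> {t i..t (Suc i)}"
        then have Ps: "P s = p s" using ti by (intro P(2)) auto
        have o: "\<bar>f (p s) - f (p (t i))\<bar> \<le> \<omega>" using osc[OF i] s by auto
        have "norm (f (P s) * g' s - f (p (t i)) * g' s) = \<bar>f (p s) - f (p (t i))\<bar> * \<bar>g' s\<bar>"
          unfolding Ps by (simp add: left_diff_distrib[symmetric] abs_mult)
        also have "\<dots> \<le> \<omega> * (B * m s)" using o g'(2)[of s] by (intro mult_mono) auto
        finally show "norm (f (P s) * g' s - f (p (t i)) * g' s) \<le> \<omega> * B * m s" by (simp add: mult.assoc)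
      qed
      then show ?thesis by simp
    qed
    finally show ?thesis by simp
  qed
  have "\<bar>line_integral p f \<pi> - (\<Sum>i<N. f (p (t i)) * (\<pi> (p (t (Suc i))) - \<pi> (p (t i))))\<bar>
     = \<bar>\<Sum>i<N. integral {t i..t (Suc i)} (\<lambda>t. f (P t) * g' t) - f (p (t i)) * (\<pi> (p (t (Suc i))) - \<pi> (p (t i)))\<bar>"
    by (simp add: li sum_subtractf)
  also have "\<dots> \<le> (\<Sum>i<N. \<omega> * B * integral {t i..t (Suc i)} m)"
    by (rule order_trans[OF sum_abs]) (auto intro!: sum_mono piece)
  also have "\<dots> = \<omega> * B * integral {0..1} m"
    using integral_sum_partition[of N t m, OF t(1) mi] t by (simp add: sum_distrib_left[symmetric])
  finally show ?thesis using m(4) by simp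
qed

section \<open>The space of curves\<close>

lemma Lip_bE:
  assumes "f \<in> Lip_b"
  obtains A M where "A-lipschitz_on UNIV f" "\<And>x. \<bar>f x\<bar> \<le> M"
proof -
  obtain A where A: "A-lipschitz_on UNIV f" using assms by (auto simp: Lip_b_def Lip_def)
  obtain M where "\<forall>y\<in>range f. norm y \<le> M"
    using assms unfolding Lip_b_def bounded_iff by blast
  then show thesis by (intro that[OF A, of M]) simp
qed

lemma LipE: "\<pi> \<in> Lip \<Longrightarrow> (\<And>B. B-lipschitz_on UNIV \<pi> \<Longrightarrow> thesis) \<Longrightarrow> thesis"
  by (auto simp: Lip_def)

text \<open>Riemann sums of \<open>p\<close> on \<open>N\<close> equal pieces are compared with
  those of \<open>q\<close> on the images of the pieces under \<open>\<phi>\<close>. The mesh term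
  is of order \<open>1 / N\<close>; the others carry the factor \<open>\<delta>\<close>, one of them
  multiplied by \<open>N\<close>, so that \<open>N\<close> has to be fixed before
  \<open>\<delta>\<close> when the estimate is used.\<close>

lemma line_integral_close:
  fixes p q :: "real \<Rightarrow> 'a::metric_space"
  assumes p: "lipschitz_curve p" "K-lipschitz_on {0..1} p" and q: "lipschitz_curve q"
    and \<phi>: "\<phi> \<in> reparams" and \<delta>: "\<And>t. t \<in> {0..1} \<Longrightarrow> dist (p t) (q (\<phi> t)) \<le> \<delta>"
    and L: "param_length p \<le> L" "param_length q \<le> L"
    and f: "A-lipschitz_on UNIV f" "\<And>x. \<bar>f x\<bar> \<le> M" and \<pi>: "B-lipschitz_on UNIV \<pi>"
    and N: "0 < N"
  shows "\<bar>line_integral p f \<pi> - line_integral q f \<pi>\<bar>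
    \<le> 2 * (A * K * B * L) / real N + (3 * A * B * L + 2 * real N * M * B) * \<delta>"
proof -
  define t where "t i = real i / real N" for i
  have t: "t i \<le> t (Suc i)" "t 0 = 0" "t N = 1" "t (Suc i) - t i = 1 / N" for i
    using N by (auto simp: t_def divide_right_mono diff_divide_distrib[symmetric])
  have t01: "t i \<in> {0..1}" if "i \<le> N" for i using that N by (auto simp: t_def)
  have A: "0 \<le> A" and B: "0 \<le> B" and K: "0 \<le> K" using f \<pi> p(2) by (auto dest: lipschitz_on_nonneg)
  have M: "0 \<le> M" using f(2)[of undefined] by linarith
  have d0: "0 \<le> \<delta>" using order_trans[OF zero_le_dist \<delta>[of 0]] by simp
  have L0: "0 \<le> L" using param_length_nonneg[OF p(1)] L by linarith
  have fl: "\<bar>f x - f y\<bar> \<le> A * dist x y" for x y using lipschitz_onD[OF f(1), of x y] by (simp add: dist_real_def)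
  have \<pi>l: "\<bar>\<pi> x - \<pi> y\<bar> \<le> B * dist x y" for x y using lipschitz_onD[OF \<pi>, of x y] by (simp add: dist_real_def)
  have mono: "\<phi> a \<le> \<phi> b" if "a \<in> {0..1}" "b \<in> {0..1}" "a \<le> b" for a b
    using that \<phi> by (cases "a = b") (auto simp: reparams_def dest!: strict_mono_onD[of _ _ a b])
  have pd: "\<bar>f (p s) - f (p (t i))\<bar> \<le> A * K / N" if i: "i < N" and s: "t i \<le> s" "s \<le> t (Suc i)" for i s
  proof -
    have "s \<in> {0..1}" "t i \<in> {0..1}" using t01[of i] t01[of "Suc i"] i s by auto
    then have "dist (p s) (p (t i)) \<le> K * dist s (t i)" by (rule lipschitz_onD[OF p(2)])
    also have "\<dots> \<le> K * (1 / N)" using s t(4)[of i] K by (intro mult_left_mono) (auto simp: dist_real_def)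
    finally have "A * dist (p s) (p (t i)) \<le> A * (K * (1 / N))" using A by (rule mult_left_mono)
    then show ?thesis using fl[of "p s" "p (t i)"] by simp
  qed
  let ?Sp = "\<Sum>i<N. f (p (t i)) * (\<pi> (p (t (Suc i))) - \<pi> (p (t i)))"
  let ?Sq = "\<Sum>i<N. f (q (\<phi> (t i))) * (\<pi> (q (\<phi> (t (Suc i)))) - \<pi> (q (\<phi> (t i))))"
  have 1: "\<bar>line_integral p f \<pi> - ?Sp\<bar> \<le> A * K / N * B * param_length p"
    by (rule line_integral_Riemann_sum[OF p(1) f(1) \<pi> t(1-3)]) (rule pd)
  \<comment> \<open>The Lipschitz constant of \<open>q\<close> is not controlled. Its oscillation is
    inherited from \<open>p\<close> through \<open>\<phi>\<close>, at the price of
    \<open>A * \<delta>\<close> at each of the two points compared.\<close>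
  have 2: "\<bar>line_integral q f \<pi> - ?Sq\<bar> \<le> (A * K / N + 2 * A * \<delta>) * B * param_length q"
  proof (rule line_integral_Riemann_sum[OF q f(1) \<pi>, where t="\<lambda>i. \<phi> (t i)"])
    show "\<phi> (t i) \<le> \<phi> (t (Suc i))" if "i < N" for i using that t01[of i] t01[of "Suc i"] t by (intro mono) auto
    show "\<phi> (t 0) = 0" "\<phi> (t N) = 1" using t reparams_0[OF \<phi>] reparams_1[OF \<phi>] by auto
    fix i s assume i: "i < N" and s: "\<phi> (t i) \<le> s" "s \<le> \<phi> (t (Suc i))"
    have ti: "t i \<in> {0..1}" "t (Suc i) \<in> {0..1}" using i t01[of i] t01[of "Suc i"] by auto
    have s01: "s \<in> {0..1}" using s reparams_mem[OF \<phi> ti(1)] reparams_mem[OF \<phi> ti(2)] by auto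
    then have "s \<in> \<phi> ` {0..1}" using \<phi> by (simp add: reparams_def bij_betw_def)
    then obtain r where r: "r \<in> {0..1}" "s = \<phi> r" by blast
    have str: "strict_mono_on {0..1} \<phi>" using \<phi> by (simp add: reparams_def)
    have "t i \<le> r" using strict_mono_onD[OF str r(1) ti(1)] s(1) r by (meson not_le)
    moreover have "r \<le> t (Suc i)" using strict_mono_onD[OF str ti(2) r(1)] s(2) r by (meson not_le)
    ultimately have a: "\<bar>f (p r) - f (p (t i))\<bar> \<le> A * K / N" by (rule pd[OF i])
    have b: "\<bar>f (p r) - f (q (\<phi> r))\<bar> \<le> A * \<delta>" "\<bar>f (p (t i)) - f (q (\<phi> (t i)))\<bar> \<le> A * \<delta>"
      using fl \<delta>[OF r(1)] \<delta>[OF ti(1)] A by (meson mult_left_mono order_trans)+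
    show "\<bar>f (q s) - f (q (\<phi> (t i)))\<bar> \<le> A * K / N + 2 * A * \<delta>"
      using a b unfolding r(2) by linarith
  qed
  have 3: "\<bar>?Sp - ?Sq\<bar> \<le> A * \<delta> * B * L + 2 * real N * M * B * \<delta>"
  proof -
    have V: "(\<Sum>i<N. dist (p (t i)) (p (t (Suc i)))) \<le> L"
      using L(1) t t01 by (simp add: param_length_le_iff[OF p(1)] variation_le_def)
    have "?Sp - ?Sq = (\<Sum>i<N. f (p (t i)) * (\<pi> (p (t (Suc i))) - \<pi> (p (t i))) - f (q (\<phi> (t i))) * (\<pi> (q (\<phi> (t (Suc i)))) - \<pi> (q (\<phi> (t i)))))"
      by (simp add: sum_subtractf)
    also have "\<bar>\<dots>\<bar> \<le> (\<Sum>i<N. A * \<delta> * B * dist (p (t i)) (p (t (Suc i))) + 2 * M * B * \<delta>)"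
    proof (rule order_trans[OF sum_abs], rule sum_mono)
      fix i assume "i \<in> {..<N}"
      then have ti: "t i \<in> {0..1}" "t (Suc i) \<in> {0..1}" using t01[of i] t01[of "Suc i"] by auto
      let ?a = "f (p (t i))" and ?a' = "f (q (\<phi> (t i)))" and ?b = "\<pi> (p (t (Suc i))) - \<pi> (p (t i))"
        and ?b' = "\<pi> (q (\<phi> (t (Suc i)))) - \<pi> (q (\<phi> (t i)))"
      \<comment> \<open>The difference of the values of \<open>f\<close> is paid for by the
        variation of \<open>p\<close>, which sums to at most \<open>L\<close>; the difference of the
        increments of \<open>\<pi>\<close> costs \<open>2 * B * \<delta>\<close> in each of the
        \<open>N\<close> terms.\<close>
      have "?a * ?b - ?a' * ?b' = (?a - ?a') * ?b + ?a' * (?b - ?b')" by (simp add: algebra_simps)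
      then have "\<bar>?a * ?b - ?a' * ?b'\<bar> \<le> \<bar>?a - ?a'\<bar> * \<bar>?b\<bar> + \<bar>?a'\<bar> * \<bar>?b - ?b'\<bar>"
        by (metis abs_mult abs_triangle_ineq)
      also have "\<bar>?a - ?a'\<bar> * \<bar>?b\<bar> \<le> (A * \<delta>) * (B * dist (p (t i)) (p (t (Suc i))))"
      proof (rule mult_mono)
        show "\<bar>?a - ?a'\<bar> \<le> A * \<delta>" using fl \<delta>[OF ti(1)] A by (meson mult_left_mono order_trans)
        show "\<bar>?b\<bar> \<le> B * dist (p (t i)) (p (t (Suc i)))"
          using \<pi>l[of "p (t (Suc i))" "p (t i)"] by (simp only: dist_commute)
      qed (use A d0 in auto)
      also have "\<bar>?a'\<bar> * \<bar>?b - ?b'\<bar> \<le> M * (2 * B * \<delta>)"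
      proof (rule mult_mono)
        have "\<bar>\<pi> (p (t (Suc i))) - \<pi> (q (\<phi> (t (Suc i))))\<bar> \<le> B * \<delta>" "\<bar>\<pi> (p (t i)) - \<pi> (q (\<phi> (t i)))\<bar> \<le> B * \<delta>"
          using \<pi>l \<delta>[OF ti(1)] \<delta>[OF ti(2)] B by (meson mult_left_mono order_trans)+
        then show "\<bar>?b - ?b'\<bar> \<le> 2 * B * \<delta>" by linarith
      qed (use f(2) M in auto)
      finally show "\<bar>?a * ?b - ?a' * ?b'\<bar> \<le> A * \<delta> * B * dist (p (t i)) (p (t (Suc i))) + 2 * M * B * \<delta>"
        by (simp add: algebra_simps)
    qed
    also have "\<dots> = A * \<delta> * B * (\<Sum>i<N. dist (p (t i)) (p (t (Suc i)))) + real N * (2 * M * B * \<delta>)"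
      unfolding sum.distrib sum_constant card_lessThan sum_distrib_left ..
    also have "\<dots> \<le> A * \<delta> * B * L + real N * (2 * M * B * \<delta>)"
      using mult_left_mono[OF V, of "A * \<delta> * B"] A B d0 by simp
    finally show ?thesis by (simp only: ac_simps)
  qed
  define w where "w = A * K / N"
  have w: "0 \<le> w" using A K by (simp add: w_def)
  have 4: "w * B * param_length p \<le> w * B * L"
    by (rule mult_left_mono[OF L(1)]) (simp add: w B)
  have 5: "(w + 2 * A * \<delta>) * B * param_length q \<le> (w + 2 * A * \<delta>) * B * L"
    by (rule mult_left_mono[OF L(2)]) (simp add: w A B d0)
  have "\<bar>line_integral p f \<pi> - line_integral q f \<pi>\<bar>
      \<le> w * B * L + (w + 2 * A * \<delta>) * B * L + (A * \<delta> * B * L + 2 * real N * M * B * \<delta>)"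
    using 1[folded w_def] 2[folded w_def] 3 4 5 by linarith
  also have "\<dots> = 2 * (w * B * L) + (3 * A * B * L + 2 * real N * M * B) * \<delta>"
    by (simp add: algebra_simps)
  also have "w * B * L = A * K * B * L / N" by (simp add: w_def)
  finally show ?thesis by simp
qed

lemma curve_dist_less_obtains:
  assumes "lipschitz_curve p" "lipschitz_curve q" "curve_dist p q < \<delta>"
  obtains \<phi> where "\<phi> \<in> reparams" "\<And>t. t \<in> {0..1} \<Longrightarrow> dist (p t) (q (\<phi> t)) \<le> \<delta>"
proof -
  have "reparams \<noteq> {}" using id_in_reparams by blast
  then obtain \<phi> where \<phi>: "\<phi> \<in> reparams" "curve_sup_dist p q \<phi> < \<delta>"
    using assms(3) unfolding curve_dist_def by (metis (mono_tags, lifting) cINF_less_iff[OF _ bdd_belowI2] assms(1,2) curve_sup_dist_nonneg)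
  show thesis
    by (rule that[OF \<phi>(1)])
       (meson \<phi> assms(1,2) curve_sup_dist_upper less_imp_le order_trans)
qed

text \<open>Continuity holds under a common length bound. Without one, many tiny loops on a
  uniformly close curve could change the integral by a fixed amount.\<close>

lemma line_integral_continuous:
  fixes p :: "real \<Rightarrow> 'a::metric_space"
  assumes p: "lipschitz_curve p" "param_length p \<le> L"
    and f: "A-lipschitz_on UNIV f" "\<And>x. \<bar>f x\<bar> \<le> M" and \<pi>: "B-lipschitz_on UNIV \<pi>" and e: "0 < e"
  obtains \<delta> where "0 < \<delta>"
    "\<And>q. lipschitz_curve q \<Longrightarrow> param_length q \<le> L \<Longrightarrow> curve_dist p q < \<delta> \<Longrightarrow>
       \<bar>line_integral p f \<pi> - line_integral q f \<pi>\<bar> < e"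
proof -
  obtain K where K: "K-lipschitz_on {0..1} p" using p by (auto simp: lipschitz_curve_def)
  let ?c = "2 * (A * K * B * L)"
  have A: "0 \<le> A" and B: "0 \<le> B" and K0: "0 \<le> K" using f \<pi> K by (auto dest: lipschitz_on_nonneg)
  have M: "0 \<le> M" using f(2)[of undefined] by linarith
  have L0: "0 \<le> L" using param_length_nonneg[OF p(1)] p(2) by linarith
  obtain N :: nat where "2 * ?c / e < real N" using reals_Archimedean2 by blast
  then have "2 * ?c / e < real (Suc N)" by simp
  then have N: "?c / real (Suc N) < e / 2" using e by (simp add: field_simps)
  define C where "C = 3 * A * B * L + 2 * real (Suc N) * M * B"
  have C: "0 \<le> C" using A B M L0 by (auto simp: C_def)
  define \<delta> where "\<delta> = e / (2 * (C + 1))"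
  have \<delta>: "0 < \<delta>" "C * \<delta> \<le> e / 2" using C e by (auto simp: \<delta>_def field_simps)
  show thesis
  proof (rule that[OF \<delta>(1)])
    fix q assume q: "lipschitz_curve q" "param_length q \<le> L" "curve_dist p q < \<delta>"
    obtain \<phi> where \<phi>: "\<phi> \<in> reparams" "\<And>t. t \<in> {0..1} \<Longrightarrow> dist (p t) (q (\<phi> t)) \<le> \<delta>"
      using curve_dist_less_obtains[OF p(1) q(1,3)] by blast
    have "\<bar>line_integral p f \<pi> - line_integral q f \<pi>\<bar> \<le> ?c / real (Suc N) + C * \<delta>"
      unfolding C_def by (rule line_integral_close[OF p(1) K q(1) \<phi> p(2) q(2) f \<pi>]) auto
    then show "\<bar>line_integral p f \<pi> - line_integral q f \<pi>\<bar> < e" using N \<delta>(2) by linarith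
  qed
qed

text \<open>Each variation sum of \<open>p\<close> is, up to an error tending to 0 with
  \<open>\<delta>\<close>, a variation sum of the nearby curve.\<close>

lemma param_length_lsc:
  fixes p :: "real \<Rightarrow> 'a::metric_space"
  assumes p: "lipschitz_curve p"
    and q: "\<And>\<delta>. 0 < \<delta> \<Longrightarrow> \<exists>q. lipschitz_curve q \<and> curve_dist p q < \<delta> \<and> param_length q \<le> L"
  shows "param_length p \<le> L"
  unfolding param_length_le_iff[OF p] variation_le_def
proof (intro allI impI)
  fix N and t :: "nat \<Rightarrow> real" assume t: "\<forall>i\<le>N. t i \<in> {0..1}" "\<forall>i<N. t i \<le> t (Suc i)"
  show "(\<Sum>i<N. dist (p (t i)) (p (t (Suc i)))) \<le> L"
  proof (rule field_le_epsilon)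
    fix e :: real assume e: "0 < e"
    define \<delta> where "\<delta> = e / (2 * real (Suc N))"
    have d: "0 < \<delta>" "real N * (2 * \<delta>) \<le> e" using e by (auto simp: \<delta>_def field_simps)
    obtain q where q: "lipschitz_curve q" "curve_dist p q < \<delta>" "param_length q \<le> L" using q[OF d(1)] by blast
    obtain \<phi> where \<phi>: "\<phi> \<in> reparams" "\<And>t. t \<in> {0..1} \<Longrightarrow> dist (p t) (q (\<phi> t)) \<le> \<delta>"
      using curve_dist_less_obtains[OF p q(1,2)] by blast
    have "(\<Sum>i<N. dist (p (t i)) (p (t (Suc i)))) \<le> (\<Sum>i<N. dist (q (\<phi> (t i))) (q (\<phi> (t (Suc i)))) + 2 * \<delta>)"
    proof (rule sum_mono)
      fix i assume "i \<in> {..<N}"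
      then have "t i \<in> {0..1}" "t (Suc i) \<in> {0..1}" using t by auto
      from \<phi>(2)[OF this(1)] \<phi>(2)[OF this(2)]
      show "dist (p (t i)) (p (t (Suc i))) \<le> dist (q (\<phi> (t i))) (q (\<phi> (t (Suc i)))) + 2 * \<delta>"
        by (smt (verit) dist_commute dist_triangle)
    qed
    also have "\<dots> = (\<Sum>i<N. dist (q (\<phi> (t i))) (q (\<phi> (t (Suc i))))) + real N * (2 * \<delta>)"
      by (simp add: sum.distrib)
    also have "(\<Sum>i<N. dist (q (\<phi> (t i))) (q (\<phi> (t (Suc i))))) \<le> L"
    proof -
      have "\<phi> (t i) \<le> \<phi> (t (Suc i))" if "i < N" for i
        using that t \<phi>(1) by (cases "t i = t (Suc i)")
          (auto simp: reparams_def less_le dest!: strict_mono_onD[of _ _ "t i" "t (Suc i)"])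
      moreover have "variation_le q L" using q(3) param_length_le_iff[OF q(1)] by blast
      moreover have "\<forall>i\<le>N. \<phi> (t i) \<in> {0..1}" using t(1) reparams_mem[OF \<phi>(1)] by blast
      ultimately show ?thesis
        by (intro \<open>variation_le q L\<close>[unfolded variation_le_def, rule_format]) blast+
    qed
    finally show "(\<Sum>i<N. dist (p (t i)) (p (t (Suc i)))) \<le> L + e" using d(2) by linarith
  qed
qed

text \<open>A vanishing infimum over reparameterizations need not be attained, so there may be no
  change of variables; semicontinuity in both directions takes its place.\<close>

lemma same_curve_param_length: "same_curve p q \<Longrightarrow> param_length p = param_length q"
proof (rule antisym)
  show "same_curve p q \<Longrightarrow> param_length p \<le> param_length q"
    by (rule param_length_lsc) (auto simp: same_curve_def)
  show "same_curve p q \<Longrightarrow> param_length q \<le> param_length p"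
    by (rule param_length_lsc) (auto simp: same_curve_def curve_dist_commute)
qed

text \<open>Once the lengths agree, continuity at \<open>p\<close> under the common length bound
  applies to \<open>q\<close>, which is at distance 0.\<close>

lemma same_curve_line_integral:
  fixes p q :: "real \<Rightarrow> 'a::metric_space"
  assumes s: "same_curve p q" and f: "f \<in> Lip_b" and \<pi>: "\<pi> \<in> Lip"
  shows "line_integral p f \<pi> = line_integral q f \<pi>"
proof -
  obtain A M where f: "A-lipschitz_on UNIV f" "\<And>x. \<bar>f x\<bar> \<le> M" using f by (rule Lip_bE) blast
  obtain B where \<pi>: "B-lipschitz_on UNIV \<pi>" using \<pi> by (rule LipE)
  have pq: "lipschitz_curve p" "lipschitz_curve q" "curve_dist p q = 0"
    using s by (auto simp: same_curve_def)
  have "\<bar>line_integral p f \<pi> - line_integral q f \<pi>\<bar> < e" if e: "0 < e" for e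
  proof (rule line_integral_continuous[OF pq(1) order_refl f \<pi> e])
    fix \<delta> :: real assume "0 < \<delta>" and *: "\<And>q. lipschitz_curve q \<Longrightarrow> param_length q \<le> param_length p \<Longrightarrow>
      curve_dist p q < \<delta> \<Longrightarrow> \<bar>line_integral p f \<pi> - line_integral q f \<pi>\<bar> < e"
    then show ?thesis using pq same_curve_param_length[OF s] by (intro *) auto
  qed
  from this[of "\<bar>line_integral p f \<pi> - line_integral q f \<pi>\<bar>"] show ?thesis by linarith
qed

section \<open>Length, current and endpoints as functions of the class of a curve\<close>

lemma rep_curve_same: "same_curve (rep_curve \<theta>) (rep_curve \<theta>)"
  by (rule Quotient3_rep_reflp[OF Quotient3_curve])

lemma rep_curve_lipschitz: "lipschitz_curve (rep_curve \<theta>)"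
  using rep_curve_same[of \<theta>] by (simp add: same_curve_def)

lemma abs_rep_curve: "abs_curve (rep_curve \<theta>) = \<theta>"
  by (rule Quotient3_abs_rep[OF Quotient3_curve])

lemma same_curve_refl: "lipschitz_curve p \<Longrightarrow> same_curve p p"
  by (simp add: same_curve_def curve_dist_refl)

lemma rep_abs_curve: "lipschitz_curve p \<Longrightarrow> same_curve (rep_curve (abs_curve p)) p"
  by (rule Quotient3_rep_abs[OF Quotient3_curve]) (rule same_curve_refl)

lemma dist_curve_eq: "dist \<theta> \<theta>' = curve_dist (rep_curve \<theta>) (rep_curve \<theta>')"
  using dist_curve.abs_eq[OF rep_curve_same rep_curve_same] by (simp add: abs_rep_curve)

lemma curve_length_eq: "curve_length \<theta> = param_length (rep_curve \<theta>)"
  by (simp add: curve_length_def param_length_def)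

lemma D_1_iff: "(f, ps) \<in> D 1 \<longleftrightarrow> f \<in> Lip_b \<and> (\<exists>\<pi>\<in>Lip. ps = [\<pi>])"
  by (auto simp: D_def length_Suc_conv)

lemma curve_current_eq: "f \<in> Lip_b \<Longrightarrow> \<pi> \<in> Lip \<Longrightarrow> curve_current \<theta> (f, [\<pi>]) = line_integral (rep_curve \<theta>) f \<pi>"
  by (simp add: curve_current_def line_integral_def D_1_iff[unfolded One_nat_def])

lemma curve_current_abs:
  "lipschitz_curve p \<Longrightarrow> f \<in> Lip_b \<Longrightarrow> \<pi> \<in> Lip \<Longrightarrow> curve_current (abs_curve p) (f, [\<pi>]) = line_integral p f \<pi>"
  by (simp add: curve_current_eq same_curve_line_integral[OF rep_abs_curve])

lemma start_rep: "start \<theta> = rep_curve \<theta> 0"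
  by (metis abs_rep_curve rep_curve_same start.abs_eq)

lemma finish_rep: "finish \<theta> = rep_curve \<theta> 1"
  by (metis abs_rep_curve rep_curve_same finish.abs_eq)

lemma dist_start_finish_le: "dist (start \<theta>) (finish \<theta>) \<le> curve_length \<theta>"
  unfolding start_rep finish_rep curve_length_eq
  by (rule dist_endpoints_le_param_length[OF rep_curve_lipschitz])

lemma curve_length_nonneg: "0 \<le> curve_length \<theta>"
  using dist_start_finish_le[of \<theta>] zero_le_dist[of "start \<theta>" "finish \<theta>"] by linarith

text \<open>Every reparameterization fixes both ends of the unit interval, so endpoints are always
  compared at the same parameter.\<close>

lemma dist_start_le: "dist (start \<theta>) (start \<theta>') \<le> dist \<theta> \<theta>'"
  and dist_finish_le: "dist (finish \<theta>) (finish \<theta>') \<le> dist \<theta> \<theta>'"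
proof -
  have *: "dist (rep_curve \<theta> e) (rep_curve \<theta>' e) \<le> dist \<theta> \<theta>'"
    if e: "e \<in> {0..1}" "\<And>\<phi>. \<phi> \<in> reparams \<Longrightarrow> \<phi> e = e" for e
    unfolding dist_curve_eq
  proof (rule curve_dist_greatest)
    fix \<phi> assume \<phi>: "\<phi> \<in> reparams"
    show "dist (rep_curve \<theta> e) (rep_curve \<theta>' e) \<le> curve_sup_dist (rep_curve \<theta>) (rep_curve \<theta>') \<phi>"
      using curve_sup_dist_upper[OF rep_curve_lipschitz rep_curve_lipschitz \<phi> e(1), of \<theta> \<theta>'] e(2)[OF \<phi>] by simp
  qed
  show "dist (start \<theta>) (start \<theta>') \<le> dist \<theta> \<theta>'" "dist (finish \<theta>) (finish \<theta>') \<le> dist \<theta> \<theta>'"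
    unfolding start_rep finish_rep by (auto intro!: * simp: reparams_0 reparams_1)
qed

lemma continuous_on_start: "continuous_on UNIV start"
  and continuous_on_finish: "continuous_on UNIV finish"
  unfolding continuous_on_iff by (meson dist_start_le dist_finish_le le_less_trans)+

lemma measurable_start [measurable]: "start \<in> borel_measurable borel"
  and measurable_finish [measurable]: "finish \<in> borel_measurable borel"
  by (rule borel_measurable_continuous_onI continuous_on_start continuous_on_finish)+

lemma closed_curve_length_le: "closed {\<theta> :: 'a::metric_space curve. curve_length \<theta> \<le> L}"
  unfolding closure_subset_eq[symmetric]
proof (rule subsetI, unfold mem_Collect_eq)
  fix \<theta> :: "'a curve" assume "\<theta> \<in> closure {\<theta>. curve_length \<theta> \<le> L}"
  then have a: "\<forall>e>0. \<exists>y\<in>{\<theta>. curve_length \<theta> \<le> L}. dist y \<theta> < e"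
    by (simp add: closure_approachable)
  show "curve_length \<theta> \<le> L"
    unfolding curve_length_eq
  proof (rule param_length_lsc[OF rep_curve_lipschitz])
    fix \<delta> :: real assume "0 < \<delta>"
    then obtain y where "curve_length y \<le> L" "dist y \<theta> < \<delta>" using a by blast
    then show "\<exists>q. lipschitz_curve q \<and> curve_dist (rep_curve \<theta>) q < \<delta> \<and> param_length q \<le> L"
      by (metis curve_length_eq dist_commute dist_curve_eq rep_curve_lipschitz)
  qed
qed

lemma measurable_curve_length [measurable]: "curve_length \<in> borel_measurable borel"
  by (subst borel_measurable_iff_le) (auto intro: borel_closed closed_curve_length_le)

lemma continuous_on_curve_current:
  "continuous_on {\<theta>. curve_length \<theta> \<le> L} (\<lambda>\<theta>. curve_current \<theta> \<omega>)"
proof (cases "\<omega> \<in> D 1")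
  case True
  then obtain f \<pi> where \<omega>: "\<omega> = (f, [\<pi>])" "f \<in> Lip_b" "\<pi> \<in> Lip"
    by (metis D_1_iff surj_pair)
  obtain A M where f: "A-lipschitz_on UNIV f" "\<And>x. \<bar>f x\<bar> \<le> M" using \<omega>(2) by (rule Lip_bE) blast
  obtain B where \<pi>: "B-lipschitz_on UNIV \<pi>" using \<omega>(3) by (rule LipE)
  show ?thesis
    unfolding continuous_on_iff
  proof (intro ballI allI impI, unfold mem_Collect_eq)
    fix \<theta> :: "'a curve" and e :: real assume \<theta>: "curve_length \<theta> \<le> L" and e: "0 < e"
    obtain \<delta> where \<delta>: "0 < \<delta>"
      "\<And>q. lipschitz_curve q \<Longrightarrow> param_length q \<le> L \<Longrightarrow> curve_dist (rep_curve \<theta>) q < \<delta> \<Longrightarrow>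
       \<bar>line_integral (rep_curve \<theta>) f \<pi> - line_integral q f \<pi>\<bar> < e"
      using line_integral_continuous[OF rep_curve_lipschitz \<theta>[unfolded curve_length_eq] f \<pi> e] by blast
    show "\<exists>d>0. \<forall>x'\<in>{\<theta>. curve_length \<theta> \<le> L}. dist x' \<theta> < d \<longrightarrow> dist (curve_current x' \<omega>) (curve_current \<theta> \<omega>) < e"
    proof (intro exI[of _ \<delta>] conjI \<delta>(1) ballI impI)
      fix x' assume "x' \<in> {\<theta>. curve_length \<theta> \<le> L}" "dist x' \<theta> < \<delta>"
      then have "\<bar>line_integral (rep_curve \<theta>) f \<pi> - line_integral (rep_curve x') f \<pi>\<bar> < e"
        by (intro \<delta>(2) rep_curve_lipschitz) (auto simp: curve_length_eq dist_curve_eq[symmetric] dist_commute)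
      then show "dist (curve_current x' \<omega>) (curve_current \<theta> \<omega>) < e"
        by (simp add: \<omega> curve_current_eq dist_real_def abs_minus_commute)
    qed
  qed
next
  case False
  then have "curve_current \<theta> \<omega> = 0" for \<theta> by (simp add: curve_current_def)
  then show ?thesis by simp
qed

text \<open>The current is known to be continuous only where the length is bounded. The closed
  sublevel sets of the length exhaust the space of curves, so the current is a pointwise limit of
  Borel functions.\<close>

lemma measurable_curve_current [measurable]: "(\<lambda>\<theta>. curve_current \<theta> \<omega>) \<in> borel_measurable borel"
proof (rule borel_measurable_LIMSEQ_real)
  let ?F = "\<lambda>n::nat. {\<theta> :: 'a curve. curve_length \<theta> \<le> real n}"
  show "(\<lambda>\<theta>. indicator (?F n) \<theta> *\<^sub>R curve_current \<theta> \<omega>) \<in> borel_measurable borel" for n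
    by (rule borel_measurable_continuous_on_indicator[OF borel_closed[OF closed_curve_length_le] continuous_on_curve_current])
  fix \<theta> :: "'a curve"
  obtain n0 :: nat where n0: "curve_length \<theta> \<le> real n0" using real_arch_simple by blast
  have "\<forall>\<^sub>F n in sequentially. indicator (?F n) \<theta> *\<^sub>R curve_current \<theta> \<omega> = curve_current \<theta> \<omega>"
    using eventually_ge_at_top[of n0] by eventually_elim (use n0 in \<open>auto simp: indicator_def\<close>)
  then show "(\<lambda>n. indicator (?F n) \<theta> *\<^sub>R curve_current \<theta> \<omega>) \<longlonglongrightarrow> curve_current \<theta> \<omega>"
    by (rule tendsto_eventually)
qed

section \<open>Geodesics\<close>

definition geodesic_curve :: "'a::metric_space curve \<Rightarrow> bool" where
  "geodesic_curve \<theta> \<longleftrightarrow> geodesic \<theta> (start \<theta>) (finish \<theta>)"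

lemma geodesic_curve_iff: "geodesic_curve \<theta> \<longleftrightarrow> dist (start \<theta>) (finish \<theta>) = curve_length \<theta>"
  by (simp add: geodesic_curve_def geodesic_def)

text \<open>A nondecreasing \<open>h\<close> may be constant on intervals and is then no
  reparameterization; a small admixture of the identity makes it strictly increasing.\<close>

lemma interpolated_reparam:
  fixes h :: "real \<Rightarrow> real"
  assumes h: "continuous_on {0..1} h" "\<And>s t. 0 \<le> s \<Longrightarrow> s \<le> t \<Longrightarrow> t \<le> 1 \<Longrightarrow> h s \<le> h t" "h 0 = 0" "h 1 = 1"
    and e: "0 < e" "e \<le> 1"
  shows "(\<lambda>t. (1 - e) * h t + e * t) \<in> reparams"
proof -
  let ?\<phi> = "\<lambda>t. (1 - e) * h t + e * t"
  have s: "strict_mono_on {0..1} ?\<phi>"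
  proof (rule strict_mono_onI)
    fix r s :: real assume "r \<in> {0..1}" "s \<in> {0..1}" "r < s"
    then have "(1 - e) * h r \<le> (1 - e) * h s" "e * r < e * s"
      using e by (auto intro!: mult_left_mono h)
    then show "?\<phi> r < ?\<phi> s" by linarith
  qed
  have c: "continuous_on {0..1} ?\<phi>" by (intro continuous_intros h)
  have "?\<phi> ` {0..1} = {0..1}"
  proof (intro equalityI subsetI)
    fix y assume "y \<in> ?\<phi> ` {0..1}"
    then obtain t where t: "t \<in> {0..1}" "y = ?\<phi> t" by blast
    have "?\<phi> 0 \<le> ?\<phi> t" "?\<phi> t \<le> ?\<phi> 1"
      using t strict_mono_on_leD[OF s, of 0 t] strict_mono_on_leD[OF s, of t 1] by auto
    then show "y \<in> {0..1}" using t h by simp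
  next
    fix y :: real assume "y \<in> {0..1}"
    then have "\<exists>x\<ge>0. x \<le> 1 \<and> ?\<phi> x = y" using h by (intro IVT' c) auto
    then show "y \<in> ?\<phi> ` {0..1}" by force
  qed
  then show ?thesis
    using s strict_mono_on_imp_inj_on[OF s] by (simp add: reparams_def bij_betw_def)
qed

text \<open>For a geodesic the variation of \<open>p\<close> is the distance of its ends, which
  forces every triangle inequality along the curve to be an equality: distances between points of
  the curve are differences of the monotone function \<open>h\<close>, the distance from the start.
  Inverting \<open>h\<close> gives constant speed.\<close>

lemma geodesic_constant_speed_exists:
  fixes \<theta> :: "'a::metric_space curve"
  assumes g: "geodesic_curve \<theta>"
  shows "\<exists>c. lipschitz_curve c \<and> abs_curve c = \<theta> \<and>
    (\<forall>s\<in>{0..1}. \<forall>t\<in>{0..1}. dist (c s) (c t) = dist (start \<theta>) (finish \<theta>) * \<bar>s - t\<bar>)"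
proof -
  define p where "p = rep_curve \<theta>"
  define l where "l = dist (p 0) (p 1)"
  have p: "lipschitz_curve p" unfolding p_def by (rule rep_curve_lipschitz)
  have l: "l = dist (start \<theta>) (finish \<theta>)" by (simp add: l_def p_def start_rep finish_rep)
  have "param_length p \<le> l"
    using g by (simp add: geodesic_curve_iff l p_def curve_length_eq)
  then have V: "variation_le p l" by (simp only: param_length_le_iff[OF p])
  define h where "h t = dist (p 0) (p t)" for t
  have add: "dist (p s) (p t) = h t - h s" if "0 \<le> s" "s \<le> t" "t \<le> 1" for s t
  proof -
    \<comment> \<open>The partition with points \<open>0, s, t, 1\<close> suffices: its sum is at
      most \<open>l\<close>, while the triangle inequality bounds \<open>l\<close> by the same
      sum.\<close>
    have "(\<Sum>i<3. dist (p ([0, s, t, 1] ! i)) (p ([0, s, t, 1] ! Suc i))) \<le> l"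
    proof (rule V[unfolded variation_le_def, rule_format])
      fix i :: nat assume "i \<le> 3"
      then have "i = 0 \<or> i = 1 \<or> i = 2 \<or> i = 3" by auto
      then show "[0, s, t, 1] ! i \<in> {0..1}" using that by auto
    next
      fix i :: nat assume "i < 3"
      then have "i = 0 \<or> i = 1 \<or> i = 2" by auto
      then show "[0, s, t, 1] ! i \<le> [0, s, t, 1] ! Suc i" using that by (auto simp: numeral_2_eq_2)
    qed
    then have "h s + dist (p s) (p t) + dist (p t) (p 1) \<le> l"
      by (simp add: eval_nat_numeral h_def)
    moreover have "l \<le> h t + dist (p t) (p 1)" unfolding l_def h_def by (rule dist_triangle)
    moreover have "h t \<le> h s + dist (p s) (p t)" unfolding h_def by (rule dist_triangle)
    ultimately show ?thesis by linarith
  qed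
  have abs: "dist (p s) (p t) = \<bar>h s - h t\<bar>" if "s \<in> {0..1}" "t \<in> {0..1}" for s t
    using add[of s t] add[of t s] that zero_le_dist[of "p s" "p t"]
    by (cases "s \<le> t") (auto simp: dist_commute)
  have mono: "h s \<le> h t" if "0 \<le> s" "s \<le> t" "t \<le> 1" for s t
    using add[OF that] zero_le_dist[of "p s" "p t"] by linarith
  obtain K where "K-lipschitz_on {0..1} p" using p by (auto simp: lipschitz_curve_def)
  then have hc: "continuous_on {0..1} h"
    unfolding h_def by (intro continuous_intros lipschitz_on_continuous_on)
  have h01: "h 0 = 0" "h 1 = l" by (simp_all add: h_def l_def)
  have l0: "0 \<le> l" by (simp add: l_def)
  have ex: "\<exists>t\<in>{0..1}. h t = r * l" if r: "r \<in> {0..1}" for r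
  proof -
    have "0 \<le> r * l" "r * l \<le> l" using r l0 by (auto simp: mult_left_le_one_le)
    then have "\<exists>x\<ge>0. x \<le> 1 \<and> h x = r * l" using h01 by (intro IVT' hc) auto
    then show ?thesis by auto
  qed
  \<comment> \<open>\<open>\<tau>\<close> may jump across intervals on which \<open>h\<close> is
    constant; \<open>p\<close> is constant there as well, so \<open>c\<close> is Lipschitz all the
    same.\<close>
  obtain \<tau> where "\<forall>r\<in>{0..1}. \<tau> r \<in> {0..1} \<and> h (\<tau> r) = r * l"
    using ex bchoice[of "{0..1}" "\<lambda>r t. t \<in> {0..1} \<and> h t = r * l"] by blast
  then have \<tau>: "\<tau> r \<in> {0..1}" "h (\<tau> r) = r * l" if "r \<in> {0..1}" for r
    using that by blast+
  define c where "c r = p (\<tau> r)" for r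
  have dc: "dist (c s) (c t) = l * \<bar>s - t\<bar>" if "s \<in> {0..1}" "t \<in> {0..1}" for s t
  proof -
    have "dist (c s) (c t) = \<bar>s * l - t * l\<bar>"
      unfolding c_def using abs[OF \<tau>(1)[OF that(1)] \<tau>(1)[OF that(2)]] \<tau>(2)[OF that(1)] \<tau>(2)[OF that(2)] by simp
    also have "\<dots> = l * \<bar>s - t\<bar>" using l0 by (simp add: left_diff_distrib[symmetric] abs_mult)
    finally show ?thesis .
  qed
  have pc: "dist (p t) (c s) = \<bar>h t - s * l\<bar>" if "s \<in> {0..1}" "t \<in> {0..1}" for s t
    unfolding c_def using abs[OF that(2) \<tau>(1)[OF that(1)]] \<tau>(2)[OF that(1)] by simp
  have cl: "lipschitz_curve c"
    unfolding lipschitz_curve_def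
    by (intro exI[of _ l] lipschitz_onI) (auto simp: dc dist_real_def l0)
  \<comment> \<open>For \<open>l > 0\<close>, \<open>p\<close> is \<open>c\<close> composed with
    \<open>h / l\<close>, which is only nondecreasing; strictly increasing perturbations of it show
    that both parameterizations belong to one class. For \<open>l = 0\<close> the curve is
    constant.\<close>
  have cd: "curve_dist p c \<le> e * l" if e: "0 < e" "e \<le> 1" for e
  proof -
    obtain \<phi> where \<phi>: "\<phi> \<in> reparams" "\<And>t. t \<in> {0..1} \<Longrightarrow> \<bar>h t - \<phi> t * l\<bar> \<le> e * l"
    proof (cases "l = 0")
      case True
      then have "h t = 0" if "t \<in> {0..1}" for t using mono[of 0 t] mono[of t 1] h01 that by auto
      then show thesis using that[OF id_in_reparams] True by auto
    next
      case False
      then have lp: "0 < l" using l0 by simp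
      let ?\<phi> = "\<lambda>t. (1 - e) * (h t / l) + e * t"
      have "?\<phi> \<in> reparams"
        using lp h01 by (intro interpolated_reparam e continuous_intros hc divide_right_mono mono) auto
      moreover have "\<bar>h t - ?\<phi> t * l\<bar> \<le> e * l" if t: "t \<in> {0..1}" for t
      proof -
        have "h t / l * l = h t" using lp by simp
        then have "h t - ?\<phi> t * l = e * (h t - t * l)"
          by (simp only: distrib_right mult.assoc) (simp add: algebra_simps)
        moreover have "\<bar>h t - t * l\<bar> \<le> l"
        proof -
          have "0 \<le> h t" "h t \<le> l" using mono[of 0 t] mono[of t 1] t h01 by auto
          moreover have "0 \<le> t * l" "t * l \<le> l" using t l0 by (auto simp: mult_left_le_one_le)
          ultimately show ?thesis by linarith
        qed
        ultimately show ?thesis using e by (simp add: abs_mult)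
      qed
      ultimately show thesis by (rule that)
    qed
    have "curve_dist p c \<le> curve_sup_dist p c \<phi>" by (rule curve_dist_lower[OF p cl \<phi>(1)])
    also have "\<dots> \<le> e * l" unfolding curve_sup_dist_def
      using pc \<phi>(2) reparams_mem[OF \<phi>(1)] by (intro cSUP_least) auto
    finally show ?thesis .
  qed
  have "curve_dist p c \<le> 0 + x" if x: "0 < x" for x
  proof -
    define e where "e = min 1 (x / (l + 1))"
    have e: "0 < e" "e \<le> 1" using x l0 by (auto simp: e_def)
    have "e * l \<le> x / (l + 1) * l" using l0 by (intro mult_right_mono) (auto simp: e_def)
    also have "\<dots> \<le> x" using x l0 by (simp add: field_simps)
    finally show ?thesis using cd[OF e] by simp
  qed
  then have "curve_dist p c \<le> 0" by (rule field_le_epsilon)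
  then have "curve_dist p c = 0" using curve_dist_nonneg[OF p cl] by simp
  then have "same_curve p c" using p cl by (simp add: same_curve_def)
  then have "abs_curve p = abs_curve c" by (rule Quotient3_rel_abs[OF Quotient3_curve])
  then have "abs_curve c = \<theta>" by (simp add: p_def abs_rep_curve)
  then show ?thesis using cl dc l by blast
qed

text \<open>\<open>rep_curve\<close> is an arbitrary choice, which cannot be expected to depend
  measurably on the class. The constant-speed parameterization of a geodesic does, and the constant
  curve at \<open>start \<theta>\<close> preserves this off the geodesics.\<close>

definition geo_param :: "'a::metric_space curve \<Rightarrow> real \<Rightarrow> 'a" where
  "geo_param \<theta> = (if geodesic_curve \<theta> then (SOME c. lipschitz_curve c \<and> abs_curve c = \<theta> \<and>
    (\<forall>s\<in>{0..1}. \<forall>t\<in>{0..1}. dist (c s) (c t) = dist (start \<theta>) (finish \<theta>) * \<bar>s - t\<bar>))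
    else (\<lambda>_. start \<theta>))"

lemma geo_param:
  assumes "geodesic_curve \<theta>"
  shows "lipschitz_curve (geo_param \<theta>)" "abs_curve (geo_param \<theta>) = \<theta>"
    "\<And>s t. s \<in> {0..1} \<Longrightarrow> t \<in> {0..1} \<Longrightarrow>
      dist (geo_param \<theta> s) (geo_param \<theta> t) = dist (start \<theta>) (finish \<theta>) * \<bar>s - t\<bar>"
proof -
  note * = someI_ex[OF geodesic_constant_speed_exists[OF assms]]
  have e: "geo_param \<theta> = (SOME c. lipschitz_curve c \<and> abs_curve c = \<theta> \<and>
    (\<forall>s\<in>{0..1}. \<forall>t\<in>{0..1}. dist (c s) (c t) = dist (start \<theta>) (finish \<theta>) * \<bar>s - t\<bar>))"
    using assms by (simp add: geo_param_def)
  show "lipschitz_curve (geo_param \<theta>)" "abs_curve (geo_param \<theta>) = \<theta>"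
    "\<And>s t. s \<in> {0..1} \<Longrightarrow> t \<in> {0..1} \<Longrightarrow>
      dist (geo_param \<theta> s) (geo_param \<theta> t) = dist (start \<theta>) (finish \<theta>) * \<bar>s - t\<bar>"
    using * unfolding e[symmetric] by blast+
qed

text \<open>An almost optimal reparameterization \<open>\<phi>\<close> need not be close to the
  identity, but constant speed limits its effect: comparing the distances from the start gives an
  error of \<open>2 * \<delta>\<close>, comparing the total lengths another
  \<open>2 * \<delta>\<close>, so moving from \<open>\<phi> t\<close> back to \<open>t\<close> costs
  at most \<open>4 * \<delta>\<close> on the second curve. Together with the initial
  \<open>\<delta>\<close> this is the factor 5.\<close>

lemma geo_param_dist_le:
  assumes g: "geodesic_curve \<theta>" "geodesic_curve \<theta>'" and t: "t \<in> {0..1}"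
  shows "dist (geo_param \<theta> t) (geo_param \<theta>' t) \<le> 5 * dist \<theta> \<theta>'"
proof (rule field_le_epsilon)
  fix e :: real assume e: "0 < e"
  let ?c = "geo_param \<theta>" and ?c' = "geo_param \<theta>'"
  define l where "l = dist (start \<theta>) (finish \<theta>)"
  define l' where "l' = dist (start \<theta>') (finish \<theta>')"
  define \<delta> where "\<delta> = dist \<theta> \<theta>' + e / 5"
  note G = geo_param[OF g(1)] and G' = geo_param[OF g(2)]
  have "dist (abs_curve ?c) (abs_curve ?c') = curve_dist ?c ?c'"
    by (rule dist_curve.abs_eq) (rule same_curve_refl G G')+
  then have "curve_dist ?c ?c' < \<delta>" using e by (simp add: \<delta>_def G(2) G'(2))
  then obtain \<phi> where \<phi>: "\<phi> \<in> reparams" "\<And>t. t \<in> {0..1} \<Longrightarrow> dist (?c t) (?c' (\<phi> t)) \<le> \<delta>"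
    using curve_dist_less_obtains[OF G(1) G'(1)] by blast
  have \<phi>t: "\<phi> t \<in> {0..1}" by (rule reparams_mem[OF \<phi>(1) t])
  have 0: "dist (?c 0) (?c' 0) \<le> \<delta>" "dist (?c 1) (?c' 1) \<le> \<delta>"
    using \<phi>(2)[of 0] \<phi>(2)[of 1] reparams_0[OF \<phi>(1)] reparams_1[OF \<phi>(1)] by auto
  have quad: "\<bar>dist a b - dist a' b'\<bar> \<le> dist a a' + dist b b'" for a b a' b' :: 'a
    using dist_triangle[of a b a'] dist_triangle[of a' b b'] dist_triangle[of a' b' a] dist_triangle[of a b' b]
    by (simp add: dist_commute abs_le_iff)
  have 1: "dist (?c 0) (?c t) = l * t" "dist (?c' 0) (?c' (\<phi> t)) = l' * \<phi> t" "dist (?c 0) (?c 1) = l"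
    "dist (?c' 0) (?c' 1) = l'" "dist (?c' (\<phi> t)) (?c' t) = l' * \<bar>\<phi> t - t\<bar>"
    using t \<phi>t by (simp_all add: G(3) G'(3) l_def l'_def)
  have 2: "\<bar>l * t - l' * \<phi> t\<bar> \<le> 2 * \<delta>" using quad[of "?c 0" "?c t" "?c' 0" "?c' (\<phi> t)"] 0(1) \<phi>(2)[OF t] 1 by simp
  have 3: "\<bar>l - l'\<bar> \<le> 2 * \<delta>" using quad[of "?c 0" "?c 1" "?c' 0" "?c' 1"] 0 1 by simp
  have "\<bar>l - l'\<bar> * t \<le> (2 * \<delta>) * 1" using 3 t by (intro mult_mono) auto
  then have 4: "\<bar>l * t - l' * t\<bar> \<le> 2 * \<delta>" using t by (simp add: left_diff_distrib[symmetric] abs_mult)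
  have "l' * \<bar>\<phi> t - t\<bar> = \<bar>l' * \<phi> t - l' * t\<bar>"
    unfolding right_diff_distrib[symmetric] abs_mult by (simp add: l'_def)
  then have "dist (?c' (\<phi> t)) (?c' t) \<le> 4 * \<delta>" using 1(5) 2 4 by linarith
  then have "dist (?c t) (?c' t) \<le> 5 * \<delta>"
    using \<phi>(2)[OF t] dist_triangle[of "?c t" "?c' t" "?c' (\<phi> t)"] by linarith
  then show "dist (?c t) (?c' t) \<le> 5 * dist \<theta> \<theta>' + e" by (simp add: \<delta>_def)
qed

lemma measurable_dist_start_finish [measurable]:
  "(\<lambda>\<theta>. dist (start \<theta>) (finish \<theta>)) \<in> borel_measurable borel"
  by (intro borel_measurable_continuous_onI continuous_on_dist continuous_on_start continuous_on_finish)

lemma sets_geodesic_curve [measurable]: "{\<theta>. geodesic_curve \<theta>} \<in> sets borel"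
proof -
  have "{\<theta> \<in> space borel. dist (start \<theta>) (finish \<theta>) = curve_length \<theta>} \<in> sets borel" by measurable
  then show ?thesis by (simp add: geodesic_curve_iff)
qed

text \<open>On the Borel set of geodesics the dependence on the curve is Lipschitz, and on its
  complement the value is the continuous \<open>start\<close>.\<close>

lemma measurable_geo_param_at:
  assumes "t \<in> {0..1}"
  shows "(\<lambda>\<theta>. geo_param \<theta> t) \<in> borel_measurable borel"
proof -
  let ?G = "{\<theta> :: 'a curve. geodesic_curve \<theta>}"
  have "continuous_on ?G (\<lambda>\<theta>. geo_param \<theta> t)"
  proof (rule continuous_onI)
    fix x and e :: real assume x: "x \<in> ?G" and e: "0 < e"
    have "dist (geo_param x' t) (geo_param x t) \<le> e" if "x' \<in> ?G" "dist x' x < e / 5" for x'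
      using geo_param_dist_le[of x' x t] that x assms by simp
    then show "\<exists>d>0. \<forall>x'\<in>?G. dist x' x < d \<longrightarrow> dist (geo_param x' t) (geo_param x t) \<le> e"
      using e by (intro exI[of _ "e / 5"]) auto
  qed
  then have 1: "(\<lambda>\<theta>. geo_param \<theta> t) \<in> borel_measurable (restrict_space borel ?G)"
    by (rule borel_measurable_continuous_on_restrict)
  have 2: "(\<lambda>\<theta>. start \<theta>) \<in> borel_measurable (restrict_space borel (- ?G))"
    by (intro measurable_restrict_space1 measurable_start)
  have "(\<lambda>\<theta>. if \<theta> \<in> ?G then geo_param \<theta> t else start \<theta>) \<in> borel_measurable borel"
    using 1 2 sets_geodesic_curve
    by (subst measurable_If_restrict_space_iff) (auto simp: Compl_eq)
  moreover have "(\<lambda>\<theta>. if \<theta> \<in> ?G then geo_param \<theta> t else start \<theta>) = (\<lambda>\<theta>. geo_param \<theta> t)"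
    by (auto simp: geo_param_def)
  ultimately show ?thesis by simp
qed

text \<open>The curve space need not be separable, so joint measurability is obtained from
  discretising the time variable only.\<close>

lemma measurable_geo_param [measurable]:
  "(\<lambda>x. geo_param (fst x) (max 0 (min 1 (snd x)))) \<in> borel_measurable (borel \<Otimes>\<^sub>M (borel :: real measure))"
proof (rule borel_measurable_LIMSEQ_metric)
  let ?r = "\<lambda>n (k::int). max 0 (min 1 (of_int k / real (Suc n)))"
  fix n :: nat
  show "(\<lambda>x. geo_param (fst x) (?r n \<lfloor>real (Suc n) * snd x\<rfloor>)) \<in> borel_measurable (borel \<Otimes>\<^sub>M (borel :: real measure))"
  proof (rule measurable_compose_countable[where g="\<lambda>x. \<lfloor>real (Suc n) * snd x\<rfloor>" and f="\<lambda>k x. geo_param (fst x) (?r n k)"])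
    show "(\<lambda>x. geo_param (fst x) (?r n k)) \<in> borel_measurable (borel \<Otimes>\<^sub>M (borel :: real measure))" for k
      by (rule measurable_compose[OF measurable_fst measurable_geo_param_at]) auto
  qed measurable
next
  fix x :: "'a curve \<times> real"
  let ?t = "snd x" and ?c = "geo_param (fst x)"
  let ?u = "\<lambda>n. max 0 (min 1 (of_int \<lfloor>real (Suc n) * ?t\<rfloor> / real (Suc n)))" and ?v = "max 0 (min 1 ?t)"
  have d: "dist (of_int \<lfloor>real (Suc n) * ?t\<rfloor> / real (Suc n)) ?t \<le> 1 / real (Suc n)" for n
  proof -
    let ?k = "of_int \<lfloor>real (Suc n) * ?t\<rfloor> :: real"
    have "?k \<le> real (Suc n) * ?t" "real (Suc n) * ?t < ?k + 1" by linarith+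
    then have "\<bar>?k - real (Suc n) * ?t\<bar> \<le> 1" by linarith
    then have "\<bar>?k - real (Suc n) * ?t\<bar> / real (Suc n) \<le> 1 / real (Suc n)" by (rule divide_right_mono) simp
    moreover have "?k / real (Suc n) - ?t = (?k - real (Suc n) * ?t) / real (Suc n)"
      by (simp add: diff_divide_distrib)
    ultimately show ?thesis by (simp add: dist_real_def)
  qed
  define a where "a n = of_int \<lfloor>real (Suc n) * ?t\<rfloor> / real (Suc n)" for n
  define b where "b n = 1 / real (Suc n)" for n
  have ab: "dist (a n) ?t \<le> b n" for n unfolding a_def b_def by (rule d)
  have b: "b \<longlonglongrightarrow> 0" unfolding b_def by (rule LIMSEQ_Suc[OF lim_1_over_n])
  have "a \<longlonglongrightarrow> ?t"
  proof (rule metric_LIMSEQ_I)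
    fix r :: real assume "0 < r"
    from order_tendstoD(2)[OF b this] obtain N where "\<forall>n\<ge>N. b n < r" by (auto simp: eventually_sequentially)
    then show "\<exists>N. \<forall>n\<ge>N. dist (a n) ?t < r" using ab by (meson le_less_trans)
  qed
  then have "(\<lambda>n. of_int \<lfloor>real (Suc n) * ?t\<rfloor> / real (Suc n)) \<longlonglongrightarrow> ?t" unfolding a_def .
  then have u: "?u \<longlonglongrightarrow> ?v" by (intro tendsto_intros)
  have "continuous_on {0..1} ?c"
  proof (cases "geodesic_curve (fst x)")
    case True
    then obtain K where "K-lipschitz_on {0..1} ?c"
      using geo_param(1) by (auto simp: lipschitz_curve_def)
    then show ?thesis by (rule lipschitz_on_continuous_on)
  qed (simp add: geo_param_def)
  then show "(\<lambda>n. ?c (?u n)) \<longlonglongrightarrow> ?c ?v"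
    by (rule continuous_on_tendsto_compose[OF _ u]) auto
qed

lemma geodesic_is_arc:
  assumes "geodesic_curve \<theta>" "start \<theta> \<noteq> finish \<theta>" shows "is_arc \<theta>"
proof -
  have "inj_on (geo_param \<theta>) {0..1}"
  proof (rule inj_onI)
    fix s t :: real assume "s \<in> {0..1}" "t \<in> {0..1}" "geo_param \<theta> s = geo_param \<theta> t"
    then have "dist (start \<theta>) (finish \<theta>) * \<bar>s - t\<bar> = 0" using geo_param(3)[OF assms(1)] by (metis dist_self)
    then show "s = t" using assms(2) by simp
  qed
  then show ?thesis using geo_param(1,2)[OF assms(1)] by (auto simp: is_arc_def)
qed

text \<open>At constant speed the derivative of \<open>\<pi>\<close> along the curve is at most
  \<open>B\<close> times the distance of the ends, so the current is bounded by \<open>B\<close>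
  times the arc-length integral of \<open>\<bar>f\<bar>\<close>. In this form the bound is jointly
  measurable in curve and time and can be integrated over a transport.\<close>

lemma abs_line_integral_geodesic_le:
  assumes g: "geodesic_curve \<theta>" and f: "f \<in> Lip_b" and \<pi>: "B-lipschitz_on UNIV \<pi>"
  shows "\<bar>curve_current \<theta> (f, [\<pi>])\<bar>
    \<le> B * (dist (start \<theta>) (finish \<theta>) * (LINT t:{0..1}|lborel. \<bar>f (geo_param \<theta> (max 0 (min 1 t)))\<bar>))"
proof -
  let ?c = "geo_param \<theta>" and ?l = "dist (start \<theta>) (finish \<theta>)"
  let ?P = "\<lambda>t. ?c (max 0 (min 1 t))"
  note G = geo_param[OF g]
  have \<pi>L: "\<pi> \<in> Lip" using \<pi> by (auto simp: Lip_def)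
  obtain A M where fA: "A-lipschitz_on UNIV f" "\<And>x. \<bar>f x\<bar> \<le> M" using f by (rule Lip_bE) blast
  have B: "0 \<le> B" using \<pi> by (rule lipschitz_on_nonneg)
  have P: "?l-lipschitz_on UNIV ?P"
  proof (rule lipschitz_onI)
    fix x y :: real
    have "dist (?P x) (?P y) = ?l * \<bar>max 0 (min 1 x) - max 0 (min 1 y)\<bar>" by (rule G(3)) auto
    also have "\<dots> \<le> ?l * dist x y" by (intro mult_left_mono) (auto simp: dist_real_def)
    finally show "dist (?P x) (?P y) \<le> ?l * dist x y" .
  qed simp
  have g1: "(B * ?l)-lipschitz_on UNIV (\<lambda>t. \<pi> (?P t))"
    by (rule lipschitz_on_compose2[OF P]) (auto intro: lipschitz_on_subset[OF \<pi>])
  obtain g' where g': "g' \<in> borel_measurable borel" "\<And>x. \<bar>g' x\<bar> \<le> B * ?l"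
    "AE x in lborel. ((\<lambda>t. \<pi> (?P t)) has_real_derivative g' x) (at x)"
    by (rule lipschitz_FTC[OF g1]) blast
  have cf: "continuous_on UNIV (\<lambda>t. f (?P t))"
    by (rule continuous_on_compose2[OF lipschitz_on_continuous_on[OF fA(1)] lipschitz_on_continuous_on[OF P]]) auto
  have mf: "(\<lambda>t. f (?P t)) \<in> borel_measurable borel" by (rule borel_measurable_continuous_onI[OF cf])
  have M: "0 \<le> M" using fA(2)[of undefined] by linarith
  have "AE t in lborel. t \<in> {0..1} \<longrightarrow> f (?c t) * deriv (\<lambda>s. \<pi> (?c s)) t = f (?P t) * g' t"
    using g'(3) AE_lborel_singleton[of "0::real"] AE_lborel_singleton[of "1::real"]
  proof eventually_elim
    case (elim t)
    show ?case
    proof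
      assume t: "t \<in> {0..1}"
      then have t': "t \<in> {0<..<1}" using elim by auto
      have "\<forall>\<^sub>F s in nhds t. \<pi> (?c s) = \<pi> (?P s)"
        using eventually_nhds_in_open[of "{0<..<1}" t] t' by (auto elim: eventually_mono)
      then have "deriv (\<lambda>s. \<pi> (?c s)) t = deriv (\<lambda>s. \<pi> (?P s)) t" by (rule deriv_cong_ev) simp
      also have "\<dots> = g' t" using elim by (auto intro: DERIV_imp_deriv)
      finally show "f (?c t) * deriv (\<lambda>s. \<pi> (?c s)) t = f (?P t) * g' t" using t by simp
    qed
  qed
  then have "line_integral ?c f \<pi> = integral {0..1} (\<lambda>t. f (?P t) * g' t)"
    unfolding line_integral_def by (rule integral_cong_AE_lborel(2))
  also have "\<bar>\<dots>\<bar> \<le> integral {0..1} (\<lambda>t. (B * ?l) * \<bar>f (?P t)\<bar>)"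
  proof -
    have "norm (integral {0..1} (\<lambda>t. f (?P t) * g' t)) \<le> integral {0..1} (\<lambda>t. (B * ?l) * \<bar>f (?P t)\<bar>)"
    proof (rule integral_norm_bound_integral)
      show "(\<lambda>t. f (?P t) * g' t) integrable_on {0..1}"
        using mf g'(1) by (intro bounded_borel_integrable_Icc(2)[where B="M * (B * ?l)"])
          (auto simp: abs_mult intro!: mult_mono fA g'(2) M)
      show "(\<lambda>t. (B * ?l) * \<bar>f (?P t)\<bar>) integrable_on {0..1}"
        by (intro integrable_continuous_real continuous_intros continuous_on_subset[OF cf]) auto
      fix t show "norm (f (?P t) * g' t) \<le> (B * ?l) * \<bar>f (?P t)\<bar>"
        using mult_right_mono[OF g'(2)[of t], of "\<bar>f (?P t)\<bar>"] by (simp add: abs_mult mult.commute)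
    qed
    then show ?thesis by simp
  qed
  also have "\<dots> = B * (?l * integral {0..1} (\<lambda>t. \<bar>f (?P t)\<bar>))" by (simp add: mult.assoc)
  also have "integral {0..1} (\<lambda>t. \<bar>f (?P t)\<bar>) = (LINT t:{0..1}|lborel. \<bar>f (?P t)\<bar>)"
    using mf by (intro bounded_borel_integrable_Icc(3)[symmetric, where B=M]) (auto simp: fA)
  finally show ?thesis
    using curve_current_abs[OF G(1) f \<pi>L] by (simp add: G(2))
qed

section \<open>Finite Borel measures and Lipschitz functions\<close>

lemma finite_borel_measureD:
  assumes "finite_borel_measure \<mu>"
  shows "finite_measure \<mu>" "sets \<mu> = sets borel" "space \<mu> = UNIV"
  using assms sets_eq_imp_space_eq[of \<mu> borel] by (auto simp: finite_borel_measure_def)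

lemma finite_borel_measureI:
  assumes "sets \<mu> = sets borel" "emeasure \<mu> UNIV < \<infinity>"
  shows "finite_borel_measure \<mu>"
  using assms sets_eq_imp_space_eq[of \<mu> borel]
  by (auto simp: finite_borel_measure_def intro!: finite_measureI)

lemma Lip_b_subset_Lip: "f \<in> Lip_b \<Longrightarrow> f \<in> Lip" by (simp add: Lip_b_def)

lemma Lip_b_bound:
  assumes "f \<in> Lip_b" obtains M where "0 \<le> M" "\<And>x. \<bar>f x\<bar> \<le> M"
proof -
  obtain M where "\<forall>y\<in>range f. norm y \<le> M" using assms unfolding Lip_b_def bounded_iff by blast
  then show thesis by (intro that[of "max 0 M"]) (auto simp: max.coboundedI2)
qed

lemma Lip_measurable: "f \<in> Lip \<Longrightarrow> f \<in> borel_measurable borel"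
  unfolding Lip_def using borel_measurable_continuous_onI lipschitz_on_continuous_on by blast

lemma Lip_bI: "L-lipschitz_on UNIV f \<Longrightarrow> (\<And>x. \<bar>f x\<bar> \<le> M) \<Longrightarrow> f \<in> Lip_b"
  by (auto simp: Lip_b_def Lip_def bounded_iff)

lemma lipschitz_real_iff:
  fixes f :: "'a::metric_space \<Rightarrow> real"
  shows "L-lipschitz_on UNIV f \<longleftrightarrow> 0 \<le> L \<and> (\<forall>x y. \<bar>f x - f y\<bar> \<le> L * dist x y)"
  by (auto simp: lipschitz_on_def dist_real_def)

lemma Lip_b_mult:
  assumes "f \<in> Lip_b" "g \<in> Lip_b" shows "(\<lambda>x. f x * g x) \<in> Lip_b"
proof -
  obtain A B where A: "A-lipschitz_on UNIV f" and B: "B-lipschitz_on UNIV g"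
    using assms by (auto simp: Lip_b_def Lip_def)
  obtain M where M: "0 \<le> M" "\<And>x. \<bar>f x\<bar> \<le> M" using Lip_b_bound[OF assms(1)] by blast
  obtain N where N: "0 \<le> N" "\<And>x. \<bar>g x\<bar> \<le> N" using Lip_b_bound[OF assms(2)] by blast
  have A0: "0 \<le> A" and B0: "0 \<le> B" using A B by (auto dest: lipschitz_on_nonneg)
  have "\<bar>f x * g x - f y * g y\<bar> \<le> (A * N + M * B) * dist x y" for x y
  proof -
    have "f x * g x - f y * g y = (f x - f y) * g x + f y * (g x - g y)" by (simp add: algebra_simps)
    then have "\<bar>f x * g x - f y * g y\<bar> \<le> \<bar>f x - f y\<bar> * \<bar>g x\<bar> + \<bar>f y\<bar> * \<bar>g x - g y\<bar>"
      by (metis abs_mult abs_triangle_ineq)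
    also have "\<dots> \<le> (A * dist x y) * N + M * (B * dist x y)"
      using A B M N A0 by (intro add_mono mult_mono) (auto simp: lipschitz_real_iff)
    finally show ?thesis by (simp add: algebra_simps)
  qed
  then have "(A * N + M * B)-lipschitz_on UNIV (\<lambda>x. f x * g x)"
    using A0 B0 M N by (simp add: lipschitz_real_iff)
  moreover have "\<bar>f x * g x\<bar> \<le> M * N" for x
    unfolding abs_mult by (intro mult_mono M N) auto
  ultimately show ?thesis by (rule Lip_bI)
qed

lemma Lip_comb:
  assumes "f \<in> Lip" "g \<in> Lip" shows "(\<lambda>x. a * f x + b * g x) \<in> Lip"
proof -
  obtain A B where A: "A-lipschitz_on UNIV f" and B: "B-lipschitz_on UNIV g"
    using assms by (auto simp: Lip_def)
  have "\<bar>(a * f x + b * g x) - (a * f y + b * g y)\<bar> \<le> (\<bar>a\<bar> * A + \<bar>b\<bar> * B) * dist x y" for x y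
  proof -
    have "(a * f x + b * g x) - (a * f y + b * g y) = a * (f x - f y) + b * (g x - g y)" by (simp add: algebra_simps)
    then have "\<bar>(a * f x + b * g x) - (a * f y + b * g y)\<bar> \<le> \<bar>a\<bar> * \<bar>f x - f y\<bar> + \<bar>b\<bar> * \<bar>g x - g y\<bar>"
      by (metis abs_mult abs_triangle_ineq)
    also have "\<dots> \<le> \<bar>a\<bar> * (A * dist x y) + \<bar>b\<bar> * (B * dist x y)"
      using A B by (intro add_mono mult_mono) (auto simp: lipschitz_real_iff)
    finally show ?thesis by (simp add: algebra_simps)
  qed
  moreover have "0 \<le> \<bar>a\<bar> * A + \<bar>b\<bar> * B"
    using lipschitz_on_nonneg[OF A] lipschitz_on_nonneg[OF B] by simp
  ultimately show ?thesis unfolding Lip_def lipschitz_real_iff by blast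
qed

lemma Lip_b_comb:
  assumes "f \<in> Lip_b" "g \<in> Lip_b" shows "(\<lambda>x. a * f x + b * g x) \<in> Lip_b"
proof -
  obtain M where M: "0 \<le> M" "\<And>x. \<bar>f x\<bar> \<le> M" using Lip_b_bound[OF assms(1)] by blast
  obtain N where N: "0 \<le> N" "\<And>x. \<bar>g x\<bar> \<le> N" using Lip_b_bound[OF assms(2)] by blast
  have "\<bar>a * f x + b * g x\<bar> \<le> \<bar>a\<bar> * M + \<bar>b\<bar> * N" for x
  proof -
    have "\<bar>a * f x + b * g x\<bar> \<le> \<bar>a\<bar> * \<bar>f x\<bar> + \<bar>b\<bar> * \<bar>g x\<bar>" by (metis abs_mult abs_triangle_ineq)
    also have "\<dots> \<le> \<bar>a\<bar> * M + \<bar>b\<bar> * N" by (intro add_mono mult_left_mono M N) auto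
    finally show ?thesis .
  qed
  then show ?thesis using Lip_comb[of f g a b] assms Lip_bI unfolding Lip_b_def Lip_def by blast
qed

lemma Lip_b_const: "(\<lambda>_. c) \<in> Lip_b"
  by (rule Lip_bI[where L=0 and M="\<bar>c\<bar>"]) (auto simp: lipschitz_real_iff)

lemma Lip_b_min_max:
  fixes f :: "'a::metric_space \<Rightarrow> real"
  assumes "L-lipschitz_on UNIV f" shows "L-lipschitz_on UNIV (\<lambda>x. max a (min b (f x)))"
  unfolding lipschitz_real_iff
proof (intro conjI allI)
  fix x y
  have "\<bar>max a (min b (f x)) - max a (min b (f y))\<bar> \<le> \<bar>f x - f y\<bar>" by (auto simp: min_def max_def abs_if)
  also have "\<dots> \<le> L * dist x y" using assms by (simp add: lipschitz_real_iff)
  finally show "\<bar>max a (min b (f x)) - max a (min b (f y))\<bar> \<le> L * dist x y" .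
qed (rule lipschitz_on_nonneg[OF assms])

lemma Lip_b_integrable:
  assumes "finite_borel_measure \<mu>" "f \<in> Lip_b" shows "integrable \<mu> f"
proof -
  interpret finite_measure \<mu> using assms by (simp add: finite_borel_measure_def)
  obtain M where "\<And>x. \<bar>f x\<bar> \<le> M" using Lip_b_bound[OF assms(2)] by blast
  moreover have "f \<in> borel_measurable \<mu>"
    using Lip_measurable[OF Lip_b_subset_Lip[OF assms(2)]] finite_borel_measureD(2)[OF assms(1)]
    by (simp cong: measurable_cong_sets)
  ultimately show ?thesis by (intro integrable_const_bound[where B=M]) auto
qed

lemma closed_indicator_Lip_b_approx:
  fixes C :: "'a::metric_space set"
  assumes C: "closed C"
  obtains f :: "nat \<Rightarrow> 'a \<Rightarrow> real" where "\<And>n. f n \<in> Lip_b" "\<And>n x. 0 \<le> f n x" "\<And>n x. f n x \<le> 1"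
    "\<And>x. (\<lambda>n. f n x) \<longlonglongrightarrow> indicator C x"
proof (cases "C = {}")
  case True
  then show thesis by (intro that[of "\<lambda>_ _. 0"]) (auto intro: Lip_b_const)
next
  case False
  define f where "f n x = max 0 (min 1 (1 - real n * infdist x C))" for n x
  have "(real n)-lipschitz_on UNIV (\<lambda>x. 1 - real n * infdist x C)" for n
    unfolding lipschitz_real_iff
  proof (intro conjI allI)
    fix x y
    have "\<bar>infdist x C - infdist y C\<bar> \<le> dist x y"
      using infdist_triangle[of x C y] infdist_triangle[of y C x] by (auto simp: dist_commute)
    then have "real n * \<bar>infdist x C - infdist y C\<bar> \<le> real n * dist x y" by (rule mult_left_mono) simp
    moreover have "1 - real n * infdist x C - (1 - real n * infdist y C) = real n * (infdist y C - infdist x C)"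
      by (simp add: algebra_simps)
    ultimately show "\<bar>1 - real n * infdist x C - (1 - real n * infdist y C)\<bar> \<le> real n * dist x y"
      by (simp only: abs_mult abs_minus_commute abs_of_nat)
  qed simp
  then have "(real n)-lipschitz_on UNIV (f n)" for n unfolding f_def by (rule Lip_b_min_max)
  then have 1: "f n \<in> Lip_b" for n by (rule Lip_bI[where M=1]) (auto simp: f_def)
  have 2: "(\<lambda>n. f n x) \<longlonglongrightarrow> indicator C x" for x
  proof (cases "x \<in> C")
    case True
    then show ?thesis by (simp add: f_def)
  next
    case F: False
    then have p: "0 < infdist x C" using C False infdist_pos_not_in_closed by blast
    obtain n0 :: nat where n0: "1 / infdist x C < real n0" using reals_Archimedean2 by blast
    have "\<forall>\<^sub>F n in sequentially. f n x = 0"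
      using eventually_ge_at_top[of n0]
    proof eventually_elim
      case (elim n)
      have "1 < real n0 * infdist x C" using n0 p by (simp add: field_simps)
      also have "\<dots> \<le> real n * infdist x C" using elim p by (intro mult_right_mono) auto
      finally show ?case by (simp add: f_def)
    qed
    then show ?thesis using F by (simp add: tendsto_eventually)
  qed
  show thesis by (rule that[OF 1 _ _ 2]) (auto simp: f_def)
qed

lemma Int_stable_closed: "Int_stable (Collect closed :: 'a::topological_space set set)"
  by (auto simp: Int_stable_def)

lemma closed_subset_Pow: "Collect closed \<subseteq> Pow (UNIV :: 'a::topological_space set)"
  by simp

text \<open>The sets that admit approximation contain the closed sets and are stable under
  complements and countable disjoint unions, hence include all Borel sets. Currents can be tested
  with the approximants but not with indicators, which is why the approximation is needed.\<close>

lemma Lip_b_approx_indicator: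
  fixes \<mu> :: "'a::metric_space measure"
  assumes \<mu>: "finite_borel_measure \<mu>" and A: "A \<in> sets borel" and e: "0 < e"
  shows "\<exists>g\<in>Lip_b. (\<forall>x. 0 \<le> g x \<and> g x \<le> 1) \<and> (\<integral>x. \<bar>g x - indicator A x\<bar> \<partial>\<mu>) < e"
proof -
  interpret finite_measure \<mu> using \<mu> by (simp add: finite_borel_measure_def)
  note sb = finite_borel_measureD(2)[OF \<mu>] and spb = finite_borel_measureD(3)[OF \<mu>]
  have meas: "g \<in> borel_measurable \<mu>" if "g \<in> Lip_b" for g
    using Lip_measurable[OF Lip_b_subset_Lip[OF that]] sb by (simp cong: measurable_cong_sets)
  have int: "integrable \<mu> (\<lambda>x. \<bar>g x - indicator B x\<bar>)" if "g \<in> Lip_b" "B \<in> sets borel" for g :: "'a \<Rightarrow> real" and B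
    using Lip_b_integrable[OF \<mu> that(1)] that(2) sb
    by (intro integrable_abs Bochner_Integration.integrable_diff integrable_const_bound[of "indicator B" 1])
      (auto simp: indicator_def)
  have "A \<in> sigma_sets UNIV (Collect closed)"
    using A by (simp add: borel_eq_closed sets_measure_of)
  with Int_stable_closed closed_subset_Pow have "\<forall>e>0. \<exists>g\<in>Lip_b. (\<forall>x. 0 \<le> g x \<and> g x \<le> 1) \<and> (\<integral>x. \<bar>g x - indicator A x\<bar> \<partial>\<mu>) < e"
  proof (induction A rule: sigma_sets_induct_disjoint)
    case (basic C)
    then have C: "closed C" by simp
    obtain f :: "nat \<Rightarrow> 'a \<Rightarrow> real" where f: "\<And>n. f n \<in> Lip_b" "\<And>n x. 0 \<le> f n x" "\<And>n x. f n x \<le> 1"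
      "\<And>x. (\<lambda>n. f n x) \<longlonglongrightarrow> indicator C x" using closed_indicator_Lip_b_approx[OF C] by blast
    have Cs: "C \<in> sets \<mu>" using C sb by simp
    have "(\<lambda>n. \<integral>x. \<bar>f n x - indicator C x\<bar> \<partial>\<mu>) \<longlonglongrightarrow> (\<integral>x. \<bar>indicator C x - indicator C x :: real\<bar> \<partial>\<mu>)"
    proof (rule integral_dominated_convergence[where w="\<lambda>_. 1"])
      show "AE x in \<mu>. (\<lambda>n. \<bar>f n x - indicator C x\<bar>) \<longlonglongrightarrow> \<bar>indicator C x - indicator C x\<bar>"
        using f(4) by (intro AE_I2 tendsto_intros)
      show "AE x in \<mu>. norm \<bar>f n x - indicator C x\<bar> \<le> 1" for n
      proof (rule AE_I2)
        fix x
        have "0 \<le> f n x" "f n x \<le> 1" by (rule f)+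
        then show "norm \<bar>f n x - indicator C x\<bar> \<le> 1" by (cases "x \<in> C") auto
      qed
    qed (use meas[OF f(1)] Cs in auto)
    then have "(\<lambda>n. \<integral>x. \<bar>f n x - indicator C x\<bar> \<partial>\<mu>) \<longlonglongrightarrow> 0" by simp
    then have lim: "\<forall>\<^sub>F n in sequentially. (\<integral>x. \<bar>f n x - indicator C x\<bar> \<partial>\<mu>) < e" if "0 < e" for e
      using that by (rule order_tendstoD(2))
    show ?case
    proof (intro allI impI)
      fix e :: real assume "0 < e"
      from lim[OF this] obtain n where "(\<integral>x. \<bar>f n x - indicator C x\<bar> \<partial>\<mu>) < e"
        by (auto simp: eventually_sequentially)
      then show "\<exists>g\<in>Lip_b. (\<forall>x. 0 \<le> g x \<and> g x \<le> 1) \<and> (\<integral>x. \<bar>g x - indicator C x\<bar> \<partial>\<mu>) < e"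
        using f(1-3) by (intro bexI[of _ "f n"]) auto
    qed
  next
    case empty
    have "(\<lambda>_. 0) \<in> Lip_b" by (rule Lip_b_const)
    then show ?case
      by (intro allI impI bexI[of _ "\<lambda>_. 0"]) auto
  next
    case (compl B)
    then have B: "\<forall>e>0. \<exists>g\<in>Lip_b. (\<forall>x. 0 \<le> g x \<and> g x \<le> 1) \<and> (\<integral>x. \<bar>g x - indicator B x\<bar> \<partial>\<mu>) < e"
      by simp
    show ?case
    proof (intro allI impI)
      fix e :: real assume "0 < e"
      then obtain g where g: "g \<in> Lip_b" "\<forall>x. 0 \<le> g x \<and> g x \<le> 1" "(\<integral>x. \<bar>g x - indicator B x\<bar> \<partial>\<mu>) < e" using B by blast
      have "(\<lambda>x. 1 * 1 + (-1) * g x) \<in> Lip_b" by (intro Lip_b_comb Lip_b_const g)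
      moreover have "\<bar>(1 - g x) - indicator (UNIV - B) x\<bar> = \<bar>g x - indicator B x\<bar>" for x
        by (auto simp: indicator_def)
      ultimately show "\<exists>g\<in>Lip_b. (\<forall>x. 0 \<le> g x \<and> g x \<le> 1) \<and> (\<integral>x. \<bar>g x - indicator (UNIV - B) x\<bar> \<partial>\<mu>) < e"
        using g by (intro bexI[of _ "\<lambda>x. 1 - g x"]) auto
    qed
  next
    case (union F)
    then have Fs: "\<And>i. F i \<in> sigma_sets UNIV (Collect closed)"
      and IH: "\<And>i. \<forall>e>0. \<exists>g\<in>Lip_b. (\<forall>x. 0 \<le> g x \<and> g x \<le> 1) \<and> (\<integral>x. \<bar>g x - indicator (F i) x\<bar> \<partial>\<mu>) < e"
      by auto
    have Fb: "F i \<in> sets borel" for i using Fs by (simp add: borel_eq_closed sets_measure_of)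
    \<comment> \<open>Finite unions come first; what a long finite part leaves of the countable
      union has small measure.\<close>
    have fin: "\<forall>e>0. \<exists>g\<in>Lip_b. (\<forall>x. 0 \<le> g x \<and> g x \<le> 1) \<and> (\<integral>x. \<bar>g x - indicator (\<Union>i<n. F i) x\<bar> \<partial>\<mu>) < e" for n
    proof (induction n)
      case 0
      have "(\<lambda>_. 0) \<in> Lip_b" by (rule Lip_b_const)
      then show ?case by (intro allI impI bexI[of _ "\<lambda>_. 0"]) auto
    next
      case (Suc n)
      show ?case
      proof (intro allI impI)
        fix e :: real assume e: "0 < e"
        obtain g where g: "g \<in> Lip_b" "\<forall>x. 0 \<le> g x \<and> g x \<le> 1" "(\<integral>x. \<bar>g x - indicator (\<Union>i<n. F i) x\<bar> \<partial>\<mu>) < e / 2"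
          using Suc e by (meson half_gt_zero)
        obtain h where h: "h \<in> Lip_b" "\<forall>x. 0 \<le> h x \<and> h x \<le> 1" "(\<integral>x. \<bar>h x - indicator (F n) x\<bar> \<partial>\<mu>) < e / 2"
          using IH e by (meson half_gt_zero)
        \<comment> \<open>The Lipschitz counterpart of a union: it stays between 0 and 1, and its
          error is at most the sum of the two errors.\<close>
        define k where "k x = 1 - (1 - g x) * (1 - h x)" for x
        have kL: "k \<in> Lip_b"
        proof -
          have 1: "(\<lambda>x. 1 * 1 + (-1) * g x) \<in> Lip_b" "(\<lambda>x. 1 * 1 + (-1) * h x) \<in> Lip_b"
            by (intro Lip_b_comb Lip_b_const g h)+
          have "(\<lambda>x. 1 * 1 + (-1) * ((1 * 1 + (-1) * g x) * (1 * 1 + (-1) * h x))) \<in> Lip_b"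
            by (intro Lip_b_comb Lip_b_mult 1 Lip_b_const)
          then show ?thesis by (simp add: k_def[abs_def])
        qed
        have k01: "0 \<le> k x \<and> k x \<le> 1" for x
        proof -
          have gh: "0 \<le> g x" "g x \<le> 1" "0 \<le> h x" "h x \<le> 1" using g(2) h(2) by auto
          then have "0 \<le> (1 - g x) * (1 - h x)" "(1 - g x) * (1 - h x) \<le> 1"
            by (auto intro!: mult_nonneg_nonneg mult_le_one)
          then show ?thesis by (simp add: k_def)
        qed
        have "\<bar>k x - indicator (\<Union>i<Suc n. F i) x\<bar> \<le> \<bar>g x - indicator (\<Union>i<n. F i) x\<bar> + \<bar>h x - indicator (F n) x\<bar>" for x
        proof -
          let ?a = "indicator (\<Union>i<n. F i) x :: real" and ?b = "indicator (F n) x :: real"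
          have ab: "0 \<le> ?a" "?a \<le> 1" "0 \<le> ?b" "?b \<le> 1" by (auto simp: indicator_def)
          have "indicator (\<Union>i<Suc n. F i) x = 1 - (1 - ?a) * (1 - ?b)"
            by (auto simp: indicator_def less_Suc_eq)
          then have "k x - indicator (\<Union>i<Suc n. F i) x = (1 - ?a) * (h x - ?b) + (1 - h x) * (g x - ?a)"
            by (simp add: k_def algebra_simps)
          also have "\<bar>\<dots>\<bar> \<le> \<bar>1 - ?a\<bar> * \<bar>h x - ?b\<bar> + \<bar>1 - h x\<bar> * \<bar>g x - ?a\<bar>"
            by (metis abs_mult abs_triangle_ineq)
          also have "\<dots> \<le> 1 * \<bar>h x - ?b\<bar> + 1 * \<bar>g x - ?a\<bar>"
            using ab h(2) by (intro add_mono mult_right_mono) auto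
          finally show ?thesis by simp
        qed
        then have "(\<integral>x. \<bar>k x - indicator (\<Union>i<Suc n. F i) x\<bar> \<partial>\<mu>)
            \<le> (\<integral>x. \<bar>g x - indicator (\<Union>i<n. F i) x\<bar> + \<bar>h x - indicator (F n) x\<bar> \<partial>\<mu>)"
          using Fb by (intro integral_mono Bochner_Integration.integrable_add int kL g h) auto
        also have "\<dots> = (\<integral>x. \<bar>g x - indicator (\<Union>i<n. F i) x\<bar> \<partial>\<mu>) + (\<integral>x. \<bar>h x - indicator (F n) x\<bar> \<partial>\<mu>)"
          using Fb by (intro Bochner_Integration.integral_add int g h) auto
        finally show "\<exists>g\<in>Lip_b. (\<forall>x. 0 \<le> g x \<and> g x \<le> 1) \<and> (\<integral>x. \<bar>g x - indicator (\<Union>i<Suc n. F i) x\<bar> \<partial>\<mu>) < e"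
          using kL k01 g(3) h(3) by (intro bexI[of _ k]) auto
      qed
    qed
    show ?case
    proof (intro allI impI)
      fix e :: real assume e: "0 < e"
      let ?U = "\<Union>i. F i"
      have Ub: "?U \<in> sets borel" using Fb by auto
      have "(\<lambda>n. measure \<mu> (\<Union>i<n. F i)) \<longlonglongrightarrow> measure \<mu> (\<Union>n. \<Union>i<n. F i)"
        using Fb sb by (intro finite_Lim_measure_incseq) (auto simp: incseq_def, force)
      moreover have "(\<Union>n. \<Union>i<n. F i) = ?U" by auto
      ultimately have "(\<lambda>n. measure \<mu> (\<Union>i<n. F i)) \<longlonglongrightarrow> measure \<mu> ?U" by simp
      then have "\<forall>\<^sub>F n in sequentially. measure \<mu> ?U - e / 2 < measure \<mu> (\<Union>i<n. F i)"
        using e by (intro order_tendstoD) auto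
      then obtain n where n: "measure \<mu> ?U - e / 2 < measure \<mu> (\<Union>i<n. F i)" by (auto simp: eventually_sequentially)
      obtain g where g: "g \<in> Lip_b" "\<forall>x. 0 \<le> g x \<and> g x \<le> 1" "(\<integral>x. \<bar>g x - indicator (\<Union>i<n. F i) x\<bar> \<partial>\<mu>) < e / 2"
        using fin e by (meson half_gt_zero)
      let ?V = "\<Union>i<n. F i"
      have Vb: "?V \<in> sets borel" using Fb by auto
      have "(\<integral>x. \<bar>g x - indicator ?U x\<bar> \<partial>\<mu>) \<le> (\<integral>x. \<bar>g x - indicator ?V x\<bar> + indicator (?U - ?V) x \<partial>\<mu>)"
      proof (rule integral_mono)
        show "integrable \<mu> (\<lambda>x. \<bar>g x - indicator ?U x\<bar>)" by (rule int[OF g(1) Ub])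
        have "integrable \<mu> (indicator (?U - ?V) :: 'a \<Rightarrow> real)"
          by (rule integrable_const_bound[where B=1]) (use Ub Vb sb in auto)
        then show "integrable \<mu> (\<lambda>x. \<bar>g x - indicator ?V x\<bar> + indicator (?U - ?V) x)"
          using int[OF g(1) Vb] by (rule Bochner_Integration.integrable_add[rotated])
        fix x
        have "0 \<le> g x" "g x \<le> 1" using g(2) by auto
        then show "\<bar>g x - indicator ?U x\<bar> \<le> \<bar>g x - indicator ?V x\<bar> + indicator (?U - ?V) x"
          by (cases "x \<in> ?U"; cases "x \<in> ?V") auto
      qed
      also have "\<dots> = (\<integral>x. \<bar>g x - indicator ?V x\<bar> \<partial>\<mu>) + measure \<mu> (?U - ?V)"
      proof (subst Bochner_Integration.integral_add[OF int[OF g(1) Vb]])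
        show "integrable \<mu> (indicator (?U - ?V) :: 'a \<Rightarrow> real)"
          by (rule integrable_const_bound[where B=1]) (use Ub Vb sb in auto)
      qed (use spb in simp)
      also have "measure \<mu> (?U - ?V) = measure \<mu> ?U - measure \<mu> ?V"
        using Ub Vb sb by (intro finite_measure_Diff) auto
      finally show "\<exists>g\<in>Lip_b. (\<forall>x. 0 \<le> g x \<and> g x \<le> 1) \<and> (\<integral>x. \<bar>g x - indicator ?U x\<bar> \<partial>\<mu>) < e"
        using g n by (intro bexI[of _ g]) auto
    qed
  qed
  then show ?thesis using e by blast
qed

text \<open>Closed sets generate the Borel sets, and their indicators are bounded limits of
  functions in \<open>Lip_b\<close>; so the tests available for currents separate measures.\<close>

lemma finite_borel_measure_eqI:
  fixes \<mu> \<nu> :: "'a::metric_space measure"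
  assumes \<mu>: "finite_borel_measure \<mu>" and \<nu>: "finite_borel_measure \<nu>"
    and eq: "\<And>f. f \<in> Lip_b \<Longrightarrow> (\<And>x. 0 \<le> f x) \<Longrightarrow> (\<integral>x. f x \<partial>\<mu>) = (\<integral>x. f x \<partial>\<nu>)"
  shows "\<mu> = \<nu>"
proof (rule measure_eqI_generator_eq[where E="Collect closed" and \<Omega>=UNIV and A="\<lambda>_. UNIV"])
  show "Int_stable (Collect closed :: 'a set set)" by (auto simp: Int_stable_def)
  show "sets \<mu> = sigma_sets UNIV (Collect closed)" "sets \<nu> = sigma_sets UNIV (Collect closed)"
    using finite_borel_measureD(2)[OF \<mu>] finite_borel_measureD(2)[OF \<nu>]
    by (simp_all add: borel_eq_closed sets_measure_of)
  fix C :: "'a set" assume "C \<in> Collect closed"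
  then have C: "closed C" by simp
  obtain f :: "nat \<Rightarrow> 'a \<Rightarrow> real" where f: "\<And>n. f n \<in> Lip_b" "\<And>n x. 0 \<le> f n x" "\<And>n x. f n x \<le> 1"
    "\<And>x. (\<lambda>n. f n x) \<longlonglongrightarrow> indicator C x" using closed_indicator_Lip_b_approx[OF C] by blast
  have lim: "(\<lambda>n. \<integral>x. f n x \<partial>\<kappa>) \<longlonglongrightarrow> measure \<kappa> C" if \<kappa>: "finite_borel_measure \<kappa>" for \<kappa>
  proof -
    interpret finite_measure \<kappa> using \<kappa> by (simp add: finite_borel_measure_def)
    note sb = finite_borel_measureD(2,3)[OF \<kappa>]
    have "(\<lambda>n. \<integral>x. f n x \<partial>\<kappa>) \<longlonglongrightarrow> (\<integral>x. indicator C x \<partial>\<kappa>)"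
    proof (rule integral_dominated_convergence[where w="\<lambda>_. 1"])
      show "f n \<in> borel_measurable \<kappa>" for n by (rule borel_measurable_integrable[OF Lip_b_integrable[OF \<kappa> f(1)]])
      show "AE x in \<kappa>. norm (f n x) \<le> 1" for n using f(2,3)[of n] by simp
    next
      have "C \<in> sets \<kappa>" using C sb by simp
      then show "indicat_real C \<in> borel_measurable \<kappa>" by (rule borel_measurable_indicator)
    qed (use f(4) in auto)
    then show ?thesis using C sb by simp
  qed
  have "measure \<mu> C = measure \<nu> C"
    using LIMSEQ_unique[OF lim[OF \<mu>]] lim[OF \<nu>] eq[OF f(1,2)] by simp
  then show "emeasure \<mu> C = emeasure \<nu> C"
    using finite_borel_measureD(1)[OF \<mu>] finite_borel_measureD(1)[OF \<nu>]
    by (simp add: finite_measure.emeasure_eq_measure)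
next
  show "emeasure \<mu> UNIV \<noteq> \<infinity>" for i :: nat
    using finite_borel_measureD[OF \<mu>] finite_measure.emeasure_finite[of \<mu>] by simp
qed auto

section \<open>The mass measure of a current\<close>

lemma finite_borel_measure_add:
  assumes "finite_borel_measure \<mu>" "finite_borel_measure \<nu>"
  shows "finite_borel_measure (measure_add \<mu> \<nu>)"
proof (rule finite_borel_measureI)
  note D = finite_borel_measureD[OF assms(1)] finite_borel_measureD[OF assms(2)]
  show "sets (measure_add \<mu> \<nu>) = sets borel" using D by simp
  have "emeasure \<mu> UNIV < \<infinity>" "emeasure \<nu> UNIV < \<infinity>"
    using finite_measure.emeasure_finite[OF D(1)] finite_measure.emeasure_finite[OF D(4)]
    by (auto simp: less_top)
  then show "emeasure (measure_add \<mu> \<nu>) UNIV < \<infinity>"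
    using D by (subst emeasure_measure_add) auto
qed

lemma finite_borel_measure_density:
  assumes "finite_borel_measure \<mu>" "h \<in> borel_measurable borel" "\<And>x. h x \<le> 1"
  shows "finite_borel_measure (density \<mu> h)"
proof (rule finite_borel_measureI)
  note D = finite_borel_measureD[OF assms(1)]
  show "sets (density \<mu> h) = sets borel" using D by simp
  have h: "h \<in> borel_measurable \<mu>" using assms(2) D(2) by (simp cong: measurable_cong_sets)
  have "emeasure (density \<mu> h) UNIV = (\<integral>\<^sup>+x. h x * indicator UNIV x \<partial>\<mu>)"
    using D h by (intro emeasure_density) auto
  also have "\<dots> \<le> (\<integral>\<^sup>+x. 1 \<partial>\<mu>)" using assms(3) by (intro nn_integral_mono) auto
  also have "\<dots> = emeasure \<mu> UNIV" using D by simp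
  also have "\<dots> < \<infinity>" using finite_measure.emeasure_finite[OF D(1)] D(3) by (simp add: less_top)
  finally show "emeasure (density \<mu> h) UNIV < \<infinity>" .
qed

text \<open>Each inequality that a Lipschitz constant satisfies is closed in the constant, so it
  survives the infimum.\<close>

lemma lip_const_props:
  assumes "f \<in> Lip"
  shows "0 \<le> lip_const f" "(lip_const f)-lipschitz_on UNIV f"
proof -
  let ?S = "{L. L-lipschitz_on UNIV f}"
  have ne: "?S \<noteq> {}" using assms by (auto simp: Lip_def)
  show 0: "0 \<le> lip_const f"
    unfolding lip_const_def using ne by (intro cInf_greatest) (auto dest: lipschitz_on_nonneg)
  show "(lip_const f)-lipschitz_on UNIV f"
    unfolding lipschitz_real_iff
  proof (intro conjI 0 allI)
    fix x y
    show "\<bar>f x - f y\<bar> \<le> lip_const f * dist x y"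
    proof (cases "x = y")
      case False
      then have d: "0 < dist x y" by simp
      have "\<bar>f x - f y\<bar> / dist x y \<le> lip_const f"
        unfolding lip_const_def
        by (rule cInf_greatest[OF ne]) (use d in \<open>auto simp: lipschitz_real_iff divide_le_eq\<close>)
      then show ?thesis using d by (simp add: divide_le_eq)
    qed simp
  qed
qed

lemma lip_const_le: "L-lipschitz_on UNIV f \<Longrightarrow> lip_const f \<le> L"
  unfolding lip_const_def by (rule cInf_lower) (auto intro!: bdd_belowI[of _ 0] dest: lipschitz_on_nonneg)

lemma Lip_b_nn_integral_abs:
  assumes "finite_borel_measure \<mu>" "f \<in> Lip_b"
  shows "(\<integral>\<^sup>+x. ennreal \<bar>f x\<bar> \<partial>\<mu>) = ennreal (\<integral>x. \<bar>f x\<bar> \<partial>\<mu>)"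
  using Lip_b_integrable[OF assms] by (intro nn_integral_eq_integral) auto

definition form_const :: "nat \<Rightarrow> ('a::metric_space \<Rightarrow> real) list \<Rightarrow> real" where
  "form_const k \<pi> = (\<Prod>i<k. lip_const (\<pi> ! i))"

lemma form_const_nonneg: "(f, \<pi>) \<in> D k \<Longrightarrow> 0 \<le> form_const k \<pi>"
  unfolding form_const_def by (intro prod_nonneg ballI lip_const_props) (auto simp: D_def)

lemma form_const_1: "form_const 1 [\<pi>] = lip_const \<pi>"
  by (simp add: form_const_def)

text \<open>Nonnegative extended integrals can be added, restricted and given densities without
  integrability conditions, which the constructions of new mass bounds below exploit.\<close>

lemma mass_bound_iff:
  "mass_bound k T \<mu> \<longleftrightarrow> finite_borel_measure \<mu> \<and>
     (\<forall>f \<pi>. (f, \<pi>) \<in> D k \<longrightarrow> ennreal \<bar>T (f, \<pi>)\<bar> \<le> ennreal (form_const k \<pi>) * (\<integral>\<^sup>+x. ennreal \<bar>f x\<bar> \<partial>\<mu>))"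
proof (cases "finite_borel_measure \<mu>")
  case True
  have "ennreal \<bar>T (f, \<pi>)\<bar> \<le> ennreal (form_const k \<pi>) * (\<integral>\<^sup>+x. ennreal \<bar>f x\<bar> \<partial>\<mu>) \<longleftrightarrow>
     \<bar>T (f, \<pi>)\<bar> \<le> form_const k \<pi> * (\<integral>x. \<bar>f x\<bar> \<partial>\<mu>)" if d: "(f, \<pi>) \<in> D k" for f \<pi>
  proof -
    have f: "f \<in> Lip_b" using d by (simp add: D_def)
    have "0 \<le> (\<integral>x. \<bar>f x\<bar> \<partial>\<mu>)" by simp
    then show ?thesis
      using form_const_nonneg[OF d]
      by (simp add: Lip_b_nn_integral_abs[OF True f] ennreal_mult[symmetric] ennreal_le_iff)
  qed
  then show ?thesis using True by (simp add: mass_bound_def form_const_def)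
qed (simp add: mass_bound_def)

text \<open>Split \<open>f = f g + f (1 - g)\<close> with a Lipschitz \<open>g\<close> close to the
  indicator of \<open>A\<close> in the mean with respect to \<open>\<mu> + \<nu>\<close>. Linearity
  in the first argument lets \<open>\<mu>\<close> bound the first part and \<open>\<nu>\<close> the
  second. All further work on the least mass bound rests on this.\<close>

lemma mass_bound_glue:
  fixes \<mu> \<nu> :: "'a::metric_space measure" and T :: "'a form_functional"
  assumes lin: "multilinear_on_forms k T" and \<mu>: "mass_bound k T \<mu>" and \<nu>: "mass_bound k T \<nu>"
    and A: "A \<in> sets borel"
  shows "mass_bound k T (measure_add (density \<mu> (indicator A)) (density \<nu> (indicator (- A))))"
  unfolding mass_bound_iff
proof (intro conjI allI impI)
  have F\<mu>: "finite_borel_measure \<mu>" and F\<nu>: "finite_borel_measure \<nu>"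
    using \<mu> \<nu> by (auto simp: mass_bound_def)
  note D\<mu> = finite_borel_measureD[OF F\<mu>] and D\<nu> = finite_borel_measureD[OF F\<nu>]
  let ?\<rho> = "measure_add (density \<mu> (indicator A)) (density \<nu> (indicator (- A)))"
  let ?\<kappa> = "measure_add \<mu> \<nu>"
  show F\<rho>: "finite_borel_measure ?\<rho>"
    using A by (intro finite_borel_measure_add finite_borel_measure_density F\<mu> F\<nu>) (auto simp: indicator_def)
  have F\<kappa>: "finite_borel_measure ?\<kappa>" by (intro finite_borel_measure_add F\<mu> F\<nu>)
  fix f :: "'a \<Rightarrow> real" and \<pi> assume d: "(f, \<pi>) \<in> D k"
  then have f: "f \<in> Lip_b" by (simp add: D_def)
  obtain M where M: "0 \<le> M" "\<And>x. \<bar>f x\<bar> \<le> M" using Lip_b_bound[OF f] by blast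
  let ?c = "form_const k \<pi>"
  have c: "0 \<le> ?c" using form_const_nonneg[OF d] .
  have fm [measurable]: "f \<in> borel_measurable borel" by (rule Lip_measurable[OF Lip_b_subset_Lip[OF f]])
  have sA [measurable]: "A \<in> sets \<mu>" "- A \<in> sets \<nu>" "A \<in> sets borel" using A D\<mu> D\<nu> by auto
  have m\<mu>: "h \<in> borel_measurable \<mu>" and m\<nu>: "h \<in> borel_measurable \<nu>"
    if "h \<in> borel_measurable borel" for h :: "'a \<Rightarrow> ennreal"
    using that D\<mu>(2) D\<nu>(2) by (simp_all cong: measurable_cong_sets)
  have \<rho>int: "(\<integral>\<^sup>+x. ennreal \<bar>f x\<bar> \<partial>?\<rho>)
     = (\<integral>\<^sup>+x. indicator A x * ennreal \<bar>f x\<bar> \<partial>\<mu>) + (\<integral>\<^sup>+x. indicator (- A) x * ennreal \<bar>f x\<bar> \<partial>\<nu>)"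
    using D\<mu>(2) D\<nu>(2)
    by (subst nn_integral_measure_add) (auto simp: nn_integral_density m\<mu> m\<nu> cong: measurable_cong_sets)
  show "ennreal \<bar>T (f, \<pi>)\<bar> \<le> ennreal ?c * (\<integral>\<^sup>+x. ennreal \<bar>f x\<bar> \<partial>?\<rho>)"
  proof (rule ennreal_le_epsilon)
    fix e :: real assume e: "0 < e"
    \<comment> \<open>The approximation error enters multiplied by \<open>?c * M\<close>; the added
      1 keeps the divisor positive.\<close>
    define e' where "e' = e / (?c * M + 1)"
    have cM: "0 \<le> ?c * M" using c M by simp
    have e': "0 < e'" "?c * M * e' \<le> e" using e cM by (auto simp: e'_def field_simps)
    obtain g where g: "g \<in> Lip_b" "\<forall>x. 0 \<le> g x \<and> g x \<le> 1" "(\<integral>x. \<bar>g x - indicator A x\<bar> \<partial>?\<kappa>) < e'"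
      using Lip_b_approx_indicator[OF F\<kappa> A e'(1)] by blast
    have gm [measurable]: "g \<in> borel_measurable borel" by (rule Lip_measurable[OF Lip_b_subset_Lip[OF g(1)]])
    define g1 where "g1 x = 1 - g x" for x
    have g1: "g1 \<in> Lip_b" using Lip_b_comb[OF Lip_b_const[of 1] g(1), of 1 "-1"] by (simp add: g1_def[abs_def])
    have fg: "(\<lambda>x. f x * g x, \<pi>) \<in> D k" "(\<lambda>x. f x * g1 x, \<pi>) \<in> D k"
      using d Lip_b_mult[OF f g(1)] Lip_b_mult[OF f g1] by (auto simp: D_def)
    have eq: "(\<lambda>x. f x * g x + f x * g1 x) = f" by (auto simp: g1_def algebra_simps)
    have "T (\<lambda>x. 1 * (f x * g x) + 1 * (f x * g1 x), \<pi>) = 1 * T (\<lambda>x. f x * g x, \<pi>) + 1 * T (\<lambda>x. f x * g1 x, \<pi>)"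
      using lin fg unfolding multilinear_on_forms_def by blast
    then have "T (f, \<pi>) = T (\<lambda>x. f x * g x, \<pi>) + T (\<lambda>x. f x * g1 x, \<pi>)"
      unfolding mult_1 eq .
    then have "ennreal \<bar>T (f, \<pi>)\<bar> \<le> ennreal (\<bar>T (\<lambda>x. f x * g x, \<pi>)\<bar> + \<bar>T (\<lambda>x. f x * g1 x, \<pi>)\<bar>)"
      by (intro ennreal_leI) simp
    also have "\<dots> = ennreal \<bar>T (\<lambda>x. f x * g x, \<pi>)\<bar> + ennreal \<bar>T (\<lambda>x. f x * g1 x, \<pi>)\<bar>" by simp
    also have "\<dots> \<le> ennreal ?c * (\<integral>\<^sup>+x. ennreal \<bar>f x * g x\<bar> \<partial>\<mu>) + ennreal ?c * (\<integral>\<^sup>+x. ennreal \<bar>f x * g1 x\<bar> \<partial>\<nu>)"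
      using \<mu> \<nu> fg unfolding mass_bound_iff by (intro add_mono) blast+
    also have "\<dots> \<le> ennreal ?c * ((\<integral>\<^sup>+x. indicator A x * ennreal \<bar>f x\<bar> \<partial>\<mu>) + (\<integral>\<^sup>+x. ennreal M * ennreal \<bar>g x - indicator A x\<bar> \<partial>\<mu>))
      + ennreal ?c * ((\<integral>\<^sup>+x. indicator (- A) x * ennreal \<bar>f x\<bar> \<partial>\<nu>) + (\<integral>\<^sup>+x. ennreal M * ennreal \<bar>g x - indicator A x\<bar> \<partial>\<nu>))"
    proof (intro add_mono mult_left_mono)
      have b: "\<bar>f x * g x\<bar> \<le> indicator A x * \<bar>f x\<bar> + M * \<bar>g x - indicator A x\<bar>"
        "\<bar>f x * g1 x\<bar> \<le> indicator (- A) x * \<bar>f x\<bar> + M * \<bar>g x - indicator A x\<bar>" for x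
      proof -
        have gx: "0 \<le> g x" "g x \<le> 1" using g(2) by auto
        have *: "\<bar>f x\<bar> * u \<le> M * u" if "0 \<le> u" for u using M that by (intro mult_right_mono) auto
        have "\<bar>f x\<bar> * g x \<le> \<bar>f x\<bar> * 1" "\<bar>f x\<bar> * (1 - g x) \<le> \<bar>f x\<bar> * 1"
          using gx by (intro mult_left_mono; simp)+
        moreover have "0 \<le> M * (1 - g x)" "0 \<le> M * g x" using M gx by auto
        ultimately show "\<bar>f x * g x\<bar> \<le> indicator A x * \<bar>f x\<bar> + M * \<bar>g x - indicator A x\<bar>"
          "\<bar>f x * g1 x\<bar> \<le> indicator (- A) x * \<bar>f x\<bar> + M * \<bar>g x - indicator A x\<bar>"
          using *[of "g x"] *[of "1 - g x"] gx by (auto simp: indicator_def abs_mult g1_def)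
      qed
      have e2: "ennreal (indicator B x * \<bar>f x\<bar> + M * \<bar>g x - indicator A x\<bar>)
        = indicator B x * ennreal \<bar>f x\<bar> + ennreal M * ennreal \<bar>g x - indicator A x\<bar>" for B x
        using M by (simp add: ennreal_mult indicator_def)
      have "(\<integral>\<^sup>+x. ennreal \<bar>f x * g x\<bar> \<partial>\<mu>) \<le> (\<integral>\<^sup>+x. indicator A x * ennreal \<bar>f x\<bar> + ennreal M * ennreal \<bar>g x - indicator A x\<bar> \<partial>\<mu>)"
        unfolding e2[symmetric] using b(1) by (intro nn_integral_mono ennreal_leI)
      also have "\<dots> = (\<integral>\<^sup>+x. indicator A x * ennreal \<bar>f x\<bar> \<partial>\<mu>) + (\<integral>\<^sup>+x. ennreal M * ennreal \<bar>g x - indicator A x\<bar> \<partial>\<mu>)"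
        by (intro nn_integral_add m\<mu>) measurable
      finally show "(\<integral>\<^sup>+x. ennreal \<bar>f x * g x\<bar> \<partial>\<mu>)
        \<le> (\<integral>\<^sup>+x. indicator A x * ennreal \<bar>f x\<bar> \<partial>\<mu>) + (\<integral>\<^sup>+x. ennreal M * ennreal \<bar>g x - indicator A x\<bar> \<partial>\<mu>)" .
      have "(\<integral>\<^sup>+x. ennreal \<bar>f x * g1 x\<bar> \<partial>\<nu>) \<le> (\<integral>\<^sup>+x. indicator (- A) x * ennreal \<bar>f x\<bar> + ennreal M * ennreal \<bar>g x - indicator A x\<bar> \<partial>\<nu>)"
        unfolding e2[symmetric] using b(2) by (intro nn_integral_mono ennreal_leI)
      also have "\<dots> = (\<integral>\<^sup>+x. indicator (- A) x * ennreal \<bar>f x\<bar> \<partial>\<nu>) + (\<integral>\<^sup>+x. ennreal M * ennreal \<bar>g x - indicator A x\<bar> \<partial>\<nu>)"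
        by (intro nn_integral_add m\<nu>) measurable
      finally show "(\<integral>\<^sup>+x. ennreal \<bar>f x * g1 x\<bar> \<partial>\<nu>)
        \<le> (\<integral>\<^sup>+x. indicator (- A) x * ennreal \<bar>f x\<bar> \<partial>\<nu>) + (\<integral>\<^sup>+x. ennreal M * ennreal \<bar>g x - indicator A x\<bar> \<partial>\<nu>)" .
    qed auto
    also have "\<dots> = ennreal ?c * (\<integral>\<^sup>+x. ennreal \<bar>f x\<bar> \<partial>?\<rho>) + ennreal ?c * (\<integral>\<^sup>+x. ennreal M * ennreal \<bar>g x - indicator A x\<bar> \<partial>?\<kappa>)"
      unfolding \<rho>int using D\<mu>(2) D\<nu>(2)
      by (subst nn_integral_measure_add) (auto simp: m\<mu> distrib_left ac_simps)
    also have "(\<integral>\<^sup>+x. ennreal M * ennreal \<bar>g x - indicator A x\<bar> \<partial>?\<kappa>) = ennreal M * (\<integral>\<^sup>+x. ennreal \<bar>g x - indicator A x\<bar> \<partial>?\<kappa>)"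
      using D\<mu>(2) by (intro nn_integral_cmult) (auto cong: measurable_cong_sets)
    also have "(\<integral>\<^sup>+x. ennreal \<bar>g x - indicator A x\<bar> \<partial>?\<kappa>) = ennreal (\<integral>x. \<bar>g x - indicator A x\<bar> \<partial>?\<kappa>)"
    proof (rule nn_integral_eq_integral)
      interpret \<kappa>: finite_measure ?\<kappa> using F\<kappa> by (simp add: finite_borel_measure_def)
      show "integrable ?\<kappa> (\<lambda>x. \<bar>g x - indicator A x\<bar>)"
      proof (rule \<kappa>.integrable_const_bound[where B=1])
        show "AE x in ?\<kappa>. norm \<bar>g x - indicator A x\<bar> \<le> 1"
        proof (rule AE_I2)
          fix x
          have "0 \<le> g x" "g x \<le> 1" using g(2) by auto
          then show "norm \<bar>g x - indicator A x\<bar> \<le> 1" by (cases "x \<in> A") auto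
        qed
        show "(\<lambda>x. \<bar>g x - indicator A x\<bar>) \<in> borel_measurable ?\<kappa>"
          using finite_borel_measureD(2)[OF F\<kappa>] by (simp cong: measurable_cong_sets)
      qed
    qed simp
    also have "ennreal ?c * (ennreal M * ennreal (\<integral>x. \<bar>g x - indicator A x\<bar> \<partial>?\<kappa>)) \<le> ennreal e"
    proof -
      have "?c * M * (\<integral>x. \<bar>g x - indicator A x\<bar> \<partial>?\<kappa>) \<le> ?c * M * e'"
        using g(3) cM by (intro mult_left_mono) auto
      then show ?thesis using e'(2) c M by (simp add: ennreal_mult[symmetric] mult.assoc ennreal_leI)
    qed
    finally show "ennreal \<bar>T (f, \<pi>)\<bar> \<le> ennreal ?c * (\<integral>\<^sup>+x. ennreal \<bar>f x\<bar> \<partial>?\<rho>) + ennreal e"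
      by (simp add: add_left_mono)
  qed
qed

lemma emeasure_glue:
  assumes "finite_borel_measure \<mu>" "finite_borel_measure \<nu>" "A \<in> sets borel" "B \<in> sets borel"
  shows "emeasure (measure_add (density \<mu> (indicator A)) (density \<nu> (indicator (- A)))) B
    = emeasure \<mu> (A \<inter> B) + emeasure \<nu> (B - A)"
proof -
  note D = finite_borel_measureD[OF assms(1)] finite_borel_measureD[OF assms(2)]
  have "emeasure (density \<mu> (indicator A)) B = emeasure \<mu> (A \<inter> B)"
    "emeasure (density \<nu> (indicator (- A))) B = emeasure \<nu> ((- A) \<inter> B)"
    using assms(3,4) D by (auto intro!: emeasure_restricted)
  then show ?thesis using assms D by (subst emeasure_measure_add) (auto simp: Int_commute Diff_eq)
qed

text \<open>A Hahn decomposition glues together whichever of \<open>\<mu>\<close> and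
  \<open>\<nu>\<close> is smaller. The result is absolutely continuous with respect to
  \<open>\<mu>\<close>, so competitors can be taken as densities over one fixed measure, and infima
  of measures become infima of functions.\<close>

lemma mass_bound_dominated:
  fixes \<mu> \<nu> :: "'a::metric_space measure" and T :: "'a form_functional"
  assumes lin: "multilinear_on_forms k T" and \<mu>: "mass_bound k T \<mu>" and \<nu>: "mass_bound k T \<nu>"
  shows "\<exists>h\<in>borel_measurable borel. mass_bound k T (density \<mu> h) \<and>
    emeasure (density \<mu> h) UNIV \<le> emeasure \<nu> UNIV"
proof -
  have F\<mu>: "finite_borel_measure \<mu>" and F\<nu>: "finite_borel_measure \<nu>"
    using \<mu> \<nu> by (auto simp: mass_bound_def)
  note D\<mu> = finite_borel_measureD[OF F\<mu>] and D\<nu> = finite_borel_measureD[OF F\<nu>]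
  interpret \<mu>: finite_measure \<mu> by (rule D\<mu>)
  obtain Y where Y: "Y \<in> sets \<mu>" "\<And>X. X \<in> sets \<mu> \<Longrightarrow> X \<subseteq> Y \<Longrightarrow> emeasure \<nu> X \<le> emeasure \<mu> X"
    "\<And>X. X \<in> sets \<mu> \<Longrightarrow> X \<inter> Y = {} \<Longrightarrow> emeasure \<mu> X \<le> emeasure \<nu> X"
    using finite_unsigned_Hahn_decomposition[OF D\<mu>(1) D\<nu>(1)] D\<mu>(2) D\<nu>(2) by auto
  have Yb: "Y \<in> sets borel" using Y(1) D\<mu>(2) by simp
  let ?\<rho> = "measure_add (density \<nu> (indicator Y)) (density \<mu> (indicator (- Y)))"
  have s\<rho>: "sets ?\<rho> = sets \<mu>" using D\<mu>(2) D\<nu>(2) by simp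
  have \<rho>\<mu>: "emeasure ?\<rho> B \<le> emeasure \<mu> B" if "B \<in> sets borel" for B
  proof -
    have "emeasure ?\<rho> B = emeasure \<nu> (Y \<inter> B) + emeasure \<mu> (B - Y)" by (rule emeasure_glue[OF F\<nu> F\<mu> Yb that])
    also have "\<dots> \<le> emeasure \<mu> (Y \<inter> B) + emeasure \<mu> (B - Y)"
      using Yb that D\<mu>(2) by (intro add_right_mono Y(2)) auto
    also have "\<dots> = emeasure \<mu> ((Y \<inter> B) \<union> (B - Y))"
      using Yb that D\<mu>(2) by (intro plus_emeasure) auto
    also have "(Y \<inter> B) \<union> (B - Y) = B" by auto
    finally show ?thesis .
  qed
  have \<rho>\<nu>: "emeasure ?\<rho> UNIV \<le> emeasure \<nu> UNIV"
  proof -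
    have "emeasure ?\<rho> UNIV = emeasure \<nu> (Y \<inter> UNIV) + emeasure \<mu> (UNIV - Y)" by (rule emeasure_glue[OF F\<nu> F\<mu> Yb]) simp
    also have "\<dots> \<le> emeasure \<nu> Y + emeasure \<nu> (UNIV - Y)"
      using Yb D\<mu>(2) by (intro add_mono Y(3)) auto
    also have "\<dots> = emeasure \<nu> (Y \<union> (UNIV - Y))"
      using Yb D\<nu>(2) by (intro plus_emeasure) auto
    finally show ?thesis by simp
  qed
  have "absolutely_continuous \<mu> ?\<rho>"
    unfolding absolutely_continuous_def
  proof
    fix N assume N: "N \<in> null_sets \<mu>"
    then have "N \<in> sets borel" using D\<mu>(2) by auto
    from \<rho>\<mu>[OF this] N s\<rho> show "N \<in> null_sets ?\<rho>" by (auto simp: null_sets_def)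
  qed
  then obtain h where "h \<in> borel_measurable \<mu>" "density \<mu> h = ?\<rho>"
    using \<mu>.Radon_Nikodym s\<rho> by blast
  moreover have "mass_bound k T ?\<rho>" by (rule mass_bound_glue[OF lin \<nu> \<mu> Yb])
  ultimately show ?thesis using \<rho>\<nu> D\<mu>(2) by (auto cong: measurable_cong_sets intro!: bexI[of _ h])
qed

text \<open>Gluing along the Borel set where \<open>h1 \<le> h2\<close> selects the smaller density
  pointwise.\<close>

lemma mass_bound_density_min:
  fixes \<mu> :: "'a::metric_space measure" and T :: "'a form_functional"
  assumes lin: "multilinear_on_forms k T"
    and [measurable]: "h1 \<in> borel_measurable borel" "h2 \<in> borel_measurable borel" and s: "sets \<mu> = sets borel"
    and 1: "mass_bound k T (density \<mu> h1)" and 2: "mass_bound k T (density \<mu> h2)"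
  shows "mass_bound k T (density \<mu> (\<lambda>x. min (h1 x) (h2 x)))"
proof -
  let ?A = "{x. h1 x \<le> h2 x}"
  have A: "?A \<in> sets borel" by measurable
  note s[measurable_cong]
  have "density \<mu> (\<lambda>x. min (h1 x) (h2 x)) =
    measure_add (density (density \<mu> h1) (indicator ?A)) (density (density \<mu> h2) (indicator (- ?A)))" (is "?L = ?R")
  proof (rule measure_eqI)
    fix B assume "B \<in> sets ?L"
    then have B[measurable]: "B \<in> sets borel" using s by simp
    have A'[measurable]: "?A \<in> sets \<mu>" "B \<in> sets \<mu>" using A B s by auto
    have "emeasure ?R B = emeasure (density \<mu> h1) (?A \<inter> B) + emeasure (density \<mu> h2) (B - ?A)"
      using 1 2 by (intro emeasure_glue A B) (auto simp: mass_bound_def)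
    also have "\<dots> = (\<integral>\<^sup>+x. h1 x * indicator (?A \<inter> B) x \<partial>\<mu>) + (\<integral>\<^sup>+x. h2 x * indicator (B - ?A) x \<partial>\<mu>)"
      by (subst (1 2) emeasure_density) (auto simp: s)
    also have "\<dots> = (\<integral>\<^sup>+x. h1 x * indicator (?A \<inter> B) x + h2 x * indicator (B - ?A) x \<partial>\<mu>)"
      by (rule nn_integral_add[symmetric]) measurable
    also have "\<dots> = (\<integral>\<^sup>+x. min (h1 x) (h2 x) * indicator B x \<partial>\<mu>)"
      by (intro nn_integral_cong) (auto simp: indicator_def min_def)
    also have "\<dots> = emeasure ?L B" by (subst emeasure_density) (auto simp: s)
    finally show "emeasure ?L B = emeasure ?R B" by simp
  qed simp
  then show ?thesis using mass_bound_glue[OF lin 1 2 A] by simp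
qed

lemma INF_mult_const_ennreal:
  fixes f :: "nat \<Rightarrow> ennreal"
  assumes f: "decseq f" and c: "c < top"
  shows "(INF n. c * f n) = c * (INF n. f n)"
proof (rule LIMSEQ_unique)
  have "decseq (\<lambda>n. c * f n)" using f by (auto simp: decseq_def intro!: mult_left_mono)
  then show "(\<lambda>n. c * f n) \<longlonglongrightarrow> (INF n. c * f n)" by (rule LIMSEQ_INF)
  show "(\<lambda>n. c * f n) \<longlonglongrightarrow> c * (INF n. f n)"
    by (intro ennreal_tendsto_cmult c LIMSEQ_INF f)
qed

text \<open>A minimising sequence of total masses is replaced by densities and then by running
  minima, which decrease to \<open>G\<close>. Monotone convergence from above carries each
  inequality of the mass bound to the limit, the coefficient of the form being finite.\<close>

lemma mass_bound_minimal_total: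
  fixes T :: "'a::metric_space form_functional"
  assumes lin: "multilinear_on_forms k T" and \<mu>: "mass_bound k T \<mu>"
  shows "\<exists>\<rho>. mass_bound k T \<rho> \<and> (\<forall>\<nu>. mass_bound k T \<nu> \<longrightarrow> emeasure \<rho> UNIV \<le> emeasure \<nu> UNIV)"
proof -
  let ?S = "{\<nu>. mass_bound k T \<nu>}"
  have F\<mu>: "finite_borel_measure \<mu>" using \<mu> by (simp add: mass_bound_def)
  note D\<mu> = finite_borel_measureD[OF F\<mu>]
  note s[measurable_cong] = D\<mu>(2)
  have "(\<lambda>\<nu>. emeasure \<nu> UNIV) ` ?S \<noteq> {}" using \<mu> by blast
  from ennreal_Inf_countable_INF[OF this]
  obtain u :: "nat \<Rightarrow> ennreal" where "decseq u \<and> range u \<subseteq> (\<lambda>\<nu>. emeasure \<nu> UNIV) ` ?S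
    \<and> (INF \<nu>\<in>?S. emeasure \<nu> UNIV) = (INF n. u n)" ..
  then have u: "range u \<subseteq> (\<lambda>\<nu>. emeasure \<nu> UNIV) ` ?S" "(INF \<nu>\<in>?S. emeasure \<nu> UNIV) = (INF n. u n)"
    by blast+
  have "\<forall>n. \<exists>\<nu>. mass_bound k T \<nu> \<and> u n = emeasure \<nu> UNIV"
  proof
    fix n
    have "u n \<in> (\<lambda>\<nu>. emeasure \<nu> UNIV) ` ?S" using u(1) by blast
    then show "\<exists>\<nu>. mass_bound k T \<nu> \<and> u n = emeasure \<nu> UNIV" by blast
  qed
  then obtain \<nu> where \<nu>: "\<And>n. mass_bound k T (\<nu> n)" "\<And>n. u n = emeasure (\<nu> n) UNIV" by metis
  have "\<forall>n. \<exists>h\<in>borel_measurable borel. mass_bound k T (density \<mu> h) \<and> emeasure (density \<mu> h) UNIV \<le> u n"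
    using mass_bound_dominated[OF lin \<mu> \<nu>(1)] \<nu>(2) by simp
  then obtain h where h[measurable]: "\<And>n. h n \<in> borel_measurable borel" and hb: "\<And>n. mass_bound k T (density \<mu> (h n))"
    and hu: "\<And>n. emeasure (density \<mu> (h n)) UNIV \<le> u n" by metis
  \<comment> \<open>Running minima make the sequence monotone without raising the total
    masses.\<close>
  define H where "H = rec_nat (h 0) (\<lambda>n g x. min (g x) (h (Suc n) x))"
  have H0: "H 0 = h 0" and HS: "H (Suc n) = (\<lambda>x. min (H n x) (h (Suc n) x))" for n
    by (auto simp: H_def)
  have Hm[measurable]: "H n \<in> borel_measurable borel" for n
    by (induction n) (auto simp: H0 HS)
  have Hb: "mass_bound k T (density \<mu> (H n))" for n
    by (induction n) (auto simp: H0 HS hb intro!: mass_bound_density_min[OF lin] s)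
  have Hh: "H n x \<le> h n x" for n x by (cases n) (auto simp: H0 HS)
  have dec: "decseq H" by (rule decseq_SucI) (auto simp: HS le_fun_def)
  define G where "G x = (INF n. H n x)" for x
  have Gm[measurable]: "G \<in> borel_measurable borel" unfolding G_def by measurable
  have GH: "G x \<le> H n x" for n x unfolding G_def by (rule INF_lower) simp
  have tot: "emeasure (density \<mu> g) UNIV = (\<integral>\<^sup>+x. g x \<partial>\<mu>)" if "g \<in> borel_measurable borel" for g :: "'a \<Rightarrow> ennreal"
    using that by (subst emeasure_density) (auto simp: s cong: measurable_cong_sets)
  have Gu: "emeasure (density \<mu> G) UNIV \<le> u n" for n
  proof -
    have "emeasure (density \<mu> G) UNIV \<le> emeasure (density \<mu> (h n)) UNIV"
      unfolding tot[OF Gm] tot[OF h] by (intro nn_integral_mono order_trans[OF GH Hh])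
    then show ?thesis using hu by (rule order_trans)
  qed
  have fin: "emeasure (density \<mu> (H n)) UNIV < \<infinity>" for n
  proof -
    have "finite_borel_measure (density \<mu> (H n))" using Hb by (simp add: mass_bound_def)
    from finite_borel_measureD[OF this] show ?thesis using finite_measure.emeasure_finite[of "density \<mu> (H n)"] by (simp add: less_top)
  qed
  have "mass_bound k T (density \<mu> G)"
    unfolding mass_bound_iff
  proof (intro conjI allI impI)
    show "finite_borel_measure (density \<mu> G)"
    proof (rule finite_borel_measureI)
      have "emeasure (density \<mu> G) UNIV \<le> emeasure (density \<mu> (H 0)) UNIV"
        unfolding tot[OF Gm] tot[OF Hm] by (intro nn_integral_mono GH)
      then show "emeasure (density \<mu> G) UNIV < \<infinity>" using fin[of 0] by (rule le_less_trans)
    qed (simp add: s)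
    fix f :: "'a \<Rightarrow> real" and \<pi> assume d: "(f, \<pi>) \<in> D k"
    then have f: "f \<in> Lip_b" by (simp add: D_def)
    obtain M where M: "0 \<le> M" "\<And>x. \<bar>f x\<bar> \<le> M" using Lip_b_bound[OF f] by blast
    have fm [measurable]: "f \<in> borel_measurable borel" by (rule Lip_measurable[OF Lip_b_subset_Lip[OF f]])
    have den: "(\<integral>\<^sup>+x. ennreal \<bar>f x\<bar> \<partial>density \<mu> g) = (\<integral>\<^sup>+x. g x * ennreal \<bar>f x\<bar> \<partial>\<mu>)"
      if "g \<in> borel_measurable borel" for g
      using that by (intro nn_integral_density) (auto cong: measurable_cong_sets simp: s)
    \<comment> \<open>Monotone convergence from above requires one finite integral; index 0 supplies
      it.\<close>
    have fin0: "(\<integral>\<^sup>+x. H 0 x * ennreal \<bar>f x\<bar> \<partial>\<mu>) < \<infinity>"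
    proof -
      have "(\<integral>\<^sup>+x. H 0 x * ennreal \<bar>f x\<bar> \<partial>\<mu>) \<le> (\<integral>\<^sup>+x. H 0 x * ennreal M \<partial>\<mu>)"
        using M by (intro nn_integral_mono mult_left_mono ennreal_leI) auto
      also have "\<dots> = (\<integral>\<^sup>+x. H 0 x \<partial>\<mu>) * ennreal M" by (intro nn_integral_multc) (auto cong: measurable_cong_sets simp: s)
      also have "\<dots> < \<infinity>" using fin[of 0] unfolding tot[OF Hm] by (simp add: ennreal_mult_less_top)
      finally show ?thesis .
    qed
    have "(INF n. (\<integral>\<^sup>+x. H n x * ennreal \<bar>f x\<bar> \<partial>\<mu>)) = (\<integral>\<^sup>+x. (INF n. H n x * ennreal \<bar>f x\<bar>) \<partial>\<mu>)"
    proof (rule nn_integral_monotone_convergence_INF_decseq[symmetric, where i=0])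
      show "decseq (\<lambda>n x. H n x * ennreal \<bar>f x\<bar>)"
        by (intro decseq_SucI le_funI mult_right_mono le_funD[OF decseq_SucD[OF dec]]) simp
    qed (use fin0 in \<open>auto cong: measurable_cong_sets simp: s\<close>)
    also have "\<dots> = (\<integral>\<^sup>+x. G x * ennreal \<bar>f x\<bar> \<partial>\<mu>)"
    proof (rule nn_integral_cong)
      fix x
      have "decseq (\<lambda>n. H n x)" by (intro decseq_SucI le_funD[OF decseq_SucD[OF dec]])
      then show "(INF n. H n x * ennreal \<bar>f x\<bar>) = G x * ennreal \<bar>f x\<bar>"
        using INF_mult_const_ennreal[of "\<lambda>n. H n x" "ennreal \<bar>f x\<bar>"] by (simp add: G_def mult.commute)
    qed
    finally have lim: "(INF n. (\<integral>\<^sup>+x. ennreal \<bar>f x\<bar> \<partial>density \<mu> (H n))) = (\<integral>\<^sup>+x. ennreal \<bar>f x\<bar> \<partial>density \<mu> G)"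
      by (simp add: den)
    have "ennreal \<bar>T (f, \<pi>)\<bar> \<le> (INF n. ennreal (form_const k \<pi>) * (\<integral>\<^sup>+x. ennreal \<bar>f x\<bar> \<partial>density \<mu> (H n)))"
      using Hb d unfolding mass_bound_iff by (intro INF_greatest) blast
    also have "\<dots> = ennreal (form_const k \<pi>) * (INF n. (\<integral>\<^sup>+x. ennreal \<bar>f x\<bar> \<partial>density \<mu> (H n)))"
    proof (rule INF_mult_const_ennreal)
      show "decseq (\<lambda>n. \<integral>\<^sup>+x. ennreal \<bar>f x\<bar> \<partial>density \<mu> (H n))"
        unfolding den[OF Hm]
        by (intro decseq_SucI nn_integral_mono mult_right_mono le_funD[OF decseq_SucD[OF dec]]) simp
    qed simp
    finally show "ennreal \<bar>T (f, \<pi>)\<bar> \<le> ennreal (form_const k \<pi>) * (\<integral>\<^sup>+x. ennreal \<bar>f x\<bar> \<partial>density \<mu> G)"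
      by (simp add: lim)
  qed
  moreover have "emeasure (density \<mu> G) UNIV \<le> emeasure \<nu>' UNIV" if "mass_bound k T \<nu>'" for \<nu>'
  proof -
    have "emeasure (density \<mu> G) UNIV \<le> (INF \<nu>\<in>?S. emeasure \<nu> UNIV)"
      unfolding u(2) using Gu by (rule INF_greatest)
    also have "\<dots> \<le> emeasure \<nu>' UNIV" using that by (intro INF_lower) simp
    finally show ?thesis .
  qed
  ultimately show ?thesis by blast
qed

text \<open>Minimality of the total implies minimality on every Borel set: gluing a competitor on
  \<open>B\<close> to the minimiser off \<open>B\<close> cannot lower the total. This is what gives
  the \<open>LEAST\<close> in \<open>mass_measure\<close> its meaning.\<close>

lemma mass_measure_least:
  fixes T :: "'a::metric_space form_functional"
  assumes lin: "multilinear_on_forms k T" and ex: "mass_bound k T \<mu>"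
  shows "mass_bound k T (mass_measure k T)"
    and "\<And>\<nu>. mass_bound k T \<nu> \<Longrightarrow> mass k T \<le> emeasure \<nu> UNIV"
proof -
  obtain \<rho> where \<rho>: "mass_bound k T \<rho>" "\<And>\<nu>. mass_bound k T \<nu> \<Longrightarrow> emeasure \<rho> UNIV \<le> emeasure \<nu> UNIV"
    using mass_bound_minimal_total[OF lin ex] by blast
  have F\<rho>: "finite_borel_measure \<rho>" using \<rho>(1) by (simp add: mass_bound_def)
  note D\<rho> = finite_borel_measureD[OF F\<rho>]
  have le: "\<rho> \<le> \<nu>" if \<nu>: "mass_bound k T \<nu>" for \<nu>
  proof -
    have F\<nu>: "finite_borel_measure \<nu>" using \<nu> by (simp add: mass_bound_def)
    note D\<nu> = finite_borel_measureD[OF F\<nu>]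
    have "emeasure \<rho> B \<le> emeasure \<nu> B" if B: "B \<in> sets borel" for B
    proof -
      have "emeasure \<rho> UNIV \<le> emeasure \<nu> (B \<inter> UNIV) + emeasure \<rho> (UNIV - B)"
        using \<rho>(2)[OF mass_bound_glue[OF lin \<nu> \<rho>(1) B]] by (subst (asm) emeasure_glue[OF F\<nu> F\<rho> B]) auto
      moreover have "emeasure \<rho> UNIV = emeasure \<rho> B + emeasure \<rho> (UNIV - B)"
        using plus_emeasure[of B \<rho> "UNIV - B"] B D\<rho>(2) by auto
      moreover have "emeasure \<rho> (UNIV - B) \<noteq> \<infinity>" using finite_measure.emeasure_finite[OF D\<rho>(1)] by simp
      ultimately show ?thesis by (auto simp: add.commute[of _ "emeasure \<rho> (UNIV - B)"] ennreal_add_left_cancel_le)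
    qed
    then show ?thesis using D\<rho>(2) D\<nu>(2) by (subst le_measure) auto
  qed
  have eq: "mass_measure k T = \<rho>" unfolding mass_measure_def by (rule Least_equality) (auto intro: \<rho>(1) le)
  show "mass_bound k T (mass_measure k T)" unfolding eq by (rule \<rho>(1))
  show "mass k T \<le> emeasure \<nu> UNIV" if "mass_bound k T \<nu>" for \<nu>
    unfolding mass_def eq by (rule \<rho>(2)[OF that])
qed

section \<open>Supports of measures\<close>

text \<open>In the discrete metric a set is its own only dense subset, so every set realizes a
  density character. The metric carriers in the assumption consist of functions on the reals;
  constant functions embed \<open>'a\<close> there.\<close>

lemma ulam_all_subsets:
  fixes B :: "'a set"
  assumes ulam: "\<forall>(M :: (real \<Rightarrow> 'a) set) d A.
      Metric_space M d \<and> realizes_density_character M d A \<longrightarrow> ulam_number A"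
  shows "ulam_number B"
proof -
  define c where "c = (\<lambda>x::'a. (\<lambda>_::real. x))"
  have inj: "inj c" by (auto simp: c_def inj_def fun_eq_iff)
  define d where "d = (\<lambda>x y :: real \<Rightarrow> 'a. if x = y then 0 else 1 :: real)"
  interpret dm: Metric_space "c ` B" d
    by unfold_locales (auto simp: d_def)
  have cl: "dm.mtopology closure_of D = D" if "D \<subseteq> c ` B" for D
  proof -
    have "x \<in> D" if x: "x \<in> dm.mtopology closure_of D" for x
    proof -
      have "\<forall>r>0. \<exists>y\<in>D. y \<in> dm.mball x r" using x unfolding dm.metric_closure_of by blast
      then have "\<exists>y\<in>D. y \<in> dm.mball x (1/2)" by (rule allE[of _ "1/2"]) simp
      then have "\<exists>y\<in>D. d x y < 1/2" by auto
      then show ?thesis by (auto simp: d_def split: if_splits)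
    qed
    moreover have "D \<subseteq> dm.mtopology closure_of D" using that by (intro closure_of_subset) simp
    ultimately show ?thesis by blast
  qed
  have "realizes_density_character (c ` B) d (c ` B)"
    unfolding realizes_density_character_def dense_subset_def using cl by auto
  then have U: "ulam_number (c ` B)" using ulam dm.Metric_space_axioms by blast
  show ?thesis
    unfolding ulam_number_def
  proof (intro allI impI, elim conjE)
    fix \<mu> :: "'a measure"
    assume fin: "finite_measure \<mu>" and sp: "space \<mu> = B" and st: "sets \<mu> = Pow B"
      and z: "\<forall>x\<in>B. emeasure \<mu> {x} = 0"
    interpret finite_measure \<mu> by fact
    define \<nu> where "\<nu> = distr \<mu> (count_space (c ` B)) c"
    have cm: "c \<in> measurable \<mu> (count_space (c ` B))"
      using sp st by (auto simp: measurable_def)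
    have pre: "c -` (c ` S) = S" for S using inj by (simp add: inj_vimage_image_eq)
    have "emeasure \<nu> (c ` B) = 0"
    proof (rule U[unfolded ulam_number_def, rule_format, OF conjI[OF _ conjI[OF _ conjI]]])
      show "finite_measure \<nu>" unfolding \<nu>_def by (rule finite_measure_distr[OF cm])
      show "space \<nu> = c ` B" "sets \<nu> = Pow (c ` B)" by (auto simp: \<nu>_def)
      show "\<forall>x\<in>c ` B. emeasure \<nu> {x} = 0"
      proof
        fix y assume "y \<in> c ` B"
        then obtain x where x: "x \<in> B" "y = c x" by auto
        have "c -` {y} \<inter> space \<mu> = {x}" using x sp inj by (auto dest: injD)
        then show "emeasure \<nu> {y} = 0" using x z by (simp add: \<nu>_def emeasure_distr[OF cm])
      qed
    qed
    moreover have "emeasure \<nu> (c ` B) = emeasure \<mu> B"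
      using sp by (simp add: \<nu>_def emeasure_distr[OF cm] pre)
    ultimately show "emeasure \<mu> B = 0" by simp
  qed
qed

text \<open>A finite measure has countably many atoms. What remains after removing them vanishes on
  singletons and is defined on all subsets, so the Ulam property makes it zero.\<close>

lemma ulam_countable_carrier:
  fixes \<nu> :: "'a measure"
  assumes ulam: "\<And>B :: 'a set. ulam_number B" and fin: "finite_measure \<nu>"
    and st: "sets \<nu> = UNIV"
  shows "\<exists>C. countable C \<and> emeasure \<nu> (- C) = 0"
proof -
  interpret finite_measure \<nu> by fact
  have sp: "space \<nu> = UNIV" using st sets.top[of \<nu>] sets.sets_into_space[of UNIV \<nu>] by auto
  let ?C = "{x. measure \<nu> {x} \<noteq> 0}"
  have C: "countable ?C" by (rule countable_support)
  let ?\<mu> = "restrict_space \<nu> (- ?C)"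
  have s: "space ?\<mu> = - ?C" by (simp add: space_restrict_space sp)
  have "emeasure ?\<mu> (- ?C) = 0"
  proof (rule ulam[unfolded ulam_number_def, rule_format, OF conjI[OF _ conjI[OF s conjI]]])
    show "finite_measure ?\<mu>"
    proof (rule finite_measureI)
      show "emeasure ?\<mu> (space ?\<mu>) \<noteq> \<infinity>"
        using emeasure_finite by (simp add: s emeasure_restrict_space st sp)
    qed
    show "sets ?\<mu> = Pow (- ?C)" by (auto simp: sets_restrict_space st)
    show "\<forall>x\<in>- ?C. emeasure ?\<mu> {x} = 0"
      by (auto simp: emeasure_restrict_space st sp emeasure_eq_measure)
  qed
  then have "emeasure \<nu> (- ?C) = 0" by (simp add: emeasure_restrict_space st sp)
  then show ?thesis using C by blast
qed

text \<open>The Borel measure has to be transferred to a measure on all subsets. For fixed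
  \<open>e\<close>, a well-order assigns to each point the first center whose \<open>e\<close>-ball
  contains it. Points lying in that ball with a fixed margin fall into classes at positive distance
  from each other, so arbitrary unions of classes are closed, the image measure on the centers is
  defined on all subsets, and it has a countable carrier.\<close>

lemma ulam_separable_carrier:
  fixes \<mu> :: "'a::metric_space measure"
  assumes ulam: "\<And>B :: 'a set. ulam_number B" and \<mu>: "finite_borel_measure \<mu>"
  obtains C where "countable C" "emeasure \<mu> (- closure C) = 0"
proof -
  note D = finite_borel_measureD[OF \<mu>]
  interpret finite_measure \<mu> by (rule D)
  obtain r :: "'a rel" where r: "Well_order r \<and> Field r = UNIV" using well_ordering ..
  have "well_order_on UNIV r" using conjunct1[OF r] unfolding conjunct2[OF r] .
  then have lin: "refl_on UNIV r" "antisym r" "total_on UNIV r" and wf: "wf (r - Id)"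
    unfolding well_order_on_def linear_order_on_def partial_order_on_def preorder_on_def by blast+
  have anti: "a = b" if "(a, b) \<in> r" "(b, a) \<in> r" for a b
    using lin(2) that by (rule antisymD)
  have min: "\<exists>m\<in>S. \<forall>s\<in>S. (m, s) \<in> r" if ne: "S \<noteq> {}" for S
  proof -
    obtain x where x: "x \<in> S" using ne by blast
    obtain m where m: "m \<in> S" "\<And>y. (y, m) \<in> r - Id \<Longrightarrow> y \<notin> S" by (rule wfE_min[OF wf x]) blast
    have "(m, s) \<in> r" if "s \<in> S" for s
    proof (cases "s = m")
      case True then show ?thesis using lin(1) by (simp add: refl_on_def)
    next
      case False
      then have "(s, m) \<notin> r" using m(2)[of s] that by auto
      then show ?thesis using lin(3) False by (auto simp: total_on_def)
    qed
    then show ?thesis using m(1) by blast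
  qed
  have main: "\<exists>C. countable C \<and> emeasure \<mu> {y. \<forall>c\<in>C. e \<le> dist y c} = 0" if e: "0 < e" for e :: real
  proof -
    define \<alpha> where "\<alpha> y = (SOME a. dist y a < e \<and> (\<forall>b. dist y b < e \<longrightarrow> (a, b) \<in> r))" for y :: 'a
    have \<alpha>: "dist y (\<alpha> y) < e" "\<And>b. dist y b < e \<Longrightarrow> (\<alpha> y, b) \<in> r" for y
    proof -
      have "{a. dist y a < e} \<noteq> {}" using e by (auto intro: exI[of _ y])
      from min[OF this] have "\<exists>a. dist y a < e \<and> (\<forall>b. dist y b < e \<longrightarrow> (a, b) \<in> r)" by auto
      from someI_ex[OF this] show "dist y (\<alpha> y) < e" "\<And>b. dist y b < e \<Longrightarrow> (\<alpha> y, b) \<in> r"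
        by (auto simp: \<alpha>_def)
    qed
    \<comment> \<open>Points that keep a margin \<open>1 / Suc n\<close> inside the ball of their
      center. If two of them are closer than the margin, each lies in the ball of the other's
      center, so each center precedes the other and they coincide.\<close>
    define W where "W n = {y. ball y (1 / Suc n) \<subseteq> ball (\<alpha> y) e}" for n :: nat
    have sep: "\<alpha> y = \<alpha> z" if yz: "y \<in> W n" "z \<in> W n" "dist y z < 1 / Suc n" for y z n
    proof (rule anti)
      have "z \<in> ball y (1 / Suc n)" "y \<in> ball z (1 / Suc n)" using yz(3) by (simp_all add: dist_commute)
      then have "z \<in> ball (\<alpha> y) e" "y \<in> ball (\<alpha> z) e" using yz(1,2) unfolding W_def by blast+
      then show "(\<alpha> y, \<alpha> z) \<in> r" "(\<alpha> z, \<alpha> y) \<in> r" by (auto intro!: \<alpha>(2) simp: dist_commute)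
    qed
    \<comment> \<open>A limit point of \<open>W n\<close> is approached through a single class,
      since nearby points of \<open>W n\<close> share their center; both the margin and the
      minimality of the center pass to the limit.\<close>
    have cl: "closed {y \<in> W n. \<alpha> y \<in> J}" for n J
      unfolding closure_subset_eq[symmetric]
    proof
      fix y assume y: "y \<in> closure {y \<in> W n. \<alpha> y \<in> J}"
      let ?h = "1 / real (Suc n)"
      have app: "\<exists>z\<in>{y \<in> W n. \<alpha> y \<in> J}. dist z y < t" if "0 < t" for t
        using y that by (simp add: closure_approachable)
      obtain z0 where z0: "z0 \<in> W n" "\<alpha> z0 \<in> J" "dist z0 y < ?h / 2" using app[of "?h / 2"] by auto
      have same: "\<alpha> z = \<alpha> z0" if "z \<in> W n" "dist z y < ?h / 2" for z
      proof (rule sep[OF that(1) z0(1)])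
        show "dist z z0 < ?h" using that(2) z0(3) dist_triangle2[of z z0 y] by linarith
      qed
      have sub: "ball y ?h \<subseteq> ball (\<alpha> z0) e"
      proof
        fix x assume x: "x \<in> ball y ?h"
        then have "0 < min (?h / 2) (?h - dist y x)" by simp
        from app[OF this] obtain z where z: "z \<in> W n" "dist z y < min (?h / 2) (?h - dist y x)" by auto
        have "x \<in> ball z ?h" using z(2) dist_triangle[of z x y] by simp
        then have "x \<in> ball (\<alpha> z) e" using z(1) unfolding W_def by blast
        then show "x \<in> ball (\<alpha> z0) e" using same[of z] z by simp
      qed
      have "\<alpha> y = \<alpha> z0"
      proof (rule anti)
        have "y \<in> ball y ?h" by simp
        then have "y \<in> ball (\<alpha> z0) e" using sub by blast
        then show "(\<alpha> y, \<alpha> z0) \<in> r" by (intro \<alpha>(2)) (simp add: dist_commute)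
        have "dist y (\<alpha> y) < e" by (rule \<alpha>)
        then have "0 < min (?h / 2) (e - dist y (\<alpha> y))" by simp
        from app[OF this] obtain z where z: "z \<in> W n" "dist z y < min (?h / 2) (e - dist y (\<alpha> y))" by auto
        have "dist z (\<alpha> y) < e" using z(2) dist_triangle[of z "\<alpha> y" y] by simp
        then have "(\<alpha> z, \<alpha> y) \<in> r" by (rule \<alpha>(2))
        then show "(\<alpha> z0, \<alpha> y) \<in> r" using same[of z] z by simp
      qed
      then show "y \<in> {y \<in> W n. \<alpha> y \<in> J}" using sub z0(2) by (simp add: W_def)
    qed
    have WU: "\<exists>n. y \<in> W n" for y
    proof -
      have "0 < e - dist y (\<alpha> y)" using \<alpha>(1)[of y] by simp
      then obtain n where n: "1 / real (Suc n) < e - dist y (\<alpha> y)" using nat_approx_posE by blast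
      have "ball y (1 / Suc n) \<subseteq> ball (\<alpha> y) e"
      proof
        fix x assume "x \<in> ball y (1 / Suc n)"
        then have "dist y x < 1 / Suc n" by simp
        then show "x \<in> ball (\<alpha> y) e" using n dist_triangle3[of "\<alpha> y" x y] by (simp add: dist_commute)
      qed
      then show ?thesis by (auto simp: W_def)
    qed
    \<comment> \<open>\<open>C\<close> carries the image of the measure restricted to
      \<open>W n\<close>, and a point whose center belongs to \<open>C\<close> is closer than
      \<open>e\<close> to \<open>C\<close>.\<close>
    have "\<exists>C. countable C \<and> emeasure \<mu> {y \<in> W n. \<alpha> y \<notin> C} = 0" for n
    proof -
      have Wn: "W n \<in> sets borel" using cl[of n UNIV] by (auto intro: borel_closed)
      let ?R = "restrict_space \<mu> (W n)"
      let ?\<nu> = "distr ?R (count_space UNIV) \<alpha>"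
      have \<alpha>m: "\<alpha> \<in> measurable ?R (count_space UNIV)"
      proof (rule measurableI)
        fix J :: "'a set"
        have "\<alpha> -` J \<inter> space ?R = {y \<in> W n. \<alpha> y \<in> J}" by (auto simp: space_restrict_space D)
        also have "\<dots> \<in> sets ?R"
          using cl[of n J] Wn D(2) by (auto simp: sets_restrict_space_iff D intro: borel_closed)
        finally show "\<alpha> -` J \<inter> space ?R \<in> sets ?R" .
      qed simp
      have "finite_measure ?R"
        using Wn D emeasure_finite by (intro finite_measureI) (simp add: emeasure_restrict_space space_restrict_space)
      then have "finite_measure ?\<nu>" by (rule finite_measure.finite_measure_distr[OF _ \<alpha>m])
      moreover have "sets ?\<nu> = UNIV" by simp
      ultimately have "\<exists>C. countable C \<and> emeasure ?\<nu> (- C) = 0"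
        by (rule ulam_countable_carrier[OF ulam])
      then obtain C where C: "countable C" "emeasure ?\<nu> (- C) = 0" by blast
      have "emeasure ?\<nu> (- C) = emeasure ?R (\<alpha> -` (- C) \<inter> space ?R)" by (intro emeasure_distr \<alpha>m) simp
      also have "\<alpha> -` (- C) \<inter> space ?R = {y \<in> W n. \<alpha> y \<notin> C}" by (auto simp: space_restrict_space D)
      also have "emeasure ?R \<dots> = emeasure \<mu> \<dots>"
        using Wn D by (intro emeasure_restrict_space) auto
      finally show ?thesis using C by auto
    qed
    then obtain C where C: "\<And>n. countable (C n)" "\<And>n. emeasure \<mu> {y \<in> W n. \<alpha> y \<notin> C n} = 0" by metis
    have cs: "{y \<in> W n. \<alpha> y \<notin> C n} \<in> sets borel" for n
      using cl[of n "- C n"] by (auto intro: borel_closed)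
    have "{y. \<forall>c\<in>(\<Union>n. C n). e \<le> dist y c} \<subseteq> (\<Union>n. {y \<in> W n. \<alpha> y \<notin> C n})"
    proof
      fix y assume y: "y \<in> {y. \<forall>c\<in>(\<Union>n. C n). e \<le> dist y c}"
      obtain n where n: "y \<in> W n" using WU by blast
      have "\<alpha> y \<notin> C n" using y \<alpha>(1)[of y] by force
      then show "y \<in> (\<Union>n. {y \<in> W n. \<alpha> y \<notin> C n})" using n by blast
    qed
    moreover have "(\<Union>n. {y \<in> W n. \<alpha> y \<notin> C n}) \<in> null_sets \<mu>"
      using C(2) cs D(2) by (intro null_sets_UN) (auto simp: null_sets_def)
    ultimately have "emeasure \<mu> {y. \<forall>c\<in>(\<Union>n. C n). e \<le> dist y c} = 0"
      by (meson emeasure_eq_0 null_setsD1 null_setsD2)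
    then show ?thesis using C(1) by (intro exI[of _ "\<Union>n. C n"]) auto
  qed
  have "\<forall>n::nat. \<exists>C. countable C \<and> emeasure \<mu> {y. \<forall>c\<in>C. 1 / Suc n \<le> dist y c} = 0"
    by (intro allI main) simp
  from choice[OF this] obtain C where "\<forall>n::nat. countable (C n) \<and> emeasure \<mu> {y. \<forall>c\<in>C n. 1 / Suc n \<le> dist y c} = 0" ..
  then have C: "\<And>n. countable (C n)" "\<And>n. emeasure \<mu> {y. \<forall>c\<in>C n. 1 / Suc n \<le> dist y c} = 0" by blast+
  have cs: "closed {y. \<forall>c\<in>C n. 1 / real (Suc n) \<le> dist y c}" for n
    unfolding Ball_def by (intro closed_Collect_all closed_Collect_imp closed_Collect_le continuous_intros) auto
  have "- closure (\<Union>n. C n) \<subseteq> (\<Union>n. {y. \<forall>c\<in>C n. 1 / Suc n \<le> dist y c})"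
  proof
    fix y assume "y \<in> - closure (\<Union>n. C n)"
    then obtain e where e: "0 < e" "\<And>c. c \<in> (\<Union>n. C n) \<Longrightarrow> e \<le> dist c y"
      by (auto simp: closure_approachable not_less)
    obtain n where "1 / real (Suc n) < e" using nat_approx_posE e(1) by blast
    then have "y \<in> {y. \<forall>c\<in>C n. 1 / Suc n \<le> dist y c}" using e(2) by (fastforce simp: dist_commute)
    then show "y \<in> (\<Union>n. {y. \<forall>c\<in>C n. 1 / Suc n \<le> dist y c})" by blast
  qed
  moreover have "(\<Union>n. {y. \<forall>c\<in>C n. 1 / Suc n \<le> dist y c}) \<in> null_sets \<mu>"
    using C(2) cs D(2) by (intro null_sets_UN) (auto simp: null_sets_def intro: borel_closed)
  ultimately have "emeasure \<mu> (- closure (\<Union>n. C n)) = 0"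
    by (meson emeasure_eq_0 null_setsD1 null_setsD2)
  then show thesis using C(1) by (intro that[of "\<Union>n. C n"]) auto
qed

lemma closed_msupport: "closed (msupport \<mu>)"
proof -
  have "open (- msupport \<mu>)"
  proof (subst open_subopen, intro ballI)
    fix x assume "x \<in> - msupport \<mu>"
    then obtain U where U: "open U" "x \<in> U" "\<not> emeasure \<mu> U > 0" by (auto simp: msupport_def)
    then have "U \<subseteq> - msupport \<mu>" by (auto simp: msupport_def)
    then show "\<exists>T. open T \<and> x \<in> T \<and> T \<subseteq> - msupport \<mu>" using U by blast
  qed
  then show ?thesis by (simp add: closed_open)
qed

text \<open>Each point off the support has a null ball, and inside a separable carrier countably
  many null balls centered in the dense set cover these points. Without a separable carrier the
  support might fail to have full measure.\<close>

lemma msupport_carrier: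
  fixes \<mu> :: "'a::metric_space measure"
  assumes ulam: "\<And>B :: 'a set. ulam_number B" and \<mu>: "finite_borel_measure \<mu>"
  obtains C where "countable C" "C \<subseteq> msupport \<mu>" "emeasure \<mu> (- closure C) = 0" "emeasure \<mu> (- msupport \<mu>) = 0"
proof -
  note D = finite_borel_measureD[OF \<mu>]
  obtain C where C: "countable C" "emeasure \<mu> (- closure C) = 0"
    using ulam_separable_carrier[OF ulam \<mu>] by blast
  let ?S = "msupport \<mu>"
  let ?K = "{(c, n). c \<in> C \<and> emeasure \<mu> (ball c (1 / Suc n)) = 0}"
  have cK: "countable ?K"
    by (rule countable_subset[of _ "C \<times> (UNIV :: nat set)"]) (use C(1) in auto)
  have sub: "- ?S \<inter> closure C \<subseteq> (\<Union>(c, n)\<in>?K. ball c (1 / Suc n))"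
  proof
    fix y assume y: "y \<in> - ?S \<inter> closure C"
    then obtain U where U: "open U" "y \<in> U" "emeasure \<mu> U = 0" by (auto simp: msupport_def)
    then obtain e where e: "0 < e" "ball y e \<subseteq> U" by (meson openE)
    obtain n where n: "1 / real (Suc n) < e / 2" using nat_approx_posE[of "e / 2"] e(1) by auto
    have "y \<in> closure C" using y by simp
    then have "\<exists>c\<in>C. dist c y < 1 / Suc n"
      unfolding closure_approachable by (rule allE[of _ "1 / Suc n"]) simp
    then obtain c where c: "c \<in> C" "dist c y < 1 / Suc n" by blast
    have "ball c (1 / Suc n) \<subseteq> ball y e"
    proof
      fix x assume "x \<in> ball c (1 / Suc n)"
      then show "x \<in> ball y e" using c(2) n dist_triangle3[of y x c] by (simp add: dist_commute)
    qed
    then have "emeasure \<mu> (ball c (1 / Suc n)) \<le> emeasure \<mu> U"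
      using e(2) U(1) D(2) by (intro emeasure_mono) auto
    then have "(c, n) \<in> ?K" using c U(3) by auto
    then show "y \<in> (\<Union>(c, n)\<in>?K. ball c (1 / Suc n))" using c(2) by force
  qed
  have "(\<Union>k\<in>?K. ball (fst k) (1 / Suc (snd k))) \<in> null_sets \<mu>"
  proof (rule null_sets_UN'[OF cK])
    fix k assume "k \<in> ?K"
    then show "ball (fst k) (1 / Suc (snd k)) \<in> null_sets \<mu>"
      using D(2) by (auto simp: null_sets_def)
  qed
  moreover have "- closure C \<in> null_sets \<mu>" using C(2) D(2) by (auto simp: null_sets_def)
  ultimately have "(\<Union>k\<in>?K. ball (fst k) (1 / Suc (snd k))) \<union> - closure C \<in> null_sets \<mu>" by (rule null_sets.Un)
  moreover have "- ?S \<subseteq> (\<Union>k\<in>?K. ball (fst k) (1 / Suc (snd k))) \<union> - closure C"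
    using sub unfolding split_beta by blast
  ultimately have S0: "emeasure \<mu> (- ?S) = 0" by (meson emeasure_eq_0 null_setsD1 null_setsD2)
  \<comment> \<open>The dense set \<open>C\<close> need not meet the support, so its points are
    replaced by nearby points of the support.\<close>
  define s where "s c n = (SOME x. x \<in> ?S \<and> dist c x < 1 / Suc n)" for c and n :: nat
  define C' where "C' = (\<lambda>(c, n). s c n) ` {(c, n). c \<in> C \<and> (\<exists>x. x \<in> ?S \<and> dist c x < 1 / Suc n)}"
  have s: "s c n \<in> ?S" "dist c (s c n) < 1 / Suc n" if "\<exists>x. x \<in> ?S \<and> dist c x < 1 / Suc n" for c n
    using someI_ex[OF that] by (auto simp: s_def)
  have "countable {(c, n :: nat). c \<in> C \<and> (\<exists>x. x \<in> ?S \<and> dist c x < 1 / Suc n)}"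
    by (rule countable_subset[of _ "C \<times> UNIV"]) (use C(1) in auto)
  then have "countable C'" unfolding C'_def by (rule countable_image)
  moreover have "C' \<subseteq> ?S" using s(1) by (auto simp: C'_def)
  moreover have "closure C \<inter> ?S \<subseteq> closure C'"
  proof
    fix y assume y: "y \<in> closure C \<inter> ?S"
    show "y \<in> closure C'"
      unfolding closure_approachable
    proof (intro allI impI)
      fix e :: real assume e: "0 < e"
      obtain n where n: "1 / real (Suc n) < e / 2" using nat_approx_posE[of "e / 2"] e by auto
      have "y \<in> closure C" using y by simp
      then have "\<exists>c\<in>C. dist c y < 1 / Suc n"
        unfolding closure_approachable by (rule allE[of _ "1 / Suc n"]) simp
      then obtain c where c: "c \<in> C" "dist c y < 1 / Suc n" by blast
      then have ex: "\<exists>x. x \<in> ?S \<and> dist c x < 1 / Suc n" using y by auto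
      have "s c n \<in> C'" using c ex by (auto simp: C'_def)
      moreover have "dist (s c n) y < e" using s(2)[OF ex] c(2) n dist_triangle3[of "s c n" y c] by linarith
      ultimately show "\<exists>z\<in>C'. dist z y < e" by blast
    qed
  qed
  then have "- closure C' \<subseteq> - closure C \<union> - ?S" by blast
  moreover have "- closure C \<union> - ?S \<in> null_sets \<mu>"
    using C(2) S0 D(2) closed_msupport[of \<mu>] by (intro null_sets.Un) (auto simp: null_sets_def open_Compl)
  ultimately have "emeasure \<mu> (- closure C') = 0"
    by (meson emeasure_eq_0 null_setsD1 null_setsD2)
  then show thesis by (rule that[OF \<open>countable C'\<close> \<open>C' \<subseteq> ?S\<close> _ S0])
qed

section \<open>Kantorovich duality\<close>

text \<open>Plans are functions on the whole index type that vanish off \<open>H \<times> H\<close>.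
  This makes them a closed subset of a product of compact intervals, so that minimisers exist by
  compactness.\<close>

definition discrete_plans :: "'i set \<Rightarrow> ('i \<Rightarrow> real) \<Rightarrow> ('i \<Rightarrow> real) \<Rightarrow> ('i \<times> 'i \<Rightarrow> real) set" where
  "discrete_plans H a b = {p. (\<forall>z. 0 \<le> p z) \<and> (\<forall>z. z \<notin> H \<times> H \<longrightarrow> p z = 0) \<and>
     (\<forall>i\<in>H. (\<Sum>j\<in>H. p (i, j)) = a i) \<and> (\<forall>j\<in>H. (\<Sum>i\<in>H. p (i, j)) = b j)}"

lemma discrete_plansD:
  assumes "p \<in> discrete_plans H a b"
  shows "0 \<le> p z" "z \<notin> H \<times> H \<Longrightarrow> p z = 0"
    "i \<in> H \<Longrightarrow> (\<Sum>j\<in>H. p (i, j)) = a i" "j \<in> H \<Longrightarrow> (\<Sum>i\<in>H. p (i, j)) = b j"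
  using assms unfolding discrete_plans_def by blast+

lemma compact_box_functions:
  fixes S :: "'i \<Rightarrow> real set"
  assumes "\<And>i. compact (S i)" shows "compact (PiE UNIV S)"
proof -
  have "compactin (product_topology (\<lambda>_. euclidean) UNIV) (PiE UNIV S)"
    unfolding compactin_PiE using assms by (auto simp: compactin_euclidean_iff)
  then show ?thesis by (simp add: euclidean_product_topology compactin_euclidean_iff)
qed

lemma discrete_plans_le_total:
  assumes "finite H" "p \<in> discrete_plans H a b" "\<And>i. i \<in> H \<Longrightarrow> 0 \<le> a i"
  shows "p z \<le> sum a H"
proof (cases "z \<in> H \<times> H")
  case True
  then obtain i j where z: "z = (i, j)" "i \<in> H" "j \<in> H" by auto
  have "p (i, j) \<le> (\<Sum>j\<in>H. p (i, j))"
    using assms z by (intro member_le_sum) (auto simp: discrete_plans_def)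
  also have "\<dots> = a i" using assms z by (simp add: discrete_plans_def)
  also have "\<dots> \<le> sum a H" using assms z by (intro member_le_sum) auto
  finally show ?thesis by (simp add: z)
next
  case False
  then have "p z = 0" by (rule discrete_plansD[OF assms(2)])
  then show ?thesis using assms(3) by (simp add: sum_nonneg)
qed

lemma discrete_optimal_plan:
  fixes a b :: "'i \<Rightarrow> real" and c :: "'i \<times> 'i \<Rightarrow> real"
  assumes fin: "finite H" and a: "\<And>i. i \<in> H \<Longrightarrow> 0 \<le> a i" and b: "\<And>i. i \<in> H \<Longrightarrow> 0 \<le> b i"
    and eq: "sum a H = sum b H"
  shows "\<exists>p\<in>discrete_plans H a b. \<forall>p'\<in>discrete_plans H a b.
    (\<Sum>z\<in>H \<times> H. p z * c z) \<le> (\<Sum>z\<in>H \<times> H. p' z * c z)"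
proof -
  let ?P = "discrete_plans H a b" and ?m = "sum a H"
  have m: "0 \<le> ?m" using a by (rule sum_nonneg)
  have cc: "continuous_on UNIV (\<lambda>p :: 'i \<times> 'i \<Rightarrow> real. p z)" for z by simp
  have "closed ?P"
    unfolding discrete_plans_def Ball_def
    by (intro closed_Collect_conj closed_Collect_all closed_Collect_imp closed_Collect_le closed_Collect_eq
        continuous_intros cc) auto
  moreover have "?P \<subseteq> PiE UNIV (\<lambda>_. {0..?m})"
  proof
    fix p assume p: "p \<in> ?P"
    have "0 \<le> p z" for z by (rule discrete_plansD[OF p])
    then show "p \<in> PiE UNIV (\<lambda>_. {0..?m})" using discrete_plans_le_total[OF fin p a] by auto
  qed
  moreover have "compact (PiE UNIV (\<lambda>_ :: 'i \<times> 'i. {0..?m}))"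
    by (rule compact_box_functions) simp
  ultimately have "compact ?P" by (metis closed_Int_compact inf.absorb1)
  moreover have "?P \<noteq> {}"
  proof -
    \<comment> \<open>The product plan. For total mass 0 the quotient is 0 by convention, and all
      weights vanish as well.\<close>
    define p where "p z = (if z \<in> H \<times> H then a (fst z) * b (snd z) / ?m else 0)" for z
    have row: "(\<Sum>j\<in>H. p (i, j)) = a i" if i: "i \<in> H" for i
    proof (cases "?m = 0")
      case True
      then have "a i = 0" using sum_nonneg_eq_0_iff[OF fin a] i by auto
      then show ?thesis by (simp add: p_def i)
    next
      case False
      then show ?thesis using i by (simp add: p_def sum_divide_distrib[symmetric] sum_distrib_left[symmetric] eq)
    qed
    have col: "(\<Sum>i\<in>H. p (i, j)) = b j" if j: "j \<in> H" for j
    proof (cases "?m = 0")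
      case True
      then have "b j = 0" using sum_nonneg_eq_0_iff[OF fin b] j eq by auto
      then show ?thesis by (simp add: p_def j)
    next
      case False
      then show ?thesis using j by (simp add: p_def sum_divide_distrib[symmetric] sum_distrib_right[symmetric])
    qed
    have "p \<in> ?P" using row col a b m by (auto simp: discrete_plans_def p_def)
    then show ?thesis by blast
  qed
  moreover have "continuous_on ?P (\<lambda>p. \<Sum>z\<in>H \<times> H. p z * c z)"
    by (intro continuous_intros continuous_on_subset[OF cc]) auto
  ultimately show ?thesis by (rule continuous_attains_inf)
qed

text \<open>Rerouting mass \<open>e\<close> from each pair \<open>(I k, J k)\<close> to
  \<open>(I k, J (\<sigma> k))\<close> preserves both marginals, because \<open>\<sigma>\<close>
  merely permutes the targets; optimality then forbids a gain.\<close>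

lemma discrete_optimal_cyclically_monotone:
  fixes c :: "'i \<times> 'i \<Rightarrow> real" and I J :: "nat \<Rightarrow> 'i"
  assumes fin: "finite H" and p: "p \<in> discrete_plans H a b"
    and opt: "\<And>p'. p' \<in> discrete_plans H a b \<Longrightarrow> (\<Sum>z\<in>H \<times> H. p z * c z) \<le> (\<Sum>z\<in>H \<times> H. p' z * c z)"
    and I: "\<And>k. k < n \<Longrightarrow> I k \<in> H" "\<And>k. k < n \<Longrightarrow> J k \<in> H" "\<And>k. k < n \<Longrightarrow> 0 < p (I k, J k)"
    and \<sigma>: "bij_betw \<sigma> {..<n} {..<n}"
  shows "(\<Sum>k<n. c (I k, J k)) \<le> (\<Sum>k<n. c (I k, J (\<sigma> k)))"
proof (cases "n = 0")
  case False
  \<comment> \<open>A pair may occur up to \<open>n\<close> times in the list; dividing the smallest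
    weight by \<open>n\<close> keeps the rerouted plan nonnegative.\<close>
  define e where "e = Min ((\<lambda>k. p (I k, J k)) ` {..<n}) / n"
  have "0 < Min ((\<lambda>k. p (I k, J k)) ` {..<n})" using I(3) False by (subst Min_gr_iff) auto
  then have e: "0 < e" using False by (simp add: e_def)
  have en: "real n * e \<le> p (I k, J k)" if "k < n" for k
  proof -
    have "real n * e = Min ((\<lambda>k. p (I k, J k)) ` {..<n})" using False by (simp add: e_def)
    also have "\<dots> \<le> p (I k, J k)" using that by (intro Min_le) auto
    finally show ?thesis .
  qed
  have \<sigma>n: "\<sigma> k < n" if "k < n" for k using \<sigma> that by (auto simp: bij_betw_def)
  define p' where "p' z = p z + e * (\<Sum>k<n. of_bool (z = (I k, J (\<sigma> k)))) - e * (\<Sum>k<n. of_bool (z = (I k, J k)))" for z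
  have p0: "\<And>z. 0 \<le> p z" "\<And>z. z \<notin> H \<times> H \<Longrightarrow> p z = 0"
    "\<And>i. i \<in> H \<Longrightarrow> (\<Sum>j\<in>H. p (i, j)) = a i" "\<And>j. j \<in> H \<Longrightarrow> (\<Sum>i\<in>H. p (i, j)) = b j"
    by (rule discrete_plansD[OF p]; assumption)+
  have test: "(\<Sum>z\<in>H \<times> H. f z * of_bool (z = (i, j))) = f (i, j)" if "i \<in> H" "j \<in> H" for f :: "'i \<times> 'i \<Rightarrow> real" and i j
    using fin that by (simp add: of_bool_def if_distrib sum.delta cong: if_cong)
  have d1: "(\<Sum>j\<in>H. of_bool ((i, j) = (x, y)) :: real) = of_bool (i = x)" if "y \<in> H" for i x y
    using fin that by (cases "i = x") (auto simp: of_bool_def sum.delta)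
  have d2: "(\<Sum>i\<in>H. of_bool ((i, j) = (x, y)) :: real) = of_bool (j = y)" if "x \<in> H" for j x y
    using fin that by (cases "j = y") (auto simp: of_bool_def sum.delta)
  have "p' \<in> discrete_plans H a b"
    unfolding discrete_plans_def
  proof (intro CollectI conjI allI ballI impI)
    fix z
    have "e * (\<Sum>k<n. of_bool (z = (I k, J k))) \<le> p z"
    proof (cases "\<exists>k<n. z = (I k, J k)")
      case True
      then obtain k where k: "k < n" "z = (I k, J k)" by blast
      have "(\<Sum>k<n. of_bool (z = (I k, J k)) :: real) \<le> (\<Sum>k<n. 1)" by (intro sum_mono) auto
      then have "e * (\<Sum>k<n. of_bool (z = (I k, J k))) \<le> e * real n" using e by (intro mult_left_mono) auto
      then show ?thesis using en[OF k(1)] k(2) by (simp add: mult.commute)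
    next
      case False
      then have "(\<Sum>k<n. of_bool (z = (I k, J k)) :: real) = 0" by (intro sum.neutral) auto
      then show ?thesis using p0(1) by simp
    qed
    moreover have "0 \<le> e * (\<Sum>k<n. of_bool (z = (I k, J (\<sigma> k))))" using e by (intro mult_nonneg_nonneg sum_nonneg) auto
    ultimately show "0 \<le> p' z" by (simp add: p'_def)
  next
    fix z assume z: "z \<notin> H \<times> H"
    have "(\<Sum>k<n. of_bool (z = (I k, J (\<sigma> k))) :: real) = 0" "(\<Sum>k<n. of_bool (z = (I k, J k)) :: real) = 0"
      using z I \<sigma>n by (auto intro!: sum.neutral)
    then show "p' z = 0" using p0(2)[OF z] by (simp add: p'_def)
  next
    fix i assume i: "i \<in> H"
    have "(\<Sum>j\<in>H. \<Sum>k<n. of_bool ((i, j) = (I k, J (\<sigma> k))) :: real) = (\<Sum>k<n. of_bool (i = I k))"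
      by (subst sum.swap) (intro sum.cong refl d1, use I \<sigma>n in auto)
    moreover have "(\<Sum>j\<in>H. \<Sum>k<n. of_bool ((i, j) = (I k, J k)) :: real) = (\<Sum>k<n. of_bool (i = I k))"
      by (subst sum.swap) (intro sum.cong refl d1, use I in auto)
    ultimately show "(\<Sum>j\<in>H. p' (i, j)) = a i"
      unfolding p'_def sum.distrib sum_subtractf sum_distrib_left[symmetric] p0(3)[OF i] by simp
  next
    fix j assume j: "j \<in> H"
    have "(\<Sum>i\<in>H. \<Sum>k<n. of_bool ((i, j) = (I k, J (\<sigma> k))) :: real) = (\<Sum>k<n. of_bool (j = J (\<sigma> k)))"
      by (subst sum.swap) (intro sum.cong refl d2, use I in auto)
    also have "\<dots> = (\<Sum>k<n. of_bool (j = J k))" by (rule sum.reindex_bij_betw[OF \<sigma>])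
    moreover have "(\<Sum>i\<in>H. \<Sum>k<n. of_bool ((i, j) = (I k, J k)) :: real) = (\<Sum>k<n. of_bool (j = J k))"
      by (subst sum.swap) (intro sum.cong refl d2, use I in auto)
    ultimately show "(\<Sum>i\<in>H. p' (i, j)) = b j"
      unfolding p'_def sum.distrib sum_subtractf sum_distrib_left[symmetric] p0(4)[OF j] by simp
  qed
  from opt[OF this] have le: "(\<Sum>z\<in>H \<times> H. p z * c z) \<le> (\<Sum>z\<in>H \<times> H. p' z * c z)" .
  have swap: "(\<Sum>z\<in>H \<times> H. (\<Sum>k<n. of_bool (z = (I k, J (\<tau> k)))) * c z) = (\<Sum>k<n. c (I k, J (\<tau> k)))"
    if "\<And>k. k < n \<Longrightarrow> \<tau> k < n" for \<tau>
  proof -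
    have "(\<Sum>z\<in>H \<times> H. (\<Sum>k<n. of_bool (z = (I k, J (\<tau> k)))) * c z)
        = (\<Sum>k<n. \<Sum>z\<in>H \<times> H. c z * of_bool (z = (I k, J (\<tau> k))))"
      unfolding sum_distrib_right by (subst sum.swap) (simp only: mult.commute)
    also have "\<dots> = (\<Sum>k<n. c (I k, J (\<tau> k)))" using I that by (intro sum.cong refl test) auto
    finally show ?thesis .
  qed
  have "(\<Sum>z\<in>H \<times> H. p' z * c z) = (\<Sum>z\<in>H \<times> H. p z * c z)
     + e * (\<Sum>z\<in>H \<times> H. (\<Sum>k<n. of_bool (z = (I k, J (\<sigma> k)))) * c z)
     - e * (\<Sum>z\<in>H \<times> H. (\<Sum>k<n. of_bool (z = (I k, J k))) * c z)"
    unfolding p'_def by (simp only: left_diff_distrib distrib_right sum_subtractf sum.distrib mult.assoc sum_distrib_left[symmetric])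
  also have "\<dots> = (\<Sum>z\<in>H \<times> H. p z * c z) + e * (\<Sum>k<n. c (I k, J (\<sigma> k))) - e * (\<Sum>k<n. c (I k, J k))"
    using swap[of \<sigma>] swap[of "\<lambda>k. k"] \<sigma>n by simp
  finally have "e * (\<Sum>k<n. c (I k, J k)) \<le> e * (\<Sum>k<n. c (I k, J (\<sigma> k)))" using le by linarith
  then show ?thesis using e by simp
qed simp

text \<open>Length of a walk from \<open>b\<close> to \<open>y\<close> that traverses each listed
  edge backwards, from target to source, at negative cost. Its infimum over lists is the Rockafellar
  potential, a shortest-path distance in the residual graph of a plan.\<close>

primrec chain_weight :: "('i \<Rightarrow> 'a::metric_space) \<Rightarrow> 'a \<Rightarrow> ('i \<times> 'i) list \<Rightarrow> 'a \<Rightarrow> real" where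
  "chain_weight z b [] y = dist b y"
| "chain_weight z b (e # l) y = dist b (z (snd e)) - dist (z (fst e)) (z (snd e)) + chain_weight z (z (fst e)) l y"

lemma chain_weight_snoc:
  "chain_weight z b (l @ [e]) y = chain_weight z b l (z (snd e)) - dist (z (fst e)) (z (snd e)) + dist (z (fst e)) y"
  by (induction l arbitrary: b) auto

lemma chain_weight_lipschitz: "chain_weight z b l y \<le> chain_weight z b l y' + dist y' y"
proof (induction l arbitrary: b)
  case Nil then show ?case by (simp add: dist_triangle)
next
  case (Cons e l) then show ?case by (simp add: Cons.IH)
qed

lemma chain_weight_eq:
  assumes "l \<noteq> []"
  shows "chain_weight z b l y = dist b (z (snd (hd l))) - (\<Sum>k<length l. dist (z (fst (l ! k))) (z (snd (l ! k))))
     + (\<Sum>k<length l - 1. dist (z (fst (l ! k))) (z (snd (l ! Suc k)))) + dist (z (fst (last l))) y"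
  using assms
proof (induction l arbitrary: b)
  case (Cons e l)
  show ?case
  proof (cases l)
    case (Cons e' l')
    have "(\<Sum>k<length (e # l) - 1. dist (z (fst ((e # l) ! k))) (z (snd ((e # l) ! Suc k))))
      = dist (z (fst e)) (z (snd (hd l))) + (\<Sum>k<length l - 1. dist (z (fst (l ! k))) (z (snd (l ! Suc k))))"
      unfolding Cons by (simp add: sum.lessThan_Suc_shift del: sum.lessThan_Suc)
    moreover have "(\<Sum>k<length (e # l). dist (z (fst ((e # l) ! k))) (z (snd ((e # l) ! k))))
      = dist (z (fst e)) (z (snd e)) + (\<Sum>k<length l. dist (z (fst (l ! k))) (z (snd (l ! k))))"
      by (simp add: sum.lessThan_Suc_shift del: sum.lessThan_Suc)
    ultimately show ?thesis using Cons.IH[of "z (fst e)"] Cons by simp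
  qed simp
qed simp

text \<open>By cyclical monotonicity the edges charged by an optimal plan form no closed walk of
  negative length, so shortest-path distances \<open>u\<close> exist. They are 1-Lipschitz on the
  whole space because the last leg of a walk is a distance. Appending an edge shows that
  \<open>u\<close> grows by the full cost along it, and summation gives equality with the dual
  value.\<close>

lemma discrete_kantorovich:
  fixes z :: "'i \<Rightarrow> 'a::metric_space"
  assumes fin: "finite H" and a: "\<And>i. i \<in> H \<Longrightarrow> 0 \<le> a i" and b: "\<And>i. i \<in> H \<Longrightarrow> 0 \<le> b i"
    and eq: "sum a H = sum b H"
  obtains p u where "p \<in> discrete_plans H a b" "1-lipschitz_on UNIV u"
    "(\<Sum>e\<in>H \<times> H. p e * dist (z (fst e)) (z (snd e))) = (\<Sum>j\<in>H. b j * u (z j)) - (\<Sum>i\<in>H. a i * u (z i))"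
proof -
  let ?c = "\<lambda>e. dist (z (fst e)) (z (snd e))"
  obtain p where p: "p \<in> discrete_plans H a b"
    and opt: "\<And>p'. p' \<in> discrete_plans H a b \<Longrightarrow> (\<Sum>e\<in>H \<times> H. p e * ?c e) \<le> (\<Sum>e\<in>H \<times> H. p' e * ?c e)"
    using discrete_optimal_plan[OF fin a b eq, of ?c] by blast
  define \<Gamma> where "\<Gamma> = {e \<in> H \<times> H. 0 < p e}"
  have closed_chain: "0 \<le> chain_weight z x l x" if l: "set l \<subseteq> \<Gamma>" for x l
  proof (cases "l = []")
    case False
    define n where "n = length l"
    have n: "0 < n" using False by (simp add: n_def)
    \<comment> \<open>The cyclic shift, which pairs the source of each edge with the target of the
      next.\<close>
    define \<sigma> where "\<sigma> k = (if Suc k = n then 0 else Suc k)" for k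
    have bij: "bij_betw \<sigma> {..<n} {..<n}"
    proof (rule bij_betwI[where g="\<lambda>k. if k = 0 then n - 1 else k - 1"])
      show "\<sigma> \<in> {..<n} \<rightarrow> {..<n}" using n by (auto simp: \<sigma>_def)
      show "(\<lambda>k. if k = 0 then n - 1 else k - 1) \<in> {..<n} \<rightarrow> {..<n}" using n by auto
    qed (use n in \<open>auto simp: \<sigma>_def\<close>)
    have mem: "l ! k \<in> \<Gamma>" if "k < n" for k using l that by (auto simp: n_def)
    have "(\<Sum>k<n. ?c (fst (l ! k), snd (l ! k))) \<le> (\<Sum>k<n. ?c (fst (l ! k), snd (l ! \<sigma> k)))"
      by (rule discrete_optimal_cyclically_monotone[OF fin p, where c="?c" and \<sigma>=\<sigma>, OF opt _ _ _ bij])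
        (use mem in \<open>auto simp: \<Gamma>_def mem_Times_iff\<close>)
    moreover obtain n' where n': "n = Suc n'" using n by (cases n) auto
    have "(\<Sum>k<n. ?c (fst (l ! k), snd (l ! \<sigma> k)))
       = (\<Sum>k<n'. dist (z (fst (l ! k))) (z (snd (l ! Suc k)))) + dist (z (fst (last l))) (z (snd (hd l)))"
      using False by (simp add: n' \<sigma>_def last_conv_nth hd_conv_nth n_def[symmetric])
    moreover have "dist (z (fst (last l))) (z (snd (hd l))) \<le> dist x (z (snd (hd l))) + dist (z (fst (last l))) x"
      by (metis add.commute dist_commute dist_triangle)
    ultimately show ?thesis
      unfolding chain_weight_eq[OF False] n_def[symmetric] by (simp add: n')
  qed simp
  define x0 where "x0 = (undefined :: 'a)"
  define u where "u y = (INF l\<in>lists \<Gamma>. chain_weight z x0 l y)" for y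
  \<comment> \<open>A walk ending at \<open>y\<close> is closed up at the price
    \<open>dist y x0\<close>, and closed walks have nonnegative length.\<close>
  have bdd: "bdd_below ((\<lambda>l. chain_weight z x0 l y) ` lists \<Gamma>)" for y
  proof (rule bdd_belowI2)
    fix l assume "l \<in> lists \<Gamma>"
    then have "0 \<le> chain_weight z x0 l x0" by (intro closed_chain) auto
    then show "- dist y x0 \<le> chain_weight z x0 l y" using chain_weight_lipschitz[of z x0 l x0 y] by simp
  qed
  have ne: "lists \<Gamma> \<noteq> {}" by auto
  have ul: "u y \<le> u y' + dist y' y" for y y'
  proof -
    have "u y - dist y' y \<le> u y'"
      unfolding u_def[of y']
    proof (rule cINF_greatest[OF ne])
      fix l assume "l \<in> lists \<Gamma>"
      then have "u y \<le> chain_weight z x0 l y" unfolding u_def by (rule cINF_lower[OF bdd])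
      then show "u y - dist y' y \<le> chain_weight z x0 l y'" using chain_weight_lipschitz[of z x0 l y y'] by simp
    qed
    then show ?thesis by simp
  qed
  have lip: "1-lipschitz_on UNIV u"
    unfolding lipschitz_real_iff
  proof (intro conjI allI)
    fix x y show "\<bar>u x - u y\<bar> \<le> 1 * dist x y"
      using ul[of x y] ul[of y x] by (simp add: dist_commute abs_le_iff)
  qed simp
  have tight: "u (z (snd e)) - u (z (fst e)) = ?c e" if e: "e \<in> \<Gamma>" for e
  proof -
    have "u (z (fst e)) + ?c e \<le> u (z (snd e))"
      unfolding u_def[of "z (snd e)"]
    proof (rule cINF_greatest[OF ne])
      fix l assume "l \<in> lists \<Gamma>"
      then have "l @ [e] \<in> lists \<Gamma>" using e by simp
      then have "u (z (fst e)) \<le> chain_weight z x0 (l @ [e]) (z (fst e))" unfolding u_def by (rule cINF_lower[OF bdd])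
      then show "u (z (fst e)) + ?c e \<le> chain_weight z x0 l (z (snd e))" by (simp add: chain_weight_snoc)
    qed
    then show ?thesis using ul[of "z (snd e)" "z (fst e)"] by simp
  qed
  have "(\<Sum>e\<in>H \<times> H. p e * ?c e) = (\<Sum>e\<in>H \<times> H. p e * (u (z (snd e)) - u (z (fst e))))"
  proof (rule sum.cong[OF refl])
    fix e assume e: "e \<in> H \<times> H"
    have "0 \<le> p e" by (rule discrete_plansD[OF p])
    then show "p e * ?c e = p e * (u (z (snd e)) - u (z (fst e)))"
      using tight[of e] e by (cases "p e = 0") (auto simp: \<Gamma>_def)
  qed
  also have "\<dots> = (\<Sum>i\<in>H. \<Sum>j\<in>H. p (i, j) * u (z j)) - (\<Sum>i\<in>H. \<Sum>j\<in>H. p (i, j) * u (z i))"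
    by (simp add: sum.cartesian_product' right_diff_distrib sum_subtractf split_beta)
  also have "(\<Sum>i\<in>H. \<Sum>j\<in>H. p (i, j) * u (z i)) = (\<Sum>i\<in>H. a i * u (z i))"
    using p by (simp add: sum_distrib_right[symmetric] discrete_plans_def)
  also have "(\<Sum>i\<in>H. \<Sum>j\<in>H. p (i, j) * u (z j)) = (\<Sum>j\<in>H. b j * u (z j))"
    using p by (subst sum.swap) (simp add: sum_distrib_right[symmetric] discrete_plans_def)
  finally show thesis by (rule that[OF p lip])
qed

text \<open>A consistent family of weights on finite sequences is realised by the digits of a
  point of an interval, with nested half-open intervals as cylinders; this replaces
  Kolmogorov's extension theorem.\<close>

primrec cyl_left :: "(nat list \<Rightarrow> real) \<Rightarrow> nat list \<Rightarrow> real" where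
  "cyl_left w [] = 0"
| "cyl_left w (c # z) = cyl_left w z + (\<Sum>c'<c. w (c' # z))"

text \<open>Words list the newest digit first, so refinement is \<open>Cons\<close> and coarsening
  is \<open>drop\<close>. The right end of child \<open>c\<close> is written as the left end of
  child \<open>Suc c\<close>, hence the shift inside \<open>LEAST\<close>.\<close>

primrec cyl_addr :: "(nat list \<Rightarrow> real) \<Rightarrow> nat \<Rightarrow> real \<Rightarrow> nat list" where
  "cyl_addr w 0 t = []"
| "cyl_addr w (Suc n) t = (LEAST c. t < cyl_left w (Suc c # cyl_addr w n t)) # cyl_addr w n t"

primrec cyl_words :: "(nat \<Rightarrow> nat) \<Rightarrow> nat \<Rightarrow> nat list set" where
  "cyl_words M 0 = {[]}"
| "cyl_words M (Suc n) = (\<lambda>(c, z). c # z) ` ({..<M n} \<times> cyl_words M n)"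

lemma finite_cyl_words: "finite (cyl_words M n)" by (induction n) auto

lemma length_cyl_words: "z \<in> cyl_words M n \<Longrightarrow> length z = n"
  by (induction n arbitrary: z) auto

text \<open>\<open>w z\<close> is the weight of the cylinder of all extensions of \<open>z\<close>;
  the sum condition is Kolmogorov consistency with \<open>M n\<close> letters at depth
  \<open>n\<close>.\<close>

locale weight_tree =
  fixes w :: "nat list \<Rightarrow> real" and M :: "nat \<Rightarrow> nat"
  assumes w_nonneg: "0 \<le> w z" and w_sum: "length z = n \<Longrightarrow> w z = (\<Sum>c<M n. w (c # z))"
begin

lemma cyl_left_Suc: "cyl_left w (Suc c # z) = cyl_left w (c # z) + w (c # z)" by simp

lemma cyl_left_mono: "c \<le> c' \<Longrightarrow> cyl_left w (c # z) \<le> cyl_left w (c' # z)"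
  using w_nonneg by (auto intro!: sum_mono2)

lemma cyl_left_le: "cyl_left w z \<le> cyl_left w (c # z)"
  using w_nonneg by (auto intro!: sum_nonneg)

lemma cyl_left_top:
  assumes "length z = n" shows "cyl_left w (M n # z) = cyl_left w z + w z"
  by (simp only: cyl_left.simps w_sum[OF assms])

text \<open>The intervals of the children tile that of the parent; \<open>M n # z\<close>, although
  not an admissible word, marks the right end of the interval of \<open>z\<close>.\<close>

lemma cyl_addr_bounds:
  assumes t: "0 \<le> t" "t < w []"
  shows "cyl_addr w n t \<in> cyl_words M n \<and> cyl_left w (cyl_addr w n t) \<le> t \<and>
    t < cyl_left w (cyl_addr w n t) + w (cyl_addr w n t)"
proof (induction n)
  case (Suc n)
  define z where "z = cyl_addr w n t"
  have z: "z \<in> cyl_words M n" "cyl_left w z \<le> t" "t < cyl_left w z + w z" using Suc by (auto simp: z_def)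
  have len: "length z = n" using z(1) by (rule length_cyl_words)
  have top: "t < cyl_left w (M n # z)" using z(3) cyl_left_top[OF len] by simp
  have "M n \<noteq> 0" using top z(2) by (cases "M n") auto
  then obtain k where k: "M n = Suc k" by (cases "M n") auto
  define c where "c = (LEAST c. t < cyl_left w (Suc c # z))"
  have top': "t < cyl_left w (Suc k # z)" using top unfolding k .
  have c1: "t < cyl_left w (Suc c # z)" unfolding c_def using top' by (rule LeastI)
  have "c \<le> k" unfolding c_def using top' by (rule Least_le)
  then have cM: "c < M n" using k by simp
  have c2: "cyl_left w (c # z) \<le> t"
  proof (cases c)
    case 0 then show ?thesis using z(2) by simp
  next
    case (Suc c')
    then have "\<not> t < cyl_left w (Suc c' # z)" using not_less_Least[of c' "\<lambda>c. t < cyl_left w (Suc c # z)"] by (simp add: c_def)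
    then show ?thesis using Suc by simp
  qed
  have "cyl_addr w (Suc n) t = c # z" by (simp add: c_def z_def)
  moreover have "c # z \<in> cyl_words M (Suc n)" using cM z(1) by auto
  moreover have "t < cyl_left w (c # z) + w (c # z)" using c1 by (simp only: cyl_left_Suc)
  ultimately show ?case using c2 by (simp only:)
qed (use t in auto)

lemma cyl_addr_unique:
  assumes "z \<in> cyl_words M n" "cyl_left w z \<le> t" "t < cyl_left w z + w z"
  shows "cyl_addr w n t = z \<and> 0 \<le> t \<and> t < w []"
  using assms
proof (induction n arbitrary: z)
  case (Suc n)
  then obtain c y where z: "z = c # y" "c < M n" "y \<in> cyl_words M n" by auto
  have len: "length y = n" using z(3) by (rule length_cyl_words)
  have t: "cyl_left w (c # y) \<le> t" "t < cyl_left w (Suc c # y)" using Suc.prems z by (auto simp: cyl_left_Suc)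
  have "cyl_left w (Suc c # y) \<le> cyl_left w (M n # y)" using z(2) by (intro cyl_left_mono) simp
  then have up: "t < cyl_left w y + w y" using t(2) cyl_left_top[OF len] by simp
  have lo: "cyl_left w y \<le> t" using t(1) cyl_left_le[of y c] by linarith
  have IH: "cyl_addr w n t = y" "0 \<le> t" "t < w []" using Suc.IH[OF z(3) lo up] by auto
  have "(LEAST c. t < cyl_left w (Suc c # y)) = c"
  proof (rule Least_equality)
    show "t < cyl_left w (Suc c # y)" by (rule t)
    fix c' assume c': "t < cyl_left w (Suc c' # y)"
    show "c \<le> c'"
    proof (rule ccontr)
      assume "\<not> c \<le> c'"
      then have "cyl_left w (Suc c' # y) \<le> cyl_left w (c # y)" by (intro cyl_left_mono) simp
      then show False using c' t(1) by linarith
    qed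
  qed
  then show ?case using IH z by simp
qed simp

text \<open>This is the point of the coding: a cylinder becomes a half-open interval of length
  \<open>w z\<close>, so Lebesgue measure gives it the prescribed weight.\<close>

lemma cyl_preimage:
  assumes "z \<in> cyl_words M n"
  shows "{t \<in> {0..<w []}. cyl_addr w n t = z} = {cyl_left w z..<cyl_left w z + w z}"
proof (intro equalityI subsetI)
  fix t assume "t \<in> {t \<in> {0..<w []}. cyl_addr w n t = z}"
  then show "t \<in> {cyl_left w z..<cyl_left w z + w z}" using cyl_addr_bounds[of t n] by auto
next
  fix t assume "t \<in> {cyl_left w z..<cyl_left w z + w z}"
  then show "t \<in> {t \<in> {0..<w []}. cyl_addr w n t = z}" using cyl_addr_unique[OF assms, of t] by auto
qed

abbreviation "\<Omega> \<equiv> restrict_space lborel {0..<w []}"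

lemma space_\<Omega>: "space \<Omega> = {0..<w []}" by (simp add: space_restrict_space)

lemma finite_measure_\<Omega>: "finite_measure \<Omega>"
  by (rule finite_measureI) (simp add: space_\<Omega> emeasure_restrict_space w_nonneg)

lemma measurable_cyl_addr [measurable]: "cyl_addr w n \<in> measurable \<Omega> (count_space UNIV)"
proof -
  have "cyl_addr w n \<in> measurable \<Omega> (count_space (cyl_words M n))"
  proof (rule measurable_count_space_eq_countable[THEN iffD2])
    show "countable (cyl_words M n)" using finite_cyl_words by (rule countable_finite)
    show "cyl_addr w n \<in> space \<Omega> \<rightarrow> cyl_words M n \<and> (\<forall>z\<in>cyl_words M n. cyl_addr w n -` {z} \<inter> space \<Omega> \<in> sets \<Omega>)"
    proof (intro conjI ballI)
      show "cyl_addr w n \<in> space \<Omega> \<rightarrow> cyl_words M n" using cyl_addr_bounds by (auto simp: space_\<Omega>)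
      fix z assume z: "z \<in> cyl_words M n"
      have e: "cyl_addr w n -` {z} \<inter> space \<Omega> = {cyl_left w z..<cyl_left w z + w z}"
        unfolding cyl_preimage[OF z, symmetric] space_\<Omega> by blast
      have "{cyl_left w z..<cyl_left w z + w z} \<subseteq> {0..<w []}" using cyl_preimage[OF z] by blast
      then show "cyl_addr w n -` {z} \<inter> space \<Omega> \<in> sets \<Omega>" unfolding e by (simp add: sets_restrict_space_iff)
    qed
  qed
  then show ?thesis by (rule measurable_compose) simp
qed

lemma measure_cyl: "z \<in> cyl_words M n \<Longrightarrow> measure \<Omega> {t \<in> space \<Omega>. cyl_addr w n t = z} = w z"
proof -
  assume z: "z \<in> cyl_words M n"
  have sub: "{cyl_left w z..<cyl_left w z + w z} \<subseteq> {0..<w []}" using cyl_preimage[OF z] by blast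
  have "{t \<in> space \<Omega>. cyl_addr w n t = z} = {cyl_left w z..<cyl_left w z + w z}"
    using cyl_preimage[OF z] by (simp add: space_\<Omega>)
  then show ?thesis using sub w_nonneg[of z] by (simp add: measure_restrict_space)
qed

end

section \<open>Discretisation of measures and limits of discrete plans\<close>

lemma integral_finite_valued:
  fixes F :: "'c \<Rightarrow> real"
  assumes "finite_measure M" and h: "h \<in> measurable M (count_space UNIV)"
    and H: "finite H" "\<And>t. t \<in> space M \<Longrightarrow> h t \<in> H"
  shows "integrable M (\<lambda>t. F (h t))" "(\<integral>t. F (h t) \<partial>M) = (\<Sum>z\<in>H. measure M {t \<in> space M. h t = z} * F z)"
proof -
  interpret finite_measure M by fact
  have s: "{t \<in> space M. h t = z} \<in> sets M" for z
  proof -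
    have "{t \<in> space M. h t = z} = h -` {z} \<inter> space M" by auto
    then show ?thesis using measurable_sets[OF h, of "{z}"] by simp
  qed
  have eq: "F (h t) = (\<Sum>z\<in>H. indicator {t \<in> space M. h t = z} t * F z)" if t: "t \<in> space M" for t
  proof -
    have "(\<Sum>z\<in>H. indicator {t \<in> space M. h t = z} t * F z) = (\<Sum>z\<in>H. if h t = z then F z else 0)"
      using t by (intro sum.cong) (auto simp: indicator_def)
    also have "\<dots> = F (h t)" using H t by (simp add: sum.delta)
    finally show ?thesis by simp
  qed
  have ii: "integrable M (\<lambda>t. indicator {t \<in> space M. h t = z} t * F z)" for z
    using s by (intro integrable_mult_left integrable_real_indicator) (auto simp: emeasure_eq_measure)
  have i: "integrable M (\<lambda>t. \<Sum>z\<in>H. indicator {t \<in> space M. h t = z} t * F z)"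
    by (intro Bochner_Integration.integrable_sum ii)
  show "integrable M (\<lambda>t. F (h t))"
    using i by (subst Bochner_Integration.integrable_cong[OF refl eq]) auto
  have "(\<integral>t. F (h t) \<partial>M) = (\<integral>t. (\<Sum>z\<in>H. indicator {t \<in> space M. h t = z} t * F z) \<partial>M)"
    by (rule Bochner_Integration.integral_cong[OF refl eq])
  also have "\<dots> = (\<Sum>z\<in>H. measure M {t \<in> space M. h t = z} * F z)"
    using s by (subst Bochner_Integration.integral_sum[OF ii]) (simp add: Int_def cong: conj_cong)
  finally show "(\<integral>t. F (h t) \<partial>M) = (\<Sum>z\<in>H. measure M {t \<in> space M. h t = z} * F z)" .
qed

text \<open>Within the closure of the centers, the points at distance at least \<open>e\<close> from
  the first \<open>N\<close> centers decrease to the empty set, so a large \<open>N\<close> leaves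
  measure less than \<open>e\<close>. On that remainder the distance to any center is at most
  \<open>R\<close>; the other points contribute at most \<open>e\<close> times the total
  mass.\<close>

lemma cell_index_exists:
  fixes \<kappa> :: "'a::metric_space measure" and x :: "nat \<Rightarrow> 'a"
  assumes \<kappa>: "finite_borel_measure \<kappa>" and x: "emeasure \<kappa> (- closure (range x)) = 0"
    and R: "\<And>i j. dist (x i) (x j) \<le> R" and e: "0 < e"
  obtains idx N where "idx \<in> measurable borel (count_space UNIV)" "\<And>y. idx y \<le> (N :: nat)"
    "(\<integral>\<^sup>+y. ennreal (dist y (x (idx y))) \<partial>\<kappa>) \<le> ennreal ((measure \<kappa> UNIV + R) * e)"
proof -
  note D = finite_borel_measureD[OF \<kappa>]
  interpret finite_measure \<kappa> by (rule D)
  let ?S = "closure (range x)"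
  have R0: "0 \<le> R" using R[of 0 0] by simp
  define B where "B n = {y \<in> ?S. \<forall>i<n. e \<le> dist y (x i)}" for n :: nat
  have Bc: "closed (B n)" for n
  proof -
    have "B n = ?S \<inter> (\<Inter>i\<in>{..<n}. {y. e \<le> dist y (x i)})" by (auto simp: B_def)
    moreover have "closed {y. e \<le> dist y (x i)}" for i
      by (intro closed_Collect_le continuous_intros)
    ultimately show ?thesis by (simp only:) (intro closed_Int closed_closure closed_INT ballI; assumption?)
  qed
  have Bs: "B n \<in> sets \<kappa>" for n using Bc D(2) by (auto intro: borel_closed)
  have "B (Suc n) \<subseteq> B n" for n unfolding B_def by auto
  then have "decseq B" by (intro decseq_SucI)
  moreover have "range B \<subseteq> sets \<kappa>" using Bs by blast
  ultimately have "(\<lambda>n. measure \<kappa> (B n)) \<longlonglongrightarrow> measure \<kappa> (\<Inter>n. B n)"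
    by (intro finite_Lim_measure_decseq)
  moreover have "(\<Inter>n. B n) = {}"
  proof -
    have "\<exists>n. y \<notin> B n" for y
    proof (cases "y \<in> ?S")
      case True
      then obtain i where "dist (x i) y < e" using e by (auto simp: closure_approachable)
      then have "y \<notin> B (Suc i)" by (auto simp: B_def dist_commute not_le)
      then show ?thesis ..
    qed (auto simp: B_def)
    then show ?thesis by auto
  qed
  ultimately have "(\<lambda>n. measure \<kappa> (B n)) \<longlonglongrightarrow> 0" by simp
  from order_tendstoD(2)[OF this e] obtain N where N: "measure \<kappa> (B N) < e"
    by (auto simp: eventually_sequentially)
  \<comment> \<open>Index \<open>N\<close> is a catch-all: it is taken when none of the first
    \<open>N\<close> centers is close, and still names an actual center.\<close>
  define idx where "idx y = (LEAST i. i = N \<or> dist y (x i) < e)" for y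
  have idxN: "idx y \<le> N" for y unfolding idx_def by (rule Least_le) simp
  have idxP: "idx y = N \<or> dist y (x (idx y)) < e" for y
    unfolding idx_def by (rule LeastI[of _ N]) simp
  have idxB: "y \<in> B N" if "y \<in> ?S" "\<not> dist y (x (idx y)) < e" for y
  proof -
    have "\<not> dist y (x i) < e" if "i < N" for i
    proof
      assume "dist y (x i) < e"
      then have "idx y \<le> i" unfolding idx_def by (intro Least_le) simp
      then show False using idxP[of y] \<open>\<not> dist y (x (idx y)) < e\<close> that by auto
    qed
    then show ?thesis using that(1) by (simp add: B_def not_less)
  qed
  have dm: "(\<lambda>y. dist y (x i)) \<in> borel_measurable borel" for i
    by (intro borel_measurable_continuous_onI continuous_intros)
  have im: "idx \<in> measurable borel (count_space UNIV)"
    unfolding idx_def by (intro measurable_Least) (use dm in measurable)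
  have distR: "dist y (x i) \<le> R" if "y \<in> ?S" for y i
  proof -
    have "closed {y. dist y (x i) \<le> R}" by (intro closed_Collect_le continuous_intros)
    moreover have "range x \<subseteq> {y. dist y (x i) \<le> R}" using R by auto
    ultimately have "?S \<subseteq> {y. dist y (x i) \<le> R}" by (rule closure_minimal[rotated])
    then show ?thesis using that by auto
  qed
  have AES: "AE y in \<kappa>. y \<in> ?S"
    using x D(2,3) by (intro AE_I[where N="- ?S"]) auto
  have "(\<integral>\<^sup>+y. ennreal (dist y (x (idx y))) \<partial>\<kappa>) \<le> (\<integral>\<^sup>+y. ennreal e + ennreal R * indicator (B N) y \<partial>\<kappa>)"
  proof (rule nn_integral_mono_AE)
    show "AE y in \<kappa>. ennreal (dist y (x (idx y))) \<le> ennreal e + ennreal R * indicator (B N) y"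
      using AES
    proof eventually_elim
      fix y assume y: "y \<in> ?S"
      show "ennreal (dist y (x (idx y))) \<le> ennreal e + ennreal R * indicator (B N) y"
      proof (cases "dist y (x (idx y)) < e")
        case True
        then have "ennreal (dist y (x (idx y))) \<le> ennreal e" by (intro ennreal_leI) simp
        then show ?thesis by (rule order_trans) simp
      next
        case False
        then have "y \<in> B N" using idxB y by simp
        moreover have "ennreal (dist y (x (idx y))) \<le> ennreal R" using distR[OF y] by (rule ennreal_leI)
        ultimately show ?thesis by (simp add: add_increasing)
      qed
    qed
  qed
  also have "\<dots> = ennreal e * emeasure \<kappa> UNIV + ennreal R * emeasure \<kappa> (B N)"
    using Bs D(3) by (subst nn_integral_add) (auto simp: nn_integral_cmult)
  also have "\<dots> \<le> ennreal ((measure \<kappa> UNIV + R) * e)"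
  proof -
    have "R * measure \<kappa> (B N) \<le> R * e" using N R0 by (intro mult_left_mono) auto
    then have "e * measure \<kappa> UNIV + R * measure \<kappa> (B N) \<le> (measure \<kappa> UNIV + R) * e" by (simp add: algebra_simps)
    then show ?thesis using e R0
      by (simp add: emeasure_eq_measure ennreal_mult[symmetric] ennreal_plus[symmetric] ennreal_leI del: ennreal_plus)
  qed
  finally show thesis by (rule that[OF im idxN])
qed

lemma cyl_words_drop: "z \<in> cyl_words M (n + j) \<Longrightarrow> drop j z \<in> cyl_words M n"
proof (induction j arbitrary: z)
  case (Suc j)
  then have "z \<in> cyl_words M (Suc (n + j))" by simp
  then obtain c y where "z = c # y" "y \<in> cyl_words M (n + j)" by auto
  then show ?case using Suc.IH by simp
qed simp

lemma cyl_words_nth: "z \<in> cyl_words M (Suc k) \<Longrightarrow> n \<le> k \<Longrightarrow> z ! (k - n) < M n"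
proof (induction k arbitrary: z)
  case (Suc k)
  then obtain c y where z: "z = c # y" "c < M (Suc k)" "y \<in> cyl_words M (Suc k)" by auto
  show ?case
  proof (cases "n = Suc k")
    case False
    then have "n \<le> k" using Suc.prems by simp
    then have "y ! (k - n) < M n" using Suc.IH z by blast
    then show ?thesis using \<open>n \<le> k\<close> z by (simp add: Suc_diff_le)
  qed (use z in simp)
qed auto

text \<open>Summable expected increments make the sequence Cauchy almost everywhere. The distances
  are assumed measurable separately, since in a nonseparable target this does not follow from
  measurability of the sequence.\<close>

lemma converging_measurable_sequence:
  fixes Z :: "nat \<Rightarrow> 'w \<Rightarrow> 'b::complete_space"
  assumes Z: "\<And>n. Z n \<in> borel_measurable \<Omega>"
    and d: "\<And>n. (\<lambda>t. dist (Z n t) (Z (Suc n) t)) \<in> borel_measurable \<Omega>"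
    and fin: "(\<Sum>n. \<integral>\<^sup>+t. ennreal (dist (Z n t) (Z (Suc n) t)) \<partial>\<Omega>) < \<infinity>"
  obtains Y where "Y \<in> borel_measurable \<Omega>" "AE t in \<Omega>. (\<lambda>n. Z n t) \<longlonglongrightarrow> Y t"
proof -
  let ?s = "\<lambda>t. \<Sum>n. ennreal (dist (Z n t) (Z (Suc n) t))"
  have sm [measurable]: "?s \<in> borel_measurable \<Omega>" using d by measurable
  have "(\<integral>\<^sup>+t. ?s t \<partial>\<Omega>) = (\<Sum>n. \<integral>\<^sup>+t. ennreal (dist (Z n t) (Z (Suc n) t)) \<partial>\<Omega>)"
    using d by (intro nn_integral_suminf) measurable
  then have "(\<integral>\<^sup>+t. ?s t \<partial>\<Omega>) \<noteq> \<infinity>" using fin by simp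
  then have AE: "AE t in \<Omega>. ?s t \<noteq> \<infinity>" by (rule nn_integral_PInf_AE[OF sm])
  have conv: "convergent (\<lambda>n. Z n t)" if "?s t \<noteq> \<infinity>" for t
  proof (rule Cauchy_convergent)
    have sum: "summable (\<lambda>n. dist (Z n t) (Z (Suc n) t))"
      using that by (intro summable_suminf_not_top) auto
    show "Cauchy (\<lambda>n. Z n t)"
    proof (rule metric_CauchyI)
      fix e :: real assume "0 < e"
      from summable_partial_sum_bound[OF sum this] obtain N
        where N: "\<And>m n. m \<ge> N \<Longrightarrow> norm (\<Sum>k=m..n. dist (Z k t) (Z (Suc k) t)) < e" by metis
      have *: "dist (Z m t) (Z n t) < e" if "N \<le> m" "m < n" for m n
      proof -
        have "dist (Z m t) (Z (Suc (m + j)) t) \<le> (\<Sum>k=m..m+j. dist (Z k t) (Z (Suc k) t))" for j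
        proof (induction j)
          case (Suc j)
          have "dist (Z m t) (Z (Suc (m + Suc j)) t) \<le> dist (Z m t) (Z (Suc (m + j)) t) + dist (Z (Suc (m + j)) t) (Z (Suc (Suc (m + j))) t)"
            by (simp add: dist_triangle)
          then show ?case using Suc by simp
        qed simp
        from this[of "n - Suc m"] N[OF that(1), of "n - 1"] that(2) show ?thesis by simp
      qed
      show "\<exists>M. \<forall>m\<ge>M. \<forall>n\<ge>M. dist (Z m t) (Z n t) < e"
      proof (intro exI[of _ N] allI impI)
        fix m n assume "N \<le> m" "N \<le> n"
        then show "dist (Z m t) (Z n t) < e"
          using *[of m n] *[of n m] \<open>0 < e\<close> by (cases m n rule: linorder_cases) (auto simp: dist_commute)
      qed
    qed
  qed
  \<comment> \<open>On the exceptional set the sequence is replaced by the constant sequence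
    \<open>Z 0 t\<close>, which makes \<open>Y\<close> an everywhere limit of measurable
    functions.\<close>
  define Y where "Y t = (if ?s t \<noteq> \<infinity> then lim (\<lambda>n. Z n t) else Z 0 t)" for t
  have "Y \<in> borel_measurable \<Omega>"
  proof (rule borel_measurable_LIMSEQ_metric)
    show "(\<lambda>t. if ?s t \<noteq> \<infinity> then Z n t else Z 0 t) \<in> borel_measurable \<Omega>" for n
      using Z by measurable
    fix t
    show "(\<lambda>n. if ?s t \<noteq> \<infinity> then Z n t else Z 0 t) \<longlonglongrightarrow> Y t"
    proof (cases "?s t \<noteq> \<infinity>")
      case True
      then show ?thesis unfolding Y_def if_P[OF True] using conv[OF True] by (simp only: convergent_LIMSEQ_iff)
    next
      case False
      show ?thesis unfolding Y_def if_not_P[OF False] by (rule tendsto_const)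
    qed
  qed
  moreover have "AE t in \<Omega>. (\<lambda>n. Z n t) \<longlonglongrightarrow> Y t"
    using AE
  proof eventually_elim
    case (elim t)
    show ?case unfolding Y_def if_P[OF elim] using conv[OF elim] by (simp only: convergent_LIMSEQ_iff)
  qed
  ultimately show thesis by (rule that)
qed

text \<open>A product of compact intervals is compact; countability of the index type turns this
  into sequential compactness.\<close>

lemma pointwise_convergent_subsequence:
  fixes w :: "nat \<Rightarrow> 'c::countable \<Rightarrow> real"
  assumes "\<And>k z. w k z \<in> {0..m}"
  obtains r W where "strict_mono (r :: nat \<Rightarrow> nat)" "\<And>z. (\<lambda>j. w (r j) z) \<longlonglongrightarrow> W z"
proof -
  have "compact (PiE UNIV (\<lambda>_ :: 'c. {0..m}))" by (rule compact_box_functions) simp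
  then have "seq_compact (PiE UNIV (\<lambda>_ :: 'c. {0..m}))" by (rule compact_imp_seq_compact)
  moreover have "\<forall>k. w k \<in> PiE UNIV (\<lambda>_. {0..m})" using assms by auto
  ultimately obtain W r where r: "strict_mono r" "(w \<circ> r) \<longlonglongrightarrow> W" by (rule seq_compactE)
  have "(\<lambda>j. w (r j) z) \<longlonglongrightarrow> W z" for z
  proof -
    have "(\<lambda>j. (w \<circ> r) j z) \<longlonglongrightarrow> W z"
      by (rule continuous_on_tendsto_compose[OF continuous_on_product_coordinates[of z] r(2)]) auto
    then show ?thesis by simp
  qed
  then show thesis using that r(1) by blast
qed

lemma bounded_Lip_integral_diff:
  assumes \<mu>: "finite_borel_measure \<mu>" and g: "g \<in> Lip_b" "1-lipschitz_on UNIV g"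
    and s: "integrable \<mu> (\<lambda>y. g (s y))"
    and d: "(\<lambda>y. dist y (s y)) \<in> borel_measurable borel" "(\<integral>\<^sup>+y. ennreal (dist y (s y)) \<partial>\<mu>) \<le> ennreal e" "0 \<le> e"
  shows "\<bar>(\<integral>y. g (s y) \<partial>\<mu>) - (\<integral>y. g y \<partial>\<mu>)\<bar> \<le> e"
proof -
  note D = finite_borel_measureD[OF \<mu>]
  have dm: "(\<lambda>y. dist y (s y)) \<in> borel_measurable \<mu>" using d(1) D(2) by (simp cong: measurable_cong_sets)
  have di: "integrable \<mu> (\<lambda>y. dist y (s y))"
    using dm d(2) by (intro integrableI_nonneg) (auto intro: le_less_trans)
  have "(\<integral>y. g (s y) \<partial>\<mu>) - (\<integral>y. g y \<partial>\<mu>) = (\<integral>y. g (s y) - g y \<partial>\<mu>)"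
    by (rule Bochner_Integration.integral_diff[symmetric, OF s Lip_b_integrable[OF \<mu> g(1)]])
  also have "\<bar>\<dots>\<bar> \<le> (\<integral>y. \<bar>g (s y) - g y\<bar> \<partial>\<mu>)" by (rule integral_abs_bound)
  also have "\<dots> \<le> (\<integral>y. dist y (s y) \<partial>\<mu>)"
  proof (rule integral_mono[OF _ di])
    show "integrable \<mu> (\<lambda>y. \<bar>g (s y) - g y\<bar>)"
      by (intro integrable_abs Bochner_Integration.integrable_diff s Lip_b_integrable[OF \<mu> g(1)])
    show "\<bar>g (s y) - g y\<bar> \<le> dist y (s y)" for y
      using g(2) unfolding lipschitz_real_iff by (metis dist_commute mult_1)
  qed
  also have "\<dots> \<le> e"
  proof -
    have "ennreal (\<integral>y. dist y (s y) \<partial>\<mu>) = (\<integral>\<^sup>+y. ennreal (dist y (s y)) \<partial>\<mu>)"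
      by (rule nn_integral_eq_integral[symmetric, OF di]) simp
    then have "ennreal (\<integral>y. dist y (s y) \<partial>\<mu>) \<le> ennreal e" using d(2) by (simp only:)
    then show ?thesis using ennreal_le_iff[OF d(3)] by blast
  qed
  finally show ?thesis .
qed

text \<open>The dual bound \<open>c\<close> controls the optimal discrete plans on nested finite partitions;
  along a subsequence their cell weights converge, and the limit weights are realised on an
  interval by the digits of a point.\<close>

theorem kantorovich_plan_exists:
  fixes \<mu> \<nu> :: "'a::complete_space measure" and x :: "nat \<Rightarrow> 'a"
  assumes \<mu>: "finite_borel_measure \<mu>" and \<nu>: "finite_borel_measure \<nu>"
    and mass: "emeasure \<mu> UNIV = emeasure \<nu> UNIV"
    and x\<mu>: "emeasure \<mu> (- closure (range x)) = 0" and x\<nu>: "emeasure \<nu> (- closure (range x)) = 0"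
    and R: "\<And>i j. dist (x i) (x j) \<le> R"
    and dual: "\<And>u. u \<in> Lip_b \<Longrightarrow> 1-lipschitz_on UNIV u \<Longrightarrow> (\<integral>y. u y \<partial>\<nu>) - (\<integral>y. u y \<partial>\<mu>) \<le> c"
  shows "\<exists>\<gamma>\<in>transport_plans \<mu> \<nu>. transport_cost \<gamma> \<le> ennreal c"
proof -

  \<comment> \<open>Nested finite partitions\<close>
  note D\<mu> = finite_borel_measureD[OF \<mu>] and D\<nu> = finite_borel_measureD[OF \<nu>]
  let ?\<kappa> = "measure_add \<mu> \<nu>"
  have \<kappa>: "finite_borel_measure ?\<kappa>" by (rule finite_borel_measure_add[OF \<mu> \<nu>])
  have x\<kappa>: "emeasure ?\<kappa> (- closure (range x)) = 0"
    using x\<mu> x\<nu> D\<mu> D\<nu> by (subst emeasure_measure_add) auto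
  define C where "C = measure ?\<kappa> UNIV + R"
  have R0: "0 \<le> R" using R[of 0 0] by simp
  have C0: "0 \<le> C" using R0 by (simp add: C_def)
  \<comment> \<open>Geometric decay makes the increments of the approximating sequence summable,
    which almost sure convergence will need.\<close>
  define e where "e n = C * (1 / 2) ^ n" for n :: nat
  have e0: "0 \<le> e n" for n using C0 by (simp add: e_def)
  have edec: "e k \<le> e n" if "n \<le> k" for n k
    unfolding e_def using C0 that by (intro mult_left_mono power_decreasing) auto
  have elim: "e \<longlonglongrightarrow> 0"
  proof -
    have "(\<lambda>n. C * (1 / 2 :: real) ^ n) \<longlonglongrightarrow> C * 0" by (intro tendsto_intros LIMSEQ_realpow_zero) auto
    then show ?thesis by (simp add: e_def[abs_def])
  qed
  have "\<forall>n. \<exists>idx N. idx \<in> measurable borel (count_space UNIV) \<and> (\<forall>y. idx y \<le> (N :: nat)) \<and>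
    (\<integral>\<^sup>+y. ennreal (dist y (x (idx y))) \<partial>?\<kappa>) \<le> ennreal (e n)"
  proof
    fix n :: nat
    show "\<exists>idx N. idx \<in> measurable borel (count_space UNIV) \<and> (\<forall>y. idx y \<le> (N :: nat)) \<and>
      (\<integral>\<^sup>+y. ennreal (dist y (x (idx y))) \<partial>?\<kappa>) \<le> ennreal (e n)"
      by (rule cell_index_exists[OF \<kappa> x\<kappa> R, of "(1 / 2) ^ n"]) (auto simp: e_def C_def)
  qed
  from choice[OF this] obtain idx where "\<forall>n. \<exists>N. idx n \<in> measurable borel (count_space UNIV) \<and> (\<forall>y. idx n y \<le> (N :: nat)) \<and>
    (\<integral>\<^sup>+y. ennreal (dist y (x (idx n y))) \<partial>?\<kappa>) \<le> ennreal (e n)" ..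
  from choice[OF this] obtain N where "\<forall>n. idx n \<in> measurable borel (count_space UNIV) \<and> (\<forall>y. idx n y \<le> (N n :: nat)) \<and>
    (\<integral>\<^sup>+y. ennreal (dist y (x (idx n y))) \<partial>?\<kappa>) \<le> ennreal (e n)" ..
  then have idx [measurable]: "\<And>n. idx n \<in> measurable borel (count_space UNIV)" and idxN: "\<And>n y. idx n y \<le> N n"
    and idxe: "\<And>n. (\<integral>\<^sup>+y. ennreal (dist y (x (idx n y))) \<partial>?\<kappa>) \<le> ennreal (e n)" by blast+
  define s where "s n y = x (idx n y)" for n y
  have sd [measurable]: "(\<lambda>y. dist y (s n y)) \<in> borel_measurable borel" for n
    unfolding s_def
    by (rule measurable_compose_countable[where f="\<lambda>i y. dist y (x i)" and g="idx n"])
      (auto intro!: borel_measurable_continuous_onI continuous_intros idx)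
  have se: "(\<integral>\<^sup>+y. ennreal (dist y (s n y)) \<partial>\<mu>) \<le> ennreal (e n)" "(\<integral>\<^sup>+y. ennreal (dist y (s n y)) \<partial>\<nu>) \<le> ennreal (e n)" for n
  proof -
    have "(\<integral>\<^sup>+y. ennreal (dist y (s n y)) \<partial>?\<kappa>) = (\<integral>\<^sup>+y. ennreal (dist y (s n y)) \<partial>\<mu>) + (\<integral>\<^sup>+y. ennreal (dist y (s n y)) \<partial>\<nu>)"
      using D\<mu>(2) D\<nu>(2) by (intro nn_integral_measure_add) (auto cong: measurable_cong_sets)
    then have "(\<integral>\<^sup>+y. ennreal (dist y (s n y)) \<partial>\<mu>) + (\<integral>\<^sup>+y. ennreal (dist y (s n y)) \<partial>\<nu>) \<le> ennreal (e n)"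
      using idxe[of n] by (simp add: s_def)
    then show "(\<integral>\<^sup>+y. ennreal (dist y (s n y)) \<partial>\<mu>) \<le> ennreal (e n)" "(\<integral>\<^sup>+y. ennreal (dist y (s n y)) \<partial>\<nu>) \<le> ennreal (e n)"
      by (auto intro: order_trans[rotated])
  qed
  \<comment> \<open>\<open>h n y\<close> will be the word of the cell indices of \<open>y\<close> in
    the first \<open>n\<close> partitions, newest first. Passing to words makes the partitions
    nested although cells of different levels are unrelated.\<close>
  define H where "H = cyl_words (\<lambda>n. Suc (N n))"
  define h where "h = rec_nat (\<lambda>_. []) (\<lambda>n g y. idx n y # g y)"
  have h0: "h 0 y = []" and hS: "h (Suc n) y = idx n y # h n y" for n y by (auto simp: h_def)
  have hH: "h n y \<in> H n" for n y
    by (induction n) (use idxN in \<open>auto simp: H_def h0 hS less_Suc_eq_le\<close>)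
  have hm: "h n \<in> measurable borel (count_space UNIV)" for n
  proof (induction n)
    case 0 show ?case by (simp add: h0[abs_def])
  next
    case (Suc n)
    have "(\<lambda>y. idx n y # h n y) \<in> measurable borel (count_space UNIV)"
      by (rule measurable_compose_countable[where f="\<lambda>l y. idx n y # l" and g="h n"])
        (auto intro: Suc measurable_compose[OF idx])
    then show ?case by (simp add: hS[abs_def])
  qed
  have hdrop: "drop j (h (n + j) y) = h n y" for j n y by (induction j) (auto simp: hS)
  have hlen: "length (h n y) = n" for n y using length_cyl_words[of "h n y"] hH[of n y] unfolding H_def by blast
  have Hfin: "finite (H n)" for n unfolding H_def by (rule finite_cyl_words)
  have hint: "integrable \<kappa>' (\<lambda>y. F (h n y))"
     "(\<integral>y. F (h n y) \<partial>\<kappa>') = (\<Sum>l\<in>H n. measure \<kappa>' {y. h n y = l} * F l)"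
    if "finite_borel_measure \<kappa>'" for \<kappa>' :: "'a measure" and n and F :: "nat list \<Rightarrow> real"
  proof -
    note D = finite_borel_measureD[OF that]
    have hm': "h n \<in> measurable \<kappa>' (count_space UNIV)" using hm D(2) by (simp cong: measurable_cong_sets)
    show "integrable \<kappa>' (\<lambda>y. F (h n y))"
      by (rule integral_finite_valued(1)[OF D(1) hm' Hfin hH])
    show "(\<integral>y. F (h n y) \<partial>\<kappa>') = (\<Sum>l\<in>H n. measure \<kappa>' {y. h n y = l} * F l)"
      using integral_finite_valued(2)[OF D(1) hm' Hfin hH, where F=F] D(3) by simp
  qed
  \<comment> \<open>Only the newest index locates a word. In a word of length \<open>Suc n\<close>
    that index belongs to partition \<open>n\<close>, hence the shift by one in what
    follows.\<close>
  define pt where "pt l = x (hd l)" for l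
  have ptS: "pt (h (Suc n) y) = s n y" for n y by (simp add: pt_def hS s_def)
  define m where "m = measure \<mu> UNIV"
  have m\<nu>: "measure \<nu> UNIV = m" using mass by (simp add: m_def measure_def)
  define a where "a n l = measure \<mu> {y. h n y = l}" for n l
  define b where "b n l = measure \<nu> {y. h n y = l}" for n l
  have suma: "sum (a n) (H n) = m" for n using hint(2)[OF \<mu>, of "\<lambda>_. 1" n] D\<mu>(3) by (simp add: a_def m_def)
  have sumb: "sum (b n) (H n) = m" for n using hint(2)[OF \<nu>, of "\<lambda>_. 1" n] D\<nu>(3) by (simp add: b_def m\<nu>)

  \<comment> \<open>Optimal plans on the cells\<close>
  have discrete: "\<exists>p\<in>discrete_plans (H (Suc k)) (a (Suc k)) (b (Suc k)).
      (\<Sum>z\<in>H (Suc k) \<times> H (Suc k). p z * dist (pt (fst z)) (pt (snd z))) \<le> c + 2 * e k" for k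
  proof -
    obtain p u where p: "p \<in> discrete_plans (H (Suc k)) (a (Suc k)) (b (Suc k))" and u: "1-lipschitz_on UNIV u"
      and pu: "(\<Sum>z\<in>H (Suc k) \<times> H (Suc k). p z * dist (pt (fst z)) (pt (snd z)))
        = (\<Sum>j\<in>H (Suc k). b (Suc k) j * u (pt j)) - (\<Sum>i\<in>H (Suc k). a (Suc k) i * u (pt i))"
      by (rule discrete_kantorovich[OF Hfin, of "Suc k" "a (Suc k)" "b (Suc k)" pt]) (auto simp: suma sumb, auto simp: a_def b_def)
    \<comment> \<open>The discrete potential is Lipschitz but possibly unbounded; truncation at
      \<open>B\<close> leaves its values at the centers unchanged and admits it to
      \<open>dual\<close>. Replacing points by centers costs \<open>e k\<close> for either measure,
      hence \<open>2 * e k\<close>.\<close>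
    define B where "B = \<bar>u (x 0)\<bar> + R"
    define g where "g y = max (- B) (min B (u y))" for y
    have ux: "g (x i) = u (x i)" for i
    proof -
      have "\<bar>u (x i) - u (x 0)\<bar> \<le> 1 * dist (x i) (x 0)" using u by (simp only: lipschitz_real_iff)
      then have "\<bar>u (x i)\<bar> \<le> B" using R[of i 0] by (simp add: B_def)
      then show ?thesis by (auto simp: g_def)
    qed
    have g1: "1-lipschitz_on UNIV g" unfolding g_def by (rule Lip_b_min_max[OF u])
    have gb: "g \<in> Lip_b" by (rule Lip_bI[OF g1, where M="\<bar>B\<bar>"]) (auto simp: g_def)
    have gs: "integrable \<kappa>' (\<lambda>y. g (s k y)) \<and> (\<integral>y. g (s k y) \<partial>\<kappa>') = (\<Sum>l\<in>H (Suc k). measure \<kappa>' {y. h (Suc k) y = l} * u (pt l))"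
      if "finite_borel_measure \<kappa>'" for \<kappa>' :: "'a measure"
      using hint[OF that, of "\<lambda>l. u (pt l)" "Suc k"] by (simp add: ptS s_def ux)
    have "\<bar>(\<integral>y. g (s k y) \<partial>\<mu>) - (\<integral>y. g y \<partial>\<mu>)\<bar> \<le> e k"
      using gs[OF \<mu>] by (intro bounded_Lip_integral_diff[OF \<mu> gb g1 _ sd se(1) e0]) simp
    moreover have "\<bar>(\<integral>y. g (s k y) \<partial>\<nu>) - (\<integral>y. g y \<partial>\<nu>)\<bar> \<le> e k"
      using gs[OF \<nu>] by (intro bounded_Lip_integral_diff[OF \<nu> gb g1 _ sd se(2) e0]) simp
    moreover have "(\<integral>y. g y \<partial>\<nu>) - (\<integral>y. g y \<partial>\<mu>) \<le> c" by (rule dual[OF gb g1])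
    ultimately have "(\<integral>y. g (s k y) \<partial>\<nu>) - (\<integral>y. g (s k y) \<partial>\<mu>) \<le> c + 2 * e k" by linarith
    then show ?thesis using p pu gs[OF \<mu>] gs[OF \<nu>] unfolding a_def b_def by (intro bexI[of _ p]) auto
  qed
  then have "\<forall>k. \<exists>p. p \<in> discrete_plans (H (Suc k)) (a (Suc k)) (b (Suc k)) \<and>
      (\<Sum>z\<in>H (Suc k) \<times> H (Suc k). p z * dist (pt (fst z)) (pt (snd z))) \<le> c + 2 * e k" by blast
  from choice[OF this] obtain p where "\<forall>k. p k \<in> discrete_plans (H (Suc k)) (a (Suc k)) (b (Suc k)) \<and>
      (\<Sum>z\<in>H (Suc k) \<times> H (Suc k). p k z * dist (pt (fst z)) (pt (snd z))) \<le> c + 2 * e k" ..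
  then have p: "p k \<in> discrete_plans (H (Suc k)) (a (Suc k)) (b (Suc k))"
    and pc: "(\<Sum>z\<in>H (Suc k) \<times> H (Suc k). p k z * dist (pt (fst z)) (pt (snd z))) \<le> c + 2 * e k" for k by blast+

  \<comment> \<open>Pairs of words coded as words over one alphabet\<close>
  define f1 where "f1 = fst \<circ> prod_decode"
  define f2 where "f2 = snd \<circ> prod_decode"
  \<comment> \<open>Large enough for the codes of all admissible pairs of digits; letters below
    \<open>M n\<close> that code no such pair will receive weight 0.\<close>
  define M where "M n = Suc (Max (prod_encode ` ({..N n} \<times> {..N n})))" for n
  define CW where "CW = cyl_words M"
  define ZZ where "ZZ n = (\<lambda>(l, l'). map2 (\<lambda>i j. prod_encode (i, j)) l l') ` (H n \<times> H n)" for n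
  have f12: "map f1 (map2 (\<lambda>i j. prod_encode (i, j)) l l') = l" "map f2 (map2 (\<lambda>i j. prod_encode (i, j)) l l') = l'"
    if "l \<in> H n" "l' \<in> H n" for l l' n
    using length_cyl_words that unfolding H_def f1_def f2_def
    by (auto intro!: nth_equalityI)
  have ZCW: "map2 (\<lambda>i j. prod_encode (i, j)) l l' \<in> CW n" if "l \<in> H n" "l' \<in> H n" for l l' n
    using that
  proof (induction n arbitrary: l l')
    case (Suc n)
    then obtain i y i' y' where l: "l = i # y" "l' = i' # y'" "i \<le> N n" "i' \<le> N n" "y \<in> H n" "y' \<in> H n"
      by (auto simp: H_def less_Suc_eq_le)
    have "prod_encode (i, i') \<le> Max (prod_encode ` ({..N n} \<times> {..N n}))" using l by (intro Max_ge) auto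
    then have "prod_encode (i, i') < M n" by (simp add: M_def)
    with Suc.IH[OF l(5,6)] have "(prod_encode (i, i'), map2 (\<lambda>i j. prod_encode (i, j)) y y') \<in> {..<M n} \<times> cyl_words M n"
      by (simp add: CW_def)
    from imageI[OF this, of "\<lambda>(x, y). x # y"] show ?case unfolding l(1,2) CW_def by simp
  qed (auto simp: H_def CW_def)
  have ZZsub: "ZZ n \<subseteq> CW n" for n using ZCW by (auto simp: ZZ_def)
  have ZZfin: "finite (ZZ n)" for n using Hfin by (auto simp: ZZ_def)
  have CWfin: "finite (CW n)" for n unfolding CW_def by (rule finite_cyl_words)
  have CWlen: "length z = n" if "z \<in> CW n" for z n using that unfolding CW_def by (rule length_cyl_words)
  have ZZinj: "inj_on (\<lambda>(l, l'). map2 (\<lambda>i j. prod_encode (i, j)) l l') (H n \<times> H n)" for n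
  proof (rule inj_onI)
    let ?F = "\<lambda>(l, l'). map2 (\<lambda>i j. prod_encode (i, j)) l l'"
    fix z z' assume z: "z \<in> H n \<times> H n" "z' \<in> H n \<times> H n" and eq: "?F z = ?F z'"
    have R: "z = (map f1 (?F z), map f2 (?F z))" if "z \<in> H n \<times> H n" for z
      using that f12[of "fst z" n "snd z"] by (cases z) simp
    have "z = (map f1 (?F z'), map f2 (?F z'))" using R[OF z(1)] unfolding eq .
    then show "z = z'" using R[OF z(2)] by (rule trans[OF _ sym])
  qed
  define Q where "Q k z = p k (map f1 z, map f2 z)" for k z
  have Q0: "0 \<le> Q k z" for k z unfolding Q_def using discrete_plansD(1)[OF p[of k]] by blast
  have ZZsum: "(\<Sum>z\<in>ZZ (Suc k). Q k z * G (map f1 z) (map f2 z)) = (\<Sum>z\<in>H (Suc k) \<times> H (Suc k). p k z * G (fst z) (snd z))"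
    for k and G :: "nat list \<Rightarrow> nat list \<Rightarrow> real"
  proof -
    let ?F = "\<lambda>(l, l'). map2 (\<lambda>i j. prod_encode (i, j)) l l'"
    have R: "map f1 (?F z) = fst z" "map f2 (?F z) = snd z" if "z \<in> H (Suc k) \<times> H (Suc k)" for z
      using that f12[of "fst z" "Suc k" "snd z"] by (cases z, simp)+
    have "(\<Sum>z\<in>ZZ (Suc k). Q k z * G (map f1 z) (map f2 z))
      = (\<Sum>z\<in>H (Suc k) \<times> H (Suc k). Q k (?F z) * G (map f1 (?F z)) (map f2 (?F z)))"
      unfolding ZZ_def by (rule sum.reindex[OF ZZinj, unfolded o_def])
    also have "\<dots> = (\<Sum>z\<in>H (Suc k) \<times> H (Suc k). p k z * G (fst z) (snd z))"
      by (rule sum.cong[OF refl]) (simp only: Q_def R prod.collapse)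
    finally show ?thesis .
  qed
  have Qmarg: "(\<Sum>z\<in>ZZ (Suc k). Q k z * F (map f1 z)) = (\<integral>y. F (h (Suc k) y) \<partial>\<mu>)"
    "(\<Sum>z\<in>ZZ (Suc k). Q k z * F (map f2 z)) = (\<integral>y. F (h (Suc k) y) \<partial>\<nu>)" for k and F :: "nat list \<Rightarrow> real"
  proof -
    have "(\<Sum>z\<in>ZZ (Suc k). Q k z * F (map f1 z)) = (\<Sum>l\<in>H (Suc k). \<Sum>l'\<in>H (Suc k). p k (l, l') * F l)"
      using ZZsum[of k "\<lambda>l l'. F l"] by (simp add: sum.cartesian_product' split_beta)
    also have "\<dots> = (\<Sum>l\<in>H (Suc k). a (Suc k) l * F l)"
      by (intro sum.cong refl) (simp add: sum_distrib_right[symmetric] discrete_plansD(3)[OF p])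
    finally show "(\<Sum>z\<in>ZZ (Suc k). Q k z * F (map f1 z)) = (\<integral>y. F (h (Suc k) y) \<partial>\<mu>)"
      by (simp add: hint(2)[OF \<mu>] a_def)
    have "(\<Sum>z\<in>ZZ (Suc k). Q k z * F (map f2 z)) = (\<Sum>l'\<in>H (Suc k). \<Sum>l\<in>H (Suc k). p k (l, l') * F l')"
      using ZZsum[of k "\<lambda>l l'. F l'"] by (subst sum.swap) (simp add: sum.cartesian_product' split_beta)
    also have "\<dots> = (\<Sum>l\<in>H (Suc k). b (Suc k) l * F l)"
      by (intro sum.cong refl) (simp add: sum_distrib_right[symmetric] discrete_plansD(4)[OF p])
    finally show "(\<Sum>z\<in>ZZ (Suc k). Q k z * F (map f2 z)) = (\<integral>y. F (h (Suc k) y) \<partial>\<nu>)"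
      by (simp add: hint(2)[OF \<nu>] b_def)
  qed

  \<comment> \<open>Weights of words under the discrete plans, and their limit\<close>
  define w where "w k z = (\<Sum>y\<in>{y \<in> ZZ (Suc k). drop (Suc k - length z) y = z}. Q k y)" for k z
  have w01: "w k z \<in> {0..m}" for k z
  proof -
    have "w k z \<le> (\<Sum>y\<in>ZZ (Suc k). Q k y)" unfolding w_def using ZZfin Q0 by (intro sum_mono2) auto
    also have "\<dots> = m" using Qmarg(1)[of k "\<lambda>_. 1"] D\<mu>(3) by (simp add: m_def)
    finally show ?thesis using Q0 by (auto simp: w_def intro!: sum_nonneg)
  qed
  \<comment> \<open>\<open>w k\<close> describes plan \<open>k\<close> seen at depth
    \<open>length z\<close>. Splitting a word into its children is consistent only up to depth
    \<open>k\<close>, the resolution of that plan; in the limit it is consistent at every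
    depth.\<close>
  have wS: "w k z = (\<Sum>c<M n. w k (c # z))" if n: "length z = n" "n \<le> k" for k z n
  proof -
    let ?S = "{y \<in> ZZ (Suc k). drop (Suc k - n) y = z}"
    have "(\<Sum>c<M n. \<Sum>y\<in>{y \<in> ?S. y ! (k - n) = c}. Q k y) = sum (Q k) ?S"
    proof (rule sum.group)
      show "(\<lambda>y. y ! (k - n)) ` ?S \<subseteq> {..<M n}"
        using ZZsub[of "Suc k"] cyl_words_nth[of _ M k n] n(2) by (auto simp: CW_def)
    qed (use ZZfin in auto)
    moreover have "{y \<in> ?S. y ! (k - n) = c} = {y \<in> ZZ (Suc k). drop (Suc k - length (c # z)) y = c # z}" for c
    proof -
      have "drop (k - n) y = y ! (k - n) # drop (Suc k - n) y" if "y \<in> ZZ (Suc k)" for y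
        using Cons_nth_drop_Suc[of "k - n" y] CWlen[of y "Suc k"] that ZZsub[of "Suc k"] n(2) by (auto simp: Suc_diff_le)
      then show ?thesis using n by auto
    qed
    ultimately show ?thesis using n by (simp add: w_def)
  qed
  have wG: "(\<Sum>z\<in>CW n. w k z * G z) = (\<Sum>y\<in>ZZ (Suc k). Q k y * G (drop (Suc k - n) y))"
    if n: "n \<le> Suc k" for n k and G :: "nat list \<Rightarrow> real"
  proof -
    have "(\<Sum>z\<in>CW n. \<Sum>y\<in>{y \<in> ZZ (Suc k). drop (Suc k - n) y = z}. Q k y * G (drop (Suc k - n) y))
      = (\<Sum>y\<in>ZZ (Suc k). Q k y * G (drop (Suc k - n) y))"
    proof (rule sum.group[OF ZZfin CWfin])
      show "drop (Suc k - n) ` ZZ (Suc k) \<subseteq> CW n"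
        using ZZsub[of "Suc k"] cyl_words_drop[of _ M n "Suc k - n"] n by (auto simp: CW_def)
    qed
    moreover have "(\<Sum>y\<in>{y \<in> ZZ (Suc k). drop (Suc k - n) y = z}. Q k y * G (drop (Suc k - n) y)) = w k z * G z"
      if "z \<in> CW n" for z
      using CWlen[OF that] by (simp add: w_def sum_distrib_right)
    ultimately show ?thesis by simp
  qed
  obtain r W where r: "strict_mono (r :: nat \<Rightarrow> nat)" and W: "\<And>z. (\<lambda>j. w (r j) z) \<longlonglongrightarrow> W z"
    using pointwise_convergent_subsequence[of w m] w01 by blast
  have ev: "eventually (\<lambda>j. n \<le> r j) sequentially" for n
    using filterlim_subseq[OF r] by (simp add: filterlim_at_top)
  interpret T: weight_tree W M
  proof
    show "0 \<le> W z" for z by (rule LIMSEQ_le_const[OF W]) (use w01 in auto)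
    show "W z = (\<Sum>c<M n. W (c # z))" if "length z = n" for z n
    proof (rule LIMSEQ_unique[OF W])
      have "(\<lambda>j. \<Sum>c<M n. w (r j) (c # z)) \<longlonglongrightarrow> (\<Sum>c<M n. W (c # z))" by (intro tendsto_sum W)
      then show "(\<lambda>j. w (r j) z) \<longlonglongrightarrow> (\<Sum>c<M n. W (c # z))"
        by (rule Lim_transform_eventually) (use ev[of n] wS[OF that] in \<open>auto elim: eventually_mono\<close>)
    qed
  qed
  let ?\<Omega> = "T.\<Omega>" and ?A = "cyl_addr W"
  have Wlim: "(\<lambda>j. \<Sum>z\<in>CW n. w (r j) z * G z) \<longlonglongrightarrow> (\<Sum>z\<in>CW n. W z * G z)" for n and G :: "nat list \<Rightarrow> real"
    by (intro tendsto_sum tendsto_mult W tendsto_const)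
  have \<Omega>int: "integrable ?\<Omega> (\<lambda>t. G (?A n t))" "(\<integral>t. G (?A n t) \<partial>?\<Omega>) = (\<Sum>z\<in>CW n. W z * G z)" for n and G :: "nat list \<Rightarrow> real"
  proof -
    have A: "?A n t \<in> CW n" if "t \<in> space ?\<Omega>" for t
      using T.cyl_addr_bounds[of t n] that by (simp add: T.space_\<Omega> CW_def)
    show "integrable ?\<Omega> (\<lambda>t. G (?A n t))"
      by (rule integral_finite_valued(1)[OF T.finite_measure_\<Omega> T.measurable_cyl_addr CWfin A])
    show "(\<integral>t. G (?A n t) \<partial>?\<Omega>) = (\<Sum>z\<in>CW n. W z * G z)"
      using integral_finite_valued(2)[OF T.finite_measure_\<Omega> T.measurable_cyl_addr CWfin A, where F=G] T.measure_cyl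
      by (simp add: CW_def)
  qed
  have map_drop1: "(\<Sum>y\<in>ZZ (Suc k). Q k y * F (map f1 (drop (Suc k - n) y))) = (\<integral>y. F (h n y) \<partial>\<mu>)"
    "(\<Sum>y\<in>ZZ (Suc k). Q k y * F (map f2 (drop (Suc k - n) y))) = (\<integral>y. F (h n y) \<partial>\<nu>)"
    if n: "n \<le> Suc k" for n k and F :: "nat list \<Rightarrow> real"
    using Qmarg(1)[of k "\<lambda>l. F (drop (Suc k - n) l)"] Qmarg(2)[of k "\<lambda>l. F (drop (Suc k - n) l)"]
      hdrop[of "Suc k - n" n] n by (simp_all add: drop_map)
  \<comment> \<open>At each depth up to its resolution every discrete plan has exactly the marginals
    of \<open>\<mu>\<close> and \<open>\<nu>\<close>, so the limit has them at every depth.\<close>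
  have marg: "(\<integral>t. F (map f1 (?A n t)) \<partial>?\<Omega>) = (\<integral>y. F (h n y) \<partial>\<mu>)"
    "(\<integral>t. F (map f2 (?A n t)) \<partial>?\<Omega>) = (\<integral>y. F (h n y) \<partial>\<nu>)" for n and F :: "nat list \<Rightarrow> real"
  proof -
    have *: "(\<integral>t. F (map f (?A n t)) \<partial>?\<Omega>) = v"
      if v: "\<And>k. n \<le> Suc k \<Longrightarrow> (\<Sum>y\<in>ZZ (Suc k). Q k y * F (map f (drop (Suc k - n) y))) = v" for f v
    proof -
      have "\<forall>\<^sub>F j in sequentially. (\<Sum>z\<in>CW n. w (r j) z * F (map f z)) = v"
        using ev[of n] by eventually_elim (use wG v in simp)
      then have "(\<lambda>j. \<Sum>z\<in>CW n. w (r j) z * F (map f z)) \<longlonglongrightarrow> v" by (rule tendsto_eventually)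
      then have "(\<Sum>z\<in>CW n. W z * F (map f z)) = v" by (rule LIMSEQ_unique[OF Wlim])
      then show ?thesis using \<Omega>int(2)[where G="\<lambda>z. F (map f z)"] by simp
    qed
    show "(\<integral>t. F (map f1 (?A n t)) \<partial>?\<Omega>) = (\<integral>y. F (h n y) \<partial>\<mu>)" by (rule *) (rule map_drop1)
    show "(\<integral>t. F (map f2 (?A n t)) \<partial>?\<Omega>) = (\<integral>y. F (h n y) \<partial>\<nu>)" by (rule *) (rule map_drop1)
  qed

  \<comment> \<open>Cost of the limit weights at each depth\<close>
  have ss: "(\<integral>y. dist (s k y) (s n y) \<partial>\<kappa>') \<le> e k + e n"
    if \<kappa>': "finite_borel_measure \<kappa>'" and le: "\<And>n. (\<integral>\<^sup>+y. ennreal (dist y (s n y)) \<partial>\<kappa>') \<le> ennreal (e n)"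
    and i: "integrable \<kappa>' (\<lambda>y. dist (s k y) (s n y))" for \<kappa>' :: "'a measure" and k n
  proof -
    note D = finite_borel_measureD[OF \<kappa>']
    have "ennreal (\<integral>y. dist (s k y) (s n y) \<partial>\<kappa>') = (\<integral>\<^sup>+y. ennreal (dist (s k y) (s n y)) \<partial>\<kappa>')"
      by (rule nn_integral_eq_integral[symmetric, OF i]) simp
    also have "\<dots> \<le> (\<integral>\<^sup>+y. ennreal (dist y (s k y)) + ennreal (dist y (s n y)) \<partial>\<kappa>')"
      by (intro nn_integral_mono) (metis dist_commute dist_triangle ennreal_leI ennreal_plus zero_le_dist)
    also have "\<dots> = (\<integral>\<^sup>+y. ennreal (dist y (s k y)) \<partial>\<kappa>') + (\<integral>\<^sup>+y. ennreal (dist y (s n y)) \<partial>\<kappa>')"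
      using sd D(2) by (intro nn_integral_add) (auto cong: measurable_cong_sets)
    also have "\<dots> \<le> ennreal (e k) + ennreal (e n)" by (intro add_mono le)
    also have "\<dots> = ennreal (e k + e n)" using e0 by simp
    finally show ?thesis using e0 by (simp add: ennreal_le_iff add_nonneg_nonneg del: ennreal_plus)
  qed
  \<comment> \<open>Coarsening plan \<open>k\<close> from depth \<open>Suc k\<close> to
    \<open>Suc n\<close> moves each coordinate by the distance of two centers, on average at most
    \<open>e k + e n\<close> because the marginals are exact. Added to \<open>c + 2 * e k\<close>
    this gives \<open>c + 6 * e n\<close>, as \<open>e k \<le> e n\<close>.\<close>
  have cost: "(\<Sum>z\<in>CW (Suc n). W z * dist (pt (map f1 z)) (pt (map f2 z))) \<le> c + 6 * e n" for n
  proof (rule LIMSEQ_le_const2[OF Wlim])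
    have "(\<Sum>z\<in>CW (Suc n). w k z * dist (pt (map f1 z)) (pt (map f2 z))) \<le> c + 6 * e n" if nk: "n \<le> k" for k
    proof -
      let ?d = "drop (Suc k - Suc n)"
      have hd': "?d (h (Suc k) y) = h (Suc n) y" for y using hdrop[of "k - n" "Suc n" y] nk by simp
      have "(\<Sum>z\<in>CW (Suc n). w k z * dist (pt (map f1 z)) (pt (map f2 z)))
         = (\<Sum>y\<in>ZZ (Suc k). Q k y * dist (pt (map f1 (?d y))) (pt (map f2 (?d y))))"
        using nk by (intro wG) simp
      also have "\<dots> \<le> (\<Sum>y\<in>ZZ (Suc k). Q k y * dist (pt (map f1 y)) (pt (map f2 y))
          + Q k y * dist (pt (map f1 y)) (pt (?d (map f1 y))) + Q k y * dist (pt (map f2 y)) (pt (?d (map f2 y))))"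
      proof (rule sum_mono)
        fix y
        have tri: "dist u v \<le> dist u' v' + dist u' u + dist v' v" for u v u' v' :: 'a
          using dist_triangle[of u v u'] dist_triangle[of u' v v'] by (simp add: dist_commute)
        have "Q k y * dist (pt (map f1 (?d y))) (pt (map f2 (?d y))) \<le> Q k y * (dist (pt (map f1 y)) (pt (map f2 y))
          + dist (pt (map f1 y)) (pt (?d (map f1 y))) + dist (pt (map f2 y)) (pt (?d (map f2 y))))"
          unfolding drop_map by (intro mult_left_mono tri Q0)
        then show "Q k y * dist (pt (map f1 (?d y))) (pt (map f2 (?d y))) \<le> Q k y * dist (pt (map f1 y)) (pt (map f2 y))
          + Q k y * dist (pt (map f1 y)) (pt (?d (map f1 y))) + Q k y * dist (pt (map f2 y)) (pt (?d (map f2 y)))"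
          by (simp only: distrib_left)
      qed
      also have "\<dots> = (\<Sum>z\<in>H (Suc k) \<times> H (Suc k). p k z * dist (pt (fst z)) (pt (snd z)))
         + (\<integral>y. dist (s k y) (s n y) \<partial>\<mu>) + (\<integral>y. dist (s k y) (s n y) \<partial>\<nu>)"
        unfolding sum.distrib
        using ZZsum[of k "\<lambda>l l'. dist (pt l) (pt l')"] Qmarg(1)[of k "\<lambda>l. dist (pt l) (pt (?d l))"]
          Qmarg(2)[of k "\<lambda>l. dist (pt l) (pt (?d l))"] by (simp only: hd' ptS)
      also have "\<dots> \<le> (c + 2 * e k) + (e k + e n) + (e k + e n)"
      proof (intro add_mono pc)
        have i: "integrable \<kappa>' (\<lambda>y. dist (s k y) (s n y))" if "finite_borel_measure \<kappa>'" for \<kappa>' :: "'a measure"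
          using hint(1)[OF that, of "\<lambda>l. dist (pt l) (pt (?d l))" "Suc k"] by (simp only: hd' ptS)
        show "(\<integral>y. dist (s k y) (s n y) \<partial>\<mu>) \<le> e k + e n" by (rule ss[OF \<mu> se(1) i[OF \<mu>]])
        show "(\<integral>y. dist (s k y) (s n y) \<partial>\<nu>) \<le> e k + e n" by (rule ss[OF \<nu> se(2) i[OF \<nu>]])
      qed
      also have "\<dots> \<le> c + 6 * e n" using edec[OF nk] by simp
      finally show ?thesis .
    qed
    then show "\<exists>J. \<forall>j\<ge>J. (\<Sum>z\<in>CW (Suc n). w (r j) z * dist (pt (map f1 z)) (pt (map f2 z))) \<le> c + 6 * e n"
      using ev[of n] unfolding eventually_sequentially by blast
  qed

  \<comment> \<open>The limiting pair of points and its law\<close>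
  define X where "X n t = (pt (map f1 (?A (Suc n) t)), pt (map f2 (?A (Suc n) t)))" for n t
  have Xm: "X n \<in> borel_measurable ?\<Omega>" for n
    unfolding X_def by (rule measurable_compose[OF T.measurable_cyl_addr]) simp
  have Xtl: "X n t = (pt (tl (map f1 (?A (Suc (Suc n)) t))), pt (tl (map f2 (?A (Suc (Suc n)) t))))" for n t
    by (simp add: X_def)
  \<comment> \<open>Written as a function of the address, which takes finitely many values at each
    depth, so that measurability is immediate without separability of the space.\<close>
  define dX where "dX z = dist (pt (tl (map f1 z)), pt (tl (map f2 z))) (pt (map f1 z), pt (map f2 z))" for z
  have dXeq: "dist (X n t) (X (Suc n) t) = dX (?A (Suc (Suc n)) t)" for n t
    unfolding dX_def Xtl[of n] by (simp only: X_def)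
  have dXm: "(\<lambda>t. dist (X n t) (X (Suc n) t)) \<in> borel_measurable ?\<Omega>" for n
    unfolding dXeq by (rule measurable_compose[OF T.measurable_cyl_addr]) simp
  have dXint: "(\<integral>\<^sup>+t. ennreal (dist (X n t) (X (Suc n) t)) \<partial>?\<Omega>) \<le> ennreal (4 * e n)" for n
  proof -
    let ?F = "\<lambda>l. dist (pt (tl l)) (pt l)"
    have Fh: "?F (h (Suc (Suc n)) y) = dist (s (Suc n) y) (s n y)" for y
      by (simp add: hS[of "Suc n"] ptS dist_commute) (simp add: pt_def s_def)
    have i: "integrable \<kappa>' (\<lambda>y. dist (s (Suc n) y) (s n y))" if "finite_borel_measure \<kappa>'" for \<kappa>' :: "'a measure"
      using hint(1)[OF that, of ?F "Suc (Suc n)"] by (simp only: Fh)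
    have "(\<integral>\<^sup>+t. ennreal (dist (X n t) (X (Suc n) t)) \<partial>?\<Omega>) = ennreal (\<integral>t. dX (?A (Suc (Suc n)) t) \<partial>?\<Omega>)"
      unfolding dXeq by (rule nn_integral_eq_integral[OF \<Omega>int(1)]) (simp add: dX_def)
    also have "(\<integral>t. dX (?A (Suc (Suc n)) t) \<partial>?\<Omega>) \<le> (\<integral>t. ?F (map f1 (?A (Suc (Suc n)) t)) + ?F (map f2 (?A (Suc (Suc n)) t)) \<partial>?\<Omega>)"
    proof (rule integral_mono[OF \<Omega>int(1)])
      show "integrable ?\<Omega> (\<lambda>t. ?F (map f1 (?A (Suc (Suc n)) t)) + ?F (map f2 (?A (Suc (Suc n)) t)))"
        by (rule \<Omega>int(1)[where G="\<lambda>z. ?F (map f1 z) + ?F (map f2 z)"])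
      show "dX (?A (Suc (Suc n)) t) \<le> ?F (map f1 (?A (Suc (Suc n)) t)) + ?F (map f2 (?A (Suc (Suc n)) t))" for t
        unfolding dX_def dist_Pair_Pair by (rule sqrt_sum_squares_le_sum) auto
    qed
    also have "\<dots> = (\<integral>t. ?F (map f1 (?A (Suc (Suc n)) t)) \<partial>?\<Omega>) + (\<integral>t. ?F (map f2 (?A (Suc (Suc n)) t)) \<partial>?\<Omega>)"
      by (rule Bochner_Integration.integral_add[OF \<Omega>int(1)[where G="\<lambda>z. ?F (map f1 z)"] \<Omega>int(1)[where G="\<lambda>z. ?F (map f2 z)"]])
    also have "\<dots> = (\<integral>y. dist (s (Suc n) y) (s n y) \<partial>\<mu>) + (\<integral>y. dist (s (Suc n) y) (s n y) \<partial>\<nu>)"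
      unfolding marg[where F="?F"] Fh ..
    also have "\<dots> \<le> (e (Suc n) + e n) + (e (Suc n) + e n)"
      by (intro add_mono ss[OF \<mu> se(1) i[OF \<mu>]] ss[OF \<nu> se(2) i[OF \<nu>]])
    also have "\<dots> \<le> 4 * e n" using edec[of n "Suc n"] by simp
    finally show ?thesis by (simp add: ennreal_leI)
  qed
  have "(\<Sum>n. \<integral>\<^sup>+t. ennreal (dist (X n t) (X (Suc n) t)) \<partial>?\<Omega>) \<le> (\<Sum>n. ennreal (4 * e n))"
    by (intro suminf_le dXint) auto
  also have "\<dots> = ennreal (\<Sum>n. 4 * e n)"
    using e0 by (intro suminf_ennreal2) (auto simp: e_def intro!: summable_mult summable_geometric)
  also have "\<dots> < \<infinity>" by simp
  finally have fin: "(\<Sum>n. \<integral>\<^sup>+t. ennreal (dist (X n t) (X (Suc n) t)) \<partial>?\<Omega>) < \<infinity>" .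
  obtain Y where Y: "Y \<in> borel_measurable ?\<Omega>" "AE t in ?\<Omega>. (\<lambda>n. X n t) \<longlonglongrightarrow> Y t"
    by (rule converging_measurable_sequence[where Z=X, OF Xm dXm fin]) blast
  define \<gamma> where "\<gamma> = distr ?\<Omega> borel Y"
  have F\<gamma>: "finite_borel_measure \<gamma>"
    unfolding finite_borel_measure_def \<gamma>_def
    using finite_measure.finite_measure_distr[OF T.finite_measure_\<Omega> Y(1)] by simp
  have fst_m: "fst \<in> borel_measurable (borel :: ('a \<times> 'a) measure)" and snd_m: "snd \<in> borel_measurable (borel :: ('a \<times> 'a) measure)"
    by (intro borel_measurable_continuous_onI continuous_intros)+
  \<comment> \<open>The law of a coordinate of \<open>Y\<close> is identified by Lipschitz tests:
    dominated convergence on the interval, and convergence in the mean of \<open>s n\<close> to the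
    identity under the given measure.\<close>
  have marginal: "distr \<gamma> borel f = \<kappa>'"
    if \<kappa>': "finite_borel_measure \<kappa>'" and f: "f \<in> borel_measurable borel" "continuous_on UNIV f"
      and le: "\<And>n. (\<integral>\<^sup>+y. ennreal (dist y (s n y)) \<partial>\<kappa>') \<le> ennreal (e n)"
      and fX: "\<And>g n. (\<integral>t. g (f (X n t)) \<partial>?\<Omega>) = (\<integral>y. (g (s n y) :: real) \<partial>\<kappa>')"
    for f :: "'a \<times> 'a \<Rightarrow> 'a" and \<kappa>' :: "'a measure"
  proof (rule finite_borel_measure_eqI[OF _ \<kappa>'])
    have f': "f \<in> measurable \<gamma> borel" using f(1) by (simp add: \<gamma>_def)
    show "finite_borel_measure (distr \<gamma> borel f)"
      using F\<gamma> finite_measure.finite_measure_distr[OF _ f'] by (simp add: finite_borel_measure_def)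
    fix g :: "'a \<Rightarrow> real" assume g: "g \<in> Lip_b"
    obtain B where B: "B-lipschitz_on UNIV g" using g by (auto simp: Lip_b_def Lip_def)
    obtain K where K: "0 \<le> K" "\<And>y. \<bar>g y\<bar> \<le> K" using Lip_b_bound[OF g] by blast
    have gm: "g \<in> borel_measurable borel" by (rule Lip_measurable[OF Lip_b_subset_Lip[OF g]])
    have gc: "continuous_on UNIV g" using B by (rule lipschitz_on_continuous_on)
    have "(\<integral>y. g y \<partial>distr \<gamma> borel f) = (\<integral>t. g (f (Y t)) \<partial>?\<Omega>)"
      unfolding \<gamma>_def using f(1) gm Y(1) by (subst integral_distr, simp, simp)+ (simp add: integral_distr measurable_compose[OF Y(1)])
    moreover have "(\<lambda>n. \<integral>t. g (f (X n t)) \<partial>?\<Omega>) \<longlonglongrightarrow> (\<integral>t. g (f (Y t)) \<partial>?\<Omega>)"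
    proof (rule integral_dominated_convergence[where w="\<lambda>_. K"])
      show "(\<lambda>t. g (f (Y t))) \<in> borel_measurable ?\<Omega>" "(\<lambda>t. g (f (X n t))) \<in> borel_measurable ?\<Omega>" for n
        using measurable_compose[OF measurable_compose[OF Y(1) f(1)] gm] measurable_compose[OF measurable_compose[OF Xm f(1)] gm] by auto
      show "integrable ?\<Omega> (\<lambda>_. K)" by (intro finite_measure.integrable_const T.finite_measure_\<Omega>)
      show "AE t in ?\<Omega>. (\<lambda>n. g (f (X n t))) \<longlonglongrightarrow> g (f (Y t))"
        using Y(2)
      proof eventually_elim
        case (elim t)
        have "(\<lambda>n. f (X n t)) \<longlonglongrightarrow> f (Y t)" by (rule continuous_on_tendsto_compose[OF f(2) elim]) auto
        then show ?case by (rule continuous_on_tendsto_compose[OF gc]) auto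
      qed
    qed (use K in auto)
    moreover have "(\<lambda>n. \<integral>t. g (f (X n t)) \<partial>?\<Omega>) \<longlonglongrightarrow> (\<integral>y. g y \<partial>\<kappa>')"
    proof -
      \<comment> \<open>Normalises the test function to Lipschitz constant at most 1; the added 1
        keeps the divisor positive.\<close>
      define B' where "B' = B + 1"
      have B': "0 < B'" using lipschitz_on_nonneg[OF B] by (simp add: B'_def)
      define g' where "g' y = g y / B'" for y
      have g'1: "1-lipschitz_on UNIV g'"
        unfolding lipschitz_real_iff
      proof (intro conjI allI)
        fix y z
        have "\<bar>g y - g z\<bar> \<le> B * dist y z" using B by (simp add: lipschitz_real_iff)
        also have "\<dots> \<le> B' * dist y z" by (simp add: B'_def mult_right_mono)
        finally show "\<bar>g' y - g' z\<bar> \<le> 1 * dist y z"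
          using B' by (simp add: g'_def diff_divide_distrib[symmetric] divide_le_eq mult.commute)
      qed simp
      have g'b: "g' \<in> Lip_b"
        using g'1 by (rule Lip_bI[where M="K / B'"]) (use K B' in \<open>auto simp: g'_def divide_right_mono\<close>)
      have "\<bar>(\<integral>y. g' (s n y) \<partial>\<kappa>') - (\<integral>y. g' y \<partial>\<kappa>')\<bar> \<le> e n" for n
        by (rule bounded_Lip_integral_diff[OF \<kappa>' g'b g'1 _ sd le e0])
          (use hint(1)[OF \<kappa>', of "\<lambda>l. g' (pt l)" "Suc n"] in \<open>simp only: ptS\<close>)
      then have "\<And>n. dist (\<integral>y. g' (s n y) \<partial>\<kappa>') (\<integral>y. g' y \<partial>\<kappa>') \<le> e n" by (simp add: dist_real_def)
      then have "(\<lambda>n. \<integral>y. g' (s n y) \<partial>\<kappa>') \<longlonglongrightarrow> (\<integral>y. g' y \<partial>\<kappa>')"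
        using elim by (intro metric_tendsto_imp_tendsto[OF elim]) (auto simp: e0 intro!: always_eventually)
      then have "(\<lambda>n. B' * (\<integral>y. g' (s n y) \<partial>\<kappa>')) \<longlonglongrightarrow> B' * (\<integral>y. g' y \<partial>\<kappa>')" by (intro tendsto_intros)
      then show ?thesis using B' by (simp add: g'_def fX)
    qed
    ultimately show "(\<integral>y. g y \<partial>distr \<gamma> borel f) = (\<integral>y. g y \<partial>\<kappa>')" using LIMSEQ_unique by metis
  qed
  have "distr \<gamma> borel fst = \<mu>"
  proof (rule marginal[OF \<mu> fst_m _ se(1)])
    show "(\<integral>t. g (fst (X n t)) \<partial>?\<Omega>) = (\<integral>y. g (s n y) \<partial>\<mu>)" for g :: "'a \<Rightarrow> real" and n
      using marg(1)[where F="\<lambda>l. g (pt l)" and n="Suc n"] by (simp only: X_def fst_conv ptS)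
  qed (intro continuous_intros)
  moreover have "distr \<gamma> borel snd = \<nu>"
  proof (rule marginal[OF \<nu> snd_m _ se(2)])
    show "(\<integral>t. g (snd (X n t)) \<partial>?\<Omega>) = (\<integral>y. g (s n y) \<partial>\<nu>)" for g :: "'a \<Rightarrow> real" and n
      using marg(2)[where F="\<lambda>l. g (pt l)" and n="Suc n"] by (simp only: X_def snd_conv ptS)
  qed (intro continuous_intros)
  ultimately have "\<gamma> \<in> transport_plans \<mu> \<nu>" using F\<gamma> by (simp add: transport_plans_def)
  moreover have "transport_cost \<gamma> \<le> ennreal c"
  proof -
    let ?d = "\<lambda>z :: 'a \<times> 'a. ennreal (dist (fst z) (snd z))"
    have dm: "?d \<in> borel_measurable borel"
      by (intro measurable_compose[OF borel_measurable_continuous_onI measurable_ennreal] continuous_intros)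
    have dXn: "?d (X n t) = ennreal (dist (pt (map f1 (?A (Suc n) t))) (pt (map f2 (?A (Suc n) t))))" for n t by (simp add: X_def)
    have "transport_cost \<gamma> = (\<integral>\<^sup>+t. ?d (Y t) \<partial>?\<Omega>)"
      unfolding transport_cost_def \<gamma>_def using dm by (intro nn_integral_distr Y(1)) simp
    also have "\<dots> = (\<integral>\<^sup>+t. liminf (\<lambda>n. ?d (X n t)) \<partial>?\<Omega>)"
    proof (rule nn_integral_cong_AE)
      show "AE t in ?\<Omega>. ?d (Y t) = liminf (\<lambda>n. ?d (X n t))"
        using Y(2)
      proof eventually_elim
        case (elim t)
        have "(\<lambda>n. ?d (X n t)) \<longlonglongrightarrow> ?d (Y t)" by (intro tendsto_intros elim)
        then show ?case by (rule lim_imp_Liminf[symmetric, rotated]) simp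
      qed
    qed
    \<comment> \<open>Fatou's lemma; the bounds \<open>c + 6 * e n\<close> on the right tend to
      \<open>c\<close>.\<close>
    also have "\<dots> \<le> liminf (\<lambda>n. \<integral>\<^sup>+t. ?d (X n t) \<partial>?\<Omega>)"
      by (intro nn_integral_liminf measurable_compose[OF Xm dm])
    also have "\<dots> \<le> liminf (\<lambda>n. ennreal (c + 6 * e n))"
    proof (rule Liminf_mono, rule always_eventually, rule allI)
      fix n
      have "(\<integral>\<^sup>+t. ?d (X n t) \<partial>?\<Omega>) = ennreal (\<integral>t. dist (pt (map f1 (?A (Suc n) t))) (pt (map f2 (?A (Suc n) t))) \<partial>?\<Omega>)"
        unfolding dXn by (rule nn_integral_eq_integral[OF \<Omega>int(1)[where G="\<lambda>z. dist (pt (map f1 z)) (pt (map f2 z))"]]) simp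
      also have "\<dots> \<le> ennreal (c + 6 * e n)"
        unfolding \<Omega>int(2)[where G="\<lambda>z. dist (pt (map f1 z)) (pt (map f2 z))"] by (intro ennreal_leI cost)
      finally show "(\<integral>\<^sup>+t. ?d (X n t) \<partial>?\<Omega>) \<le> ennreal (c + 6 * e n)" .
    qed
    also have "\<dots> = ennreal c"
    proof (rule lim_imp_Liminf)
      have "(\<lambda>n. ennreal (c + 6 * e n)) \<longlonglongrightarrow> ennreal (c + 6 * 0)" by (intro tendsto_intros elim)
      then show "(\<lambda>n. ennreal (c + 6 * e n)) \<longlonglongrightarrow> ennreal c" by simp
    qed simp
    finally show ?thesis .
  qed
  ultimately show ?thesis by blast
qed

section \<open>Currents induced by geodesic transports\<close>

text \<open>One density \<open>h\<close> of \<open>\<pi>\<close> along the curve, independent of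
  \<open>f\<close>, turns the rules for line integrals into rules for ordinary integrals.\<close>

lemma line_integral_density:
  fixes p :: "real \<Rightarrow> 'a::metric_space"
  assumes p: "lipschitz_curve p" and \<pi>: "B-lipschitz_on UNIV \<pi>"
  obtains h where
    "AE t in lborel. t \<in> {0<..<1} \<longrightarrow> ((\<lambda>s. \<pi> (p s)) has_real_derivative h t) (at t)"
    "(h has_integral (\<pi> (p 1) - \<pi> (p 0))) {0..1}"
    "\<And>f. f \<in> Lip_b \<Longrightarrow> ((\<lambda>t. f (p t) * h t) has_integral line_integral p f \<pi>) {0..1}"
proof -
  obtain K P where P: "K-lipschitz_on UNIV P" "\<And>t. t \<in> {0..1} \<Longrightarrow> P t = p t"
    by (rule lipschitz_curve_extension[OF p]) blast
  obtain C m where m: "\<And>t. 0 \<le> m t" "\<And>t. m t \<le> C"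
    and ex: "\<And>\<pi> B. B-lipschitz_on UNIV \<pi> \<Longrightarrow> \<exists>g'. g' \<in> borel_measurable borel \<and> (\<forall>t. \<bar>g' t\<bar> \<le> B * m t) \<and>
      (AE t in lborel. t \<in> {0<..<1} \<longrightarrow> ((\<lambda>s. \<pi> (p s)) has_real_derivative g' t) (at t)) \<and>
      (\<forall>a b. 0 \<le> a \<longrightarrow> a \<le> b \<longrightarrow> b \<le> 1 \<longrightarrow> (g' has_integral (\<pi> (p b) - \<pi> (p a))) {a..b})"
    by (rule curve_derivatives[OF p]) blast
  from ex[OF \<pi>] obtain h where h: "h \<in> borel_measurable borel" "\<forall>t. \<bar>h t\<bar> \<le> B * m t"
    "AE t in lborel. t \<in> {0<..<1} \<longrightarrow> ((\<lambda>s. \<pi> (p s)) has_real_derivative h t) (at t)"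
    "\<forall>a b. 0 \<le> a \<longrightarrow> a \<le> b \<longrightarrow> b \<le> 1 \<longrightarrow> (h has_integral (\<pi> (p b) - \<pi> (p a))) {a..b}" by blast
  have B: "0 \<le> B" using \<pi> by (rule lipschitz_on_nonneg)
  have hb: "\<bar>h t\<bar> \<le> B * C" for t
    using h(2)[rule_format, of t] mult_left_mono[OF m(2)[of t] B] by linarith
  have "((\<lambda>t. f (p t) * h t) has_integral line_integral p f \<pi>) {0..1}" if f: "f \<in> Lip_b" for f
  proof -
    obtain A M where fA: "A-lipschitz_on UNIV f" "\<And>x. \<bar>f x\<bar> \<le> M" using f by (rule Lip_bE) blast
    have cf: "continuous_on UNIV (\<lambda>t. f (P t))"
      by (rule continuous_on_compose2[OF lipschitz_on_continuous_on[OF fA(1)] lipschitz_on_continuous_on[OF P(1)]]) auto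
    have M: "0 \<le> M" using fA(2)[of undefined] by linarith
    have "(\<lambda>t. f (P t) * h t) integrable_on {0..1}"
    proof (rule bounded_borel_integrable_Icc(2)[where B="M * (B * C)"])
      show "(\<lambda>t. f (P t) * h t) \<in> borel_measurable borel"
        by (intro borel_measurable_times borel_measurable_continuous_onI cf h(1))
      show "\<bar>f (P t) * h t\<bar> \<le> M * (B * C)" for t
        unfolding abs_mult by (intro mult_mono fA hb M) simp
    qed
    then have "(\<lambda>t. f (p t) * h t) integrable_on {0..1}"
      by (rule integrable_eq) (simp add: P(2))
    moreover have "line_integral p f \<pi> = integral {0..1} (\<lambda>t. f (p t) * h t)"
      unfolding line_integral_def
    proof (rule integral_cong_AE_lborel(2))
      show "AE t in lborel. t \<in> {0..1} \<longrightarrow> f (p t) * deriv (\<lambda>s. \<pi> (p s)) t = f (p t) * h t"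
        using h(3) AE_lborel_singleton[of "0::real"] AE_lborel_singleton[of "1::real"]
      proof eventually_elim
        case (elim t)
        show ?case
        proof
          assume "t \<in> {0..1}"
          then have "t \<in> {0<..<1}" using elim by auto
          then have "deriv (\<lambda>s. \<pi> (p s)) t = h t" using elim by (intro DERIV_imp_deriv) blast
          then show "f (p t) * deriv (\<lambda>s. \<pi> (p s)) t = f (p t) * h t" by simp
        qed
      qed
    qed
    ultimately show ?thesis by (simp add: integrable_integral)
  qed
  moreover have "(h has_integral (\<pi> (p 1) - \<pi> (p 0))) {0..1}" using h(4) by simp
  ultimately show thesis using that h(3) by blast
qed

lemma line_integral_one:
  assumes "lipschitz_curve p" "\<pi> \<in> Lip"
  shows "line_integral p (\<lambda>_. 1) \<pi> = \<pi> (p 1) - \<pi> (p 0)"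
proof -
  obtain B where B: "B-lipschitz_on UNIV \<pi>" using assms(2) by (rule LipE)
  obtain h where h: "(h has_integral (\<pi> (p 1) - \<pi> (p 0))) {0..1}"
    "\<And>f. f \<in> Lip_b \<Longrightarrow> ((\<lambda>t. f (p t) * h t) has_integral line_integral p f \<pi>) {0..1}"
    by (rule line_integral_density[OF assms(1) B]) blast
  have "(h has_integral line_integral p (\<lambda>_. 1) \<pi>) {0..1}" using h(2)[OF Lip_b_const[of 1]] by simp
  then show ?thesis using h(1) by (rule has_integral_unique)
qed

lemma line_integral_linear_left:
  assumes p: "lipschitz_curve p" and f: "f \<in> Lip_b" "g \<in> Lip_b" and \<pi>: "\<pi> \<in> Lip"
  shows "line_integral p (\<lambda>x. a * f x + b * g x) \<pi> = a * line_integral p f \<pi> + b * line_integral p g \<pi>"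
proof -
  obtain B where B: "B-lipschitz_on UNIV \<pi>" using \<pi> by (rule LipE)
  obtain h where h: "\<And>f. f \<in> Lip_b \<Longrightarrow> ((\<lambda>t. f (p t) * h t) has_integral line_integral p f \<pi>) {0..1}"
    by (rule line_integral_density[OF p B]) blast
  have "((\<lambda>t. a * (f (p t) * h t) + b * (g (p t) * h t)) has_integral
      a * line_integral p f \<pi> + b * line_integral p g \<pi>) {0..1}"
    by (intro has_integral_add has_integral_mult_right h f)
  then have "((\<lambda>t. (a * f (p t) + b * g (p t)) * h t) has_integral
      a * line_integral p f \<pi> + b * line_integral p g \<pi>) {0..1}"
    by (simp only: distrib_right mult.assoc)
  with h[OF Lip_b_comb[OF f]] show ?thesis by (rule has_integral_unique)
qed

text \<open>The densities of \<open>u\<close>, \<open>v\<close> and their combination are chosen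
  independently of each other; uniqueness of derivatives relates them almost everywhere.\<close>

lemma line_integral_linear_right:
  assumes p: "lipschitz_curve p" and f: "f \<in> Lip_b" and u: "u \<in> Lip" "v \<in> Lip"
  shows "line_integral p f (\<lambda>x. a * u x + b * v x) = a * line_integral p f u + b * line_integral p f v"
proof -
  obtain B where B: "B-lipschitz_on UNIV u" using u(1) by (rule LipE)
  obtain B' where B': "B'-lipschitz_on UNIV v" using u(2) by (rule LipE)
  obtain B'' where B'': "B''-lipschitz_on UNIV (\<lambda>x. a * u x + b * v x)" using Lip_comb[OF u] by (rule LipE)
  obtain h where h: "AE t in lborel. t \<in> {0<..<1} \<longrightarrow> ((\<lambda>s. u (p s)) has_real_derivative h t) (at t)"
    "((\<lambda>t. f (p t) * h t) has_integral line_integral p f u) {0..1}"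
    by (rule line_integral_density[OF p B]) (use f in blast)
  obtain k where k: "AE t in lborel. t \<in> {0<..<1} \<longrightarrow> ((\<lambda>s. v (p s)) has_real_derivative k t) (at t)"
    "((\<lambda>t. f (p t) * k t) has_integral line_integral p f v) {0..1}"
    by (rule line_integral_density[OF p B']) (use f in blast)
  obtain l where l: "AE t in lborel. t \<in> {0<..<1} \<longrightarrow> ((\<lambda>s. a * u (p s) + b * v (p s)) has_real_derivative l t) (at t)"
    "((\<lambda>t. f (p t) * l t) has_integral line_integral p f (\<lambda>x. a * u x + b * v x)) {0..1}"
    by (rule line_integral_density[OF p B'']) (use f in blast)
  have "((\<lambda>t. a * (f (p t) * h t) + b * (f (p t) * k t)) has_integral
      a * line_integral p f u + b * line_integral p f v) {0..1}"
    by (intro has_integral_add has_integral_mult_right h k)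
  moreover have "AE t in lborel. t \<in> {0..1} \<longrightarrow> f (p t) * l t = a * (f (p t) * h t) + b * (f (p t) * k t)"
    using h(1) k(1) l(1) AE_lborel_singleton[of "0::real"] AE_lborel_singleton[of "1::real"]
  proof eventually_elim
    case (elim t)
    show ?case
    proof
      assume "t \<in> {0..1}"
      then have t: "t \<in> {0<..<1}" using elim by auto
      have "((\<lambda>s. a * u (p s) + b * v (p s)) has_real_derivative a * h t + b * k t) (at t)"
        using elim(1,2) t by (intro DERIV_add DERIV_cmult) blast+
      then have "l t = a * h t + b * k t" using elim(3) t DERIV_unique by blast
      then show "f (p t) * l t = a * (f (p t) * h t) + b * (f (p t) * k t)" by (simp add: algebra_simps)
    qed
  qed
  ultimately have "((\<lambda>t. f (p t) * l t) has_integral a * line_integral p f u + b * line_integral p f v) {0..1}"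
    by (simp only: integral_cong_AE_lborel(1))
  with l(2) show ?thesis by (rule has_integral_unique)
qed

text \<open>Where \<open>f\<close> does not vanish on the curve, continuity keeps the curve in
  \<open>U\<close> for nearby times, so \<open>\<pi>\<close> is locally constant along it and its
  derivative is zero.\<close>

lemma line_integral_local:
  fixes p :: "real \<Rightarrow> 'a::metric_space"
  assumes p: "lipschitz_curve p" and f: "f \<in> Lip_b" and \<pi>: "\<pi> \<in> Lip"
    and U: "open U" "{x. f x \<noteq> 0} \<subseteq> U" "\<And>x. x \<in> U \<Longrightarrow> \<pi> x = c"
  shows "line_integral p f \<pi> = 0"
proof -
  obtain B where B: "B-lipschitz_on UNIV \<pi>" using \<pi> by (rule LipE)
  obtain K P where P: "K-lipschitz_on UNIV P" "\<And>t. t \<in> {0..1} \<Longrightarrow> P t = p t"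
    by (rule lipschitz_curve_extension[OF p]) blast
  obtain h where h: "AE t in lborel. t \<in> {0<..<1} \<longrightarrow> ((\<lambda>s. \<pi> (p s)) has_real_derivative h t) (at t)"
    "((\<lambda>t. f (p t) * h t) has_integral line_integral p f \<pi>) {0..1}"
    by (rule line_integral_density[OF p B]) (use f in blast)
  have oP: "open (P -` U)" by (rule open_vimage[OF U(1) lipschitz_on_continuous_on[OF P(1)]])
  have ae: "AE t in lborel. t \<in> {0..1} \<longrightarrow> f (p t) * h t = 0"
    using h(1) AE_lborel_singleton[of "0::real"] AE_lborel_singleton[of "1::real"]
  proof eventually_elim
    case (elim t)
    show ?case
    proof
      assume "t \<in> {0..1}"
      then have t: "t \<in> {0<..<1}" using elim by auto
      show "f (p t) * h t = 0"
      proof (cases "f (p t) = 0")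
        case False
        then have "t \<in> P -` U \<inter> {0<..<1}" using U(2) t P(2)[of t] by auto
        then have "\<forall>\<^sub>F s in nhds t. s \<in> P -` U \<inter> {0<..<1}"
          by (intro eventually_nhds_in_open open_Int oP) auto
        then have "\<forall>\<^sub>F s in nhds t. \<pi> (p s) = c"
          by (rule eventually_mono) (use U(3) P(2) in force)
        then have "((\<lambda>s. \<pi> (p s)) has_real_derivative 0) (at t)"
          by (subst DERIV_cong_ev[where g="\<lambda>_. c" and y=t]) auto
        then have "h t = 0" using elim(1) t DERIV_unique by blast
        then show ?thesis by simp
      qed simp
    qed
  qed
  have "((\<lambda>t :: real. 0 :: real) has_integral line_integral p f \<pi>) {0..1}"
    using h(2) unfolding integral_cong_AE_lborel(1)[OF ae] .
  then show ?thesis by (rule has_integral_unique[OF _ has_integral_0])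
qed

text \<open>Pointwise convergence of \<open>\<sigma> n\<close> gives no convergence of the
  derivatives along the curve. Riemann sums involve finitely many values, and their error is uniform
  in \<open>n\<close> thanks to the common Lipschitz constant.\<close>

lemma line_integral_tendsto:
  fixes p :: "real \<Rightarrow> 'a::metric_space"
  assumes p: "lipschitz_curve p" and f: "f \<in> Lip_b"
    and \<sigma>: "\<And>n. L-lipschitz_on UNIV (\<sigma> n)" and \<pi>: "\<pi> \<in> Lip" and lim: "\<And>x. (\<lambda>n. \<sigma> n x) \<longlonglongrightarrow> \<pi> x"
  shows "(\<lambda>n. line_integral p f (\<sigma> n)) \<longlonglongrightarrow> line_integral p f \<pi>"
proof -
  obtain B where B: "B-lipschitz_on UNIV \<pi>" using \<pi> by (rule LipE)
  obtain A M where fA: "A-lipschitz_on UNIV f" "\<And>x. \<bar>f x\<bar> \<le> M" using f by (rule Lip_bE) blast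
  obtain K where K: "K-lipschitz_on {0..1} p" using p by (auto simp: lipschitz_curve_def)
  define L' where "L' = L + B"
  have L0: "0 \<le> L" "0 \<le> B" "0 \<le> A" "0 \<le> K"
    using lipschitz_on_nonneg[OF \<sigma>] lipschitz_on_nonneg[OF B] lipschitz_on_nonneg[OF fA(1)] lipschitz_on_nonneg[OF K] by auto
  have L\<sigma>: "L'-lipschitz_on UNIV (\<sigma> n)" and L\<pi>: "L'-lipschitz_on UNIV \<pi>" for n
    using L0 by (auto simp: L'_def intro: lipschitz_on_le[OF \<sigma>] lipschitz_on_le[OF B])
  define \<l> where "\<l> = param_length p"
  have l0: "0 \<le> \<l>" unfolding \<l>_def by (rule param_length_nonneg[OF p])
  define S where "S N \<rho> = (\<Sum>i<N. f (p (real i / real N)) * (\<rho> (p (real (Suc i) / real N)) - \<rho> (p (real i / real N))))"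
    for N :: nat and \<rho> :: "'a \<Rightarrow> real"
  have R: "\<bar>line_integral p f \<rho> - S N \<rho>\<bar> \<le> (A * K / real N) * L' * \<l>"
    if N: "0 < N" and \<rho>: "L'-lipschitz_on UNIV \<rho>" for N \<rho>
    unfolding S_def \<l>_def
  proof (rule line_integral_Riemann_sum[OF p fA(1) \<rho>])
    fix i s assume i: "i < N" and s: "real i / real N \<le> s" "s \<le> real (Suc i) / real N"
    have "real (Suc i) / real N \<le> 1" "0 \<le> real i / real N" using i N by auto
    moreover have "0 \<le> s" using calculation(2) s(1) by (rule order_trans)
    ultimately have I: "s \<in> {0..1}" "real i / real N \<in> {0..1}" using s by auto
    have "\<bar>f (p s) - f (p (real i / real N))\<bar> \<le> A * dist (p s) (p (real i / real N))"
      using lipschitz_onD[OF fA(1), of "p s" "p (real i / real N)"] by (simp add: dist_real_def)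
    also have "\<dots> \<le> A * (K * dist s (real i / real N))"
      by (intro mult_left_mono lipschitz_onD[OF K] I L0)
    also have "\<dots> \<le> A * (K * (1 / real N))"
    proof (intro mult_left_mono L0)
      have "real (Suc i) / real N = real i / real N + 1 / real N" by (simp add: add_divide_distrib)
      then show "dist s (real i / real N) \<le> 1 / real N" using s by (simp add: dist_real_def)
    qed
    finally show "\<bar>f (p s) - f (p (real i / real N))\<bar> \<le> A * K / real N" by simp
  qed (use N in \<open>auto simp: divide_right_mono\<close>)
  show ?thesis
  proof (rule LIMSEQ_I)
    fix r :: real assume r: "0 < r"
    \<comment> \<open>\<open>Q / N\<close> bounds the Riemann error for all integrands at once; two
      such errors and the difference of the sums share the tolerance in thirds.\<close>
    define Q where "Q = A * K * L' * \<l>"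
    have Q0: "0 \<le> Q" using L0 l0 by (simp add: Q_def L'_def)
    obtain N :: nat where N: "Q / (r / 3) < real N" using reals_Archimedean2 by blast
    have "0 \<le> Q / (r / 3)" using Q0 r by simp
    then have "0 < real N" using N by linarith
    then have N0: "0 < N" by simp
    have "Q < real N * (r / 3)" using N r by (simp add: pos_divide_less_eq)
    then have "Q / real N < r / 3" using N0 by (simp add: pos_divide_less_eq mult.commute)
    then have q: "(A * K / real N) * L' * \<l> < r / 3" by (simp add: Q_def)
    have "(\<lambda>n. S N (\<sigma> n)) \<longlonglongrightarrow> S N \<pi>" unfolding S_def by (intro tendsto_intros lim)
    then obtain n0 where n0: "\<And>n. n \<ge> n0 \<Longrightarrow> norm (S N (\<sigma> n) - S N \<pi>) < r / 3"
      using LIMSEQ_D[of _ _ "r / 3"] r by (metis divide_pos_pos zero_less_numeral)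
    have "norm (line_integral p f (\<sigma> n) - line_integral p f \<pi>) < r" if "n \<ge> n0" for n
      using n0[OF that] R[OF N0 L\<sigma>[of n]] R[OF N0 L\<pi>] q unfolding real_norm_def by linarith
    then show "\<exists>no. \<forall>n\<ge>no. norm (line_integral p f (\<sigma> n) - line_integral p f \<pi>) < r" by blast
  qed
qed

text \<open>The weak side of duality: the form \<open>1 du\<close> has Lipschitz constant at most 1,
  and integrating 1 against the mass measure gives the mass.\<close>

lemma mass_lower_bound:
  assumes T: "T \<in> currents 1" and u: "u \<in> Lip_b" "1-lipschitz_on UNIV u"
  shows "ennreal \<bar>T (\<lambda>_. 1, [u])\<bar> \<le> mass 1 T"
proof -
  obtain \<mu> where \<mu>: "mass_bound 1 T \<mu>" and lin: "multilinear_on_forms 1 T" using T by (auto simp: currents_def)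
  let ?m = "mass_measure 1 T"
  have m: "mass_bound 1 T ?m" by (rule mass_measure_least(1)[OF lin \<mu>])
  then have "finite_borel_measure ?m" by (simp add: mass_bound_def)
  note D = finite_borel_measureD[OF this]
  have d: "((\<lambda>_. 1, [u]) :: 'a form) \<in> D 1" unfolding D_1_iff using u(1) Lip_b_const Lip_b_subset_Lip by blast
  have "ennreal \<bar>T (\<lambda>_. 1, [u])\<bar> \<le> ennreal (form_const 1 [u]) * (\<integral>\<^sup>+x. ennreal \<bar>1\<bar> \<partial>?m)"
    using m d unfolding mass_bound_iff by blast
  also have "\<dots> \<le> 1 * (\<integral>\<^sup>+x. 1 \<partial>?m)"
    unfolding form_const_1 using lip_const_le[OF u(2)] by (intro mult_mono) (auto simp: ennreal_le_1)
  also have "\<dots> = mass 1 T" using D by (simp add: mass_def)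
  finally show ?thesis .
qed

locale geodesic_transport =
  fixes \<eta> :: "'a::metric_space curve measure"
  assumes finite_borel: "finite_borel_measure \<eta>"
    and AE_geodesic: "AE \<theta> in \<eta>. geodesic_curve \<theta>"
    and finite_length: "(\<integral>\<^sup>+\<theta>. ennreal (curve_length \<theta>) \<partial>\<eta>) < \<infinity>"
begin

lemmas \<eta>D = finite_borel_measureD[OF finite_borel]

lemma measurable_\<eta>: "borel_measurable \<eta> = borel_measurable borel"
  using \<eta>D(2) by (simp cong: measurable_cong_sets)

lemma integrable_length: "integrable \<eta> curve_length"
  using finite_length measurable_curve_length curve_length_nonneg
  by (intro integrableI_nonneg) (auto simp: measurable_\<eta>)

lemma curve_current_le:
  assumes "geodesic_curve \<theta>" "f \<in> Lip_b" "\<And>x. \<bar>f x\<bar> \<le> M" "B-lipschitz_on UNIV \<pi>"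
  shows "\<bar>curve_current \<theta> (f, [\<pi>])\<bar> \<le> B * M * curve_length \<theta>"
proof -
  let ?g = "\<lambda>t. f (geo_param \<theta> (max 0 (min 1 t)))"
  have M: "0 \<le> M" using assms(3)[of undefined] by linarith
  have B: "0 \<le> B" using assms(4) by (rule lipschitz_on_nonneg)
  \<comment> \<open>A Bochner integral of a nonintegrable function is 0 by convention, so the bound
    holds in either case and no measurability has to be shown.\<close>
  have "(LINT t:{0..1}|lborel. \<bar>?g t\<bar>) \<le> M"
  proof (cases "set_integrable lborel {0..1::real} (\<lambda>t. \<bar>?g t\<bar>)")
    case True
    then have "(LINT t:{0..1}|lborel. \<bar>?g t\<bar>) \<le> (LINT t:{0..1::real}|lborel. M)"
      by (rule set_integral_mono) (use assms(3) in \<open>auto simp: set_integrable_def\<close>)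
    then show ?thesis by (simp add: set_lebesgue_integral_def)
  next
    case False
    then show ?thesis using M by (simp add: set_lebesgue_integral_def set_integrable_def not_integrable_integral_eq)
  qed
  then have "B * (dist (start \<theta>) (finish \<theta>) * (LINT t:{0..1}|lborel. \<bar>?g t\<bar>)) \<le> B * (dist (start \<theta>) (finish \<theta>) * M)"
    using B by (intro mult_left_mono) auto
  also have "\<dots> = B * M * curve_length \<theta>" using assms(1) by (simp add: geodesic_curve_iff)
  finally show ?thesis using abs_line_integral_geodesic_le[OF assms(1,2,4)] by linarith
qed

lemma AE_curve_current_le:
  assumes "f \<in> Lip_b" "\<And>x. \<bar>f x\<bar> \<le> M" "B-lipschitz_on UNIV \<pi>"
  shows "AE \<theta> in \<eta>. norm (curve_current \<theta> (f, [\<pi>])) \<le> B * M * curve_length \<theta>"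
  using AE_geodesic by eventually_elim (simp add: curve_current_le[OF _ assms])

lemma integrable_curve_current: "integrable \<eta> (\<lambda>\<theta>. curve_current \<theta> \<omega>)"
proof (cases "\<omega> \<in> D 1")
  case True
  then obtain f \<pi> where \<omega>: "\<omega> = (f, [\<pi>])" and f: "f \<in> Lip_b" and \<pi>: "\<pi> \<in> Lip"
    using D_1_iff by (cases \<omega>) blast
  obtain M where M: "\<And>x. \<bar>f x\<bar> \<le> M" using f by (rule Lip_b_bound) blast
  obtain B where B: "B-lipschitz_on UNIV \<pi>" using \<pi> by (rule LipE)
  show ?thesis
  proof (rule Bochner_Integration.integrable_bound)
    show "integrable \<eta> (\<lambda>\<theta>. B * M * curve_length \<theta>)" by (intro integrable_mult_right integrable_length)
    show "(\<lambda>\<theta>. curve_current \<theta> \<omega>) \<in> borel_measurable \<eta>" using measurable_curve_current by (simp add: measurable_\<eta>)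
    show "AE \<theta> in \<eta>. norm (curve_current \<theta> \<omega>) \<le> norm (B * M * curve_length \<theta>)"
      using AE_curve_current_le[OF f M B] unfolding \<omega> by eventually_elim auto
  qed
next
  case False
  then show ?thesis by (simp add: curve_current_def)
qed

definition unit_lebesgue :: "real measure" where
  "unit_lebesgue = density lborel (indicator {0..1})"

text \<open>The mean over \<open>\<eta>\<close> of the arc-length measures of the geodesics: at
  constant speed, arc length is the distance of the ends times the image of Lebesgue measure on the
  unit interval. It is the candidate that bounds the mass of the induced current.\<close>

definition trace_measure :: "'a measure" where
  "trace_measure = distr (density (\<eta> \<Otimes>\<^sub>M unit_lebesgue) (\<lambda>x. ennreal (dist (start (fst x)) (finish (fst x)))))
     borel (\<lambda>x. geo_param (fst x) (max 0 (min 1 (snd x))))"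

lemma nn_integral_trace_measure:
  fixes g :: "'a \<Rightarrow> ennreal"
  assumes g: "g \<in> borel_measurable borel"
  shows "(\<integral>\<^sup>+x. g x \<partial>trace_measure) = (\<integral>\<^sup>+\<theta>. ennreal (dist (start \<theta>) (finish \<theta>)) *
     (\<integral>\<^sup>+t. g (geo_param \<theta> (max 0 (min 1 t))) * indicator {0..1} t \<partial>lborel) \<partial>\<eta>)"
proof -
  let ?N = "\<eta> \<Otimes>\<^sub>M unit_lebesgue" and ?l = "\<lambda>\<theta> :: 'a curve. ennreal (dist (start \<theta>) (finish \<theta>))"
  let ?e = "\<lambda>x. geo_param (fst x) (max 0 (min 1 (snd x)))"
  \<comment> \<open>The product sigma-algebra is used throughout; for a nonseparable space of curves
    it may be smaller than the Borel sets of the product.\<close>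
  have sN: "sets ?N = sets (borel \<Otimes>\<^sub>M borel)"
    by (rule sets_pair_measure_cong) (simp_all add: \<eta>D unit_lebesgue_def)
  have mN: "measurable ?N M' = measurable (borel \<Otimes>\<^sub>M borel) M'" for M' :: "'c measure"
    by (rule measurable_cong_sets[OF sN refl])
  have e: "?e \<in> borel_measurable ?N" unfolding mN by (rule measurable_geo_param)
  have l: "?l \<in> borel_measurable borel"
    by (rule measurable_compose[OF measurable_dist_start_finish measurable_ennreal])
  have lN: "(\<lambda>x. ?l (fst x)) \<in> borel_measurable ?N"
    unfolding mN by (rule measurable_compose[OF measurable_fst l])
  have geN: "(\<lambda>x. g (?e x)) \<in> borel_measurable ?N" by (rule measurable_compose[OF e g])
  interpret U: finite_measure unit_lebesgue
    by (rule finite_measureI) (simp add: unit_lebesgue_def emeasure_density)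
  have "(\<integral>\<^sup>+x. g x \<partial>trace_measure) = (\<integral>\<^sup>+x. g (?e x) \<partial>density ?N (\<lambda>x. ?l (fst x)))"
    unfolding trace_measure_def using e g by (intro nn_integral_distr) auto
  also have "\<dots> = (\<integral>\<^sup>+x. ?l (fst x) * g (?e x) \<partial>?N)"
    by (rule nn_integral_density[OF lN geN])
  also have "\<dots> = (\<integral>\<^sup>+\<theta>. \<integral>\<^sup>+t. ?l (fst (\<theta>, t)) * g (?e (\<theta>, t)) \<partial>unit_lebesgue \<partial>\<eta>)"
    by (rule U.nn_integral_fst[symmetric]) (intro borel_measurable_times_ennreal lN geN)
  also have "\<dots> = (\<integral>\<^sup>+\<theta>. ?l \<theta> * (\<integral>\<^sup>+t. g (geo_param \<theta> (max 0 (min 1 t))) * indicator {0..1} t \<partial>lborel) \<partial>\<eta>)"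
  proof (rule nn_integral_cong)
    fix \<theta> assume "\<theta> \<in> space \<eta>"
    have "(\<lambda>t. ?e (\<theta>, t)) \<in> borel_measurable borel"
      by (rule measurable_compose[OF measurable_Pair1' measurable_geo_param]) simp
    then have m: "(\<lambda>t. g (geo_param \<theta> (max 0 (min 1 t)))) \<in> borel_measurable borel"
      using g by (auto intro: measurable_compose)
    then have "(\<integral>\<^sup>+t. ?l \<theta> * g (geo_param \<theta> (max 0 (min 1 t))) \<partial>unit_lebesgue)
      = ?l \<theta> * (\<integral>\<^sup>+t. g (geo_param \<theta> (max 0 (min 1 t))) \<partial>unit_lebesgue)"
      by (intro nn_integral_cmult) (simp add: unit_lebesgue_def)
    also have "(\<integral>\<^sup>+t. g (geo_param \<theta> (max 0 (min 1 t))) \<partial>unit_lebesgue)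
      = (\<integral>\<^sup>+t. indicator {0..1} t * g (geo_param \<theta> (max 0 (min 1 t))) \<partial>lborel)"
      unfolding unit_lebesgue_def using m by (intro nn_integral_density) auto
    finally show "(\<integral>\<^sup>+t. ?l (fst (\<theta>, t)) * g (?e (\<theta>, t)) \<partial>unit_lebesgue)
      = ?l \<theta> * (\<integral>\<^sup>+t. g (geo_param \<theta> (max 0 (min 1 t))) * indicator {0..1} t \<partial>lborel)"
      by (simp add: mult.commute)
  qed
  finally show ?thesis .
qed

lemma emeasure_trace_measure: "emeasure trace_measure UNIV = (\<integral>\<^sup>+\<theta>. ennreal (curve_length \<theta>) \<partial>\<eta>)"
proof -
  have "emeasure trace_measure UNIV = (\<integral>\<^sup>+x. 1 \<partial>trace_measure)" by (simp add: trace_measure_def)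
  also have "\<dots> = (\<integral>\<^sup>+\<theta>. ennreal (dist (start \<theta>) (finish \<theta>)) \<partial>\<eta>)"
    by (subst nn_integral_trace_measure) auto
  also have "\<dots> = (\<integral>\<^sup>+\<theta>. ennreal (curve_length \<theta>) \<partial>\<eta>)"
    using AE_geodesic by (intro nn_integral_cong_AE) (auto simp: geodesic_curve_iff elim: eventually_mono)
  finally show ?thesis .
qed

text \<open>The bound for a single geodesic is integrated over \<open>\<eta>\<close>; Tonelli's
  theorem, contained in the integral formula for the trace measure, turns the result into an
  integral over the space.\<close>

lemma mass_bound_trace_measure: "mass_bound 1 (transport_current \<eta>) trace_measure"
  unfolding mass_bound_iff
proof (intro conjI allI impI)
  show "finite_borel_measure trace_measure"
    using emeasure_trace_measure finite_length by (intro finite_borel_measureI) (auto simp: trace_measure_def)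
  fix f :: "'a \<Rightarrow> real" and ps assume "(f, ps) \<in> D 1"
  then obtain \<pi> where ps: "ps = [\<pi>]" and f: "f \<in> Lip_b" and \<pi>: "\<pi> \<in> Lip" unfolding D_1_iff by blast
  note B = lip_const_props[OF \<pi>]
  obtain M where M: "\<And>x. \<bar>f x\<bar> \<le> M" using f by (rule Lip_b_bound) blast
  have fm: "f \<in> borel_measurable borel" by (rule Lip_measurable[OF Lip_b_subset_Lip[OF f]])
  let ?c = "lip_const \<pi>" and ?l = "\<lambda>\<theta> :: 'a curve. dist (start \<theta>) (finish \<theta>)"
  let ?I = "\<lambda>\<theta>. \<integral>\<^sup>+t. ennreal \<bar>f (geo_param \<theta> (max 0 (min 1 t)))\<bar> * indicator {0..1} t \<partial>lborel"
  have "ennreal \<bar>transport_current \<eta> (f, ps)\<bar> \<le> (\<integral>\<^sup>+\<theta>. ennreal \<bar>curve_current \<theta> (f, [\<pi>])\<bar> \<partial>\<eta>)"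
    unfolding transport_current_def ps
    using integral_norm_bound_ennreal[OF integrable_curve_current[of "(f, [\<pi>])"]] by simp
  also have "\<dots> \<le> (\<integral>\<^sup>+\<theta>. ennreal ?c * (ennreal (?l \<theta>) * ?I \<theta>) \<partial>\<eta>)"
  proof (rule nn_integral_mono_AE)
    show "AE \<theta> in \<eta>. ennreal \<bar>curve_current \<theta> (f, [\<pi>])\<bar> \<le> ennreal ?c * (ennreal (?l \<theta>) * ?I \<theta>)"
      using AE_geodesic
    proof eventually_elim
      case (elim \<theta>)
      let ?g = "\<lambda>t. \<bar>f (geo_param \<theta> (max 0 (min 1 t)))\<bar>"
      have "(\<lambda>t. geo_param (fst (\<theta>, t)) (max 0 (min 1 (snd (\<theta>, t))))) \<in> borel_measurable borel"
        by (rule measurable_compose[OF measurable_Pair1' measurable_geo_param]) simp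
      then have "?g \<in> borel_measurable borel"
        using fm by (auto intro!: borel_measurable_abs intro: measurable_compose)
      then have si: "set_integrable lborel {0..1::real} ?g"
        by (rule bounded_borel_integrable_Icc(1)[where B=M]) (simp add: M)
      have "?I \<theta> = (\<integral>\<^sup>+t. ennreal (indicator {0..1} t *\<^sub>R ?g t) \<partial>lborel)"
        by (intro nn_integral_cong) (auto simp: indicator_def)
      also have "\<dots> = ennreal (LINT t:{0..1}|lborel. ?g t)"
        unfolding set_lebesgue_integral_def using si
        by (intro nn_integral_eq_integral) (auto simp: set_integrable_def)
      finally have I: "?I \<theta> = ennreal (LINT t:{0..1}|lborel. ?g t)" .
      have J0: "0 \<le> (LINT t:{0..1}|lborel. ?g t)"
        unfolding set_lebesgue_integral_def by (rule Bochner_Integration.integral_nonneg) simp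
      have "ennreal \<bar>curve_current \<theta> (f, [\<pi>])\<bar> \<le> ennreal (?c * (?l \<theta> * (LINT t:{0..1}|lborel. ?g t)))"
        by (rule ennreal_leI[OF abs_line_integral_geodesic_le[OF elim f B(2)]])
      also have "\<dots> = ennreal ?c * (ennreal (?l \<theta>) * ?I \<theta>)"
        unfolding I using B(1) J0 by (simp add: ennreal_mult)
      finally show ?case .
    qed
  qed
  also have "\<dots> = ennreal ?c * (\<integral>\<^sup>+x. ennreal \<bar>f x\<bar> \<partial>trace_measure)"
  proof -
    have m: "(\<lambda>\<theta>. ennreal (?l \<theta>) * ?I \<theta>) \<in> borel_measurable \<eta>"
    proof (intro borel_measurable_times_ennreal)
      show "(\<lambda>\<theta>. ennreal (?l \<theta>)) \<in> borel_measurable \<eta>"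
        unfolding measurable_\<eta> by (rule measurable_compose[OF measurable_dist_start_finish measurable_ennreal])
      have "(\<lambda>x. ennreal \<bar>f (geo_param (fst x) (max 0 (min 1 (snd x))))\<bar> * indicator {0..1} (snd x))
        \<in> borel_measurable (borel \<Otimes>\<^sub>M (lborel :: real measure))"
      proof (intro borel_measurable_times_ennreal)
        have eq: "measurable (borel \<Otimes>\<^sub>M (lborel :: real measure)) M' = measurable (borel \<Otimes>\<^sub>M (borel :: real measure)) M'"
          for M' :: "ennreal measure"
          by (intro measurable_cong_sets sets_pair_measure_cong) auto
        show "(\<lambda>x. ennreal \<bar>f (geo_param (fst x) (max 0 (min 1 (snd x))))\<bar>) \<in> borel_measurable (borel \<Otimes>\<^sub>M (lborel :: real measure))"
          unfolding eq using fm
          by (intro measurable_compose[OF _ measurable_ennreal] borel_measurable_abs measurable_compose[OF measurable_geo_param])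
      qed measurable
      from lborel.borel_measurable_nn_integral_fst[OF this]
      show "?I \<in> borel_measurable \<eta>" unfolding measurable_\<eta> by simp
    qed
    show ?thesis
      using fm by (subst nn_integral_trace_measure) (auto intro: nn_integral_cmult[OF m])
  qed
  finally show "ennreal \<bar>transport_current \<eta> (f, ps)\<bar>
      \<le> ennreal (form_const 1 ps) * (\<integral>\<^sup>+x. ennreal \<bar>f x\<bar> \<partial>trace_measure)"
    by (simp only: ps form_const_1)
qed

text \<open>Linearity, locality and continuity hold curve by curve. Integrability of the length
  carries linearity over to the mean, and dominated convergence carries continuity, with a majorant
  proportional to the length.\<close>

lemma transport_current_currents: "transport_current \<eta> \<in> currents 1"
  unfolding currents_def mem_Collect_eq
proof (intro conjI allI impI)
  show "transport_current \<eta> \<omega> = 0" if "\<omega> \<notin> D 1" for \<omega>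
    using that by (simp add: transport_current_def curve_current_def)
  show "\<exists>\<mu>. mass_bound 1 (transport_current \<eta>) \<mu>" using mass_bound_trace_measure by blast
  note cc = curve_current_eq and rl = rep_curve_lipschitz
  show "multilinear_on_forms 1 (transport_current \<eta>)"
    unfolding multilinear_on_forms_def
  proof (intro conjI allI impI)
    fix f g :: "'a \<Rightarrow> real" and ps :: "('a \<Rightarrow> real) list" and a b :: real
    assume A: "(f, ps) \<in> D 1 \<and> (g, ps) \<in> D 1"
    then obtain \<pi> where ps: "ps = [\<pi>]" and f: "f \<in> Lip_b" "g \<in> Lip_b" and \<pi>: "\<pi> \<in> Lip" unfolding D_1_iff by blast
    have "curve_current \<theta> (\<lambda>x. a * f x + b * g x, [\<pi>]) = a * curve_current \<theta> (f, [\<pi>]) + b * curve_current \<theta> (g, [\<pi>])" for \<theta>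
      unfolding cc[OF f(1) \<pi>] cc[OF f(2) \<pi>] cc[OF Lip_b_comb[OF f] \<pi>] by (rule line_integral_linear_left[OF rl f \<pi>])
    then show "transport_current \<eta> (\<lambda>x. a * f x + b * g x, ps) = a * transport_current \<eta> (f, ps) + b * transport_current \<eta> (g, ps)"
      unfolding transport_current_def ps using integrable_curve_current by simp
  next
    fix f :: "'a \<Rightarrow> real" and ps and i :: nat and u v :: "'a \<Rightarrow> real" and a b :: real
    assume A: "(f, ps) \<in> D 1 \<and> i < 1 \<and> u \<in> Lip \<and> v \<in> Lip"
    then obtain \<pi> where ps: "ps = [\<pi>]" and f: "f \<in> Lip_b" and u: "u \<in> Lip" "v \<in> Lip" and i: "i = 0"
      unfolding D_1_iff by blast
    have "curve_current \<theta> (f, [\<lambda>x. a * u x + b * v x]) = a * curve_current \<theta> (f, [u]) + b * curve_current \<theta> (f, [v])" for \<theta>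
      unfolding cc[OF f u(1)] cc[OF f u(2)] cc[OF f Lip_comb[OF u]] by (rule line_integral_linear_right[OF rl f u])
    then show "transport_current \<eta> (f, ps[i := \<lambda>x. a * u x + b * v x])
      = a * transport_current \<eta> (f, ps[i := u]) + b * transport_current \<eta> (f, ps[i := v])"
      unfolding transport_current_def ps i using integrable_curve_current by simp
  qed
  show "local_on_forms 1 (transport_current \<eta>)"
    unfolding local_on_forms_def
  proof (intro allI impI)
    fix f :: "'a \<Rightarrow> real" and ps
    assume A: "(f, ps) \<in> D 1 \<and> (\<exists>i<1. \<exists>U c. open U \<and> {x. f x \<noteq> 0} \<subseteq> U \<and> (\<forall>x\<in>U. (ps ! i) x = c))"
    then obtain \<pi> where ps: "ps = [\<pi>]" and f: "f \<in> Lip_b" and \<pi>: "\<pi> \<in> Lip" unfolding D_1_iff by blast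
    obtain U c where U: "open U" "{x. f x \<noteq> 0} \<subseteq> U" "\<forall>x\<in>U. \<pi> x = c" using A ps by auto
    have "curve_current \<theta> (f, [\<pi>]) = 0" for \<theta>
      unfolding cc[OF f \<pi>] by (rule line_integral_local[OF rl f \<pi> U(1,2)]) (use U(3) in blast)
    then show "transport_current \<eta> (f, ps) = 0" by (simp add: transport_current_def ps)
  qed
  show "continuous_on_forms 1 (transport_current \<eta>)"
    unfolding continuous_on_forms_def
  proof (intro allI impI)
    fix f :: "'a \<Rightarrow> real" and psn :: "nat \<Rightarrow> ('a \<Rightarrow> real) list" and ps L
    assume A: "(f, ps) \<in> D 1 \<and> (\<forall>n. (f, psn n) \<in> D 1) \<and> (\<forall>i<1. \<forall>n. L-lipschitz_on UNIV (psn n ! i)) \<and>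
      (\<forall>i<1. \<forall>x. (\<lambda>n. (psn n ! i) x) \<longlonglongrightarrow> (ps ! i) x)"
    then obtain \<pi> where ps: "ps = [\<pi>]" and f: "f \<in> Lip_b" and \<pi>: "\<pi> \<in> Lip" unfolding D_1_iff by blast
    define \<sigma> where "\<sigma> n = psn n ! 0" for n
    have psn: "psn n = [\<sigma> n]" and \<sigma>L: "\<sigma> n \<in> Lip" for n
    proof -
      have "(f, psn n) \<in> D 1" using A by blast
      then show "psn n = [\<sigma> n]" "\<sigma> n \<in> Lip" unfolding D_1_iff \<sigma>_def by auto
    qed
    have \<sigma>: "L-lipschitz_on UNIV (\<sigma> n)" for n using A by (auto simp: \<sigma>_def)
    have lim: "(\<lambda>n. \<sigma> n x) \<longlonglongrightarrow> \<pi> x" for x using A by (auto simp: \<sigma>_def ps)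
    obtain M where M: "\<And>x. \<bar>f x\<bar> \<le> M" using f by (rule Lip_b_bound) blast
    show "(\<lambda>n. transport_current \<eta> (f, psn n)) \<longlonglongrightarrow> transport_current \<eta> (f, ps)"
      unfolding transport_current_def psn ps
    proof (rule integral_dominated_convergence[where w="\<lambda>\<theta>. L * M * curve_length \<theta>"])
      show "(\<lambda>\<theta>. curve_current \<theta> (f, [\<pi>])) \<in> borel_measurable \<eta>" "(\<lambda>\<theta>. curve_current \<theta> (f, [\<sigma> n])) \<in> borel_measurable \<eta>" for n
        using measurable_curve_current by (auto simp: measurable_\<eta>)
      show "integrable \<eta> (\<lambda>\<theta>. L * M * curve_length \<theta>)" by (intro integrable_mult_right integrable_length)
      show "AE \<theta> in \<eta>. norm (curve_current \<theta> (f, [\<sigma> n])) \<le> L * M * curve_length \<theta>" for n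
        by (rule AE_curve_current_le[OF f M \<sigma>])
      have "(\<lambda>n. curve_current \<theta> (f, [\<sigma> n])) \<longlonglongrightarrow> curve_current \<theta> (f, [\<pi>])" for \<theta>
        unfolding cc[OF f \<pi>] cc[OF f \<sigma>L] by (rule line_integral_tendsto[OF rl f \<sigma> \<pi> lim])
      then show "AE \<theta> in \<eta>. (\<lambda>n. curve_current \<theta> (f, [\<sigma> n])) \<longlonglongrightarrow> curve_current \<theta> (f, [\<pi>])" by simp
    qed
  qed
qed

lemma mass_transport_current_le: "mass 1 (transport_current \<eta>) \<le> (\<integral>\<^sup>+\<theta>. ennreal (curve_length \<theta>) \<partial>\<eta>)"
proof -
  have "multilinear_on_forms 1 (transport_current \<eta>)" using transport_current_currents by (simp add: currents_def)
  from mass_measure_least(2)[OF this mass_bound_trace_measure mass_bound_trace_measure]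
  show ?thesis by (simp only: emeasure_trace_measure)
qed

text \<open>The fundamental theorem along each curve leaves only the end values of \<open>u\<close>,
  so the boundary sees \<open>\<eta>\<close> through its two endpoint marginals alone.\<close>

lemma transport_current_one:
  assumes u: "u \<in> Lip_b"
  shows "transport_current \<eta> (\<lambda>_. 1, [u]) = (\<integral>x. u x \<partial>distr \<eta> borel finish) - (\<integral>x. u x \<partial>distr \<eta> borel start)"
proof -
  note uL = Lip_b_subset_Lip[OF u]
  have m: "start \<in> measurable \<eta> borel" "finish \<in> measurable \<eta> borel"
    using measurable_start measurable_finish by (auto simp: measurable_\<eta>)
  have um: "u \<in> borel_measurable borel" by (rule Lip_measurable[OF uL])
  obtain M where M: "\<And>x. \<bar>u x\<bar> \<le> M" using u by (rule Lip_b_bound) blast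
  have i: "integrable \<eta> (\<lambda>\<theta>. u (e \<theta>))" if "e \<in> measurable \<eta> borel" for e
    by (rule finite_measure.integrable_const_bound[OF \<eta>D(1), where B=M]) (use M measurable_compose[OF that um] in auto)
  have "curve_current \<theta> (\<lambda>_. 1, [u]) = u (finish \<theta>) - u (start \<theta>)" for \<theta>
    unfolding curve_current_eq[OF Lip_b_const uL]
    by (simp add: line_integral_one[OF rep_curve_lipschitz uL] start_rep finish_rep)
  then show ?thesis
    unfolding transport_current_def integral_distr[OF m(1) um] integral_distr[OF m(2) um]
    using i[OF m(1)] i[OF m(2)] by simp
qed

lemma boundary_transport_current:
  "boundary (transport_current \<eta>) = difference_current (distr \<eta> borel finish) (distr \<eta> borel start)"
proof
  fix \<omega> :: "'a form"
  show "boundary (transport_current \<eta>) \<omega> = difference_current (distr \<eta> borel finish) (distr \<eta> borel start) \<omega>"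
  proof (cases "\<omega> \<in> D 0")
    case True
    then have "fst \<omega> \<in> Lip_b" by (auto simp: D_def)
    then show ?thesis by (simp add: boundary_def difference_current_def True transport_current_one)
  qed (simp add: boundary_def difference_current_def)
qed

end

text \<open>A unit mass at a single geodesic is a transport, which bounds the mass from above. From
  below, the distance to the start, truncated at the distance of the ends so as to be bounded,
  increases between the ends by the whole length.\<close>

lemma mass_curve_current:
  fixes \<theta> :: "'a::metric_space curve"
  assumes g: "geodesic_curve \<theta>"
  shows "mass 1 (curve_current \<theta>) = ennreal (curve_length \<theta>)"
proof -
  define N where "N = distr (count_space {()}) borel (\<lambda>_. \<theta>)"
  have len: "(\<integral>\<^sup>+\<theta>'. ennreal (curve_length \<theta>') \<partial>N) = ennreal (curve_length \<theta>)"
    unfolding N_def by (subst nn_integral_distr) (auto simp: nn_integral_count_space_finite)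
  interpret geodesic_transport N
  proof
    show "finite_borel_measure N"
      unfolding N_def by (intro finite_borel_measureI) (auto simp: emeasure_distr)
    show "AE \<theta>' in N. geodesic_curve \<theta>'"
      unfolding N_def using g by (subst AE_distr_iff) (auto simp: AE_count_space)
    show "(\<integral>\<^sup>+\<theta>'. ennreal (curve_length \<theta>') \<partial>N) < \<infinity>" unfolding len by simp
  qed
  have T: "transport_current N = curve_current \<theta>"
    unfolding transport_current_def N_def
    by (rule ext, subst integral_distr) (auto simp: lebesgue_integral_count_space_finite)
  define R where "R = dist (start \<theta>) (finish \<theta>)"
  define u where "u x = max 0 (min R (dist (start \<theta>) x))" for x
  have u1: "1-lipschitz_on UNIV u"
    unfolding u_def
  proof (rule Lip_b_min_max, rule lipschitz_onI)
    fix x y show "dist (dist (start \<theta>) x) (dist (start \<theta>) y) \<le> 1 * dist x y"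
      using dist_triangle[of "start \<theta>" x y] dist_triangle[of "start \<theta>" y x] by (simp add: dist_real_def dist_commute abs_le_iff)
  qed simp
  have R0: "0 \<le> R" by (simp add: R_def)
  have ub: "u \<in> Lip_b" using u1 by (rule Lip_bI[where M=R]) (use R0 in \<open>auto simp: u_def\<close>)
  have "curve_current \<theta> (\<lambda>_. 1, [u]) = u (finish \<theta>) - u (start \<theta>)"
    unfolding curve_current_eq[OF Lip_b_const Lip_b_subset_Lip[OF ub]]
    by (simp add: line_integral_one[OF rep_curve_lipschitz Lip_b_subset_Lip[OF ub]] start_rep finish_rep)
  also have "\<dots> = curve_length \<theta>" using g R0 by (simp add: u_def R_def geodesic_curve_iff)
  finally have "ennreal (curve_length \<theta>) \<le> mass 1 (curve_current \<theta>)"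
    using mass_lower_bound[OF transport_current_currents ub u1] curve_length_nonneg[of \<theta>] by (simp add: T)
  then show ?thesis using mass_transport_current_le by (intro antisym) (simp_all add: T len)
qed

section \<open>Currents and plans\<close>

lemma zero_current: "(\<lambda>_ :: 'a::metric_space form. 0) \<in> currents 1" "mass 1 (\<lambda>_ :: 'a::metric_space form. 0) = 0"
proof -
  let ?Z = "\<lambda>_ :: 'a form. 0 :: real" and ?N = "null_measure borel :: 'a measure"
  have N: "mass_bound 1 ?Z ?N"
    unfolding mass_bound_iff by (auto intro!: finite_borel_measureI)
  have lin: "multilinear_on_forms 1 ?Z" by (simp add: multilinear_on_forms_def)
  show "?Z \<in> currents 1"
    using N lin by (auto simp: currents_def continuous_on_forms_def local_on_forms_def)
  show "mass 1 ?Z = 0" using mass_measure_least(2)[OF lin N N] by simp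
qed

lemma currents_diff:
  assumes T: "T \<in> currents 1" and S: "S \<in> currents 1"
  shows "(\<lambda>\<omega>. T \<omega> - S \<omega>) \<in> currents 1"
  unfolding currents_def mem_Collect_eq
proof (intro conjI)
  have lT: "multilinear_on_forms 1 T" and lS: "multilinear_on_forms 1 S"
    and cT: "continuous_on_forms 1 T" and cS: "continuous_on_forms 1 S"
    and oT: "local_on_forms 1 T" and oS: "local_on_forms 1 S"
    and zT: "\<And>\<omega>. \<omega> \<notin> D 1 \<Longrightarrow> T \<omega> = 0" and zS: "\<And>\<omega>. \<omega> \<notin> D 1 \<Longrightarrow> S \<omega> = 0"
    using T S unfolding currents_def by blast+
  show "\<forall>\<omega>. \<omega> \<notin> D 1 \<longrightarrow> T \<omega> - S \<omega> = 0" using zT zS by simp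
  show "multilinear_on_forms 1 (\<lambda>\<omega>. T \<omega> - S \<omega>)"
    unfolding multilinear_on_forms_def
  proof (intro conjI allI impI)
    fix f g :: "'a \<Rightarrow> real" and \<pi> and a b :: real assume A: "(f, \<pi>) \<in> D 1 \<and> (g, \<pi>) \<in> D 1"
    have "T (\<lambda>x. a * f x + b * g x, \<pi>) = a * T (f, \<pi>) + b * T (g, \<pi>)"
      using lT A unfolding multilinear_on_forms_def by blast
    moreover have "S (\<lambda>x. a * f x + b * g x, \<pi>) = a * S (f, \<pi>) + b * S (g, \<pi>)"
      using lS A unfolding multilinear_on_forms_def by blast
    ultimately show "T (\<lambda>x. a * f x + b * g x, \<pi>) - S (\<lambda>x. a * f x + b * g x, \<pi>)
      = a * (T (f, \<pi>) - S (f, \<pi>)) + b * (T (g, \<pi>) - S (g, \<pi>))" by (simp only: right_diff_distrib)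
  next
    fix f :: "'a \<Rightarrow> real" and \<pi> and i :: nat and u v :: "'a \<Rightarrow> real" and a b :: real
    assume A: "(f, \<pi>) \<in> D 1 \<and> i < 1 \<and> u \<in> Lip \<and> v \<in> Lip"
    have "T (f, \<pi>[i := \<lambda>x. a * u x + b * v x]) = a * T (f, \<pi>[i := u]) + b * T (f, \<pi>[i := v])"
      using lT A unfolding multilinear_on_forms_def by blast
    moreover have "S (f, \<pi>[i := \<lambda>x. a * u x + b * v x]) = a * S (f, \<pi>[i := u]) + b * S (f, \<pi>[i := v])"
      using lS A unfolding multilinear_on_forms_def by blast
    ultimately show "T (f, \<pi>[i := \<lambda>x. a * u x + b * v x]) - S (f, \<pi>[i := \<lambda>x. a * u x + b * v x])
      = a * (T (f, \<pi>[i := u]) - S (f, \<pi>[i := u])) + b * (T (f, \<pi>[i := v]) - S (f, \<pi>[i := v]))"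
      by (simp only: right_diff_distrib)
  qed
  show "continuous_on_forms 1 (\<lambda>\<omega>. T \<omega> - S \<omega>)"
    unfolding continuous_on_forms_def
    by (intro allI impI tendsto_diff cT[unfolded continuous_on_forms_def, rule_format]
      cS[unfolded continuous_on_forms_def, rule_format])
  show "local_on_forms 1 (\<lambda>\<omega>. T \<omega> - S \<omega>)"
    unfolding local_on_forms_def
  proof (intro allI impI)
    fix f :: "'a \<Rightarrow> real" and \<pi>
    assume A: "(f, \<pi>) \<in> D 1 \<and> (\<exists>i<1. \<exists>U c. open U \<and> {x. f x \<noteq> 0} \<subseteq> U \<and> (\<forall>x\<in>U. (\<pi> ! i) x = c))"
    have "T (f, \<pi>) = 0" by (rule oT[unfolded local_on_forms_def, rule_format, OF A])
    moreover have "S (f, \<pi>) = 0" by (rule oS[unfolded local_on_forms_def, rule_format, OF A])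
    ultimately show "T (f, \<pi>) - S (f, \<pi>) = 0" by simp
  qed
  obtain \<mu> where \<mu>: "mass_bound 1 T \<mu>" using T by (auto simp: currents_def)
  obtain \<nu> where \<nu>: "mass_bound 1 S \<nu>" using S by (auto simp: currents_def)
  have F: "finite_borel_measure \<mu>" "finite_borel_measure \<nu>" using \<mu> \<nu> by (simp_all add: mass_bound_def)
  note D = finite_borel_measureD[OF F(1)] finite_borel_measureD[OF F(2)]
  have "mass_bound 1 (\<lambda>\<omega>. T \<omega> - S \<omega>) (measure_add \<mu> \<nu>)"
    unfolding mass_bound_iff
  proof (intro conjI allI impI finite_borel_measure_add F)
    fix f :: "'a \<Rightarrow> real" and \<pi> assume d: "(f, \<pi>) \<in> D 1"
    then have "f \<in> borel_measurable borel" by (intro Lip_measurable Lip_b_subset_Lip) (simp add: D_def)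
    then have m: "(\<lambda>x. ennreal \<bar>f x\<bar>) \<in> borel_measurable \<mu>"
      using D(2) by (simp cong: measurable_cong_sets)
    have "ennreal \<bar>T (f, \<pi>) - S (f, \<pi>)\<bar> \<le> ennreal (\<bar>T (f, \<pi>)\<bar> + \<bar>S (f, \<pi>)\<bar>)"
      by (intro ennreal_leI abs_triangle_ineq4)
    also have "\<dots> = ennreal \<bar>T (f, \<pi>)\<bar> + ennreal \<bar>S (f, \<pi>)\<bar>" by simp
    also have "\<dots> \<le> ennreal (form_const 1 \<pi>) * (\<integral>\<^sup>+x. ennreal \<bar>f x\<bar> \<partial>\<mu>)
        + ennreal (form_const 1 \<pi>) * (\<integral>\<^sup>+x. ennreal \<bar>f x\<bar> \<partial>\<nu>)"
      using \<mu> \<nu> d unfolding mass_bound_iff by (intro add_mono) blast+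
    also have "\<dots> = ennreal (form_const 1 \<pi>) * (\<integral>\<^sup>+x. ennreal \<bar>f x\<bar> \<partial>measure_add \<mu> \<nu>)"
      using D m by (subst nn_integral_measure_add) (simp_all add: distrib_left)
    finally show "ennreal \<bar>T (f, \<pi>) - S (f, \<pi>)\<bar>
        \<le> ennreal (form_const 1 \<pi>) * (\<integral>\<^sup>+x. ennreal \<bar>f x\<bar> \<partial>measure_add \<mu> \<nu>)" .
  qed
  then show "\<exists>\<mu>. mass_bound 1 (\<lambda>\<omega>. T \<omega> - S \<omega>) \<mu>" by blast
qed

lemma mass_eq_0_imp:
  assumes T: "T \<in> currents 1" and 0: "mass 1 T = 0"
  shows "T = (\<lambda>_. 0)"
proof
  fix \<omega>
  obtain \<mu> where \<mu>: "mass_bound 1 T \<mu>" and lin: "multilinear_on_forms 1 T"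
    and z: "\<And>\<omega>. \<omega> \<notin> D 1 \<Longrightarrow> T \<omega> = 0" using T by (auto simp: currents_def)
  let ?m = "mass_measure 1 T"
  have m: "mass_bound 1 T ?m" by (rule mass_measure_least(1)[OF lin \<mu>])
  then have F: "finite_borel_measure ?m" by (simp add: mass_bound_def)
  note D = finite_borel_measureD[OF F]
  show "T \<omega> = 0"
  proof (cases "\<omega> \<in> D 1")
    case True
    obtain f \<pi> where \<omega>: "\<omega> = (f, \<pi>)" by (cases \<omega>)
    have "AE x in ?m. False" using 0 D(2,3) by (intro AE_I[where N=UNIV]) (auto simp: mass_def)
    then have "(\<integral>\<^sup>+x. ennreal \<bar>f x\<bar> \<partial>?m) = (\<integral>\<^sup>+x. 0 \<partial>?m)" by (intro nn_integral_cong_AE) (auto elim: eventually_mono)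
    moreover have "ennreal \<bar>T \<omega>\<bar> \<le> ennreal (form_const 1 \<pi>) * (\<integral>\<^sup>+x. ennreal \<bar>f x\<bar> \<partial>?m)"
      using m True unfolding mass_bound_iff \<omega> by blast
    ultimately show ?thesis by simp
  qed (rule z)
qed

lemma difference_current_integral:
  assumes "difference_current \<mu> \<nu> = difference_current \<mu>' \<nu>'" "u \<in> Lip_b"
  shows "(\<integral>x. u x \<partial>\<mu>) - (\<integral>x. u x \<partial>\<nu>) = (\<integral>x. u x \<partial>\<mu>') - (\<integral>x. u x \<partial>\<nu>')"
proof -
  have "(u, []) \<in> D 0" using assms(2) by (simp add: D_def)
  then show ?thesis using fun_cong[OF assms(1), of "(u, [])"] by (simp add: difference_current_def)
qed

text \<open>Lipschitz tests give \<open>\<mu> + \<nu>' = \<mu>' + \<nu>\<close>. The two separating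
  sets cut the space into four pieces; on each of them one measure of either pair vanishes, and
  nonnegativity settles what is left of the equation.\<close>

lemma jordan_positive_part_unique:
  fixes \<mu> \<nu> \<mu>' \<nu>' :: "'a::metric_space measure"
  assumes F: "finite_borel_measure \<mu>" "finite_borel_measure \<nu>" "finite_borel_measure \<mu>'" "finite_borel_measure \<nu>'"
    and s: "mutually_singular \<mu> \<nu>" "mutually_singular \<mu>' \<nu>'"
    and eq: "\<And>u. u \<in> Lip_b \<Longrightarrow> (\<integral>x. u x \<partial>\<mu>) - (\<integral>x. u x \<partial>\<nu>) = (\<integral>x. u x \<partial>\<mu>') - (\<integral>x. u x \<partial>\<nu>')"
  shows "\<mu> = \<mu>'"
proof -
  note D = finite_borel_measureD[OF F(1)] finite_borel_measureD[OF F(2)] finite_borel_measureD[OF F(3)] finite_borel_measureD[OF F(4)]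
  have int: "(\<integral>x. u x \<partial>measure_add \<kappa> \<kappa>') = (\<integral>x. u x \<partial>\<kappa>) + (\<integral>x. u x \<partial>\<kappa>')"
    if k: "finite_borel_measure \<kappa>" "finite_borel_measure \<kappa>'" and u: "u \<in> Lip_b" "\<And>x. 0 \<le> u x"
    for u and \<kappa> \<kappa>' :: "'a measure"
  proof -
    note E = finite_borel_measureD[OF k(1)] finite_borel_measureD[OF k(2)]
    have nn: "(\<integral>\<^sup>+x. ennreal (u x) \<partial>\<rho>) = ennreal (\<integral>x. u x \<partial>\<rho>)" if "finite_borel_measure \<rho>" for \<rho>
      by (rule nn_integral_eq_integral[OF Lip_b_integrable[OF that u(1)]]) (simp add: u(2))
    have "u \<in> borel_measurable borel" by (rule Lip_measurable[OF Lip_b_subset_Lip[OF u(1)]])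
    then have "(\<lambda>x. ennreal (u x)) \<in> borel_measurable \<kappa>" using E by (simp cong: measurable_cong_sets)
    then have "(\<integral>\<^sup>+x. ennreal (u x) \<partial>measure_add \<kappa> \<kappa>') = (\<integral>\<^sup>+x. ennreal (u x) \<partial>\<kappa>) + (\<integral>\<^sup>+x. ennreal (u x) \<partial>\<kappa>')"
      using E by (intro nn_integral_measure_add) auto
    moreover have pos: "0 \<le> (\<integral>x. u x \<partial>\<rho>)" for \<rho> using u(2) by (rule Bochner_Integration.integral_nonneg)
    ultimately have "ennreal (\<integral>x. u x \<partial>measure_add \<kappa> \<kappa>') = ennreal ((\<integral>x. u x \<partial>\<kappa>) + (\<integral>x. u x \<partial>\<kappa>'))"
      unfolding nn[OF k(1)] nn[OF k(2)] nn[OF finite_borel_measure_add[OF k]] by (simp only: ennreal_plus[OF pos pos])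
    then show ?thesis using pos[of "measure_add \<kappa> \<kappa>'"] add_nonneg_nonneg[OF pos[of \<kappa>] pos[of \<kappa>']] by (simp only: ennreal_inj)
  qed
  have "measure_add \<mu> \<nu>' = measure_add \<mu>' \<nu>"
  proof (rule finite_borel_measure_eqI)
    fix u :: "'a \<Rightarrow> real" assume u: "u \<in> Lip_b" "\<And>x. 0 \<le> u x"
    show "(\<integral>x. u x \<partial>measure_add \<mu> \<nu>') = (\<integral>x. u x \<partial>measure_add \<mu>' \<nu>)"
      using int[OF F(1,4) u] int[OF F(3,2) u] eq[OF u(1)] by linarith
  qed (intro finite_borel_measure_add F)+
  then have add: "emeasure \<mu> B + emeasure \<nu>' B = emeasure \<mu>' B + emeasure \<nu> B" if "B \<in> sets borel" for B
    using D that emeasure_measure_add[of \<nu>' \<mu> B] emeasure_measure_add[of \<nu> \<mu>' B] by simp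
  obtain A where A: "A \<in> sets borel" "emeasure \<mu> A = 0" "emeasure \<nu> (- A) = 0"
    using s(1) by (auto simp: mutually_singular_def)
  obtain A' where A': "A' \<in> sets borel" "emeasure \<mu>' A' = 0" "emeasure \<nu>' (- A') = 0"
    using s(2) by (auto simp: mutually_singular_def)
  have sub: "emeasure \<kappa> C = 0" if "emeasure \<kappa> N = 0" "C \<subseteq> N" "N \<in> sets borel" "sets \<kappa> = sets borel" for \<kappa> :: "'a measure" and C N
    using emeasure_mono[of C N \<kappa>] that by simp
  show ?thesis
  proof (rule measure_eqI)
    fix B assume "B \<in> sets \<mu>"
    then have B: "B \<in> sets borel" using D by simp
    define P where "P i = (case i of (a, b) \<Rightarrow> B \<inter> (if a then A else - A) \<inter> (if b then A' else - A'))" for i :: "bool \<times> bool"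
    have Ps: "P i \<in> sets borel" for i using B A(1) A'(1) by (auto simp: P_def split: prod.splits)
    have PB: "B = (\<Union>i\<in>UNIV. P i)" unfolding P_def by (auto split: prod.splits if_splits)
    have dj: "disjoint_family_on P UNIV" unfolding disjoint_family_on_def P_def by (auto split: prod.splits if_splits)
    have Peq: "emeasure \<mu> (P i) = emeasure \<mu>' (P i)" for i
    proof -
      obtain a b where i: "i = (a, b)" by (cases i)
      have sA: "P i \<subseteq> (if a then A else - A)" "P i \<subseteq> (if b then A' else - A')" by (auto simp: P_def i)
      have 1: "emeasure \<mu> (P i) = 0" if a
        by (rule sub[OF A(2) _ A(1) D(2)]) (use that sA in simp)
      have 2: "emeasure \<nu> (P i) = 0" if "\<not> a"
        by (rule sub[OF A(3) _ borel_comp[OF A(1)] D(5)]) (use that sA in simp)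
      have 3: "emeasure \<mu>' (P i) = 0" if b
        by (rule sub[OF A'(2) _ A'(1) D(8)]) (use that sA in simp)
      have 4: "emeasure \<nu>' (P i) = 0" if "\<not> b"
        by (rule sub[OF A'(3) _ borel_comp[OF A'(1)] D(11)]) (use that sA in simp)
      note add' = add[OF Ps[of i]]
      consider "a" "b" | "a" "\<not> b" | "\<not> a" "b" | "\<not> a" "\<not> b" by blast
      then show ?thesis
      proof cases
        case c: 1
        then show ?thesis using 1 3 by simp
      next
        case c: 2
        then have "emeasure \<mu>' (P i) + emeasure \<nu> (P i) = 0" using add' 1 4 by simp
        then show ?thesis using 1[OF c(1)] by simp
      next
        case c: 3
        then have "emeasure \<mu> (P i) + emeasure \<nu>' (P i) = 0" using add' 2 3 by simp
        then show ?thesis using 3[OF c(2)] by simp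
      next
        case c: 4
        then show ?thesis using add' 2 4 by simp
      qed
    qed
    have fin: "finite (UNIV :: (bool \<times> bool) set)" by simp
    have "emeasure \<mu> B = (\<Sum>i\<in>UNIV. emeasure \<mu> (P i))"
      unfolding PB using D Ps by (intro sum_emeasure[symmetric] dj fin) auto
    also have "\<dots> = (\<Sum>i\<in>UNIV. emeasure \<mu>' (P i))" by (simp only: Peq)
    also have "\<dots> = emeasure \<mu>' B"
      unfolding PB using D Ps by (intro sum_emeasure dj fin) auto
    finally show "emeasure \<mu> B = emeasure \<mu>' B" .
  qed (use D in simp)
qed

text \<open>\<open>c\<close> is the supremum of the dual values over bounded 1-Lipschitz functions.
  It is finite because the supports are bounded and the masses agree: constants cancel in the
  difference, so \<open>u\<close> may be compared with its value at a base point.\<close>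

lemma kantorovich_duality:
  fixes \<mu> \<nu> :: "'a::complete_space measure"
  assumes ulam: "\<And>B :: 'a set. ulam_number B"
    and \<mu>: "finite_borel_measure \<mu>" and \<nu>: "finite_borel_measure \<nu>"
    and mass: "emeasure \<mu> UNIV = emeasure \<nu> UNIV"
    and bdd: "bounded (msupport \<mu>)" "bounded (msupport \<nu>)"
  obtains c \<gamma> where "\<gamma> \<in> transport_plans \<mu> \<nu>" "transport_cost \<gamma> \<le> ennreal c"
    "\<And>M. 0 \<le> M \<Longrightarrow> (\<And>u. u \<in> Lip_b \<Longrightarrow> 1-lipschitz_on UNIV u \<Longrightarrow> (\<integral>y. u y \<partial>\<nu>) - (\<integral>y. u y \<partial>\<mu>) \<le> M) \<Longrightarrow> c \<le> M"
proof -
  note D = finite_borel_measureD[OF \<mu>] finite_borel_measureD[OF \<nu>]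
  obtain C1 where C1: "countable C1" "C1 \<subseteq> msupport \<mu>" "emeasure \<mu> (- closure C1) = 0" "emeasure \<mu> (- msupport \<mu>) = 0"
    by (rule msupport_carrier[OF ulam \<mu>]) blast
  obtain C2 where C2: "countable C2" "C2 \<subseteq> msupport \<nu>" "emeasure \<nu> (- closure C2) = 0" "emeasure \<nu> (- msupport \<nu>) = 0"
    by (rule msupport_carrier[OF ulam \<nu>]) blast
  define x0 :: 'a where "x0 = undefined"
  have "bounded (msupport \<mu> \<union> msupport \<nu>)" using bdd by simp
  then obtain R where R: "\<And>y. y \<in> msupport \<mu> \<union> msupport \<nu> \<Longrightarrow> dist x0 y \<le> R"
    unfolding bounded_any_center[where a=x0] by blast
  \<comment> \<open>Adding the base point keeps the set nonempty when both supports are empty, so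
    that it can be enumerated.\<close>
  define C where "C = insert x0 (C1 \<union> C2)"
  define x where "x = from_nat_into C"
  have C: "countable C" "C \<noteq> {}" using C1 C2 by (auto simp: C_def)
  have rx: "range x = C" unfolding x_def by (rule range_from_nat_into[OF C(2,1)])
  have xC: "x i \<in> C" for i using rx by blast
  have Cd: "dist x0 y \<le> max R 0" if "y \<in> C" for y
  proof (cases "y = x0")
    case False
    then have "dist x0 y \<le> R" using that C1(2) C2(2) R unfolding C_def by blast
    then show ?thesis by simp
  qed simp
  have xd: "dist (x i) (x j) \<le> 2 * max R 0" for i j
    using Cd[OF xC[of i]] Cd[OF xC[of j]] dist_triangle3[of "x i" "x j" x0] by linarith
  have sub: "closure C1 \<subseteq> closure (range x)" "closure C2 \<subseteq> closure (range x)"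
    unfolding rx C_def by (intro closure_mono, blast)+
  have x\<mu>: "emeasure \<mu> (- closure (range x)) = 0"
    using emeasure_mono[of "- closure (range x)" "- closure C1" \<mu>] sub(1) C1(3) D by auto
  have x\<nu>: "emeasure \<nu> (- closure (range x)) = 0"
    using emeasure_mono[of "- closure (range x)" "- closure C2" \<nu>] sub(2) C2(3) D by auto
  define V where "V = {(\<integral>y. u y \<partial>\<nu>) - (\<integral>y. u y \<partial>\<mu>) |u. u \<in> Lip_b \<and> 1-lipschitz_on UNIV u}"
  define m where "m = measure \<mu> UNIV"
  have m\<nu>: "measure \<nu> UNIV = m" using mass by (simp add: m_def measure_def)
  have bound: "\<bar>(\<integral>y. u y \<partial>\<kappa>) - u x0 * m\<bar> \<le> max R 0 * m"
    if u: "u \<in> Lip_b" "1-lipschitz_on UNIV u" and \<kappa>: "finite_borel_measure \<kappa>" "measure \<kappa> UNIV = m"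
      "emeasure \<kappa> (- msupport \<kappa>) = 0" "msupport \<kappa> \<subseteq> msupport \<mu> \<union> msupport \<nu>" for u and \<kappa> :: "'a measure"
  proof -
    note E = finite_borel_measureD[OF \<kappa>(1)]
    interpret finite_measure \<kappa> by (rule E)
    have "(\<integral>y. u y \<partial>\<kappa>) - u x0 * m = (\<integral>y. u y - u x0 \<partial>\<kappa>)"
      using Lip_b_integrable[OF \<kappa>(1) u(1)] \<kappa>(2) E(3) by simp
    also have "\<bar>\<dots>\<bar> \<le> (\<integral>y. \<bar>u y - u x0\<bar> \<partial>\<kappa>)" by (rule integral_abs_bound)
    also have "\<dots> \<le> (\<integral>y. max R 0 \<partial>\<kappa>)"
    proof (rule integral_mono_AE)
      show "integrable \<kappa> (\<lambda>y. \<bar>u y - u x0\<bar>)" using Lip_b_integrable[OF \<kappa>(1) u(1)] by simp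
      have "AE y in \<kappa>. y \<in> msupport \<kappa>"
        using \<kappa>(3) E closed_msupport[of \<kappa>] by (intro AE_I[where N="- msupport \<kappa>"]) auto
      then show "AE y in \<kappa>. \<bar>u y - u x0\<bar> \<le> max R 0"
      proof eventually_elim
        case (elim y)
        have "\<bar>u y - u x0\<bar> \<le> 1 * dist y x0" using u(2) unfolding lipschitz_real_iff by blast
        also have "\<dots> \<le> max R 0" using R[of y] elim \<kappa>(4) by (auto simp: dist_commute)
        finally show ?case .
      qed
    qed simp
    also have "\<dots> = max R 0 * m" using \<kappa>(2) E(3) by simp
    finally show ?thesis .
  qed
  have bddV: "bdd_above V"
  proof (rule bdd_aboveI)
    fix v assume "v \<in> V"
    then obtain u where u: "u \<in> Lip_b" "1-lipschitz_on UNIV u" and v: "v = (\<integral>y. u y \<partial>\<nu>) - (\<integral>y. u y \<partial>\<mu>)"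
      unfolding V_def by blast
    show "v \<le> 2 * (max R 0 * m)"
      using bound[OF u \<mu> _ C1(4)] bound[OF u \<nu> _ C2(4)] m\<nu> unfolding v m_def by fastforce
  qed
  have V0: "0 \<in> V"
    unfolding V_def by (intro CollectI exI[of _ "\<lambda>_. 0"]) (auto intro: Lip_b_const lipschitz_onI)
  define c where "c = Sup V"
  have "\<exists>\<gamma>\<in>transport_plans \<mu> \<nu>. transport_cost \<gamma> \<le> ennreal c"
  proof (rule kantorovich_plan_exists[OF \<mu> \<nu> mass x\<mu> x\<nu> xd])
    fix u :: "'a \<Rightarrow> real" assume "u \<in> Lip_b" "1-lipschitz_on UNIV u"
    then show "(\<integral>y. u y \<partial>\<nu>) - (\<integral>y. u y \<partial>\<mu>) \<le> c"
      unfolding c_def by (intro cSup_upper bddV) (auto simp: V_def)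
  qed
  then obtain \<gamma> where \<gamma>: "\<gamma> \<in> transport_plans \<mu> \<nu>" "transport_cost \<gamma> \<le> ennreal c" by blast
  show thesis
  proof (rule that[OF \<gamma>])
    fix M :: real assume "0 \<le> M" "\<And>u. u \<in> Lip_b \<Longrightarrow> 1-lipschitz_on UNIV u \<Longrightarrow> (\<integral>y. u y \<partial>\<nu>) - (\<integral>y. u y \<partial>\<mu>) \<le> M"
    then show "c \<le> M" unfolding c_def using V0 by (intro cSup_least) (auto simp: V_def)
  qed
qed

text \<open>The endpoints of \<open>q (x, y)\<close> return \<open>x\<close> and \<open>y\<close>,
  and its length is their distance; so integrals over the transport that depend on endpoints or
  length are integrals over the plan. \<open>q\<close> is controlled only over the product of the
  supports, which the plan charges fully, hence the restriction.\<close>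

lemma geodesic_transport_of_plan:
  fixes \<phi>p \<phi>m :: "'a::metric_space measure" and q :: "'a \<times> 'a \<Rightarrow> 'a curve" and \<gamma> :: "('a \<times> 'a) measure"
  assumes null: "emeasure \<phi>p (- msupport \<phi>p) = 0" "emeasure \<phi>m (- msupport \<phi>m) = 0"
    and q_borel: "q \<in> measurable (restrict_space borel (msupport \<phi>p \<times> msupport \<phi>m)) borel"
    and q_geodesic: "\<forall>x\<in>msupport \<phi>p. \<forall>y\<in>msupport \<phi>m. geodesic (q (x, y)) x y"
    and \<gamma>: "\<gamma> \<in> transport_plans \<phi>p \<phi>m"
  defines "\<eta> \<equiv> distr (restrict_space \<gamma> (msupport \<phi>p \<times> msupport \<phi>m)) borel q"
  shows "finite_borel_measure \<eta>" "AE \<theta> in \<eta>. geodesic_curve \<theta>"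
    "(\<integral>\<^sup>+\<theta>. ennreal (curve_length \<theta>) \<partial>\<eta>) = transport_cost \<gamma>"
    "distr \<eta> borel start = \<phi>p" "distr \<eta> borel finish = \<phi>m"
    "mutually_singular \<phi>p \<phi>m \<Longrightarrow> AE \<theta> in \<eta>. is_arc \<theta>"
proof -
  let ?S = "msupport \<phi>p \<times> msupport \<phi>m"
  have F: "finite_borel_measure \<gamma>" and fst\<gamma>: "distr \<gamma> borel fst = \<phi>p" and snd\<gamma>: "distr \<gamma> borel snd = \<phi>m"
    using \<gamma> by (auto simp: transport_plans_def)
  note D = finite_borel_measureD[OF F]
  have S: "?S \<in> sets borel" by (intro borel_closed closed_Times closed_msupport)
  have mfst: "fst \<in> measurable \<gamma> borel" and msnd: "snd \<in> measurable \<gamma> borel"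
  proof -
    have "fst \<in> borel_measurable (borel :: ('a \<times> 'a) measure)" "snd \<in> borel_measurable (borel :: ('a \<times> 'a) measure)"
      by (intro borel_measurable_continuous_onI continuous_intros)+
    then show "fst \<in> measurable \<gamma> borel" "snd \<in> measurable \<gamma> borel" using D(2) by (simp_all cong: measurable_cong_sets)
  qed
  have null\<gamma>: "emeasure \<gamma> {z. fst z \<in> A} = emeasure \<phi>p A" "emeasure \<gamma> {z. snd z \<in> A} = emeasure \<phi>m A" if "A \<in> sets borel" for A
    using emeasure_distr[OF mfst that] emeasure_distr[OF msnd that] D(3) by (simp_all add: fst\<gamma> snd\<gamma> vimage_def)
  have AES: "AE z in \<gamma>. z \<in> ?S"
  proof -
    have "{z. fst z \<in> - msupport \<phi>p} \<in> null_sets \<gamma>" "{z. snd z \<in> - msupport \<phi>m} \<in> null_sets \<gamma>"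
      using null\<gamma>[of "- msupport \<phi>p"] null\<gamma>[of "- msupport \<phi>m"] null closed_msupport[of \<phi>p] closed_msupport[of \<phi>m]
        measurable_sets[OF mfst, of "- msupport \<phi>p"] measurable_sets[OF msnd, of "- msupport \<phi>m"] D(3)
      by (auto simp: null_sets_def vimage_def borel_closed)
    then have "AE z in \<gamma>. z \<notin> {z. fst z \<in> - msupport \<phi>p}" "AE z in \<gamma>. z \<notin> {z. snd z \<in> - msupport \<phi>m}"
      by (auto dest: AE_not_in)
    then show ?thesis by eventually_elim (auto simp: mem_Times_iff)
  qed
  let ?R = "restrict_space \<gamma> ?S"
  have qm: "q \<in> measurable ?R borel"
    using q_borel measurable_cong_sets[OF sets_restrict_space_cong[OF D(2)] refl] by blast
  show F\<eta>: "finite_borel_measure \<eta>"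
  proof (rule finite_borel_measureI)
    have "emeasure \<eta> UNIV = emeasure ?R (space ?R)" unfolding \<eta>_def using qm by (subst emeasure_distr) auto
    also have "\<dots> \<le> emeasure \<gamma> UNIV"
      using S D by (subst emeasure_restrict_space) (auto simp: space_restrict_space intro!: emeasure_mono)
    also have "\<dots> < \<infinity>" using finite_measure.emeasure_finite[OF D(1), of UNIV] by (simp add: less_top)
    finally show "emeasure \<eta> UNIV < \<infinity>" .
  qed (simp add: \<eta>_def)
  note E = finite_borel_measureD[OF F\<eta>]
  have nn: "(\<integral>\<^sup>+\<theta>. h \<theta> \<partial>\<eta>) = (\<integral>\<^sup>+z. k z \<partial>\<gamma>)"
    if h: "h \<in> borel_measurable borel" and hk: "\<And>x y. x \<in> msupport \<phi>p \<Longrightarrow> y \<in> msupport \<phi>m \<Longrightarrow> h (q (x, y)) = k (x, y)" for h k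
  proof -
    have "(\<integral>\<^sup>+\<theta>. h \<theta> \<partial>\<eta>) = (\<integral>\<^sup>+z. h (q z) \<partial>?R)" unfolding \<eta>_def using qm h by (intro nn_integral_distr) auto
    also have "\<dots> = (\<integral>\<^sup>+z. h (q z) * indicator ?S z \<partial>\<gamma>)"
      using S D by (intro nn_integral_restrict_space) auto
    also have "\<dots> = (\<integral>\<^sup>+z. k z \<partial>\<gamma>)"
      using AES by (intro nn_integral_cong_AE) (auto elim!: eventually_mono simp: hk)
    finally show ?thesis .
  qed
  have geo: "start (q (x, y)) = x" "finish (q (x, y)) = y" "dist x y = curve_length (q (x, y))" "geodesic_curve (q (x, y))"
    if "x \<in> msupport \<phi>p" "y \<in> msupport \<phi>m" for x y
    using q_geodesic that by (auto simp: geodesic_def geodesic_curve_def)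
  have AE\<eta>: "AE \<theta> in \<eta>. P \<theta>"
    if P: "{\<theta>. P \<theta>} \<in> sets borel" and k: "(\<integral>\<^sup>+z. k z \<partial>\<gamma>) = 0"
      "\<And>x y. x \<in> msupport \<phi>p \<Longrightarrow> y \<in> msupport \<phi>m \<Longrightarrow> indicator (- {\<theta>. P \<theta>}) (q (x, y)) = k (x, y)" for P and k :: "'a \<times> 'a \<Rightarrow> ennreal"
  proof -
    have "emeasure \<eta> (- {\<theta>. P \<theta>}) = (\<integral>\<^sup>+\<theta>. indicator (- {\<theta>. P \<theta>}) \<theta> \<partial>\<eta>)"
      using P E by (intro nn_integral_indicator[symmetric]) auto
    also have "\<dots> = 0" using nn[of "indicator (- {\<theta>. P \<theta>})" k] P k by simp
    finally show ?thesis using P E by (intro AE_I[where N="- {\<theta>. P \<theta>}"]) auto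
  qed
  show AEg: "AE \<theta> in \<eta>. geodesic_curve \<theta>"
    by (rule AE\<eta>[where k="\<lambda>_. 0"]) (auto simp: geo sets_geodesic_curve)
  show "(\<integral>\<^sup>+\<theta>. ennreal (curve_length \<theta>) \<partial>\<eta>) = transport_cost \<gamma>"
    unfolding transport_cost_def
    by (rule nn[OF measurable_compose[OF measurable_curve_length measurable_ennreal]]) (simp add: geo)
  have m: "start \<in> measurable \<eta> borel" "finish \<in> measurable \<eta> borel"
    using measurable_start measurable_finish E(2) by (simp_all cong: measurable_cong_sets)
  have push: "distr \<eta> borel e = distr \<gamma> borel p"
    if e: "e \<in> measurable borel borel" "\<And>x y. x \<in> msupport \<phi>p \<Longrightarrow> y \<in> msupport \<phi>m \<Longrightarrow> e (q (x, y)) = p (x, y)"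
      and p: "p \<in> measurable \<gamma> borel" for e :: "'a curve \<Rightarrow> 'a" and p
  proof (rule measure_eqI)
    fix A assume "A \<in> sets (distr \<eta> borel e)"
    then have A: "A \<in> sets borel" by simp
    have e': "e \<in> measurable \<eta> borel" using e(1) E(2) by (simp cong: measurable_cong_sets)
    have "emeasure (distr \<eta> borel e) A = (\<integral>\<^sup>+\<theta>. indicator A \<theta> \<partial>distr \<eta> borel e)" using A by simp
    also have "\<dots> = (\<integral>\<^sup>+\<theta>. indicator A (e \<theta>) \<partial>\<eta>)" using A e' by (intro nn_integral_distr) auto
    also have "\<dots> = (\<integral>\<^sup>+z. indicator A (p z) \<partial>\<gamma>)"
      using A by (intro nn measurable_compose[OF e(1)]) (auto simp: e(2))
    also have "\<dots> = (\<integral>\<^sup>+\<theta>. indicator A \<theta> \<partial>distr \<gamma> borel p)" using A p by (intro nn_integral_distr[symmetric]) auto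
    also have "\<dots> = emeasure (distr \<gamma> borel p) A" using A by simp
    finally show "emeasure (distr \<eta> borel e) A = emeasure (distr \<gamma> borel p) A" .
  qed simp
  show "distr \<eta> borel start = \<phi>p" using push[OF measurable_start _ mfst] by (simp add: geo fst\<gamma>)
  show "distr \<eta> borel finish = \<phi>m" using push[OF measurable_finish _ msnd] by (simp add: geo snd\<gamma>)
  show "AE \<theta> in \<eta>. is_arc \<theta>" if sing: "mutually_singular \<phi>p \<phi>m"
  proof -
    obtain A where A: "A \<in> sets borel" "emeasure \<phi>p A = 0" "emeasure \<phi>m (- A) = 0"
      using sing by (auto simp: mutually_singular_def)
    have "{z. fst z \<in> A} \<in> null_sets \<gamma>" "{z. snd z \<in> - A} \<in> null_sets \<gamma>"
      using null\<gamma>[of A] null\<gamma>[of "- A"] A measurable_sets[OF mfst, of A] measurable_sets[OF msnd, of "- A"] D(3)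
      by (auto simp: null_sets_def vimage_def)
    then have "AE z in \<gamma>. z \<notin> {z. fst z \<in> A}" "AE z in \<gamma>. z \<notin> {z. snd z \<in> - A}"
      by (auto dest: AE_not_in)
    \<comment> \<open>Almost surely the first coordinate lies outside \<open>A\<close> and the
      second inside, so the plan does not charge the diagonal. A geodesic with distinct ends is
      injective at constant speed.\<close>
    then have ne: "AE z in \<gamma>. fst z \<noteq> snd z" by eventually_elim auto
    have "AE \<theta> in \<eta>. start \<theta> \<noteq> finish \<theta>"
    proof (rule AE\<eta>[where k="indicator {z. fst z = snd z}"])
      have "closed {\<theta> :: 'a curve. start \<theta> = finish \<theta>}"
        by (intro closed_Collect_eq continuous_on_start continuous_on_finish)
      then have "- {\<theta> :: 'a curve. start \<theta> = finish \<theta>} \<in> sets borel" by (intro borel_open) auto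
      then show "{\<theta> :: 'a curve. start \<theta> \<noteq> finish \<theta>} \<in> sets borel" by (simp add: Collect_neg_eq)
      have "(\<integral>\<^sup>+z. indicator {z. fst z = snd z} z \<partial>\<gamma>) = (\<integral>\<^sup>+z. 0 \<partial>\<gamma>)"
        using ne by (intro nn_integral_cong_AE) (auto elim!: eventually_mono)
      then show "(\<integral>\<^sup>+z. indicator {z. fst z = snd z} z \<partial>\<gamma>) = 0" by simp
    qed (auto simp: geo indicator_def)
    then show ?thesis using AEg by eventually_elim (rule geodesic_is_arc)
  qed
qed

lemma mutually_singular_sym: "mutually_singular \<mu> \<nu> \<Longrightarrow> mutually_singular \<nu> \<mu>"
  unfolding mutually_singular_def by (metis borel_comp double_complement)

theorem theoremA1:
  fixes \<phi>p \<phi>m :: "'a::complete_space measure"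
    and q :: "'a \<times> 'a \<Rightarrow> 'a curve"
  assumes ulam: "\<forall>(M :: (real \<Rightarrow> 'a) set) d A.
      Metric_space M d \<and> realizes_density_character M d A \<longrightarrow> ulam_number A"
    and fin: "finite_borel_measure \<phi>p" "finite_borel_measure \<phi>m"
    and eq_mass: "emeasure \<phi>p UNIV = emeasure \<phi>m UNIV"
    and bdd: "bounded (msupport \<phi>p)" "bounded (msupport \<phi>m)"
    and geodesic_space: "\<forall>x y :: 'a. \<exists>\<theta>. geodesic \<theta> x y"
    and q_borel: "q \<in> measurable (restrict_space borel (msupport \<phi>p \<times> msupport \<phi>m)) borel"
    and q_geodesic: "\<forall>x\<in>msupport \<phi>p. \<forall>y\<in>msupport \<phi>m. geodesic (q (x, y)) x y"
  shows "(\<exists>T. minimal_current \<phi>p \<phi>m T \<and> W1 \<phi>p \<phi>m = mass 1 T) \<and>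
    (\<forall>T. minimal_current \<phi>p \<phi>m T \<longrightarrow>
       acyclic_current T \<and>
       (mutually_singular \<phi>p \<phi>m \<longrightarrow>
         (\<forall>\<eta>. represents \<eta> T \<longrightarrow>
            optimal_plan \<phi>p \<phi>m (distr \<eta> borel (\<lambda>\<theta>. (start \<theta>, finish \<theta>)))))) \<and>
    (\<forall>\<gamma>. optimal_plan \<phi>p \<phi>m \<gamma> \<longrightarrow>
       (let \<eta> = distr (restrict_space \<gamma> (msupport \<phi>p \<times> msupport \<phi>m)) borel q;
            T = transport_current \<eta>
        in minimal_current \<phi>p \<phi>m T \<and>
           (AE \<theta> in \<eta>. geodesic \<theta> (start \<theta>) (finish \<theta>)) \<and>
           transport_mass_identity \<eta> T \<and>
           (mutually_singular \<phi>p \<phi>m \<longrightarrow> represents \<eta> T)))"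
proof -
  have ul: "ulam_number B" for B :: "'a set" by (rule ulam_all_subsets[OF ulam])
  have null: "emeasure \<phi>p (- msupport \<phi>p) = 0" "emeasure \<phi>m (- msupport \<phi>m) = 0"
    by (rule msupport_carrier[OF ul fin(1)], blast) (rule msupport_carrier[OF ul fin(2)], blast)
  obtain c \<gamma>0 where \<gamma>0: "\<gamma>0 \<in> transport_plans \<phi>p \<phi>m" "transport_cost \<gamma>0 \<le> ennreal c"
    and dual: "\<And>M. 0 \<le> M \<Longrightarrow> (\<And>u. u \<in> Lip_b \<Longrightarrow> 1-lipschitz_on UNIV u \<Longrightarrow> (\<integral>y. u y \<partial>\<phi>m) - (\<integral>y. u y \<partial>\<phi>p) \<le> M) \<Longrightarrow> c \<le> M"
    by (rule kantorovich_duality[OF ul fin eq_mass bdd]) blast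
  define H where "H \<gamma> = distr (restrict_space \<gamma> (msupport \<phi>p \<times> msupport \<phi>m)) borel q" for \<gamma> :: "('a \<times> 'a) measure"
  \<comment> \<open>For finite mass, every dual value is the value of \<open>T\<close> on a form
    \<open>1 du\<close>, hence at most the mass; \<open>c\<close> is the least such bound.\<close>
  have lower: "ennreal c \<le> mass 1 T" if T: "T \<in> admissible_currents \<phi>p \<phi>m" for T
  proof (cases "mass 1 T")
    case (real r)
    have Tc: "T \<in> currents 1" and bT: "boundary T = difference_current \<phi>m \<phi>p"
      using T by (auto simp: admissible_currents_def)
    have "c \<le> r"
    proof (rule dual[OF real(1)])
      fix u :: "'a \<Rightarrow> real" assume u: "u \<in> Lip_b" "1-lipschitz_on UNIV u"
      have "(u, []) \<in> D 0" using u(1) by (simp add: D_def)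
      then have "(\<integral>y. u y \<partial>\<phi>m) - (\<integral>y. u y \<partial>\<phi>p) = T (\<lambda>_. 1, [u])"
        using fun_cong[OF bT, of "(u, [])"] by (simp add: boundary_def difference_current_def)
      moreover have "\<bar>T (\<lambda>_. 1, [u])\<bar> \<le> r"
        using mass_lower_bound[OF Tc u] real by (simp add: ennreal_le_iff)
      ultimately show "(\<integral>y. u y \<partial>\<phi>m) - (\<integral>y. u y \<partial>\<phi>p) \<le> r" by linarith
    qed
    then show ?thesis using real by (simp add: ennreal_leI)
  qed simp
  have plan: "geodesic_transport (H \<gamma>)" "transport_current (H \<gamma>) \<in> admissible_currents \<phi>p \<phi>m"
    "mass 1 (transport_current (H \<gamma>)) \<le> transport_cost \<gamma>"
    if \<gamma>: "\<gamma> \<in> transport_plans \<phi>p \<phi>m" and f: "transport_cost \<gamma> < \<infinity>" for \<gamma>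
  proof -
    note P = geodesic_transport_of_plan[OF null q_borel q_geodesic \<gamma>, folded H_def]
    show gt: "geodesic_transport (H \<gamma>)" by unfold_locales (use P f in simp_all)
    interpret geodesic_transport "H \<gamma>" by (rule gt)
    show "transport_current (H \<gamma>) \<in> admissible_currents \<phi>p \<phi>m"
      using transport_current_currents boundary_transport_current P(4,5) by (simp add: admissible_currents_def)
    show "mass 1 (transport_current (H \<gamma>)) \<le> transport_cost \<gamma>" using mass_transport_current_le P(3) by simp
  qed
  \<comment> \<open>The bound for plans goes through currents: a plan of finite cost induces an
    admissible current of no larger mass.\<close>
  have cost: "ennreal c \<le> transport_cost \<gamma>" if "\<gamma> \<in> transport_plans \<phi>p \<phi>m" for \<gamma>
  proof (cases "transport_cost \<gamma> < \<infinity>")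
    case True
    show ?thesis using lower[OF plan(2)[OF that True]] plan(3)[OF that True] by (rule order_trans)
  qed (simp add: less_top[symmetric])
  have fin0: "transport_cost \<gamma> < \<infinity>" if "transport_cost \<gamma> \<le> ennreal c" for \<gamma> :: "('a \<times> 'a) measure"
    using that by (rule le_less_trans) simp
  \<comment> \<open>As \<open>c\<close> is a lower bound that \<open>\<gamma>0\<close> attains,
    being optimal becomes the single inequality cost at most \<open>c\<close>; minimal currents are
    described in the same way below.\<close>
  have opt: "optimal_plan \<phi>p \<phi>m \<gamma> \<longleftrightarrow> \<gamma> \<in> transport_plans \<phi>p \<phi>m \<and> transport_cost \<gamma> \<le> ennreal c" for \<gamma>
    unfolding optimal_plan_def is_arg_min_def
    using cost \<gamma>0 by (meson leD le_less_trans not_le order_trans)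
  have W1: "W1 \<phi>p \<phi>m = ennreal c"
    unfolding W1_def
  proof (rule antisym)
    show "(INF \<gamma>\<in>transport_plans \<phi>p \<phi>m. transport_cost \<gamma>) \<le> ennreal c"
      using \<gamma>0 by (rule INF_lower2)
    show "ennreal c \<le> (INF \<gamma>\<in>transport_plans \<phi>p \<phi>m. transport_cost \<gamma>)" by (rule INF_greatest) (rule cost)
  qed
  have mass0: "mass 1 (transport_current (H \<gamma>0)) \<le> ennreal c"
    using plan(3)[OF \<gamma>0(1) fin0[OF \<gamma>0(2)]] \<gamma>0(2) by (rule order_trans)
  have minimal: "minimal_current \<phi>p \<phi>m T \<longleftrightarrow> T \<in> admissible_currents \<phi>p \<phi>m \<and> mass 1 T \<le> ennreal c" for T
    unfolding minimal_current_def is_arg_min_def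
    using lower mass0 plan(2)[OF \<gamma>0(1) fin0[OF \<gamma>0(2)]] by (meson leD le_less_trans not_le order_trans)
  have 1: "\<exists>T. minimal_current \<phi>p \<phi>m T \<and> W1 \<phi>p \<phi>m = mass 1 T"
  proof (intro exI conjI)
    let ?T = "transport_current (H \<gamma>0)"
    have adm: "?T \<in> admissible_currents \<phi>p \<phi>m" by (rule plan(2)[OF \<gamma>0(1) fin0[OF \<gamma>0(2)]])
    show "minimal_current \<phi>p \<phi>m ?T" using adm mass0 by (simp add: minimal)
    show "W1 \<phi>p \<phi>m = mass 1 ?T" using lower[OF adm] mass0 by (simp add: W1)
  qed
  have 2: "acyclic_current T" if T: "minimal_current \<phi>p \<phi>m T" for T
    unfolding acyclic_current_def
  proof (intro allI iffI)
    have Tc: "T \<in> currents 1" and bT: "boundary T = difference_current \<phi>m \<phi>p" and mT: "mass 1 T \<le> ennreal c"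
      using T unfolding minimal admissible_currents_def by auto
    fix C
    assume "cycle_of C T"
    then have C: "C \<in> currents 1" "mass 1 (\<lambda>\<omega>. T \<omega> - C \<omega>) + mass 1 C \<le> mass 1 T" "boundary C = (\<lambda>_. 0)"
      by (auto simp: cycle_of_def subcurrent_def)
    have "boundary (\<lambda>\<omega>. T \<omega> - C \<omega>) = boundary T"
    proof
      fix \<omega> :: "'a form"
      show "boundary (\<lambda>\<omega>. T \<omega> - C \<omega>) \<omega> = boundary T \<omega>"
        using fun_cong[OF C(3), of \<omega>] by (auto simp: boundary_def)
    qed
    then have "(\<lambda>\<omega>. T \<omega> - C \<omega>) \<in> admissible_currents \<phi>p \<phi>m"
      using currents_diff[OF Tc C(1)] bT by (simp add: admissible_currents_def)
    then have "ennreal c \<le> mass 1 (\<lambda>\<omega>. T \<omega> - C \<omega>)" by (rule lower)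
    \<comment> \<open>Removing the cycle leaves an admissible competitor, whose mass is already at
      least \<open>c\<close>; finiteness of \<open>c\<close> permits cancelling it.\<close>
    then have "ennreal c + mass 1 C \<le> mass 1 (\<lambda>\<omega>. T \<omega> - C \<omega>) + mass 1 C" by (rule add_right_mono)
    also have "\<dots> \<le> ennreal c + 0" using C(2) mT by simp
    finally have "mass 1 C \<le> 0" by (subst (asm) ennreal_add_left_cancel_le) auto
    then show "C = (\<lambda>_. 0)" using mass_eq_0_imp[OF C(1)] by simp
  next
    fix C assume "C = (\<lambda>_ :: 'a form. 0 :: real)"
    then show "cycle_of C T"
      using zero_current by (auto simp: cycle_of_def subcurrent_def boundary_def)
  qed
  have 3: "optimal_plan \<phi>p \<phi>m (distr \<eta> borel (\<lambda>\<theta>. (start \<theta>, finish \<theta>)))"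
    if T: "minimal_current \<phi>p \<phi>m T" and sing: "mutually_singular \<phi>p \<phi>m" and rep: "represents \<eta> T" for T \<eta>
  proof -
    have bT: "boundary T = difference_current \<phi>m \<phi>p" and mT: "mass 1 T \<le> ennreal c"
      using T unfolding minimal admissible_currents_def by auto
    have F: "finite_borel_measure \<eta>" and len: "mass 1 T = (\<integral>\<^sup>+\<theta>. ennreal (curve_length \<theta>) \<partial>\<eta>)"
      and J: "finite_borel_measure (distr \<eta> borel finish)" "finite_borel_measure (distr \<eta> borel start)"
        "mutually_singular (distr \<eta> borel finish) (distr \<eta> borel start)"
        "boundary T = difference_current (distr \<eta> borel finish) (distr \<eta> borel start)"
      using rep by (auto simp: represents_def transport_mass_identity_def jordan_parts_def)
    note E = finite_borel_measureD[OF F]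
    have eq: "(\<integral>x. u x \<partial>distr \<eta> borel finish) - (\<integral>x. u x \<partial>distr \<eta> borel start) = (\<integral>x. u x \<partial>\<phi>m) - (\<integral>x. u x \<partial>\<phi>p)"
      if "u \<in> Lip_b" for u
      by (rule difference_current_integral[OF _ that]) (simp only: J(4)[symmetric] bT)
    \<comment> \<open>The Jordan decomposition of the boundary is unique, and
      \<open>\<phi>m\<close>, \<open>\<phi>p\<close> provide one because they are mutually singular;
      this identifies the marginals of the endpoint plan.\<close>
    have fm: "distr \<eta> borel finish = \<phi>m"
      by (rule jordan_positive_part_unique[OF J(1,2) fin(2,1) J(3) mutually_singular_sym[OF sing] eq])
    have sp: "distr \<eta> borel start = \<phi>p"
      by (rule jordan_positive_part_unique[OF J(2,1) fin(1,2) mutually_singular_sym[OF J(3)] sing])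
        (use eq in \<open>simp add: algebra_simps\<close>)
    let ?e = "\<lambda>\<theta> :: 'a curve. (start \<theta>, finish \<theta>)"
    have e: "?e \<in> measurable \<eta> borel"
    proof -
      have "?e \<in> borel_measurable borel"
        by (intro borel_measurable_continuous_onI continuous_on_Pair continuous_on_start continuous_on_finish)
      then show ?thesis using E(2) by (simp cong: measurable_cong_sets)
    qed
    have p: "(fst :: 'a \<times> 'a \<Rightarrow> 'a) \<in> borel_measurable borel" "(snd :: 'a \<times> 'a \<Rightarrow> 'a) \<in> borel_measurable borel"
      by (intro borel_measurable_continuous_onI continuous_intros)+
    have "finite_borel_measure (distr \<eta> borel ?e)"
      using finite_measure.finite_measure_distr[OF E(1) e] by (simp add: finite_borel_measure_def)
    moreover have "distr (distr \<eta> borel ?e) borel fst = \<phi>p" "distr (distr \<eta> borel ?e) borel snd = \<phi>m"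
      using distr_distr[OF p(1) e] distr_distr[OF p(2) e] by (simp_all add: o_def fm sp)
    ultimately have pl: "distr \<eta> borel ?e \<in> transport_plans \<phi>p \<phi>m" by (simp add: transport_plans_def)
    have "transport_cost (distr \<eta> borel ?e) = (\<integral>\<^sup>+\<theta>. ennreal (dist (start \<theta>) (finish \<theta>)) \<partial>\<eta>)"
    proof -
      have "(\<lambda>z :: 'a \<times> 'a. ennreal (dist (fst z) (snd z))) \<in> borel_measurable borel"
        by (intro measurable_compose[OF borel_measurable_continuous_onI measurable_ennreal] continuous_intros)
      then show ?thesis unfolding transport_cost_def using e by (subst nn_integral_distr) auto
    qed
    also have "\<dots> \<le> (\<integral>\<^sup>+\<theta>. ennreal (curve_length \<theta>) \<partial>\<eta>)"
      by (intro nn_integral_mono ennreal_leI dist_start_finish_le)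
    also have "\<dots> \<le> ennreal c" using mT len by simp
    finally show ?thesis using pl by (simp add: opt)
  qed
  have 4: "minimal_current \<phi>p \<phi>m (transport_current (H \<gamma>)) \<and>
      (AE \<theta> in H \<gamma>. geodesic \<theta> (start \<theta>) (finish \<theta>)) \<and>
      transport_mass_identity (H \<gamma>) (transport_current (H \<gamma>)) \<and>
      (mutually_singular \<phi>p \<phi>m \<longrightarrow> represents (H \<gamma>) (transport_current (H \<gamma>)))"
    if \<gamma>: "optimal_plan \<phi>p \<phi>m \<gamma>" for \<gamma>
  proof -
    have \<gamma>p: "\<gamma> \<in> transport_plans \<phi>p \<phi>m" and \<gamma>c: "transport_cost \<gamma> \<le> ennreal c" using \<gamma> by (simp_all add: opt)
    note P = geodesic_transport_of_plan[OF null q_borel q_geodesic \<gamma>p, folded H_def]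
    note K = plan[OF \<gamma>p fin0[OF \<gamma>c]]
    interpret geodesic_transport "H \<gamma>" by (rule K(1))
    let ?T = "transport_current (H \<gamma>)"
    have min: "minimal_current \<phi>p \<phi>m ?T" using K(2) order_trans[OF K(3) \<gamma>c] by (simp add: minimal)
    \<comment> \<open>The mass is at least \<open>c\<close> and at most the cost of the plan, which
      is the mean length and at most \<open>c\<close>; so all of these agree.\<close>
    have len: "mass 1 ?T = (\<integral>\<^sup>+\<theta>. ennreal (curve_length \<theta>) \<partial>H \<gamma>)"
      unfolding P(3) using lower[OF K(2)] \<gamma>c K(3) by (intro antisym) (auto intro: order_trans)
    have "(\<integral>\<^sup>+\<theta>. mass 1 (curve_current \<theta>) \<partial>H \<gamma>) = (\<integral>\<^sup>+\<theta>. ennreal (curve_length \<theta>) \<partial>H \<gamma>)"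
    proof (rule nn_integral_cong_AE)
      show "AE \<theta> in H \<gamma>. mass 1 (curve_current \<theta>) = ennreal (curve_length \<theta>)"
        using P(2) by eventually_elim (rule mass_curve_current)
    qed
    then have mi: "transport_mass_identity (H \<gamma>) ?T" using len by (simp add: transport_mass_identity_def)
    have "represents (H \<gamma>) ?T" if sing: "mutually_singular \<phi>p \<phi>m"
      unfolding represents_def jordan_parts_def P(4,5)
      using P(1) mi fin mutually_singular_sym[OF sing] boundary_transport_current P(6)[OF sing]
      by (simp add: P(4,5))
    then show ?thesis using min mi P(2) by (simp add: geodesic_curve_def)
  qed
  show ?thesis
    using 1 2 3 4 unfolding H_def Let_def by blast
qed

end
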